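(* Let $A$ be a basic finite-dimensional algebra over a field $\mathbb{K}$, $E$ a basic generating-cogenerating $A$-module and $\Gamma\cong\operatorname{End}_A(E)^{\mathrm{op}}$, so $\operatorname{domdim}\Gamma=d+1$ with $d\geq1$, and let $\Pi$ be a maximal projective-injective summand of $\Gamma$. For $0\leq k\leq d+1$, let $T_k$ be the $k$-shifted module of $\Gamma$, $B_k=\operatorname{End}_\Gamma(T_k)^{\mathrm{op}}$, and let $c_k$ be the intermediate extension functor from $A$-modules to $B_k$-modules. Write $P_k=\operatorname{Hom}_\Gamma(T_k,\Pi)$ and $I_k=D\operatorname{Hom}_\Gamma(\Pi,T_k)$. Then $$DT_k\in\operatorname{gen}_{d-k}(P_k)\cap\operatorname{cogen}^{k-1}(I_k).$$ If $1\leq k\leq d$, it follows that $$DT_k\cong c_k(E).$$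
   Context: Modules are finitely generated left modules; morphisms are composed right-to-left; $D=\operatorname{Hom}_{\mathbb{K}}(-,\mathbb{K})$. $E$ is generating-cogenerating if $A,DA\in\operatorname{add}E$. $\operatorname{domdim}\Gamma\geq k$ if ${}_\Gamma\Gamma$ has an injective resolution whose first $k$ terms are projective-injective; $\operatorname{domdim}\Gamma=k$ if moreover not $\geq k+1$. A $\Gamma$-module $T$ is $k$-tilting if $\operatorname{pdim}T\leq k$, $\operatorname{Ext}^i_\Gamma(T,T)=0$ for $i>0$, and there is an exact sequence $0\to\Gamma\to t_0\to\cdots\to t_k\to0$ with all $t_j\in\operatorname{add}T$. It is $P$-special, for $P$ projective, if $P\in\operatorname{add}T$ and there is such a sequence with $t_j\in\operatorname{add}P$ for $0\leq j\leq k-1$. For $0\leq k\leq\operatorname{domdim}\Gamma$, $T_k$ is the basic $\Pi$-special $k$-tilting module (unique up to isomorphism); it has $\Pi$ as a summand. Let $e_k\in B_k$ be the idempotent given by projection onto $\Pi$. By the Morita--Tachikawa correspondence we identify $A=\operatorname{End}_\Gamma(\Pi)^{\mathrm{op}}=e_kB_ke_k$ and $E=D\Pi$. For a module $X$ and $m\geq0$, $\operatorname{gen}_m(X)$ is the full subcategory of modules $M$ admitting an exact sequence $X^m\to\cdots\to X^0\to M\to0$ with all $X^i\in\operatorname{add}X$ that stays exact under $\operatorname{Hom}(X,-)$. $\operatorname{cogen}^m(X)$ is the full subcategory of modules $N$ admitting an exact sequence $0\to N\to X_0\to\cdots\to X_m$ with all $X_i\in\operatorname{add}X$ that stays exact under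 $\operatorname{Hom}(-,X)$. $\operatorname{gen}_{-1}(X)=\operatorname{cogen}^{-1}(X)$ is the whole module category. Intermediate extension: for an algebra $B$ with idempotent $e$ and $A=eBe$, let $\ell=Be\otimes_A-$ and $r=\operatorname{Hom}_A(eB,-)$, the left and right adjoints of $N\mapsto eN$. Let $\zeta_M:\ell M\to rM$ be the canonical map corresponding to $\mathrm{id}_M$ under $\operatorname{Hom}_B(\ell M,rM)\cong\operatorname{Hom}_A(M,M)$, i.e. $be\otimes m\mapsto(eb'\mapsto eb'be\cdot m)$. Then $c(M)=\operatorname{im}\zeta_M$. The functor $c_k$ is $c$ for $(B,e)=(B_k,e_k)$. *)

theory Defs
  imports
    "HOL-Algebra.Module"
    "HOL-Algebra.QuotRing"
    "HOL-Algebra.Free_Abelian_Groups"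
begin

text \<open>
  Conventions.  A \<open>K\<close>-algebra is a ring that carries the \<open>K\<close>-action in its field \<open>smult\<close>, so it has
  the record type \<open>('k, 'a) module\<close>.  A left module over it has the type \<open>('a, 'm) module\<close>; its
  fields \<open>mult\<close> and \<open>one\<close> are never used, and its \<open>K\<close>-structure is the one induced by the algebra.
  A right \<open>A\<close>-module is a left module over \<open>op_alg A\<close>.  Homomorphisms are extensional functions
  (\<open>undefined\<close> outside the carrier), so that sets of homomorphisms are honest abelian groups.
\<close>

section \<open>Modules and algebras\<close>

text \<open>The locale \<open>module\<close> of the library demands commutative scalars.\<close>

locale left_module = R?: ring R + M?: abelian_group M for R (structure) and M (structure) +
  assumes smult_closed:
      "\<lbrakk>a \<in> carrier R; x \<in> carrier M\<rbrakk> \<Longrightarrow> a \<odot>\<^bsub>M\<^esub> x \<in> carrier M"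
    and smult_l_distr:
      "\<lbrakk>a \<in> carrier R; b \<in> carrier R; x \<in> carrier M\<rbrakk> \<Longrightarrow>
        (a \<oplus>\<^bsub>R\<^esub> b) \<odot>\<^bsub>M\<^esub> x = a \<odot>\<^bsub>M\<^esub> x \<oplus>\<^bsub>M\<^esub> b \<odot>\<^bsub>M\<^esub> x"
    and smult_r_distr:
      "\<lbrakk>a \<in> carrier R; x \<in> carrier M; y \<in> carrier M\<rbrakk> \<Longrightarrow>
        a \<odot>\<^bsub>M\<^esub> (x \<oplus>\<^bsub>M\<^esub> y) = a \<odot>\<^bsub>M\<^esub> x \<oplus>\<^bsub>M\<^esub> a \<odot>\<^bsub>M\<^esub> y"
    and smult_assoc1:
      "\<lbrakk>a \<in> carrier R; b \<in> carrier R; x \<in> carrier M\<rbrakk> \<Longrightarrow>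
        (a \<otimes>\<^bsub>R\<^esub> b) \<odot>\<^bsub>M\<^esub> x = a \<odot>\<^bsub>M\<^esub> (b \<odot>\<^bsub>M\<^esub> x)"
    and smult_one: "x \<in> carrier M \<Longrightarrow> \<one>\<^bsub>R\<^esub> \<odot>\<^bsub>M\<^esub> x = x"

definition finitely_generated :: "('a, 'z) ring_scheme \<Rightarrow> ('a, 'm) module \<Rightarrow> bool" where
  "finitely_generated R M \<longleftrightarrow>
    (\<exists>S. finite S \<and> S \<subseteq> carrier M \<and>
      (\<forall>x\<in>carrier M. \<exists>c\<in>S \<rightarrow> carrier R. x = (\<Oplus>\<^bsub>M\<^esub>s\<in>S. c s \<odot>\<^bsub>M\<^esub> s)))"

definition fg_module :: "('a, 'z) ring_scheme \<Rightarrow> ('a, 'm) module \<Rightarrow> bool" where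
  "fg_module R M \<longleftrightarrow> left_module R M \<and> finitely_generated R M"

definition fd_algebra :: "('k, 'z) ring_scheme \<Rightarrow> ('k, 'a) module \<Rightarrow> bool" where
  "fd_algebra K A \<longleftrightarrow> field K \<and> ring A \<and> module K A \<and>
    (\<forall>c\<in>carrier K. \<forall>x\<in>carrier A. \<forall>y\<in>carrier A.
      (c \<odot>\<^bsub>A\<^esub> x) \<otimes>\<^bsub>A\<^esub> y = c \<odot>\<^bsub>A\<^esub> (x \<otimes>\<^bsub>A\<^esub> y) \<and>
      x \<otimes>\<^bsub>A\<^esub> (c \<odot>\<^bsub>A\<^esub> y) = c \<odot>\<^bsub>A\<^esub> (x \<otimes>\<^bsub>A\<^esub> y)) \<and>
    finitely_generated K A"

definition alg_iso ::
  "('k, 'z) ring_scheme \<Rightarrow> ('k, 'a) module \<Rightarrow> ('k, 'b) module \<Rightarrow> ('a \<Rightarrow> 'b) set" where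
  "alg_iso K A B =
    {f \<in> ring_iso A B. \<forall>c\<in>carrier K. \<forall>x\<in>carrier A. f (c \<odot>\<^bsub>A\<^esub> x) = c \<odot>\<^bsub>B\<^esub> f x}"

definition op_alg :: "('k, 'a) module \<Rightarrow> ('k, 'a) module" where
  "op_alg A = A\<lparr>monoid.mult := \<lambda>x y. y \<otimes>\<^bsub>A\<^esub> x\<rparr>"

text \<open>A ring as a left module over itself.\<close>

definition regular :: "('a, 'z) ring_scheme \<Rightarrow> ('a, 'a) module" where
  "regular R = \<lparr>carrier = carrier R, monoid.mult = monoid.mult R,
    monoid.one = \<one>\<^bsub>R\<^esub>, ring.zero = \<zero>\<^bsub>R\<^esub>, ring.add = ring.add R, smult = monoid.mult R\<rparr>"

text \<open>The same abelian group with another scalar action.\<close>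

definition with_smult :: "('a, 'm) module \<Rightarrow> ('b \<Rightarrow> 'm \<Rightarrow> 'm) \<Rightarrow> ('b, 'm) module" where
  "with_smult M s = \<lparr>carrier = carrier M, monoid.mult = monoid.mult M,
    monoid.one = \<one>\<^bsub>M\<^esub>, ring.zero = \<zero>\<^bsub>M\<^esub>, ring.add = ring.add M, smult = s\<rparr>"

definition restrict_scalars :: "('b \<Rightarrow> 'a) \<Rightarrow> ('a, 'm) module \<Rightarrow> ('b, 'm) module" where
  "restrict_scalars f M = with_smult M (\<lambda>b x. f b \<odot>\<^bsub>M\<^esub> x)"

definition K_space :: "('k, 'a) module \<Rightarrow> ('a, 'm) module \<Rightarrow> ('k, 'm) module" where
  "K_space A M = restrict_scalars (\<lambda>c. c \<odot>\<^bsub>A\<^esub> \<one>\<^bsub>A\<^esub>) M"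

section \<open>Homomorphisms, endomorphism algebras and duality\<close>

definition mod_hom ::
  "('a, 'z) ring_scheme \<Rightarrow> ('a, 'm) module \<Rightarrow> ('a, 'n) module \<Rightarrow> ('m \<Rightarrow> 'n) set" where
  "mod_hom R M N =
    {f \<in> carrier M \<rightarrow>\<^sub>E carrier N.
      (\<forall>x\<in>carrier M. \<forall>y\<in>carrier M. f (x \<oplus>\<^bsub>M\<^esub> y) = f x \<oplus>\<^bsub>N\<^esub> f y) \<and>
      (\<forall>a\<in>carrier R. \<forall>x\<in>carrier M. f (a \<odot>\<^bsub>M\<^esub> x) = a \<odot>\<^bsub>N\<^esub> f x)}"

definition mod_iso ::
  "('a, 'z) ring_scheme \<Rightarrow> ('a, 'm) module \<Rightarrow> ('a, 'n) module \<Rightarrow> bool" where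
  "mod_iso R M N \<longleftrightarrow> (\<exists>f\<in>mod_hom R M N. bij_betw f (carrier M) (carrier N))"

text \<open>The group of homomorphisms under pointwise addition, with a prescribed action \<open>s\<close>.\<close>

definition hom_struct ::
  "('a, 'z) ring_scheme \<Rightarrow> ('a, 'm) module \<Rightarrow> ('a, 'n) module \<Rightarrow>
    ('b \<Rightarrow> ('m \<Rightarrow> 'n) \<Rightarrow> ('m \<Rightarrow> 'n)) \<Rightarrow> ('b, 'm \<Rightarrow> 'n) module" where
  "hom_struct R M N s =
    \<lparr>carrier = mod_hom R M N, monoid.mult = undefined, monoid.one = undefined,
     ring.zero = (\<lambda>x\<in>carrier M. \<zero>\<^bsub>N\<^esub>),
     ring.add = (\<lambda>f g. \<lambda>x\<in>carrier M. f x \<oplus>\<^bsub>N\<^esub> g x), smult = s\<rparr>"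

text \<open>\<open>Hom_A(M,N)\<close> as a \<open>K\<close>-vector space.\<close>

definition Hom ::
  "('k, 'a) module \<Rightarrow> ('a, 'm) module \<Rightarrow> ('a, 'n) module \<Rightarrow> ('k, 'm \<Rightarrow> 'n) module" where
  "Hom A M N = hom_struct A M N (\<lambda>c f. \<lambda>x\<in>carrier M. (c \<odot>\<^bsub>A\<^esub> \<one>\<^bsub>A\<^esub>) \<odot>\<^bsub>N\<^esub> f x)"

text \<open>Endomorphisms are multiplied by right-to-left composition, so \<open>M\<close> is a left module over
  \<open>End_alg A M\<close>.\<close>

definition End_alg :: "('k, 'a) module \<Rightarrow> ('a, 'm) module \<Rightarrow> ('k, 'm \<Rightarrow> 'm) module" where
  "End_alg A M =
    (Hom A M M)\<lparr>monoid.mult := compose (carrier M), monoid.one := (\<lambda>x\<in>carrier M. x)\<rparr>"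

definition eval_module :: "('a, 'm) module \<Rightarrow> ('m \<Rightarrow> 'm, 'm) module" where
  "eval_module M = with_smult M (\<lambda>f x. f x)"

text \<open>\<open>Hom_A(M,N)\<close> as a left module over \<open>End_A(N)\<close>, and over the opposite of \<open>End_A(M)\<close>.\<close>

definition Hom_End_target ::
  "('k, 'a) module \<Rightarrow> ('a, 'm) module \<Rightarrow> ('a, 'n) module \<Rightarrow> ('n \<Rightarrow> 'n, 'm \<Rightarrow> 'n) module" where
  "Hom_End_target A M N = hom_struct A M N (\<lambda>b f. compose (carrier M) b f)"

definition Hom_End_source ::
  "('k, 'a) module \<Rightarrow> ('a, 'm) module \<Rightarrow> ('a, 'n) module \<Rightarrow> ('m \<Rightarrow> 'm, 'm \<Rightarrow> 'n) module" where
  "Hom_End_source A M N = hom_struct A M N (\<lambda>b f. compose (carrier M) f b)"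

text \<open>\<open>D = Hom_K(-,K)\<close>: the dual of a left \<open>A\<close>-module is a left module over \<open>op_alg A\<close>.\<close>

definition dual ::
  "'k ring \<Rightarrow> ('k, 'a) module \<Rightarrow> ('a, 'm) module \<Rightarrow> ('a, 'm \<Rightarrow> 'k) module" where
  "dual K A M =
    hom_struct K (K_space A M) (regular K) (\<lambda>a f. \<lambda>x\<in>carrier M. f (a \<odot>\<^bsub>M\<^esub> x))"

definition postcomp ::
  "('k, 'a) module \<Rightarrow> ('a, 'l) module \<Rightarrow> ('a, 'm) module \<Rightarrow> ('m \<Rightarrow> 'n) \<Rightarrow> ('l \<Rightarrow> 'm) \<Rightarrow> ('l \<Rightarrow> 'n)"
  where "postcomp A L M f = (\<lambda>h\<in>mod_hom A L M. compose (carrier L) f h)"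

definition precomp ::
  "('k, 'a) module \<Rightarrow> ('a, 'm) module \<Rightarrow> ('a, 'n) module \<Rightarrow> ('a, 'l) module \<Rightarrow>
    ('m \<Rightarrow> 'n) \<Rightarrow> ('n \<Rightarrow> 'l) \<Rightarrow> ('m \<Rightarrow> 'l)"
  where "precomp A M N L f = (\<lambda>h\<in>mod_hom A N L. compose (carrier M) h f)"

section \<open>Direct sums, add, basic modules\<close>

definition submod :: "('a, 'm) module \<Rightarrow> 'm set \<Rightarrow> ('a, 'm) module" where
  "submod M U = M\<lparr>carrier := U\<rparr>"

definition is_summand :: "('a, 'z) ring_scheme \<Rightarrow> ('a, 'm) module \<Rightarrow> 'm set \<Rightarrow> bool" where
  "is_summand R M U \<longleftrightarrow> submodule U R M \<and>
    (\<exists>V. submodule V R M \<and> U \<inter> V = {\<zero>\<^bsub>M\<^esub>} \<and> U <+>\<^bsub>M\<^esub> V = carrier M)"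

definition indecomposable :: "('a, 'z) ring_scheme \<Rightarrow> ('a, 'm) module \<Rightarrow> bool" where
  "indecomposable R M \<longleftrightarrow> carrier M \<noteq> {\<zero>\<^bsub>M\<^esub>} \<and>
    (\<forall>U. is_summand R M U \<longrightarrow> U = {\<zero>\<^bsub>M\<^esub>} \<or> U = carrier M)"

definition basic :: "('a, 'z) ring_scheme \<Rightarrow> ('a, 'm) module \<Rightarrow> bool" where
  "basic R M \<longleftrightarrow> (\<exists>(n::nat) U.
    (\<forall>i<n. submodule (U i) R M \<and> indecomposable R (submod M (U i))) \<and>
    (\<forall>x\<in>carrier M. \<exists>!u. u \<in> (\<Pi>\<^sub>E i\<in>{..<n}. U i) \<and> x = (\<Oplus>\<^bsub>M\<^esub>i\<in>{..<n}. u i)) \<and>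
    (\<forall>i<n. \<forall>j<n. i \<noteq> j \<longrightarrow> \<not> mod_iso R (submod M (U i)) (submod M (U j))))"

definition mod_power :: "('a, 'm) module \<Rightarrow> nat \<Rightarrow> ('a, nat \<Rightarrow> 'm) module" where
  "mod_power M n =
    \<lparr>carrier = {..<n} \<rightarrow>\<^sub>E carrier M, monoid.mult = undefined, monoid.one = undefined,
     ring.zero = (\<lambda>i\<in>{..<n}. \<zero>\<^bsub>M\<^esub>), ring.add = (\<lambda>x y. \<lambda>i\<in>{..<n}. x i \<oplus>\<^bsub>M\<^esub> y i),
     smult = (\<lambda>a x. \<lambda>i\<in>{..<n}. a \<odot>\<^bsub>M\<^esub> x i)\<rparr>"

text \<open>In particular every module in \<open>add X\<close>, for \<open>X\<close> with elements of type \<open>'x\<close>, is isomorphic to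
  one with elements of type \<open>nat \<Rightarrow> 'x\<close>; this is why that type is enough below wherever the terms
  of a sequence lie in \<open>add X\<close>.\<close>

definition add_cat :: "('a, 'z) ring_scheme \<Rightarrow> ('a, 'x) module \<Rightarrow> ('a, 'm) module set" where
  "add_cat R X = {M. fg_module R M \<and>
    (\<exists>n U. is_summand R (mod_power X n) U \<and> mod_iso R M (submod (mod_power X n) U))}"

definition generating_cogenerating ::
  "'k ring \<Rightarrow> ('k, 'a) module \<Rightarrow> ('a, 'e) module \<Rightarrow> bool" where
  "generating_cogenerating K A E \<longleftrightarrow>
    regular A \<in> add_cat A E \<and> dual K (op_alg A) (regular (op_alg A)) \<in> add_cat A E"

section \<open>Exact sequences, gen and cogen\<close>

text \<open>\<open>0 \<rightarrow> M \<rightarrow> t 0 \<rightarrow> \<dots> \<rightarrow> t n\<close> is exact at \<open>M, t 0, \<dots>, t (n - 1)\<close>.\<close>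

definition left_exact ::
  "('a, 'z) ring_scheme \<Rightarrow> ('a, 'm) module \<Rightarrow> ('m \<Rightarrow> 'n) \<Rightarrow> (nat \<Rightarrow> ('a, 'n) module) \<Rightarrow>
    (nat \<Rightarrow> 'n \<Rightarrow> 'n) \<Rightarrow> nat \<Rightarrow> bool" where
  "left_exact R M j t d n \<longleftrightarrow>
    j \<in> mod_hom R M (t 0) \<and> (\<forall>i<n. d i \<in> mod_hom R (t i) (t (Suc i))) \<and>
    inj_on j (carrier M) \<and>
    (0 < n \<longrightarrow> j ` carrier M = a_kernel (t 0) (t 1) (d 0)) \<and>
    (\<forall>i. Suc i < n \<longrightarrow>
      d i ` carrier (t i) = a_kernel (t (Suc i)) (t (Suc (Suc i))) (d (Suc i)))"

text \<open>\<open>t n \<rightarrow> \<dots> \<rightarrow> t 0 \<rightarrow> M \<rightarrow> 0\<close> is exact at \<open>t (n - 1), \<dots>, t 0, M\<close>.\<close>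

definition right_exact ::
  "('a, 'z) ring_scheme \<Rightarrow> (nat \<Rightarrow> ('a, 'n) module) \<Rightarrow> (nat \<Rightarrow> 'n \<Rightarrow> 'n) \<Rightarrow> ('n \<Rightarrow> 'm) \<Rightarrow>
    ('a, 'm) module \<Rightarrow> nat \<Rightarrow> bool" where
  "right_exact R t d p M n \<longleftrightarrow>
    p \<in> mod_hom R (t 0) M \<and> (\<forall>i<n. d i \<in> mod_hom R (t (Suc i)) (t i)) \<and>
    p ` carrier (t 0) = carrier M \<and>
    (0 < n \<longrightarrow> d 0 ` carrier (t 1) = a_kernel (t 0) M p) \<and>
    (\<forall>i. Suc i < n \<longrightarrow>
      d (Suc i) ` carrier (t (Suc (Suc i))) = a_kernel (t (Suc i)) (t i) (d i))"

definition gen_cat ::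
  "'k ring \<Rightarrow> ('k, 'b) module \<Rightarrow> int \<Rightarrow> ('b, 'x) module \<Rightarrow> ('b, 'm) module set" where
  "gen_cat K B m X = {M. fg_module B M \<and> (0 \<le> m \<longrightarrow>
    (\<exists>(t :: nat \<Rightarrow> ('b, nat \<Rightarrow> 'x) module) d p.
      (\<forall>i\<le>nat m. t i \<in> add_cat B X) \<and>
      right_exact B t d p M (nat m) \<and>
      right_exact K (\<lambda>i. Hom B X (t i)) (\<lambda>i. postcomp B X (t (Suc i)) (d i))
        (postcomp B X (t 0) p) (Hom B X M) (nat m)))}"

definition cogen_cat ::
  "'k ring \<Rightarrow> ('k, 'b) module \<Rightarrow> int \<Rightarrow> ('b, 'x) module \<Rightarrow> ('b, 'm) module set" where
  "cogen_cat K B m X = {N. fg_module B N \<and> (0 \<le> m \<longrightarrow>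
    (\<exists>(t :: nat \<Rightarrow> ('b, nat \<Rightarrow> 'x) module) d j.
      (\<forall>i\<le>nat m. t i \<in> add_cat B X) \<and>
      left_exact B N j t d (nat m) \<and>
      right_exact K (\<lambda>i. Hom B (t i) X) (\<lambda>i. precomp B (t i) (t (Suc i)) X (d i))
        (precomp B N (t 0) X j) (Hom B N X) (nat m)))}"

section \<open>Projectives, injectives, resolutions, dominant dimension\<close>

text \<open>The type argument is a universe: quantifiers over modules range over modules whose elements
  have that type.  It is to be taken large enough to contain an isomorphic copy of every finitely
  generated module.  Over a finite-dimensional \<open>K\<close>-algebra with \<open>K :: 'k ring\<close>, the type
  \<open>nat \<Rightarrow> 'k\<close> will do, since it contains every \<open>K\<^sup>n\<close>.\<close>

definition projective :: "'u itself \<Rightarrow> ('k, 'a) module \<Rightarrow> ('a, 'm) module \<Rightarrow> bool" where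
  "projective U A P \<longleftrightarrow> fg_module A P \<and>
    (\<forall>(M :: ('a, 'u) module) (N :: ('a, 'u) module) f g.
      fg_module A M \<and> fg_module A N \<and>
      f \<in> mod_hom A M N \<and> f ` carrier M = carrier N \<and> g \<in> mod_hom A P N \<longrightarrow>
      (\<exists>h\<in>mod_hom A P M. compose (carrier P) f h = g))"

definition injective :: "'u itself \<Rightarrow> ('k, 'a) module \<Rightarrow> ('a, 'm) module \<Rightarrow> bool" where
  "injective U A I \<longleftrightarrow> fg_module A I \<and>
    (\<forall>(M :: ('a, 'u) module) (N :: ('a, 'u) module) f g.
      fg_module A M \<and> fg_module A N \<and>
      f \<in> mod_hom A M N \<and> inj_on f (carrier M) \<and> g \<in> mod_hom A M I \<longrightarrow>
      (\<exists>h\<in>mod_hom A N I. compose (carrier M) h f = g))"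

definition projective_resolution ::
  "'u itself \<Rightarrow> ('k, 'a) module \<Rightarrow> (nat \<Rightarrow> ('a, 'u) module) \<Rightarrow> (nat \<Rightarrow> 'u \<Rightarrow> 'u) \<Rightarrow> ('u \<Rightarrow> 'm) \<Rightarrow>
    ('a, 'm) module \<Rightarrow> bool" where
  "projective_resolution U A P d p M \<longleftrightarrow>
    (\<forall>i. projective U A (P i)) \<and> (\<forall>n. right_exact A P d p M n)"

definition injective_resolution ::
  "'u itself \<Rightarrow> ('k, 'a) module \<Rightarrow> ('a, 'm) module \<Rightarrow> ('m \<Rightarrow> 'u) \<Rightarrow> (nat \<Rightarrow> ('a, 'u) module) \<Rightarrow>
    (nat \<Rightarrow> 'u \<Rightarrow> 'u) \<Rightarrow> bool" where
  "injective_resolution U A M j I d \<longleftrightarrow>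
    (\<forall>i. injective U A (I i)) \<and> (\<forall>n. left_exact A M j I d n)"

definition pdim_le :: "'u itself \<Rightarrow> ('k, 'a) module \<Rightarrow> nat \<Rightarrow> ('a, 'm) module \<Rightarrow> bool" where
  "pdim_le U A n M \<longleftrightarrow> (\<exists>P d p. projective_resolution U A P d p M \<and>
    (\<forall>i>n. carrier (P i) = {\<zero>\<^bsub>P i\<^esub>}))"

text \<open>Vanishing, for \<open>i > 0\<close>, of \<open>Ext^i_A(M,N)\<close>, the \<open>i\<close>-th cohomology of \<open>Hom_A(P,N)\<close> for a
  projective resolution \<open>P\<close> of \<open>M\<close>.\<close>

definition Ext_vanishes ::
  "'u itself \<Rightarrow> ('k, 'a) module \<Rightarrow> nat \<Rightarrow> ('a, 'm) module \<Rightarrow> ('a, 'n) module \<Rightarrow> bool" where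
  "Ext_vanishes U A i M N \<longleftrightarrow> (\<forall>P d p. projective_resolution U A P d p M \<longrightarrow>
    precomp A (P i) (P (i - 1)) N (d (i - 1)) ` mod_hom A (P (i - 1)) N =
    a_kernel (Hom A (P i) N) (Hom A (P (Suc i)) N) (precomp A (P (Suc i)) (P i) N (d i)))"

definition domdim_ge :: "'u itself \<Rightarrow> ('k, 'a) module \<Rightarrow> nat \<Rightarrow> bool" where
  "domdim_ge U A k \<longleftrightarrow> (\<exists>j I d. injective_resolution U A (regular A) j I d \<and>
    (\<forall>i<k. projective U A (I i)))"

definition domdim_eq :: "'u itself \<Rightarrow> ('k, 'a) module \<Rightarrow> nat \<Rightarrow> bool" where
  "domdim_eq U A k \<longleftrightarrow> domdim_ge U A k \<and> \<not> domdim_ge U A (k + 1)"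

definition max_proj_inj_summand :: "'u itself \<Rightarrow> ('k, 'a) module \<Rightarrow> 'a set \<Rightarrow> bool" where
  "max_proj_inj_summand U A X \<longleftrightarrow>
    is_summand A (regular A) X \<and>
    projective U A (submod (regular A) X) \<and> injective U A (submod (regular A) X) \<and>
    (\<forall>Y. is_summand A (regular A) Y \<and>
      projective U A (submod (regular A) Y) \<and> injective U A (submod (regular A) Y) \<and>
      X \<subseteq> Y \<longrightarrow> Y = X)"

section \<open>Special tilting modules\<close>

text \<open>An exact sequence \<open>0 \<rightarrow> A \<rightarrow> t 0 \<rightarrow> \<dots> \<rightarrow> t k \<rightarrow> 0\<close> with all terms \<open>t i\<close> in \<open>add T\<close>; the final
  zero is the term \<open>t (k + 1)\<close>.\<close>

definition tilting_coresolution ::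
  "('k, 'a) module \<Rightarrow> nat \<Rightarrow> ('a, 't) module \<Rightarrow> ('a \<Rightarrow> (nat \<Rightarrow> 't)) \<Rightarrow>
    (nat \<Rightarrow> ('a, nat \<Rightarrow> 't) module) \<Rightarrow> (nat \<Rightarrow> (nat \<Rightarrow> 't) \<Rightarrow> (nat \<Rightarrow> 't)) \<Rightarrow> bool" where
  "tilting_coresolution A k T j t d \<longleftrightarrow>
    (\<forall>i\<le>k. t i \<in> add_cat A T) \<and>
    left_module A (t (Suc k)) \<and> carrier (t (Suc k)) = {\<zero>\<^bsub>t (Suc k)\<^esub>} \<and>
    left_exact A (regular A) j t d (Suc k)"

definition tilting :: "'u itself \<Rightarrow> ('k, 'a) module \<Rightarrow> nat \<Rightarrow> ('a, 't) module \<Rightarrow> bool" where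
  "tilting U A k T \<longleftrightarrow> fg_module A T \<and> pdim_le U A k T \<and>
    (\<forall>i>0. Ext_vanishes U A i T T) \<and> (\<exists>j t d. tilting_coresolution A k T j t d)"

definition special_tilting ::
  "'u itself \<Rightarrow> ('k, 'a) module \<Rightarrow> ('a, 'p) module \<Rightarrow> nat \<Rightarrow> ('a, 't) module \<Rightarrow> bool" where
  "special_tilting U A P k T \<longleftrightarrow> tilting U A k T \<and> projective U A P \<and> P \<in> add_cat A T \<and>
    (\<exists>j t d. tilting_coresolution A k T j t d \<and> (\<forall>i<k. t i \<in> add_cat A P))"

section \<open>Tensor products and the intermediate extension\<close>

text \<open>The tensor product of a right \<open>A\<close>-module \<open>N\<close> (a left module over \<open>op_alg A\<close>) and a left
  \<open>A\<close>-module \<open>M\<close> is the free abelian group on pairs modulo the usual relations.\<close>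

definition tensor_free :: "('a, 'n) module \<Rightarrow> ('a, 'm) module \<Rightarrow> (('n \<times> 'm) \<Rightarrow>\<^sub>0 int) monoid" where
  "tensor_free N M = free_Abelian_group (carrier N \<times> carrier M)"

definition tensor_relations ::
  "('k, 'a) module \<Rightarrow> ('a, 'n) module \<Rightarrow> ('a, 'm) module \<Rightarrow> (('n \<times> 'm) \<Rightarrow>\<^sub>0 int) set" where
  "tensor_relations A N M =
    {frag_of (x \<oplus>\<^bsub>N\<^esub> y, m) - frag_of (x, m) - frag_of (y, m) | x y m.
      x \<in> carrier N \<and> y \<in> carrier N \<and> m \<in> carrier M} \<union>
    {frag_of (x, m \<oplus>\<^bsub>M\<^esub> n) - frag_of (x, m) - frag_of (x, n) | x m n.
      x \<in> carrier N \<and> m \<in> carrier M \<and> n \<in> carrier M} \<union>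
    {frag_of (a \<odot>\<^bsub>N\<^esub> x, m) - frag_of (x, a \<odot>\<^bsub>M\<^esub> m) | a x m.
      a \<in> carrier A \<and> x \<in> carrier N \<and> m \<in> carrier M}"

definition tensor_null ::
  "('k, 'a) module \<Rightarrow> ('a, 'n) module \<Rightarrow> ('a, 'm) module \<Rightarrow> (('n \<times> 'm) \<Rightarrow>\<^sub>0 int) set" where
  "tensor_null A N M = generate (tensor_free N M) (tensor_relations A N M)"

definition pure_tensor ::
  "('k, 'a) module \<Rightarrow> ('a, 'n) module \<Rightarrow> ('a, 'm) module \<Rightarrow> 'n \<Rightarrow> 'm \<Rightarrow> (('n \<times> 'm) \<Rightarrow>\<^sub>0 int) set"
  where
  "pure_tensor A N M x m = tensor_null A N M #>\<^bsub>tensor_free N M\<^esub> frag_of (x, m)"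

text \<open>The algebra \<open>eBe\<close> with identity \<open>e\<close>, the right \<open>eBe\<close>-module \<open>Be\<close> and the left
  \<open>eBe\<close>-module \<open>eB\<close>.\<close>

definition corner :: "('k, 'b) module \<Rightarrow> 'b \<Rightarrow> ('k, 'b) module" where
  "corner B e = B\<lparr>carrier := {e \<otimes>\<^bsub>B\<^esub> b \<otimes>\<^bsub>B\<^esub> e | b. b \<in> carrier B}, monoid.one := e\<rparr>"

definition Be_module :: "('k, 'b) module \<Rightarrow> 'b \<Rightarrow> ('b, 'b) module" where
  "Be_module B e = submod (regular (op_alg B)) {b \<otimes>\<^bsub>B\<^esub> e | b. b \<in> carrier B}"

definition eB_module :: "('k, 'b) module \<Rightarrow> 'b \<Rightarrow> ('b, 'b) module" where
  "eB_module B e = submod (regular B) {e \<otimes>\<^bsub>B\<^esub> b | b. b \<in> carrier B}"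

text \<open>In \<open>Be \<otimes> M\<close> the element \<open>b\<close> of \<open>B\<close> sends the class of \<open>c\<close> to the class of the image of
  \<open>c\<close> under \<open>(x, m) \<mapsto> (bx, m)\<close>; the union below is over a set of equal cosets.\<close>

definition left_adjoint ::
  "('k, 'b) module \<Rightarrow> 'b \<Rightarrow> ('b, 'm) module \<Rightarrow> ('b, (('b \<times> 'm) \<Rightarrow>\<^sub>0 int) set) module" where
  "left_adjoint B e M =
    (let N = Be_module B e; F = tensor_free N M; H = tensor_null (corner B e) N M in
      \<lparr>carrier = rcosets\<^bsub>F\<^esub> H, monoid.mult = undefined, monoid.one = undefined,
       ring.zero = H, ring.add = set_mult F,
       smult = (\<lambda>b C. \<Union>c\<in>C. H #>\<^bsub>F\<^esub> frag_extend (\<lambda>(x, m). frag_of (b \<otimes>\<^bsub>B\<^esub> x, m)) c)\<rparr>)"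

definition right_adjoint ::
  "('k, 'b) module \<Rightarrow> 'b \<Rightarrow> ('b, 'm) module \<Rightarrow> ('b, 'b \<Rightarrow> 'm) module" where
  "right_adjoint B e M = hom_struct (corner B e) (eB_module B e) M
    (\<lambda>b h. \<lambda>y\<in>carrier (eB_module B e). h (y \<otimes>\<^bsub>B\<^esub> b))"

definition zeta ::
  "('k, 'b) module \<Rightarrow> 'b \<Rightarrow> ('b, 'm) module \<Rightarrow> (('b \<times> 'm) \<Rightarrow>\<^sub>0 int) set \<Rightarrow> ('b \<Rightarrow> 'm)" where
  "zeta B e M =
    (THE f. f \<in> mod_hom B (left_adjoint B e M) (right_adjoint B e M) \<and>
      (\<forall>x\<in>carrier (Be_module B e). \<forall>m\<in>carrier M.
        f (pure_tensor (corner B e) (Be_module B e) M x m) =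
          (\<lambda>y\<in>carrier (eB_module B e). (y \<otimes>\<^bsub>B\<^esub> x) \<odot>\<^bsub>M\<^esub> m)))"

definition intermediate_extension ::
  "('k, 'b) module \<Rightarrow> 'b \<Rightarrow> ('b, 'm) module \<Rightarrow> ('b, 'b \<Rightarrow> 'm) module" where
  "intermediate_extension B e M =
    submod (right_adjoint B e M) (zeta B e M ` carrier (left_adjoint B e M))"

text \<open>If \<open>j : P \<rightarrow> T\<close> and \<open>q : T \<rightarrow> P\<close> exhibit \<open>P\<close> as a direct summand of \<open>T\<close>, then \<open>f \<mapsto> jfq\<close>
  identifies the algebra \<open>End(P)\<close> with \<open>e End(T) e\<close> for the projection \<open>e = jq\<close>, and likewise
  for the opposite algebras.\<close>

definition to_corner ::
  "('a, 't) module \<Rightarrow> ('p \<Rightarrow> 't) \<Rightarrow> ('t \<Rightarrow> 'p) \<Rightarrow> ('p \<Rightarrow> 'p) \<Rightarrow> ('t \<Rightarrow> 't)" where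
  "to_corner T j q f = (\<lambda>t\<in>carrier T. j (f (q t)))"

end

theory Submission
  imports Defs
begin

text \<open>
  Let \<open>0 \<rightarrow> \<Gamma> \<rightarrow> I 0 \<rightarrow> I 1 \<rightarrow> \<dots>\<close> be the injective resolution whose terms \<open>I 0, \<dots>, I d\<close> are projective; they lie
  in \<open>add PI\<close> by maximality of \<open>PI\<close>.  Extending maps from cosyzygies of \<open>\<Gamma>\<close> along this resolution shows
  that \<open>D\<Gamma>\<close> has a resolution \<open>\<dots> \<rightarrow> t 1 \<rightarrow> t 0 \<rightarrow> D\<Gamma> \<rightarrow> 0\<close> with \<open>t 0, \<dots>, t d\<close> in \<open>add PI\<close>.  Since
  \<open>pdim T \<le> k\<close> and the \<open>t i\<close> are injective, \<open>Hom(T, -)\<close> keeps it exact up to the term \<open>t (d - k)\<close>, and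
  \<open>Hom(T, D\<Gamma>) = DT\<close>; this is the presentation that puts \<open>DT\<close> into \<open>gen\<close>.  For \<open>cogen\<close>, apply
  \<open>D Hom(-, T)\<close> to the special coresolution of \<open>\<Gamma>\<close>: it stays exact because the higher self-extensions
  of \<open>T\<close> vanish.

  For the intermediate extension, \<open>P = Be\<close> and \<open>I\<close> is the coinduced module of the functionals on \<open>eB\<close>, so
  the first terms of the two presentations say that \<open>DT\<close> is generated by \<open>e DT = E\<close> and that no nonzero
  element of \<open>DT\<close> is killed by \<open>eB\<close>.  Hence \<open>Be \<otimes> E \<rightarrow> DT\<close> is onto and \<open>DT \<rightarrow> Hom(eB, E)\<close> is injective, and
  their composite is \<open>\<zeta>\<close>.
\<close>

section \<open>Linear maps\<close>

text \<open>Dominant dimension speaks about injective terms for the regular left module, whereas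
  \<open>gen\<close> asks for projective-injective terms over its dual; extending maps along the
  given resolution replaces the detour through right modules. Each step in the projective dimension
  of \<open>T\<close> costs one term, whence \<open>d - k\<close>. The coresolution of
  \<open>\<Gamma>\<close> ends in \<open>add T\<close>, so up to projectives its kernels are built
  from syzygies of \<open>T\<close>; this is how the vanishing of self-extensions enters. Exactness
  under \<open>Hom(P, -)\<close> and \<open>Hom(-, I)\<close> is automatic, \<open>P\<close> being
  projective and \<open>I\<close> injective. Two devices shape the text. Membership in
  \<open>add X\<close> becomes a property of the identity map, being a finite sum of maps through
  \<open>X\<close>; such sums survive functors, lifts and passage to syzygies, and direct sums of
  modules of different types are never formed. As quantifiers over modules range over a single
  element type, finitely generated modules are replaced by copies made of coordinate sequences.
  Maximality of \<open>PI\<close> concerns inclusion of submodules only; that it absorbs every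
  projective-injective module, up to \<open>add\<close>, requires a Fitting argument.\<close>

context left_module
begin

lemma smult_zero_right: "a \<in> carrier R \<Longrightarrow> a \<odot>\<^bsub>M\<^esub> \<zero>\<^bsub>M\<^esub> = \<zero>\<^bsub>M\<^esub>"
  using smult_r_distr[of a "\<zero>\<^bsub>M\<^esub>" "\<zero>\<^bsub>M\<^esub>"] smult_closed[of a "\<zero>\<^bsub>M\<^esub>"]
  by (metis M.add.l_cancel_one M.zero_closed M.l_zero)

lemma smult_zero_left: "x \<in> carrier M \<Longrightarrow> \<zero>\<^bsub>R\<^esub> \<odot>\<^bsub>M\<^esub> x = \<zero>\<^bsub>M\<^esub>"
  using smult_l_distr[of "\<zero>\<^bsub>R\<^esub>" "\<zero>\<^bsub>R\<^esub>" x] smult_closed[of "\<zero>\<^bsub>R\<^esub>" x]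
  by (metis M.add.l_cancel_one R.zero_closed R.l_zero)

lemma smult_minus_right: "\<lbrakk>a \<in> carrier R; x \<in> carrier M\<rbrakk> \<Longrightarrow> a \<odot>\<^bsub>M\<^esub> (\<ominus>\<^bsub>M\<^esub> x) = \<ominus>\<^bsub>M\<^esub> (a \<odot>\<^bsub>M\<^esub> x)"
  using smult_r_distr[of a "\<ominus>\<^bsub>M\<^esub> x" x] smult_closed smult_zero_right
  by (metis M.add.inv_closed M.l_neg M.minus_equality)

lemma smult_minus_left: "\<lbrakk>a \<in> carrier R; x \<in> carrier M\<rbrakk> \<Longrightarrow> (\<ominus>\<^bsub>R\<^esub> a) \<odot>\<^bsub>M\<^esub> x = \<ominus>\<^bsub>M\<^esub> (a \<odot>\<^bsub>M\<^esub> x)"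
  using smult_l_distr[of "\<ominus>\<^bsub>R\<^esub> a" a x] smult_closed smult_zero_left
  by (metis R.add.inv_closed R.l_neg M.minus_equality)

lemma minus_as_smult: "x \<in> carrier M \<Longrightarrow> (\<ominus>\<^bsub>R\<^esub> \<one>\<^bsub>R\<^esub>) \<odot>\<^bsub>M\<^esub> x = \<ominus>\<^bsub>M\<^esub> x"
  by (simp add: smult_minus_left smult_one)

text \<open>Closure under negation is not demanded, because additive inverses are multiples by
  \<open>\<ominus> \<one>\<close>.\<close>

lemma submodI:
  assumes "U \<subseteq> carrier M" "\<zero>\<^bsub>M\<^esub> \<in> U" "\<And>x y. \<lbrakk>x \<in> U; y \<in> U\<rbrakk> \<Longrightarrow> x \<oplus>\<^bsub>M\<^esub> y \<in> U"
    "\<And>a x. \<lbrakk>a \<in> carrier R; x \<in> U\<rbrakk> \<Longrightarrow> a \<odot>\<^bsub>M\<^esub> x \<in> U"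
  shows "submodule U R M"
proof (rule submodule.intro)
  have "inv\<^bsub>add_monoid M\<^esub> x \<in> U" if "x \<in> U" for x
    using assms(1) assms(4)[of "\<ominus>\<^bsub>R\<^esub> \<one>\<^bsub>R\<^esub>" x] minus_as_smult[of x] that by (auto simp: a_inv_def)
  with assms show "subgroup U (add_monoid M)" by (auto intro!: subgroup.intro)
  show "submodule_axioms U R M" using assms by (auto intro!: submodule_axioms.intro)
qed

lemma submod_carrier: "submodule (carrier M) R M"
  by (rule submodI) (auto simp: smult_closed)

lemma submod_zero: "submodule {\<zero>\<^bsub>M\<^esub>} R M"
  by (rule submodI) (auto simp: smult_zero_right)

lemma eq_by_diff: "\<lbrakk>x \<in> carrier M; y \<in> carrier M; x \<ominus>\<^bsub>M\<^esub> y = \<zero>\<^bsub>M\<^esub>\<rbrakk> \<Longrightarrow> x = y"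
  by (metis M.add.inv_closed M.minus_eq M.minus_equality M.minus_minus)

lemma diff_self: "x \<in> carrier M \<Longrightarrow> x \<ominus>\<^bsub>M\<^esub> x = \<zero>\<^bsub>M\<^esub>"
  by (simp add: M.minus_eq M.r_neg)

lemma diff_add_cancel: "\<lbrakk>x \<in> carrier M; y \<in> carrier M\<rbrakk> \<Longrightarrow> (x \<ominus>\<^bsub>M\<^esub> y) \<oplus>\<^bsub>M\<^esub> y = x"
  by (simp add: M.minus_eq M.a_assoc M.l_neg)

lemma add_diff_cancel: "\<lbrakk>x \<in> carrier M; y \<in> carrier M\<rbrakk> \<Longrightarrow> x \<oplus>\<^bsub>M\<^esub> (y \<ominus>\<^bsub>M\<^esub> x) = y"
  by (metis M.add.inv_closed M.a_comm M.add.m_closed M.minus_eq diff_add_cancel)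

end

lemma submodD:
  assumes "submodule U R M"
  shows "U \<subseteq> carrier M" "\<zero>\<^bsub>M\<^esub> \<in> U" "x \<in> U \<Longrightarrow> y \<in> U \<Longrightarrow> x \<oplus>\<^bsub>M\<^esub> y \<in> U"
    "a \<in> carrier R \<Longrightarrow> x \<in> U \<Longrightarrow> a \<odot>\<^bsub>M\<^esub> x \<in> U" "x \<in> U \<Longrightarrow> \<ominus>\<^bsub>M\<^esub> x \<in> U" "x \<in> U \<Longrightarrow> y \<in> U \<Longrightarrow> x \<ominus>\<^bsub>M\<^esub> y \<in> U"
proof -
  interpret submodule U R M by fact
  show "U \<subseteq> carrier M" "\<zero>\<^bsub>M\<^esub> \<in> U" "x \<in> U \<Longrightarrow> y \<in> U \<Longrightarrow> x \<oplus>\<^bsub>M\<^esub> y \<in> U"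
    "a \<in> carrier R \<Longrightarrow> x \<in> U \<Longrightarrow> a \<odot>\<^bsub>M\<^esub> x \<in> U"
    using subset one_closed m_closed smult_closed by (auto)
  show m: "\<ominus>\<^bsub>M\<^esub> x \<in> U" if "x \<in> U" for x using m_inv_closed[OF that] by (simp add: a_inv_def)
  show "x \<ominus>\<^bsub>M\<^esub> y \<in> U" if "x \<in> U" "y \<in> U" using m[OF that(2)] that(1) m_closed by (simp add: a_minus_def)
qed

lemma submod_simps [simp]:
  "carrier (submod M U) = U" "\<zero>\<^bsub>submod M U\<^esub> = \<zero>\<^bsub>M\<^esub>" "x \<oplus>\<^bsub>submod M U\<^esub> y = x \<oplus>\<^bsub>M\<^esub> y"
  "a \<odot>\<^bsub>submod M U\<^esub> x = a \<odot>\<^bsub>M\<^esub> x"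
  by (auto simp: submod_def)

lemma submodule_left_module:
  assumes "left_module R M" "submodule U R M" shows "left_module R (submod M U)"
proof -
  interpret left_module R M by fact
  note U = submodD[OF assms(2)]
  have [simp]: "x \<in> U \<Longrightarrow> x \<in> carrier M" for x using U(1) by auto
  show ?thesis
  proof (intro left_module.intro abelian_groupI left_module_axioms.intro)
    show "ring R" by (rule R.ring_axioms)
    fix x assume "x \<in> carrier (submod M U)"
    then show "\<exists>y\<in>carrier (submod M U). y \<oplus>\<^bsub>submod M U\<^esub> x = \<zero>\<^bsub>submod M U\<^esub>"
      using U(5)[of x] by (auto intro!: bexI[of _ "\<ominus>\<^bsub>M\<^esub> x"] simp: M.l_neg)
  qed (auto simp: U M.a_ac smult_l_distr smult_r_distr smult_assoc1 smult_one)
qed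

lemma submodule_of_submod:
  assumes "left_module R M" "submodule U R M"
  shows "submodule W R (submod M U) \<longleftrightarrow> submodule W R M \<and> W \<subseteq> U"
proof -
  interpret left_module R M by fact
  interpret S: left_module R "submod M U" using assms by (rule submodule_left_module)
  note U = submodD[OF assms(2)]
  show ?thesis
  proof safe
    assume W: "submodule W R (submod M U)"
    show "submodule W R M" using submodD[OF W] U by (intro submodI) auto
    show "x \<in> U" if "x \<in> W" for x using submodD(1)[OF W] that by auto
  next
    assume W: "submodule W R M" "W \<subseteq> U"
    show "submodule W R (submod M U)" using submodD[OF W(1)] W(2) by (intro S.submodI) auto
  qed
qed

text \<open>\<open>mod_hom\<close> without extensionality. Plain lambda terms can then be composed,
  added and restricted as linear maps; \<open>lin_restrict\<close> returns to extensional functions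
  where a set of homomorphisms is involved.\<close>

definition lin ::
  "('a, 'z) ring_scheme \<Rightarrow> ('a, 'm) module \<Rightarrow> ('a, 'n) module \<Rightarrow> ('m \<Rightarrow> 'n) \<Rightarrow> bool" where
  "lin R M N f \<longleftrightarrow> f \<in> carrier M \<rightarrow> carrier N \<and>
    (\<forall>x\<in>carrier M. \<forall>y\<in>carrier M. f (x \<oplus>\<^bsub>M\<^esub> y) = f x \<oplus>\<^bsub>N\<^esub> f y) \<and>
    (\<forall>a\<in>carrier R. \<forall>x\<in>carrier M. f (a \<odot>\<^bsub>M\<^esub> x) = a \<odot>\<^bsub>N\<^esub> f x)"

lemma linI:
  assumes "\<And>x. x \<in> carrier M \<Longrightarrow> f x \<in> carrier N"
    "\<And>x y. \<lbrakk>x \<in> carrier M; y \<in> carrier M\<rbrakk> \<Longrightarrow> f (x \<oplus>\<^bsub>M\<^esub> y) = f x \<oplus>\<^bsub>N\<^esub> f y"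
    "\<And>a x. \<lbrakk>a \<in> carrier R; x \<in> carrier M\<rbrakk> \<Longrightarrow> f (a \<odot>\<^bsub>M\<^esub> x) = a \<odot>\<^bsub>N\<^esub> f x"
  shows "lin R M N f"
  using assms by (auto simp: lin_def)

lemma linD:
  assumes "lin R M N f"
  shows "x \<in> carrier M \<Longrightarrow> f x \<in> carrier N"
    "\<lbrakk>x \<in> carrier M; y \<in> carrier M\<rbrakk> \<Longrightarrow> f (x \<oplus>\<^bsub>M\<^esub> y) = f x \<oplus>\<^bsub>N\<^esub> f y"
    "\<lbrakk>a \<in> carrier R; x \<in> carrier M\<rbrakk> \<Longrightarrow> f (a \<odot>\<^bsub>M\<^esub> x) = a \<odot>\<^bsub>N\<^esub> f x"
  using assms by (auto simp: lin_def)

lemma mod_hom_iff: "f \<in> mod_hom R M N \<longleftrightarrow> lin R M N f \<and> f \<in> extensional (carrier M)"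
  by (auto simp: mod_hom_def lin_def PiE_def)

lemma mod_homD: "f \<in> mod_hom R M N \<Longrightarrow> lin R M N f"
  by (simp add: mod_hom_iff)

lemma lin_cong_imp:
  assumes "left_module R M" "lin R M N f" "\<And>x. x \<in> carrier M \<Longrightarrow> g x = f x"
  shows "lin R M N g"
proof -
  interpret left_module R M by fact
  show ?thesis by (rule linI) (auto simp: assms(3) linD[OF assms(2)] smult_closed)
qed

lemma lin_restrict:
  "left_module R M \<Longrightarrow> lin R M N f \<Longrightarrow> (\<lambda>x\<in>carrier M. f x) \<in> mod_hom R M N"
  by (auto simp: mod_hom_iff intro: lin_cong_imp)

lemma lin_zero:
  assumes "left_module R M" "left_module R N" "lin R M N f" shows "f \<zero>\<^bsub>M\<^esub> = \<zero>\<^bsub>N\<^esub>"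
proof -
  interpret M: left_module R M by fact
  interpret N: left_module R N by fact
  have "f \<zero>\<^bsub>M\<^esub> = f \<zero>\<^bsub>M\<^esub> \<oplus>\<^bsub>N\<^esub> f \<zero>\<^bsub>M\<^esub>" using linD(2)[OF assms(3), of "\<zero>\<^bsub>M\<^esub>" "\<zero>\<^bsub>M\<^esub>"] by simp
  then show ?thesis by (metis M.M.zero_closed N.M.add.l_cancel_one linD(1)[OF assms(3)])
qed

lemma lin_minus:
  assumes "left_module R M" "left_module R N" "lin R M N f" "x \<in> carrier M"
  shows "f (\<ominus>\<^bsub>M\<^esub> x) = \<ominus>\<^bsub>N\<^esub> f x"
proof -
  interpret M: left_module R M by fact
  interpret N: left_module R N by fact
  show ?thesis using linD(3)[OF assms(3), of "\<ominus>\<^bsub>R\<^esub> \<one>\<^bsub>R\<^esub>" x] linD(1)[OF assms(3)] assms(4)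
    by (simp add: M.minus_as_smult N.minus_as_smult)
qed

lemma lin_diff:
  assumes "left_module R M" "left_module R N" "lin R M N f" "x \<in> carrier M" "y \<in> carrier M"
  shows "f (x \<ominus>\<^bsub>M\<^esub> y) = f x \<ominus>\<^bsub>N\<^esub> f y"
proof -
  interpret M: left_module R M by fact
  show ?thesis using assms by (simp add: a_minus_def linD(2)[OF assms(3)] lin_minus)
qed

lemma lin_id: "lin R M M (\<lambda>x. x)"
  by (auto simp: lin_def)

lemma lin_comp: "\<lbrakk>lin R M N f; lin R N L g\<rbrakk> \<Longrightarrow> lin R M L (\<lambda>x. g (f x))"
  by (auto simp: lin_def Pi_iff)

lemma lin_const_zero: "left_module R N \<Longrightarrow> lin R M N (\<lambda>x. \<zero>\<^bsub>N\<^esub>)"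
  by (auto simp: lin_def left_module.smult_zero_right abelian_group_def abelian_monoid.zero_closed
    abelian_monoid.l_zero left_module_def)

lemma lin_sum:
  assumes "left_module R N" "lin R M N f" "lin R M N g" shows "lin R M N (\<lambda>x. f x \<oplus>\<^bsub>N\<^esub> g x)"
proof -
  interpret left_module R N by fact
  show ?thesis using linD[OF assms(2)] linD[OF assms(3)] by (intro linI) (auto simp: M.a_ac smult_r_distr)
qed

lemma lin_difference:
  assumes "left_module R N" "lin R M N f" "lin R M N g" shows "lin R M N (\<lambda>x. f x \<ominus>\<^bsub>N\<^esub> g x)"
proof -
  interpret left_module R N by fact
  show ?thesis using linD[OF assms(2)] linD[OF assms(3)]
    by (intro linI) (auto simp: a_minus_def M.a_ac M.minus_add smult_r_distr smult_minus_right)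
qed

lemma lin_incl: "submodule U R M \<Longrightarrow> lin R (submod M U) M (\<lambda>x. x)"
  using submodD[of U R M] by (auto simp: lin_def)

lemma lin_on_submod: "lin R M N f \<Longrightarrow> U \<subseteq> carrier M \<Longrightarrow> lin R (submod M U) N f"
  unfolding lin_def Pi_iff submod_simps by blast

lemma lin_into_submod:
  "lin R M N f \<Longrightarrow> (\<And>x. x \<in> carrier M \<Longrightarrow> f x \<in> U) \<Longrightarrow> lin R M (submod N U) f"
  by (auto simp: lin_def)

lemma lin_from_submod: "lin R L (submod M U) f \<Longrightarrow> submodule U R M \<Longrightarrow> lin R L M f"
  using submodD(1)[of U R M] by (auto simp: lin_def Pi_iff)

lemma preimage_submodule:
  assumes "left_module R M" "left_module R N" "lin R M N f" "submodule U R N"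
  shows "submodule {x \<in> carrier M. f x \<in> U} R M"
proof -
  interpret left_module R M by fact
  show ?thesis using linD[OF assms(3)] submodD[OF assms(4)] lin_zero[OF assms(1-3)]
    by (intro submodI) (auto simp: smult_closed)
qed

lemma kernel_submodule:
  assumes "left_module R M" "left_module R N" "lin R M N f"
  shows "submodule {x \<in> carrier M. f x = \<zero>\<^bsub>N\<^esub>} R M"
proof -
  interpret left_module R N by fact
  show ?thesis using preimage_submodule[OF assms submod_zero] by simp
qed

lemma image_submodule:
  assumes "left_module R M" "left_module R N" "lin R M N f" "submodule U R M"
  shows "submodule (f ` U) R N"
proof -
  interpret left_module R N by fact
  note f = linD[OF assms(3)] and U = submodD[OF assms(4)]
  have [simp]: "x \<in> U \<Longrightarrow> x \<in> carrier M" for x using U(1) by auto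
  show ?thesis
  proof (rule submodI)
    show "\<zero>\<^bsub>N\<^esub> \<in> f ` U" using lin_zero[OF assms(1-3)] U(2) by force
    show "x \<oplus>\<^bsub>N\<^esub> y \<in> f ` U" if xy: "x \<in> f ` U" "y \<in> f ` U" for x y
    proof -
      obtain a b where "a \<in> U" "b \<in> U" "x = f a" "y = f b" using xy by blast
      then show ?thesis using f(2)[of a b] U(3)[of a b] by (metis U(1) imageI subsetD)
    qed
    show "a \<odot>\<^bsub>N\<^esub> x \<in> f ` U" if ax: "a \<in> carrier R" "x \<in> f ` U" for a x
    proof -
      obtain b where "b \<in> U" "x = f b" using ax by auto
      then show ?thesis using f(3)[of a b] U(4)[of a b] ax by (metis U(1) imageI subsetD)
    qed
  qed (auto simp: f)
qed

lemma range_submodule: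
  "\<lbrakk>left_module R M; left_module R N; lin R M N f\<rbrakk> \<Longrightarrow> submodule (f ` carrier M) R N"
  by (rule image_submodule) (auto intro: left_module.submod_carrier)

text \<open>The homomorphism theorem: two preimages under \<open>g\<close> differ by an element of
  its kernel, so \<open>f\<close> depends only on \<open>g x\<close>. It takes the place of quotient
  modules: cosyzygies are represented by images, and maps out of them are obtained here.\<close>

lemma lin_factor:
  assumes "left_module R M" "left_module R L" "left_module R N"
    and g: "lin R M L g" "g ` carrier M = carrier L"
    and f: "lin R M N f" and k: "\<And>x. \<lbrakk>x \<in> carrier M; g x = \<zero>\<^bsub>L\<^esub>\<rbrakk> \<Longrightarrow> f x = \<zero>\<^bsub>N\<^esub>"
  obtains h where "lin R L N h" "\<And>x. x \<in> carrier M \<Longrightarrow> h (g x) = f x"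
proof -
  interpret M: left_module R M by fact
  interpret L: left_module R L by fact
  interpret N: left_module R N by fact
  note g' = linD[OF g(1)] and f' = linD[OF f]
  define s where "s y = (SOME x. x \<in> carrier M \<and> g x = y)" for y
  have s: "s y \<in> carrier M \<and> g (s y) = y" if "y \<in> carrier L" for y
    unfolding s_def by (rule someI_ex) (metis that g(2) imageE)
  have e: "f x = f y" if "x \<in> carrier M" "y \<in> carrier M" "g x = g y" for x y
  proof (rule N.eq_by_diff)
    have "g (x \<ominus>\<^bsub>M\<^esub> y) = \<zero>\<^bsub>L\<^esub>"
      using that lin_diff[OF assms(1,2) g(1)] L.diff_self[of "g y"] g'(1) by simp
    then show "f x \<ominus>\<^bsub>N\<^esub> f y = \<zero>\<^bsub>N\<^esub>"
      using k[of "x \<ominus>\<^bsub>M\<^esub> y"] lin_diff[OF assms(1,3) f] that by simp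
  qed (use that f' in auto)
  have h: "f (s (g x)) = f x" if "x \<in> carrier M" for x
    using s[of "g x"] g'(1) that by (intro e) auto
  show thesis
  proof (rule that)
    show "lin R L N (\<lambda>y. f (s y))"
    proof (rule linI)
      fix x y assume x: "x \<in> carrier L" "y \<in> carrier L"
      show "f (s (x \<oplus>\<^bsub>L\<^esub> y)) = f (s x) \<oplus>\<^bsub>N\<^esub> f (s y)"
        using s x g' f' h[of "s x \<oplus>\<^bsub>M\<^esub> s y"] by simp
    next
      fix a x assume x: "a \<in> carrier R" "x \<in> carrier L"
      show "f (s (a \<odot>\<^bsub>L\<^esub> x)) = a \<odot>\<^bsub>N\<^esub> f (s x)"
        using s x g' f' h[of "a \<odot>\<^bsub>M\<^esub> s x"] by (simp add: M.smult_closed)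
    qed (use s f' in auto)
  qed (rule h)
qed

lemma lin_inverse:
  assumes "lin R M N f" "left_module R M" "bij_betw f (carrier M) (carrier N)"
  obtains g where "lin R N M g" "\<And>x. x \<in> carrier M \<Longrightarrow> g (f x) = x" "\<And>y. y \<in> carrier N \<Longrightarrow> f (g y) = y"
proof
  interpret left_module R M by fact
  let ?g = "inv_into (carrier M) f"
  show 1: "\<And>x. x \<in> carrier M \<Longrightarrow> ?g (f x) = x" using assms(3) by (simp add: bij_betw_inv_into_left)
  show 2: "\<And>y. y \<in> carrier N \<Longrightarrow> f (?g y) = y" using assms(3) by (simp add: bij_betw_inv_into_right)
  have 3: "y \<in> carrier N \<Longrightarrow> ?g y \<in> carrier M" for y
    using assms(3) by (metis bij_betw_def inv_into_into)
  show "lin R N M ?g"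
  proof (rule linI)
    fix x y assume "x \<in> carrier N" "y \<in> carrier N"
    then show "?g (x \<oplus>\<^bsub>N\<^esub> y) = ?g x \<oplus>\<^bsub>M\<^esub> ?g y"
      using 1[of "?g x \<oplus>\<^bsub>M\<^esub> ?g y"] 2 3 linD(2)[OF assms(1)] by simp
  next
    fix a x assume "a \<in> carrier R" "x \<in> carrier N"
    then show "?g (a \<odot>\<^bsub>N\<^esub> x) = a \<odot>\<^bsub>M\<^esub> ?g x"
      using 1[of "a \<odot>\<^bsub>M\<^esub> ?g x"] 2 3 linD(3)[OF assms(1)] by (simp add: smult_closed)
  qed (rule 3)
qed

lemma mod_isoI:
  assumes "left_module R M" "lin R M N f" "bij_betw f (carrier M) (carrier N)"
  shows "mod_iso R M N"
  unfolding mod_iso_def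
  by (rule bexI[OF _ lin_restrict[OF assms(1,2)]]) (use assms(3) in \<open>simp cong: bij_betw_cong\<close>)

section \<open>Finite generation without sums\<close>

text \<open>A finite set contained in no proper submodule. In this form finite generation passes to
  images and extensions without any computation with linear combinations.\<close>

definition fgen :: "('a, 'z) ring_scheme \<Rightarrow> ('a, 'm) module \<Rightarrow> bool" where
  "fgen R M \<longleftrightarrow> (\<exists>S. finite S \<and> S \<subseteq> carrier M \<and> (\<forall>U. submodule U R M \<and> S \<subseteq> U \<longrightarrow> U = carrier M))"

lemma submodule_finsum:
  assumes "left_module R M" "submodule U R M" "finite S" "f \<in> S \<rightarrow> U"
  shows "(\<Oplus>\<^bsub>M\<^esub>s\<in>S. f s) \<in> U"
proof -
  interpret left_module R M by fact
  note U = submodD[OF assms(2)]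
  show ?thesis using assms(3,4)
  proof (induction S rule: finite_induct)
    case (insert s S)
    then have "f \<in> S \<rightarrow> carrier M" "f s \<in> carrier M" using U(1) by auto
    then show ?case using insert U(3)[of "f s"] by (simp add: M.finsum_insert)
  qed (use U in simp)
qed

text \<open>Linear combinations of \<open>S\<close> lie in every submodule that contains
  \<open>S\<close>; conversely they form such a submodule themselves, which must then be
  everything.\<close>

lemma finitely_generated_iff_fgen:
  assumes "left_module R M" shows "finitely_generated R M \<longleftrightarrow> fgen R M"
proof
  interpret left_module R M by fact
  assume "finitely_generated R M"
  then obtain S where S: "finite S" "S \<subseteq> carrier M"
    "\<forall>x\<in>carrier M. \<exists>c\<in>S \<rightarrow> carrier R. x = (\<Oplus>\<^bsub>M\<^esub>s\<in>S. c s \<odot>\<^bsub>M\<^esub> s)"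
    by (auto simp: finitely_generated_def)
  have "x \<in> U" if U: "submodule U R M" "S \<subseteq> U" and x: "x \<in> carrier M" for U x
  proof -
    obtain c where c: "c \<in> S \<rightarrow> carrier R" "x = (\<Oplus>\<^bsub>M\<^esub>s\<in>S. c s \<odot>\<^bsub>M\<^esub> s)" using S(3) x by blast
    have "(\<lambda>s. c s \<odot>\<^bsub>M\<^esub> s) \<in> S \<rightarrow> U" using c U submodD(4)[OF U(1)] by auto
    from submodule_finsum[OF assms U(1) S(1) this] show ?thesis using c by simp
  qed
  then show "fgen R M" unfolding fgen_def using S submodD(1) by (metis subsetI subset_antisym)
next
  interpret left_module R M by fact
  assume "fgen R M"
  then obtain S where S: "finite S" "S \<subseteq> carrier M"
    "\<And>U. submodule U R M \<Longrightarrow> S \<subseteq> U \<Longrightarrow> U = carrier M" by (auto simp: fgen_def)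
  define U where "U = {\<Oplus>\<^bsub>M\<^esub>s\<in>S. c s \<odot>\<^bsub>M\<^esub> s | c. c \<in> S \<rightarrow> carrier R}"
  have cl: "(\<lambda>s. c s \<odot>\<^bsub>M\<^esub> s) \<in> S \<rightarrow> carrier M" if "c \<in> S \<rightarrow> carrier R" for c
    using that S(2) by (auto intro!: smult_closed)
  have "submodule U R M"
  proof (rule submodI)
    show "U \<subseteq> carrier M" using M.finsum_closed[OF cl] by (auto simp: U_def)
    have "(\<Oplus>\<^bsub>M\<^esub>s\<in>S. \<zero>\<^bsub>R\<^esub> \<odot>\<^bsub>M\<^esub> s) = \<zero>\<^bsub>M\<^esub>"
      using S by (intro M.add.finprod_one_eqI) (auto simp: smult_zero_left)
    then show "\<zero>\<^bsub>M\<^esub> \<in> U" unfolding U_def by (force intro: exI[of _ "\<lambda>_. \<zero>\<^bsub>R\<^esub>"])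
    show "x \<oplus>\<^bsub>M\<^esub> y \<in> U" if xy: "x \<in> U" "y \<in> U" for x y
    proof -
      obtain c d where c: "c \<in> S \<rightarrow> carrier R" "d \<in> S \<rightarrow> carrier R"
        "x = (\<Oplus>\<^bsub>M\<^esub>s\<in>S. c s \<odot>\<^bsub>M\<^esub> s)" "y = (\<Oplus>\<^bsub>M\<^esub>s\<in>S. d s \<odot>\<^bsub>M\<^esub> s)" using xy by (auto simp: U_def)
      have "x \<oplus>\<^bsub>M\<^esub> y = (\<Oplus>\<^bsub>M\<^esub>s\<in>S. c s \<odot>\<^bsub>M\<^esub> s \<oplus>\<^bsub>M\<^esub> d s \<odot>\<^bsub>M\<^esub> s)"
        using c cl by (simp add: M.finsum_addf)
      also have "\<dots> = (\<Oplus>\<^bsub>M\<^esub>s\<in>S. (c s \<oplus>\<^bsub>R\<^esub> d s) \<odot>\<^bsub>M\<^esub> s)"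
        using c S(2) by (intro M.finsum_cong') (auto simp: smult_l_distr Pi_iff subset_iff smult_closed)
      finally show ?thesis using c unfolding U_def by (auto intro!: exI[of _ "\<lambda>s. c s \<oplus>\<^bsub>R\<^esub> d s"])
    qed
    show "a \<odot>\<^bsub>M\<^esub> x \<in> U" if a: "a \<in> carrier R" and x: "x \<in> U" for a x
    proof -
      obtain c where c: "c \<in> S \<rightarrow> carrier R" "x = (\<Oplus>\<^bsub>M\<^esub>s\<in>S. c s \<odot>\<^bsub>M\<^esub> s)" using x by (auto simp: U_def)
      have "a \<odot>\<^bsub>M\<^esub> (\<Oplus>\<^bsub>M\<^esub>s\<in>S'. c s \<odot>\<^bsub>M\<^esub> s) = (\<Oplus>\<^bsub>M\<^esub>s\<in>S'. (a \<otimes>\<^bsub>R\<^esub> c s) \<odot>\<^bsub>M\<^esub> s)" if "S' \<subseteq> S" for S'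
        using finite_subset[OF that S(1)] that
      proof (induction S' rule: finite_induct)
        case (insert t S')
        then have "c \<in> S' \<rightarrow> carrier R" "S' \<subseteq> carrier M" "t \<in> carrier M" "c t \<in> carrier R"
          using c S(2) by auto
        then show ?case using insert a
          by (subst M.finsum_insert M.finsum_insert[of S'])+
            (auto simp: smult_r_distr smult_assoc1 smult_closed Pi_iff subset_iff)
      qed (use a smult_zero_right in auto)
      then show ?thesis using c a unfolding U_def by (auto intro!: exI[of _ "\<lambda>s. a \<otimes>\<^bsub>R\<^esub> c s"])
    qed
  qed
  moreover have "S \<subseteq> U"
  proof
    fix t assume t: "t \<in> S"
    let ?c = "\<lambda>s. if s = t then \<one>\<^bsub>R\<^esub> else \<zero>\<^bsub>R\<^esub>"
    have "(\<Oplus>\<^bsub>M\<^esub>s\<in>S. ?c s \<odot>\<^bsub>M\<^esub> s) = (\<Oplus>\<^bsub>M\<^esub>s\<in>S. if t = s then s else \<zero>\<^bsub>M\<^esub>)"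
      using S by (intro M.finsum_cong') (auto simp: smult_zero_left smult_one subset_iff)
    also have "\<dots> = t" using t S M.finsum_singleton[of t S "\<lambda>s. s"] by auto
    finally show "t \<in> U" unfolding U_def by (force intro: exI[of _ ?c])
  qed
  ultimately have "U = carrier M" by (rule S(3))
  then have "\<exists>c\<in>S \<rightarrow> carrier R. x = (\<Oplus>\<^bsub>M\<^esub>s\<in>S. c s \<odot>\<^bsub>M\<^esub> s)" if "x \<in> carrier M" for x
    using that by (auto simp: U_def)
  with S(1,2) show "finitely_generated R M" unfolding finitely_generated_def
    by (intro exI[of _ S] conjI ballI)
qed

lemma fg_module_iff: "fg_module R M \<longleftrightarrow> left_module R M \<and> fgen R M"
  by (auto simp: fg_module_def finitely_generated_iff_fgen)

lemma fgen_image: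
  assumes "left_module R M" "left_module R N" "lin R M N f" "f ` carrier M = carrier N" "fgen R M"
  shows "fgen R N"
proof -
  obtain S where S: "finite S" "S \<subseteq> carrier M"
    "\<And>U. submodule U R M \<Longrightarrow> S \<subseteq> U \<Longrightarrow> U = carrier M" using assms(5) by (auto simp: fgen_def)
  have "U = carrier N" if U: "submodule U R N" "f ` S \<subseteq> U" for U
  proof -
    have "{x \<in> carrier M. f x \<in> U} = carrier M"
      using S(2) U by (intro S(3) preimage_submodule[OF assms(1-3)]) auto
    then have "carrier N \<subseteq> U" using assms(4) by (metis (no_types, lifting) image_subsetI mem_Collect_eq)
    then show ?thesis using submodD(1)[OF U(1)] by auto
  qed
  then show ?thesis unfolding fgen_def using S(1,2) linD(1)[OF assms(3)]
    by (intro exI[of _ "f ` S"]) auto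
qed

text \<open>Generators of the kernel together with preimages of generators of the image suffice: an
  element of \<open>M\<close> agrees under \<open>f\<close> with some \<open>u\<close> of the given
  submodule, and the difference lies in the kernel.\<close>

lemma fgen_extension:
  assumes "left_module R M" "left_module R N" "lin R M N f"
    "fgen R (submod M {x \<in> carrier M. f x = \<zero>\<^bsub>N\<^esub>})" "fgen R (submod N (f ` carrier M))"
  shows "fgen R M"
proof -
  interpret M: left_module R M by fact
  interpret N: left_module R N by fact
  let ?K = "{x \<in> carrier M. f x = \<zero>\<^bsub>N\<^esub>}"
  have K: "submodule ?K R M" using assms(1-3) by (rule kernel_submodule)
  have I: "submodule (f ` carrier M) R N" using assms(1-3) by (rule range_submodule)
  obtain S where S: "finite S" "S \<subseteq> ?K" "\<And>U. submodule U R (submod M ?K) \<Longrightarrow> S \<subseteq> U \<Longrightarrow> U = ?K"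
    using assms(4) by (auto simp: fgen_def)
  obtain T where T: "finite T" "T \<subseteq> f ` carrier M"
    "\<And>U. submodule U R (submod N (f ` carrier M)) \<Longrightarrow> T \<subseteq> U \<Longrightarrow> U = f ` carrier M"
    using assms(5) by (auto simp: fgen_def)
  obtain T' where T': "T' \<subseteq> carrier M" "finite T'" "T = f ` T'" using T(1,2) by (meson finite_subset_image)
  have "x \<in> U" if U: "submodule U R M" "S \<union> T' \<subseteq> U" and x: "x \<in> carrier M" for U x
  proof -
    have "U \<inter> ?K = ?K"
    proof (rule S(3))
      have "submodule (U \<inter> ?K) R M" using submodD[OF U(1)] submodD[OF K] by (intro M.submodI) auto
      then show "submodule (U \<inter> ?K) R (submod M ?K)" by (simp add: submodule_of_submod[OF assms(1) K])
    qed (use S U in auto)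
    moreover have "f ` U = f ` carrier M"
    proof (rule T(3))
      show "submodule (f ` U) R (submod N (f ` carrier M))"
        using image_submodule[OF assms(1-3) U(1)] submodD(1)[OF U(1)]
        by (auto simp: submodule_of_submod[OF assms(2) I])
    qed (use T' U in auto)
    ultimately obtain u where u: "u \<in> U" "f x = f u" using x by (metis imageE imageI)
    have uc: "u \<in> carrier M" using u submodD(1)[OF U(1)] by auto
    have "f (x \<ominus>\<^bsub>M\<^esub> u) = \<zero>\<^bsub>N\<^esub>" using u uc x linD(1)[OF assms(3) x] N.diff_self by (simp add: lin_diff[OF assms(1-3)])
    then have "x \<ominus>\<^bsub>M\<^esub> u \<in> U" using \<open>U \<inter> ?K = ?K\<close> x uc by auto
    then have "(x \<ominus>\<^bsub>M\<^esub> u) \<oplus>\<^bsub>M\<^esub> u \<in> U" using u submodD(3)[OF U(1)] by auto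
    then show ?thesis using M.diff_add_cancel[OF x uc] by simp
  qed
  then have "\<forall>U. submodule U R M \<and> S \<union> T' \<subseteq> U \<longrightarrow> U = carrier M"
    using submodD(1) by (metis subsetI subset_antisym)
  then show ?thesis unfolding fgen_def using S(1,2) T'(1,2)
    by (intro exI[of _ "S \<union> T'"]) auto
qed

section \<open>Finite-dimensional spaces\<close>

definition span :: "('a, 'z) ring_scheme \<Rightarrow> ('a, 'm, 'y) module_scheme \<Rightarrow> 'm set \<Rightarrow> 'm set" where
  "span R M S = \<Inter> {U. submodule U R M \<and> S \<subseteq> U}"

context left_module
begin

lemma span_submodule: assumes "S \<subseteq> carrier M" shows "submodule (span R M S) R M"
proof (rule submodI)
  show "span R M S \<subseteq> carrier M" unfolding span_def using submod_carrier assms by blast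
qed (auto simp: span_def submodD)

lemma span_superset: "S \<subseteq> span R M S"
  by (auto simp: span_def)

lemma span_least: "submodule U R M \<Longrightarrow> S \<subseteq> U \<Longrightarrow> span R M S \<subseteq> U"
  by (auto simp: span_def)

lemma add_line_submodule:
  assumes X: "submodule X R M" and s: "s \<in> carrier M"
  shows "submodule {x \<oplus>\<^bsub>M\<^esub> c \<odot>\<^bsub>M\<^esub> s | x c. x \<in> X \<and> c \<in> carrier R} R M" (is "submodule ?Y R M")
proof (rule submodI)
  note X' = submodD[OF X]
  have [simp]: "x \<in> X \<Longrightarrow> x \<in> carrier M" for x using X' by auto
  show "?Y \<subseteq> carrier M" using s by (auto simp: smult_closed)
  show "\<zero>\<^bsub>M\<^esub> \<in> ?Y" using X'(2) s by (auto intro!: exI[of _ "\<zero>\<^bsub>M\<^esub>"] exI[of _ "\<zero>\<^bsub>R\<^esub>"] simp: smult_zero_left)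
  show "x \<oplus>\<^bsub>M\<^esub> y \<in> ?Y" if xy: "x \<in> ?Y" "y \<in> ?Y" for x y
  proof -
    obtain u c v d where "x = u \<oplus>\<^bsub>M\<^esub> c \<odot>\<^bsub>M\<^esub> s" "y = v \<oplus>\<^bsub>M\<^esub> d \<odot>\<^bsub>M\<^esub> s" "u \<in> X" "v \<in> X"
      "c \<in> carrier R" "d \<in> carrier R" using xy by blast
    then have "x \<oplus>\<^bsub>M\<^esub> y = (u \<oplus>\<^bsub>M\<^esub> v) \<oplus>\<^bsub>M\<^esub> (c \<oplus>\<^bsub>R\<^esub> d) \<odot>\<^bsub>M\<^esub> s" "u \<oplus>\<^bsub>M\<^esub> v \<in> X" "c \<oplus>\<^bsub>R\<^esub> d \<in> carrier R"
      using s X' by (auto simp: smult_l_distr smult_closed M.a_ac)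
    then show ?thesis by blast
  qed
  show "a \<odot>\<^bsub>M\<^esub> x \<in> ?Y" if ax: "a \<in> carrier R" "x \<in> ?Y" for a x
  proof -
    obtain u c where "x = u \<oplus>\<^bsub>M\<^esub> c \<odot>\<^bsub>M\<^esub> s" "u \<in> X" "c \<in> carrier R" using ax by blast
    then have "a \<odot>\<^bsub>M\<^esub> x = (a \<odot>\<^bsub>M\<^esub> u) \<oplus>\<^bsub>M\<^esub> (a \<otimes>\<^bsub>R\<^esub> c) \<odot>\<^bsub>M\<^esub> s" "a \<odot>\<^bsub>M\<^esub> u \<in> X" "a \<otimes>\<^bsub>R\<^esub> c \<in> carrier R"
      using ax s X' by (auto simp: smult_r_distr smult_closed smult_assoc1)
    then show ?thesis by blast
  qed
qed

lemma span_insert_decompose: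
  assumes "insert s S \<subseteq> carrier M" "x \<in> span R M (insert s S)"
  obtains v c where "v \<in> span R M S" "c \<in> carrier R" "x = v \<oplus>\<^bsub>M\<^esub> c \<odot>\<^bsub>M\<^esub> s"
proof -
  let ?X = "span R M S"
  have X: "submodule ?X R M" using assms by (auto intro: span_submodule)
  note X' = submodD[OF X]
  let ?Y = "{x \<oplus>\<^bsub>M\<^esub> c \<odot>\<^bsub>M\<^esub> s | x c. x \<in> ?X \<and> c \<in> carrier R}"
  have "insert s S \<subseteq> ?Y"
  proof -
    have "s = \<zero>\<^bsub>M\<^esub> \<oplus>\<^bsub>M\<^esub> \<one>\<^bsub>R\<^esub> \<odot>\<^bsub>M\<^esub> s" "v \<in> S \<Longrightarrow> v = v \<oplus>\<^bsub>M\<^esub> \<zero>\<^bsub>R\<^esub> \<odot>\<^bsub>M\<^esub> s" for v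
      using assms(1) by (auto simp: smult_one smult_zero_left subset_iff)
    then show ?thesis using X'(2) span_superset[of S] by blast
  qed
  moreover have "submodule ?Y R M" using X assms(1) by (intro add_line_submodule) auto
  ultimately have "x \<in> ?Y" using span_least[of ?Y "insert s S"] assms(2) by blast
  then show thesis using that by blast
qed

end

text \<open>\<open>span K V S\<close> has codimension at most one in the larger span, so any
  \<open>w\<close> outside it accounts for the rest.\<close>

lemma field_line:
  assumes "field K" "left_module K V" "insert s S \<subseteq> carrier V"
    "w \<in> span K V (insert s S)" "w \<notin> span K V S" "x \<in> span K V (insert s S)"
  obtains a where "a \<in> carrier K" "x \<ominus>\<^bsub>V\<^esub> a \<odot>\<^bsub>V\<^esub> w \<in> span K V S"
proof -
  interpret K: field K by fact
  interpret left_module K V by fact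
  have X: "submodule (span K V S) K V" using assms by (auto intro: span_submodule)
  note X' = submodD[OF X]
  have s: "s \<in> carrier V" using assms by auto
  obtain v c where v: "v \<in> span K V S" "c \<in> carrier K" "w = v \<oplus>\<^bsub>V\<^esub> c \<odot>\<^bsub>V\<^esub> s"
    using span_insert_decompose assms by metis
  obtain v' c' where v': "v' \<in> span K V S" "c' \<in> carrier K" "x = v' \<oplus>\<^bsub>V\<^esub> c' \<odot>\<^bsub>V\<^esub> s"
    using span_insert_decompose assms by metis
  have vc: "v \<in> carrier V" "v' \<in> carrier V" using v v' X' by auto
  have "c \<noteq> \<zero>\<^bsub>K\<^esub>" using v assms(5) vc s by (auto simp: smult_zero_left)
  then have ci: "inv\<^bsub>K\<^esub> c \<in> carrier K" "inv\<^bsub>K\<^esub> c \<otimes>\<^bsub>K\<^esub> c = \<one>\<^bsub>K\<^esub>" using v(2) K.field_Units by auto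
  \<comment> \<open>With this factor \<open>x\<close> and \<open>a w\<close> have the same
    coefficient at \<open>s\<close>, which therefore cancels in the difference.\<close>
  define a where "a = c' \<otimes>\<^bsub>K\<^esub> inv\<^bsub>K\<^esub> c"
  have a: "a \<in> carrier K" "a \<otimes>\<^bsub>K\<^esub> c = c'" using ci v v' by (auto simp: a_def K.m_assoc)
  have "x \<ominus>\<^bsub>V\<^esub> a \<odot>\<^bsub>V\<^esub> w = v' \<ominus>\<^bsub>V\<^esub> a \<odot>\<^bsub>V\<^esub> v"
  proof -
    have "a \<odot>\<^bsub>V\<^esub> w = a \<odot>\<^bsub>V\<^esub> v \<oplus>\<^bsub>V\<^esub> c' \<odot>\<^bsub>V\<^esub> s"
      using v a s vc by (simp add: smult_r_distr smult_closed flip: smult_assoc1)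
    then show ?thesis using v'(3) a v' vc s
      by (simp add: M.minus_eq smult_closed M.minus_add M.a_ac M.r_neg M.r_neg1)
  qed
  then show thesis using that[OF a(1)] X'(4,6) v v' a(1) by auto
qed

text \<open>A substitute for dimension: what is used later is a natural number attached to subspaces
  that grows strictly along proper inclusions. It counts the steps of a flag, given by adding
  generators one at a time, at which the subspace acquires a new vector.\<close>

lemma dimension_exists:
  assumes "field K" "left_module K V" "fgen K V"
  obtains m :: "'v set \<Rightarrow> nat" where
    "\<And>W W'. \<lbrakk>submodule W K V; submodule W' K V; W \<subseteq> W'\<rbrakk> \<Longrightarrow> m W \<le> m W'"
    "\<And>W W'. \<lbrakk>submodule W K V; submodule W' K V; W \<subseteq> W'; m W = m W'\<rbrakk> \<Longrightarrow> W = W'"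
proof -
  interpret left_module K V by fact
  obtain S where S: "finite S" "S \<subseteq> carrier V" "\<And>U. submodule U K V \<Longrightarrow> S \<subseteq> U \<Longrightarrow> U = carrier V"
    using assms(3) by (auto simp: fgen_def)
  have "\<exists>m::'v set \<Rightarrow> nat. \<forall>W W'. submodule W K V \<and> submodule W' K V \<and> W \<subseteq> W' \<longrightarrow>
      m W \<le> m W' \<and> (m W = m W' \<longrightarrow> W \<inter> span K V S = W' \<inter> span K V S)"
    using S(1,2)
  proof (induction S rule: finite_induct)
    case empty
    have z: "span K V {} = {\<zero>\<^bsub>V\<^esub>}"
      using span_least[OF submod_zero, of "{}"] submodD(2)[OF span_submodule[of "{}"]] by auto
    show ?case by (rule exI[of _ "\<lambda>_. 0"]) (use submodD(2) in \<open>auto simp: z\<close>)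
  next
    case (insert s S)
    let ?X = "span K V S" and ?X' = "span K V (insert s S)"
    obtain m :: "'v set \<Rightarrow> nat" where m: "\<And>W W'. \<lbrakk>submodule W K V; submodule W' K V; W \<subseteq> W'\<rbrakk> \<Longrightarrow>
      m W \<le> m W' \<and> (m W = m W' \<longrightarrow> W \<inter> ?X = W' \<inter> ?X)" using insert.IH insert.prems by (metis insert_subset)
    have XX: "?X \<subseteq> ?X'" by (auto simp: span_def)
    \<comment> \<open>One more if \<open>W\<close> meets the new layer of the flag. Equal counts
      then force equal intersections: \<open>field_line\<close> reduces a vector of
      \<open>W'\<close> by a multiple of some \<open>w\<close> in \<open>W\<close> to the old layer,
      where the induction hypothesis applies.\<close>
    define m' where "m' W = m W + (if W \<inter> ?X' \<subseteq> ?X then 0 else 1)" for W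
    have "m' W \<le> m' W' \<and> (m' W = m' W' \<longrightarrow> W \<inter> ?X' = W' \<inter> ?X')"
      if W: "submodule W K V" "submodule W' K V" "W \<subseteq> W'" for W W'
    proof (intro conjI impI)
      have ind: "W' \<inter> ?X' \<subseteq> ?X \<Longrightarrow> W \<inter> ?X' \<subseteq> ?X" using W by auto
      show "m' W \<le> m' W'" using m[OF W] ind by (auto simp: m'_def)
      assume e: "m' W = m' W'"
      then have e1: "m W = m W'" "(W \<inter> ?X' \<subseteq> ?X) = (W' \<inter> ?X' \<subseteq> ?X)"
        using m[OF W] ind by (auto simp: m'_def split: if_splits)
      have e2: "W \<inter> ?X = W' \<inter> ?X" using m[OF W] e1 by auto
      show "W \<inter> ?X' = W' \<inter> ?X'"
      proof (cases "W \<inter> ?X' \<subseteq> ?X")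
        case True then show ?thesis using e1(2) e2 W(3) by blast
      next
        case False
        then obtain w where w: "w \<in> W" "w \<in> ?X'" "w \<notin> ?X" by auto
        have "x \<in> W" if x: "x \<in> W'" "x \<in> ?X'" for x
        proof -
          obtain a where a: "a \<in> carrier K" "x \<ominus>\<^bsub>V\<^esub> a \<odot>\<^bsub>V\<^esub> w \<in> ?X"
            using field_line[OF assms(1,2) insert.prems w(2,3) x(2)] .
          have aw: "a \<odot>\<^bsub>V\<^esub> w \<in> W" using submodD(4)[OF W(1) a(1) w(1)] .
          have "x \<ominus>\<^bsub>V\<^esub> a \<odot>\<^bsub>V\<^esub> w \<in> W'" using submodD(6)[OF W(2) x(1)] aw W(3) by auto
          then have "x \<ominus>\<^bsub>V\<^esub> a \<odot>\<^bsub>V\<^esub> w \<in> W" using a e2 by auto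
          then have "(x \<ominus>\<^bsub>V\<^esub> a \<odot>\<^bsub>V\<^esub> w) \<oplus>\<^bsub>V\<^esub> a \<odot>\<^bsub>V\<^esub> w \<in> W" using submodD(3)[OF W(1)] aw by auto
          moreover have "x \<in> carrier V" "a \<odot>\<^bsub>V\<^esub> w \<in> carrier V"
            using x(1) aw submodD(1)[OF W(1)] submodD(1)[OF W(2)] by blast+
          ultimately show ?thesis by (simp add: diff_add_cancel)
        qed
        then show ?thesis using W(3) by auto
      qed
    qed
    then show ?case by blast
  qed
  then obtain m :: "'v set \<Rightarrow> nat" where m: "\<And>W W'. \<lbrakk>submodule W K V; submodule W' K V; W \<subseteq> W'\<rbrakk> \<Longrightarrow>
      m W \<le> m W' \<and> (m W = m W' \<longrightarrow> W \<inter> span K V S = W' \<inter> span K V S)" by metis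
  have "span K V S = carrier V" using S(3)[OF span_submodule[OF S(2)] span_superset] .
  then have "W \<inter> span K V S = W" if "submodule W K V" for W using submodD(1)[OF that] by auto
  with m show thesis by (intro that[of m]) metis+
qed

text \<open>A finite subset of \<open>W\<close> whose span has the largest measure spans
  \<open>W\<close>, since adding a vector cannot increase it; the measure of \<open>W\<close> is an
  upper bound.\<close>

lemma fgen_subspace:
  assumes "field K" "left_module K V" "fgen K V" "submodule W K V"
  shows "fgen K (submod V W)"
proof -
  interpret left_module K V by fact
  obtain m where m: "\<And>W W'. \<lbrakk>submodule W K V; submodule W' K V; W \<subseteq> W'\<rbrakk> \<Longrightarrow> m W \<le> (m W' :: nat)"
    "\<And>W W'. \<lbrakk>submodule W K V; submodule W' K V; W \<subseteq> W'; m W = m W'\<rbrakk> \<Longrightarrow> W = W'"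
    using dimension_exists[OF assms(1-3)] by blast
  note W = submodD[OF assms(4)]
  have fin: "submodule (span K V F) K V" "span K V F \<subseteq> W" if "finite F \<and> F \<subseteq> W" for F
    using that W(1) span_submodule[of F] span_least[OF assms(4), of F] by auto
  obtain F where F: "finite F \<and> F \<subseteq> W" "\<And>G. finite G \<and> G \<subseteq> W \<Longrightarrow> m (span K V G) \<le> m (span K V F)"
    using ex_has_greatest_nat[of "\<lambda>F. finite F \<and> F \<subseteq> W" "{}" "\<lambda>F. m (span K V F)" "Suc (m W)"]
      m(1)[OF fin(1) assms(4) fin(2)] by (auto simp: less_Suc_eq_le)
  have "W \<subseteq> span K V F"
  proof
    fix w assume w: "w \<in> W"
    have G: "finite (insert w F) \<and> insert w F \<subseteq> W" using F(1) w by auto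
    have s: "span K V F \<subseteq> span K V (insert w F)" by (auto simp: span_def)
    have "m (span K V F) = m (span K V (insert w F))"
      using F(2)[OF G] m(1)[OF fin(1)[OF F(1)] fin(1)[OF G] s] by simp
    then have "span K V F = span K V (insert w F)"
      using m(2)[OF fin(1)[OF F(1)] fin(1)[OF G] s] by simp
    then show "w \<in> span K V F" using span_superset[of "insert w F"] by auto
  qed
  then have "\<forall>U. submodule U K (submod V W) \<and> F \<subseteq> U \<longrightarrow> U = W"
    using span_least[of _ F] by (auto simp: submodule_of_submod[OF assms(2,4)])
  then show ?thesis unfolding fgen_def using F(1) by (intro exI[of _ F]) auto
qed

text \<open>The kernel of one map is handled by the remaining maps, and its image is a subspace of
  \<open>W\<close>. Spaces of homomorphisms become finite-dimensional this way, evaluations at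
  finitely many generators being jointly injective.\<close>

lemma fgen_joint_injective:
  assumes "field K" "left_module K V" "left_module K W" "fgen K W"
    "finite F" "\<And>f. f \<in> F \<Longrightarrow> lin K V W f"
    "\<And>x. \<lbrakk>x \<in> carrier V; \<forall>f\<in>F. f x = \<zero>\<^bsub>W\<^esub>\<rbrakk> \<Longrightarrow> x = \<zero>\<^bsub>V\<^esub>"
  shows "fgen K V"
  using assms(5,2,6,7)
proof (induction F arbitrary: V rule: finite_induct)
  case empty
  interpret left_module K V by fact
  have "carrier V = {\<zero>\<^bsub>V\<^esub>}" using empty by auto
  then have "\<forall>U. submodule U K V \<and> {} \<subseteq> U \<longrightarrow> U = carrier V"
    using submodD(1,2)[of _ K V] by (metis singletonD subset_singleton_iff empty_iff)
  then show ?case unfolding fgen_def by (intro exI[of _ "{}"]) simp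
next
  case (insert f F)
  let ?N = "{x \<in> carrier V. f x = \<zero>\<^bsub>W\<^esub>}"
  have f: "lin K V W f" using insert.prems by auto
  have N: "submodule ?N K V" using insert.prems(1) assms(3) f by (rule kernel_submodule)
  have "fgen K (submod V ?N)"
  proof (rule insert.IH)
    show "left_module K (submod V ?N)" using insert.prems(1) N by (rule submodule_left_module)
  qed (use insert.prems in \<open>auto intro: lin_on_submod\<close>)
  moreover have "fgen K (submod W (f ` carrier V))"
    using fgen_subspace[OF assms(1,3,4) range_submodule[OF insert.prems(1) assms(3) f]] .
  ultimately show ?case using fgen_extension[OF insert.prems(1) assms(3) f] by auto
qed

lemma regular_simps [simp]:
  "carrier (regular R) = carrier R" "\<zero>\<^bsub>regular R\<^esub> = \<zero>\<^bsub>R\<^esub>" "x \<oplus>\<^bsub>regular R\<^esub> y = x \<oplus>\<^bsub>R\<^esub> y"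
  "a \<odot>\<^bsub>regular R\<^esub> x = a \<otimes>\<^bsub>R\<^esub> x"
  by (auto simp: regular_def)

lemma regular_left_module: assumes "ring R" shows "left_module R (regular R)"
proof -
  interpret ring R by fact
  have "abelian_group (regular R)"
    by (rule abelian_groupI) (auto simp: a_ac intro: bexI[of _ "\<ominus>\<^bsub>R\<^esub> x" for x] l_neg)
  then show ?thesis
    by (intro left_module.intro left_module_axioms.intro) (auto simp: l_distr r_distr m_assoc ring_axioms)
qed

lemma regular_fgen: assumes "ring R" shows "fgen R (regular R)"
proof -
  interpret ring R by fact
  have "U = carrier R" if "submodule U R (regular R)" "\<one>\<^bsub>R\<^esub> \<in> U" for U
    using submodD(1)[OF that(1)] submodD(4)[OF that(1) _ that(2)] by auto
  then show ?thesis unfolding fgen_def by (intro exI[of _ "{\<one>\<^bsub>R\<^esub>}"]) auto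
qed

text \<open>Induction on the gap between the measures of \<open>V\<close> and \<open>W\<close>; the
  functional is extended by zero on one new vector at a time.\<close>

lemma extend_functional:
  assumes "field K" "left_module K V" "fgen K V" "submodule W K V" "lin K (submod V W) (regular K) \<phi>"
  shows "\<exists>\<psi>. lin K V (regular K) \<psi> \<and> (\<forall>x\<in>W. \<psi> x = \<phi> x)"
proof -
  interpret K: field K by fact
  interpret left_module K V by fact
  obtain m where m: "\<And>W W'. \<lbrakk>submodule W K V; submodule W' K V; W \<subseteq> W'\<rbrakk> \<Longrightarrow> m W \<le> (m W' :: nat)"
    "\<And>W W'. \<lbrakk>submodule W K V; submodule W' K V; W \<subseteq> W'; m W = m W'\<rbrakk> \<Longrightarrow> W = W'"
    using dimension_exists[OF assms(1-3)] by blast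
  show ?thesis using assms(4,5)
  proof (induction "m (carrier V) - m W" arbitrary: W \<phi> rule: less_induct)
    case less
    note W = submodD[OF less.prems(1)] and \<phi> = linD[OF less.prems(2), simplified]
    have WV[simp]: "x \<in> W \<Longrightarrow> x \<in> carrier V" for x using W by auto
    show ?case
    proof (cases "W = carrier V")
      case True then show ?thesis using less.prems by (auto simp: submod_def)
    next
      case False
      then obtain v where v: "v \<in> carrier V" "v \<notin> W" using W by auto
      let ?W = "{x \<oplus>\<^bsub>V\<^esub> c \<odot>\<^bsub>V\<^esub> v | x c. x \<in> W \<and> c \<in> carrier K}"
      have W': "submodule ?W K V" using less.prems(1) v(1) by (rule add_line_submodule)
      have "w = w \<oplus>\<^bsub>V\<^esub> \<zero>\<^bsub>K\<^esub> \<odot>\<^bsub>V\<^esub> v" "v = \<zero>\<^bsub>V\<^esub> \<oplus>\<^bsub>V\<^esub> \<one>\<^bsub>K\<^esub> \<odot>\<^bsub>V\<^esub> v" if "w \<in> W" for w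
        using that v by (auto simp: smult_zero_left smult_one)
      then have WW: "W \<subseteq> ?W" "v \<in> ?W" using W(2) by blast+
      have dec: "m (carrier V) - m ?W < m (carrier V) - m W"
      proof -
        have "m W \<noteq> m ?W"
        proof
          assume "m W = m ?W"
          then have "W = ?W" by (rule m(2)[OF less.prems(1) W' WW(1)])
          with WW(2) v(2) show False by metis
        qed
        then show ?thesis using m(1)[OF less.prems(1) W' WW(1)] m(1)[OF W' submod_carrier submodD(1)[OF W']]
          by linarith
      qed
      \<comment> \<open>If the coefficients differed, division by \<open>c - d\<close> would put
        \<open>v\<close> into \<open>W\<close>.\<close>
      have uniq: "c = d \<and> x = y" if "x \<in> W" "y \<in> W" "c \<in> carrier K" "d \<in> carrier K"
        "x \<oplus>\<^bsub>V\<^esub> c \<odot>\<^bsub>V\<^esub> v = y \<oplus>\<^bsub>V\<^esub> d \<odot>\<^bsub>V\<^esub> v" for x y c d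
      proof (rule ccontr)
        have cd: "c \<odot>\<^bsub>V\<^esub> v \<in> carrier V" "d \<odot>\<^bsub>V\<^esub> v \<in> carrier V" using that v by (auto simp: smult_closed)
        assume n: "\<not> (c = d \<and> x = y)"
        have ne: "c \<ominus>\<^bsub>K\<^esub> d \<noteq> \<zero>\<^bsub>K\<^esub>"
        proof
          assume "c \<ominus>\<^bsub>K\<^esub> d = \<zero>\<^bsub>K\<^esub>"
          then have "c = d" using that(3,4)
            by (metis K.add.inv_closed K.a_assoc K.l_neg K.l_zero K.minus_eq K.r_zero)
          then show False using n that cd by auto
        qed
        have "(c \<ominus>\<^bsub>K\<^esub> d) \<odot>\<^bsub>V\<^esub> v = c \<odot>\<^bsub>V\<^esub> v \<ominus>\<^bsub>V\<^esub> d \<odot>\<^bsub>V\<^esub> v"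
          using that v by (simp add: K.minus_eq M.minus_eq smult_l_distr smult_minus_left)
        also have "\<dots> = y \<ominus>\<^bsub>V\<^esub> x"
        proof -
          have "c \<odot>\<^bsub>V\<^esub> v = (y \<oplus>\<^bsub>V\<^esub> d \<odot>\<^bsub>V\<^esub> v) \<ominus>\<^bsub>V\<^esub> x"
            using that(5)[symmetric] that(1) cd by (simp add: M.minus_eq M.a_ac M.r_neg2 M.r_neg1)
          then show ?thesis using that(1,2) cd
            by (simp add: M.minus_eq M.a_ac M.r_neg)
        qed
        finally have *: "(c \<ominus>\<^bsub>K\<^esub> d) \<odot>\<^bsub>V\<^esub> v \<in> W" using that W(6) by simp
        have "c \<ominus>\<^bsub>K\<^esub> d \<in> Units K" using ne that K.field_Units by auto
        then have i: "inv\<^bsub>K\<^esub> (c \<ominus>\<^bsub>K\<^esub> d) \<in> carrier K" "inv\<^bsub>K\<^esub> (c \<ominus>\<^bsub>K\<^esub> d) \<otimes>\<^bsub>K\<^esub> (c \<ominus>\<^bsub>K\<^esub> d) = \<one>\<^bsub>K\<^esub>" by auto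
        from W(4)[OF i(1) *] have "v \<in> W" using i v that
          by (simp add: smult_one flip: smult_assoc1)
        then show False using v by simp
      qed
      define p where "p z = (SOME q. fst q \<in> W \<and> snd q \<in> carrier K \<and> z = fst q \<oplus>\<^bsub>V\<^esub> snd q \<odot>\<^bsub>V\<^esub> v)" for z
      have p: "p (x \<oplus>\<^bsub>V\<^esub> c \<odot>\<^bsub>V\<^esub> v) = (x, c)" if xc: "x \<in> W" "c \<in> carrier K" for x c
      proof -
        let ?z = "x \<oplus>\<^bsub>V\<^esub> c \<odot>\<^bsub>V\<^esub> v"
        have "fst (p ?z) \<in> W \<and> snd (p ?z) \<in> carrier K \<and> ?z = fst (p ?z) \<oplus>\<^bsub>V\<^esub> snd (p ?z) \<odot>\<^bsub>V\<^esub> v"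
          unfolding p_def by (rule someI[of _ "(x, c)"]) (use xc in auto)
        then show ?thesis using uniq[of x "fst (p ?z)" c "snd (p ?z)"] xc by (auto simp: prod_eq_iff)
      qed
      have L: "lin K (submod V ?W) (regular K) (\<lambda>z. \<phi> (fst (p z)))"
      proof (rule linI)
        fix z z' assume "z \<in> carrier (submod V ?W)" "z' \<in> carrier (submod V ?W)"
        then obtain x c y d where z: "z = x \<oplus>\<^bsub>V\<^esub> c \<odot>\<^bsub>V\<^esub> v" "z' = y \<oplus>\<^bsub>V\<^esub> d \<odot>\<^bsub>V\<^esub> v" "x \<in> W" "y \<in> W"
          "c \<in> carrier K" "d \<in> carrier K" by auto
        then have "z \<oplus>\<^bsub>V\<^esub> z' = (x \<oplus>\<^bsub>V\<^esub> y) \<oplus>\<^bsub>V\<^esub> (c \<oplus>\<^bsub>K\<^esub> d) \<odot>\<^bsub>V\<^esub> v"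
          using v by (auto simp: smult_l_distr smult_closed M.a_ac)
        then show "\<phi> (fst (p (z \<oplus>\<^bsub>submod V ?W\<^esub> z'))) = \<phi> (fst (p z)) \<oplus>\<^bsub>regular K\<^esub> \<phi> (fst (p z'))"
          using z W p \<phi> by simp
      next
        fix a z assume "a \<in> carrier K" "z \<in> carrier (submod V ?W)"
        moreover then obtain x c where z: "z = x \<oplus>\<^bsub>V\<^esub> c \<odot>\<^bsub>V\<^esub> v" "x \<in> W" "c \<in> carrier K" by auto
        moreover have "a \<odot>\<^bsub>V\<^esub> z = (a \<odot>\<^bsub>V\<^esub> x) \<oplus>\<^bsub>V\<^esub> (a \<otimes>\<^bsub>K\<^esub> c) \<odot>\<^bsub>V\<^esub> v"
          using v z \<open>a \<in> carrier K\<close> by (auto simp: smult_r_distr smult_closed smult_assoc1)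
        ultimately show "\<phi> (fst (p (a \<odot>\<^bsub>submod V ?W\<^esub> z))) = a \<odot>\<^bsub>regular K\<^esub> \<phi> (fst (p z))"
          using W p \<phi> by simp
      qed (use p \<phi> in auto)
      obtain \<psi> where \<psi>: "lin K V (regular K) \<psi>" "\<forall>x\<in>?W. \<psi> x = \<phi> (fst (p x))"
        using less.hyps[OF dec W' L] by auto
      have "\<psi> x = \<phi> x" if "x \<in> W" for x
      proof -
        have "x \<in> ?W" using WW(1) that by blast
        then have "\<psi> x = \<phi> (fst (p x))" using \<psi>(2) by blast
        moreover have "p x = (x, \<zero>\<^bsub>K\<^esub>)" using p[of x "\<zero>\<^bsub>K\<^esub>"] that v by (simp add: smult_zero_left)
        ultimately show ?thesis by simp
      qed
      then show ?thesis using \<psi> by auto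
    qed
  qed
qed

text \<open>Exactness of \<open>Hom(-, K)\<close>, in the form in which it is used for the duality:
  the functional descends to the image of \<open>g\<close> and extends from there.\<close>

lemma functional_factor:
  assumes "field K" "left_module K V" "left_module K W" "fgen K W" "lin K V W g" "lin K V (regular K) \<phi>"
    "\<And>x. \<lbrakk>x \<in> carrier V; g x = \<zero>\<^bsub>W\<^esub>\<rbrakk> \<Longrightarrow> \<phi> x = \<zero>\<^bsub>K\<^esub>"
  obtains \<psi> where "lin K W (regular K) \<psi>" "\<And>x. x \<in> carrier V \<Longrightarrow> \<psi> (g x) = \<phi> x"
proof -
  interpret K: field K by fact
  have I: "submodule (g ` carrier V) K W" using assms by (auto intro: range_submodule)
  obtain h where h: "lin K (submod W (g ` carrier V)) (regular K) h" "\<And>x. x \<in> carrier V \<Longrightarrow> h (g x) = \<phi> x"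
  proof (rule lin_factor[OF assms(2) submodule_left_module[OF assms(3) I] regular_left_module[OF K.ring_axioms]
        _ _ assms(6)])
    show "lin K V (submod W (g ` carrier V)) g" using assms(5) by (rule lin_into_submod) auto
  qed (use assms(7) in simp_all)
  show thesis using extend_functional[OF assms(1,3,4) I h(1)] h(2) that by (metis imageI)
qed

section \<open>Fitting's lemma\<close>

lemma funpow_lin: "lin R V V c \<Longrightarrow> lin R V V (c ^^ n)"
  by (induction n) (auto simp: lin_def Pi_iff)

text \<open>Images of the powers of \<open>c\<close> decrease and kernels increase. Their measures
  attain a minimum and a maximum, and beyond the larger of the two indices neither changes any more.
  The resulting splitting is read off where it is needed, in
  \<open>complement_nilpotent\<close>.\<close>

lemma fitting:
  assumes "field K" "left_module K V" "fgen K V" "lin K V V c"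
  obtains N where "\<And>n. n \<ge> N \<Longrightarrow> (c ^^ n) ` carrier V = (c ^^ N) ` carrier V"
    "\<And>n x. \<lbrakk>n \<ge> N; x \<in> carrier V; (c ^^ n) x = \<zero>\<^bsub>V\<^esub>\<rbrakk> \<Longrightarrow> (c ^^ N) x = \<zero>\<^bsub>V\<^esub>"
proof -
  interpret left_module K V by fact
  obtain m where m: "\<And>W W'. \<lbrakk>submodule W K V; submodule W' K V; W \<subseteq> W'\<rbrakk> \<Longrightarrow> m W \<le> (m W' :: nat)"
    "\<And>W W'. \<lbrakk>submodule W K V; submodule W' K V; W \<subseteq> W'; m W = m W'\<rbrakk> \<Longrightarrow> W = W'"
    using dimension_exists[OF assms(1-3)] by blast
  note c = funpow_lin[OF assms(4)]
  let ?I = "\<lambda>n. (c ^^ n) ` carrier V" and ?K = "\<lambda>n. {x \<in> carrier V. (c ^^ n) x = \<zero>\<^bsub>V\<^esub>}"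
  have I: "submodule (?I n) K V" and Ke: "submodule (?K n) K V" for n
    using assms(2) c by (auto intro: range_submodule kernel_submodule)
  have add: "(c ^^ n) x = (c ^^ (n - N)) ((c ^^ N) x)" "(c ^^ n) x = (c ^^ N) ((c ^^ (n - N)) x)"
    if "N \<le> n" for n N x
    using fun_cong[OF funpow_add[of "n - N" N c], of x] fun_cong[OF funpow_add[of N "n - N" c], of x] that
    by simp_all
  have Im: "?I n \<subseteq> ?I N" if "N \<le> n" for n N
    using linD(1)[OF c] by (auto simp: add(2)[OF that])
  have Km: "?K N \<subseteq> ?K n" if "N \<le> n" for n N
    using lin_zero[OF assms(2,2) c] by (auto simp: add(1)[OF that])
  obtain N1 where N1: "\<And>n. m (?I N1) \<le> m (?I n)"
    using ex_has_least_nat[of "\<lambda>_. True" 0 "\<lambda>n. m (?I n)"] by auto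
  obtain N2 where N2: "\<And>n. m (?K n) \<le> m (?K N2)"
    using ex_has_greatest_nat[of "\<lambda>_. True" 0 "\<lambda>n. m (?K n)" "Suc (m (carrier V))"]
      m(1)[OF Ke submod_carrier] by (auto simp: less_Suc_eq_le)
  have e1: "?I n = ?I N1" if "n \<ge> N1" for n
    using m(2)[OF I I Im[OF that]] m(1)[OF I I Im[OF that]] N1[of n] by simp
  have e2: "?K N2 = ?K n" if "n \<ge> N2" for n
    using m(2)[OF Ke Ke Km[OF that]] m(1)[OF Ke Ke Km[OF that]] N2[of n] by simp
  show thesis
  proof (rule that[of "max N1 N2"])
    show "\<And>n. n \<ge> max N1 N2 \<Longrightarrow> ?I n = ?I (max N1 N2)" using e1 by (metis max.bounded_iff max.cobounded1)
    show "(c ^^ max N1 N2) x = \<zero>\<^bsub>V\<^esub>" if "n \<ge> max N1 N2" "x \<in> carrier V" "(c ^^ n) x = \<zero>\<^bsub>V\<^esub>" for n x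
    proof -
      have "x \<in> ?K n" using that by blast
      then have "x \<in> ?K N2" using e2[of n] that(1) by simp
      then have "x \<in> ?K (max N1 N2)" using e2[of "max N1 N2"] by simp
      then show ?thesis by blast
    qed
  qed
qed

context left_module
begin

lemma add_eq_imp_diff_eq:
  assumes "x \<in> carrier M" "y \<in> carrier M" "u \<in> carrier M" "v \<in> carrier M" "x \<oplus>\<^bsub>M\<^esub> y = u \<oplus>\<^bsub>M\<^esub> v"
  shows "x \<ominus>\<^bsub>M\<^esub> u = v \<ominus>\<^bsub>M\<^esub> y"
proof -
  have "(x \<ominus>\<^bsub>M\<^esub> u) \<oplus>\<^bsub>M\<^esub> (u \<oplus>\<^bsub>M\<^esub> y) = ((x \<ominus>\<^bsub>M\<^esub> u) \<oplus>\<^bsub>M\<^esub> u) \<oplus>\<^bsub>M\<^esub> y"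
    using assms(1-4) by (simp add: M.a_assoc)
  also have "\<dots> = u \<oplus>\<^bsub>M\<^esub> v" by (simp only: diff_add_cancel[OF assms(1,3)] assms(5))
  also have "\<dots> = ((v \<ominus>\<^bsub>M\<^esub> y) \<oplus>\<^bsub>M\<^esub> y) \<oplus>\<^bsub>M\<^esub> u"
    using assms(1-4) by (simp only: diff_add_cancel[OF assms(4,2)] M.a_comm)
  also have "\<dots> = (v \<ominus>\<^bsub>M\<^esub> y) \<oplus>\<^bsub>M\<^esub> (u \<oplus>\<^bsub>M\<^esub> y)"
    using assms(1-4) by (simp add: M.a_ac)
  finally show ?thesis using assms(1-4) by (meson M.add.right_cancel M.add.m_closed M.minus_closed)
qed

end

section \<open>Maps factoring through sums of copies of a module\<close>

text \<open>\<open>fac R X M N f\<close>: on \<open>M\<close>, the map \<open>f\<close> is a finite sum of maps that factor through \<open>X\<close>.  In particular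
  \<open>M\<close> is in \<open>add X\<close> iff it is finitely generated and its identity is such a sum.\<close>

inductive fac ::
  "('a, 'z) ring_scheme \<Rightarrow> ('a, 'x) module \<Rightarrow> ('a, 'm) module \<Rightarrow> ('a, 'n) module \<Rightarrow> ('m \<Rightarrow> 'n) \<Rightarrow> bool"
  for R X M N where
  fac_zero: "(\<And>x. x \<in> carrier M \<Longrightarrow> f x = \<zero>\<^bsub>N\<^esub>) \<Longrightarrow> fac R X M N f"
| fac_step: "\<lbrakk>fac R X M N f; lin R M X r; lin R X N s;
    \<And>x. x \<in> carrier M \<Longrightarrow> h x = f x \<oplus>\<^bsub>N\<^esub> s (r x)\<rbrakk> \<Longrightarrow> fac R X M N h"

lemma fac_cong: "fac R X M N f \<Longrightarrow> (\<And>x. x \<in> carrier M \<Longrightarrow> g x = f x) \<Longrightarrow> fac R X M N g"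
  by (erule fac.cases) (auto intro: fac_zero fac_step)

lemma fac_lin:
  assumes "left_module R M" "left_module R N" "fac R X M N f" shows "lin R M N f"
  using assms(3)
proof induction
  case (fac_zero f)
  then show ?case using lin_cong_imp[OF assms(1) lin_const_zero[OF assms(2)]] by blast
next
  case (fac_step f r s h)
  show ?case using lin_cong_imp[OF assms(1) lin_sum[OF assms(2) fac_step.IH lin_comp[OF fac_step.hyps(2,3)]]]
    fac_step.hyps(4) by blast
qed

lemma fac_through:
  assumes "left_module R N" "lin R M X r" "lin R X N s" shows "fac R X M N (\<lambda>x. s (r x))"
proof (rule fac_step[OF fac_zero[of M "\<lambda>_. \<zero>\<^bsub>N\<^esub>"] assms(2,3)])
  interpret left_module R N by fact
  fix x assume "x \<in> carrier M"
  then show "s (r x) = \<zero>\<^bsub>N\<^esub> \<oplus>\<^bsub>N\<^esub> s (r x)" using linD(1)[OF assms(2)] linD(1)[OF assms(3)] by simp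
qed simp

lemma fac_sum:
  assumes "left_module R M" "left_module R N" "fac R X M N f" "fac R X M N g"
  shows "fac R X M N (\<lambda>x. f x \<oplus>\<^bsub>N\<^esub> g x)"
  using assms(4)
proof induction
  case (fac_zero g)
  interpret N: left_module R N by fact
  show ?case using fac_zero linD(1)[OF fac_lin[OF assms(1-3)]] by (intro fac_cong[OF assms(3)]) simp
next
  case (fac_step g r s h)
  interpret N: left_module R N by fact
  have "f x \<oplus>\<^bsub>N\<^esub> h x = (f x \<oplus>\<^bsub>N\<^esub> g x) \<oplus>\<^bsub>N\<^esub> s (r x)" if "x \<in> carrier M" for x
    using that fac_step linD(1)[OF fac_lin[OF assms(1-3)]] linD(1)[OF fac_lin[OF assms(1,2) fac_step.hyps(1)]]
      linD(1)[OF fac_step.hyps(2)] linD(1)[OF fac_step.hyps(3)] by (simp add: N.M.a_assoc)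
  then show ?case by (rule fac.fac_step[OF fac_step.IH fac_step.hyps(2,3)])
qed

lemma fac_pre:
  assumes "fac R X M N f" "lin R L M a" shows "fac R X L N (\<lambda>x. f (a x))"
  using assms(1)
proof induction
  case (fac_zero f) then show ?case using linD(1)[OF assms(2)] by (auto intro: fac.fac_zero)
next
  case (fac_step f r s h)
  then show ?case using linD(1)[OF assms(2)] lin_comp[OF assms(2) fac_step.hyps(2)]
    by (intro fac.fac_step[OF fac_step.IH _ fac_step.hyps(3)]) auto
qed

lemma fac_post:
  assumes "left_module R M" "left_module R N" "left_module R L" "fac R X M N f" "lin R N L b"
  shows "fac R X M L (\<lambda>x. b (f x))"
  using assms(4)
proof induction
  case (fac_zero f) then show ?case using lin_zero[OF assms(2,3,5)] by (auto intro: fac.fac_zero)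
next
  case (fac_step f r s h)
  then show ?case
    using linD[OF assms(5)] linD(1)[OF fac_lin[OF assms(1,2) fac_step.hyps(1)]] linD(1)[OF fac_step.hyps(2)]
      linD(1)[OF fac_step.hyps(3)]
    by (intro fac.fac_step[OF fac_step.IH fac_step.hyps(2) lin_comp[OF fac_step.hyps(3) assms(5)]]) simp
qed

text \<open>Membership in \<open>add\<close> is transitive: every passage through \<open>Y\<close>
  is broken up by the sum that expresses the identity of \<open>Y\<close>.\<close>

lemma fac_trans:
  assumes "left_module R M" "left_module R N" "left_module R Y" "fac R Y M N f" "fac R X Y Y (\<lambda>x. x)"
  shows "fac R X M N f"
  using assms(4)
proof induction
  case (fac_zero f) then show ?case by (rule fac.fac_zero)
next
  case (fac_step f r s h)
  have "fac R X M N (\<lambda>x. s (r x))"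
    using fac_post[OF assms(3,3,2,5) fac_step.hyps(3), THEN fac_pre[OF _ fac_step.hyps(2)]] .
  from fac_cong[OF fac_sum[OF assms(1,2) fac_step.IH this], of h] show ?case using fac_step.hyps(4) by simp
qed

section \<open>Powers of a module and \<open>add\<close>\<close>

lemma mod_power_simps [simp]:
  "carrier (mod_power M n) = {..<n} \<rightarrow>\<^sub>E carrier M"
  "\<zero>\<^bsub>mod_power M n\<^esub> = (\<lambda>i\<in>{..<n}. \<zero>\<^bsub>M\<^esub>)"
  "x \<oplus>\<^bsub>mod_power M n\<^esub> y = (\<lambda>i\<in>{..<n}. x i \<oplus>\<^bsub>M\<^esub> y i)"
  "a \<odot>\<^bsub>mod_power M n\<^esub> x = (\<lambda>i\<in>{..<n}. a \<odot>\<^bsub>M\<^esub> x i)"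
  by (simp_all add: mod_power_def)

lemma mod_power_left_module:
  assumes "left_module R M" shows "left_module R (mod_power M n)"
proof -
  interpret left_module R M by fact
  have "abelian_group (mod_power M n)"
  proof (rule abelian_groupI)
    fix x assume "x \<in> carrier (mod_power M n)"
    then show "\<exists>y\<in>carrier (mod_power M n). y \<oplus>\<^bsub>mod_power M n\<^esub> x = \<zero>\<^bsub>mod_power M n\<^esub>"
      by (intro bexI[of _ "\<lambda>i\<in>{..<n}. \<ominus>\<^bsub>M\<^esub> x i"]) (auto simp: PiE_iff M.l_neg fun_eq_iff)
  qed (auto simp: PiE_iff fun_eq_iff M.a_ac extensional_def)
  then show ?thesis
    by (intro left_module.intro left_module_axioms.intro R.ring_axioms)
      (auto simp: PiE_iff fun_eq_iff smult_closed smult_l_distr smult_r_distr smult_assoc1 smult_one extensional_def)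
qed

lemma mod_power_proj: "i < n \<Longrightarrow> lin R (mod_power M n) M (\<lambda>z. z i)"
  by (auto simp: lin_def)

lemma mod_power_inj:
  assumes "left_module R M" shows "lin R M (mod_power M n) (\<lambda>x. \<lambda>j\<in>{..<n}. if j = i then x else \<zero>\<^bsub>M\<^esub>)"
proof -
  interpret left_module R M by fact
  show ?thesis by (rule linI) (auto simp: fun_eq_iff smult_zero_right)
qed

lemma mod_power_fac_id:
  assumes "left_module R M" shows "fac R M (mod_power M n) (mod_power M n) (\<lambda>z. z)"
proof -
  interpret left_module R M by fact
  \<comment> \<open>Truncation to the first \<open>k\<close> coordinates; each step adds the summand
    that keeps coordinate \<open>k\<close>.\<close>
  have "fac R M (mod_power M n) (mod_power M n) (\<lambda>z. \<lambda>i\<in>{..<n}. if i < k then z i else \<zero>\<^bsub>M\<^esub>)" if "k \<le> n" for k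
    using that
  proof (induction k)
    case 0 show ?case by (rule fac_zero) (simp add: restrict_def)
  next
    case (Suc k)
    then have k: "k < n" by simp
    show ?case
    proof (rule fac_step[OF _ mod_power_proj[OF k] mod_power_inj[OF assms, of n k]])
      show "fac R M (mod_power M n) (mod_power M n) (\<lambda>z. \<lambda>i\<in>{..<n}. if i < k then z i else \<zero>\<^bsub>M\<^esub>)"
        by (rule Suc.IH) (use Suc.prems in simp)
      fix x assume "x \<in> carrier (mod_power M n)"
      then have "x i \<in> carrier M" if "i < n" for i using that by auto
      with k show "(\<lambda>i\<in>{..<n}. if i < Suc k then x i else \<zero>\<^bsub>M\<^esub>) =
        (\<lambda>i\<in>{..<n}. if i < k then x i else \<zero>\<^bsub>M\<^esub>) \<oplus>\<^bsub>mod_power M n\<^esub> (\<lambda>j\<in>{..<n}. if j = k then x k else \<zero>\<^bsub>M\<^esub>)"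
        by (auto simp: fun_eq_iff less_Suc_eq)
    qed
  qed
  from this[of n] show ?thesis
  proof (rule fac_cong)
    fix z assume "z \<in> carrier (mod_power M n)"
    then show "z = (\<lambda>i\<in>{..<n}. if i < n then z i else \<zero>\<^bsub>M\<^esub>)"
      by (auto simp: fun_eq_iff PiE_iff extensional_def)
  qed simp
qed

lemma mod_power_snoc_source:
  assumes "left_module R X" "left_module R N" "lin R (mod_power X n) N \<sigma>" "lin R X N s"
  shows "lin R (mod_power X (Suc n)) N (\<lambda>z. \<sigma> (\<lambda>i\<in>{..<n}. z i) \<oplus>\<^bsub>N\<^esub> s (z n))"
proof (rule lin_sum[OF assms(2) lin_comp[OF _ assms(3)] lin_comp[OF _ assms(4)]])
  interpret left_module R X by fact
  show "lin R (mod_power X (Suc n)) (mod_power X n) (\<lambda>z. \<lambda>i\<in>{..<n}. z i)"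
    by (rule linI) (auto simp: fun_eq_iff PiE_iff)
  show "lin R (mod_power X (Suc n)) X (\<lambda>z. z n)" by (rule mod_power_proj) simp
qed

lemma mod_power_snoc_target:
  assumes "lin R M (mod_power X n) \<rho>" "lin R M X r"
  shows "lin R M (mod_power X (Suc n)) (\<lambda>x. (\<rho> x)(n := r x))"
  using linD[OF assms(1)] linD[OF assms(2)] by (intro linI) (auto simp: fun_eq_iff PiE_iff extensional_def)

lemma restrict_fun_upd_PiE: "x \<in> {..<n::nat} \<rightarrow>\<^sub>E C \<Longrightarrow> (\<lambda>i\<in>{..<n}. (x(n := a)) i) = x"
  by (rule ext) (simp add: PiE_iff extensional_def restrict_def)

text \<open>The summands through \<open>X\<close> are the components of a single map through a power
  of \<open>X\<close>; each of them contributes one coordinate.\<close>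

lemma fac_power:
  assumes "left_module R X" "left_module R M" "left_module R N" "fac R X M N f"
  obtains n \<rho> \<sigma> where "lin R M (mod_power X n) \<rho>" "lin R (mod_power X n) N \<sigma>"
    "\<And>x. x \<in> carrier M \<Longrightarrow> f x = \<sigma> (\<rho> x)"
proof -
  have "\<exists>n \<rho> \<sigma>. lin R M (mod_power X n) \<rho> \<and> lin R (mod_power X n) N \<sigma> \<and> (\<forall>x\<in>carrier M. f x = \<sigma> (\<rho> x))"
    using assms(4)
  proof induction
    case (fac_zero f)
    show ?case
      by (rule exI[of _ 0], rule exI[of _ "\<lambda>_. \<zero>\<^bsub>mod_power X 0\<^esub>"], rule exI[of _ "\<lambda>_. \<zero>\<^bsub>N\<^esub>"])
        (intro conjI lin_const_zero mod_power_left_module assms ballI fac_zero)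
  next
    case (fac_step f r s h)
    then obtain n \<rho> \<sigma> where *: "lin R M (mod_power X n) \<rho>" "lin R (mod_power X n) N \<sigma>"
      "\<forall>x\<in>carrier M. f x = \<sigma> (\<rho> x)" by auto
    have "(\<lambda>i\<in>{..<n}. ((\<rho> x)(n := r x)) i) = \<rho> x" if "x \<in> carrier M" for x
      using linD(1)[OF *(1) that] by (intro restrict_fun_upd_PiE) auto
    then have "\<forall>x\<in>carrier M. h x = (\<lambda>z. \<sigma> (\<lambda>i\<in>{..<n}. z i) \<oplus>\<^bsub>N\<^esub> s (z n)) ((\<rho> x)(n := r x))"
      using *(3) fac_step.hyps(4) by simp
    then show ?case using mod_power_snoc_target[OF *(1) fac_step.hyps(2)]
      mod_power_snoc_source[OF assms(1,3) *(2) fac_step.hyps(3)] by blast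
  qed
  then show thesis using that by blast
qed

text \<open>Finitely many of the given maps hit a generating set. Together they form one map from a
  power, and its image is a submodule.\<close>

lemma power_cover:
  assumes "left_module R X" "left_module R N" "fgen R N"
    "\<And>x. x \<in> carrier N \<Longrightarrow> \<exists>g. lin R X N g \<and> x \<in> g ` carrier X"
  obtains n p where "lin R (mod_power X n) N p" "p ` carrier (mod_power X n) = carrier N"
proof -
  interpret X: left_module R X by fact
  interpret N: left_module R N by fact
  obtain S where S: "finite S" "S \<subseteq> carrier N" "\<And>U. submodule U R N \<Longrightarrow> S \<subseteq> U \<Longrightarrow> U = carrier N"
    using assms(3) by (auto simp: fgen_def)
  have "\<exists>n p. lin R (mod_power X n) N p \<and> S \<subseteq> p ` carrier (mod_power X n)" using S(1,2)
  proof (induction S rule: finite_induct)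
    case empty
    show ?case using lin_const_zero[OF assms(2)] by (intro exI[of _ 0] exI[of _ "\<lambda>_. \<zero>\<^bsub>N\<^esub>"]) simp
  next
    case (insert x S)
    then obtain n p where p: "lin R (mod_power X n) N p" "S \<subseteq> p ` carrier (mod_power X n)" by auto
    obtain g y where g: "lin R X N g" "x = g y" "y \<in> carrier X" using assms(4)[of x] insert by auto
    let ?p = "\<lambda>z. p (\<lambda>i\<in>{..<n}. z i) \<oplus>\<^bsub>N\<^esub> g (z n)"
    \<comment> \<open>\<open>w\<close> is appended as coordinate number \<open>n\<close>. Taking
      \<open>z\<close> or \<open>w\<close> to be zero shows that the new element is reached and that
      the old ones are not lost.\<close>
    have *: "p z \<oplus>\<^bsub>N\<^esub> g w \<in> ?p ` carrier (mod_power X (Suc n))"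
      if "z \<in> carrier (mod_power X n)" "w \<in> carrier X" for z w
    proof (rule image_eqI[of _ _ "z(n := w)"])
      show "p z \<oplus>\<^bsub>N\<^esub> g w = ?p (z(n := w))" using that restrict_fun_upd_PiE[of z n "carrier X" w] by simp
      show "z(n := w) \<in> carrier (mod_power X (Suc n))" using that
        by (auto simp: PiE_iff extensional_def less_Suc_eq)
    qed
    have "x \<in> ?p ` carrier (mod_power X (Suc n))"
      using *[of "\<zero>\<^bsub>mod_power X n\<^esub>" y] g lin_zero[OF mod_power_left_module[OF assms(1)] assms(2) p(1)]
        linD(1)[OF g(1)] by simp
    moreover have "v \<in> ?p ` carrier (mod_power X (Suc n))" if v: "v \<in> S" for v
    proof -
      obtain z where z: "z \<in> carrier (mod_power X n)" "v = p z" using p(2) v by blast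
      then have "v = p z \<oplus>\<^bsub>N\<^esub> g \<zero>\<^bsub>X\<^esub>" using lin_zero[OF assms(1,2) g(1)] linD(1)[OF p(1)] by auto
      then show ?thesis using *[OF z(1), of "\<zero>\<^bsub>X\<^esub>"] by auto
    qed
    ultimately show ?case using mod_power_snoc_source[OF assms(1,2) p(1) g(1)] by blast
  qed
  then obtain n p where p: "lin R (mod_power X n) N p" "S \<subseteq> p ` carrier (mod_power X n)" by auto
  then show thesis using that[OF p(1)] S(3)[OF range_submodule[OF mod_power_left_module[OF assms(1)] assms(2)
      p(1)] p(2)]
    by blast
qed

text \<open>Only the existence of a complement is given. The projections choose components, and the
  trivial intersection of \<open>U\<close> and \<open>V\<close> makes the choice
  unambiguous.\<close>

lemma summand_decomposition:
  assumes "left_module R M" "is_summand R M U"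
  obtains V \<pi> \<rho> where "submodule U R M" "submodule V R M" "U \<inter> V = {\<zero>\<^bsub>M\<^esub>}"
    "lin R M (submod M U) \<pi>" "lin R M (submod M V) \<rho>" "\<And>x. x \<in> carrier M \<Longrightarrow> x = \<pi> x \<oplus>\<^bsub>M\<^esub> \<rho> x"
    "\<And>u v. \<lbrakk>u \<in> U; v \<in> V\<rbrakk> \<Longrightarrow> \<pi> (u \<oplus>\<^bsub>M\<^esub> v) = u \<and> \<rho> (u \<oplus>\<^bsub>M\<^esub> v) = v"
proof -
  interpret left_module R M by fact
  obtain V where U: "submodule U R M" and V: "submodule V R M" and UV: "U \<inter> V = {\<zero>\<^bsub>M\<^esub>}" "U <+>\<^bsub>M\<^esub> V = carrier M"
    using assms(2) by (auto simp: is_summand_def)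
  note U' = submodD[OF U] and V' = submodD[OF V]
  have c[simp]: "x \<in> U \<Longrightarrow> x \<in> carrier M" "x \<in> V \<Longrightarrow> x \<in> carrier M" for x using U' V' by auto
  define \<pi> where "\<pi> z = (SOME u. u \<in> U \<and> (\<exists>v\<in>V. z = u \<oplus>\<^bsub>M\<^esub> v))" for z
  have \<pi>: "\<pi> (u \<oplus>\<^bsub>M\<^esub> v) = u" if uv: "u \<in> U" "v \<in> V" for u v
  proof -
    have "\<pi> (u \<oplus>\<^bsub>M\<^esub> v) \<in> U \<and> (\<exists>w\<in>V. u \<oplus>\<^bsub>M\<^esub> v = \<pi> (u \<oplus>\<^bsub>M\<^esub> v) \<oplus>\<^bsub>M\<^esub> w)"
      unfolding \<pi>_def by (rule someI[of _ u]) (use uv in auto)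
    then obtain w where w: "w \<in> V" "u \<oplus>\<^bsub>M\<^esub> v = \<pi> (u \<oplus>\<^bsub>M\<^esub> v) \<oplus>\<^bsub>M\<^esub> w" "\<pi> (u \<oplus>\<^bsub>M\<^esub> v) \<in> U" by auto
    let ?u = "\<pi> (u \<oplus>\<^bsub>M\<^esub> v)"
    have "u \<ominus>\<^bsub>M\<^esub> ?u = w \<ominus>\<^bsub>M\<^esub> v"
      using w uv by (intro add_eq_imp_diff_eq) auto
    moreover have "u \<ominus>\<^bsub>M\<^esub> ?u \<in> U" "w \<ominus>\<^bsub>M\<^esub> v \<in> V" using uv w U'(6) V'(6) by blast+
    ultimately have "u \<ominus>\<^bsub>M\<^esub> ?u \<in> U \<inter> V" by simp
    then have "u \<ominus>\<^bsub>M\<^esub> ?u = \<zero>\<^bsub>M\<^esub>" using UV by auto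
    then show ?thesis using eq_by_diff[of u ?u] uv w by auto
  qed
  have ex: "\<exists>u\<in>U. \<exists>v\<in>V. z = u \<oplus>\<^bsub>M\<^esub> v" if "z \<in> carrier M" for z
    using that UV(2) unfolding set_add_def' by blast
  have \<rho>: "(u \<oplus>\<^bsub>M\<^esub> v) \<ominus>\<^bsub>M\<^esub> \<pi> (u \<oplus>\<^bsub>M\<^esub> v) = v" if uv: "u \<in> U" "v \<in> V" for u v
  proof -
    have "(u \<oplus>\<^bsub>M\<^esub> v) \<ominus>\<^bsub>M\<^esub> u = v \<ominus>\<^bsub>M\<^esub> \<zero>\<^bsub>M\<^esub>" using uv by (intro add_eq_imp_diff_eq) (auto simp: M.a_comm)
    then show ?thesis using uv \<pi> by (simp add: M.minus_eq)
  qed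
  show thesis
  proof (rule that[OF U V UV(1)])
    show 1: "lin R M (submod M U) \<pi>"
    proof (rule linI)
      fix x assume "x \<in> carrier M"
      then show "\<pi> x \<in> carrier (submod M U)" using ex \<pi> by fastforce
    next
      fix x y assume "x \<in> carrier M" "y \<in> carrier M"
      then obtain u v u' v' where *: "x = u \<oplus>\<^bsub>M\<^esub> v" "y = u' \<oplus>\<^bsub>M\<^esub> v'" "u \<in> U" "u' \<in> U" "v \<in> V" "v' \<in> V"
        using ex by meson
      then have "x \<oplus>\<^bsub>M\<^esub> y = (u \<oplus>\<^bsub>M\<^esub> u') \<oplus>\<^bsub>M\<^esub> (v \<oplus>\<^bsub>M\<^esub> v')" by (simp add: M.a_ac)
      then show "\<pi> (x \<oplus>\<^bsub>M\<^esub> y) = \<pi> x \<oplus>\<^bsub>submod M U\<^esub> \<pi> y" using * \<pi> U'(3) V'(3) by simp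
    next
      fix a x assume a: "a \<in> carrier R" "x \<in> carrier M"
      then obtain u v where *: "x = u \<oplus>\<^bsub>M\<^esub> v" "u \<in> U" "v \<in> V" using ex by meson
      then show "\<pi> (a \<odot>\<^bsub>M\<^esub> x) = a \<odot>\<^bsub>submod M U\<^esub> \<pi> x" using a \<pi> U'(4) V'(4) by (simp add: smult_r_distr)
    qed
    show "lin R M (submod M V) (\<lambda>x. x \<ominus>\<^bsub>M\<^esub> \<pi> x)"
    proof (rule lin_into_submod[OF lin_difference[OF assms(1) lin_id lin_from_submod[OF 1 U]]])
      fix x assume "x \<in> carrier M"
      then show "x \<ominus>\<^bsub>M\<^esub> \<pi> x \<in> V" using ex \<rho> by fastforce
    qed
    show "x = \<pi> x \<oplus>\<^bsub>M\<^esub> (x \<ominus>\<^bsub>M\<^esub> \<pi> x)" if "x \<in> carrier M" for x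
      using that linD(1)[OF 1 that] by (simp add: add_diff_cancel)
  qed (use \<pi> \<rho> in auto)
qed

lemma add_cat_fac:
  assumes "left_module R X" "M \<in> add_cat R X" shows "fac R X M M (\<lambda>x. x)"
proof -
  obtain n U f where M: "left_module R M" and U: "is_summand R (mod_power X n) U"
    and f: "lin R M (submod (mod_power X n) U) f" "bij_betw f (carrier M) (carrier (submod (mod_power X n) U))"
    using assms(2) by (auto simp: add_cat_def fg_module_def mod_iso_def dest: mod_homD)
  note P = mod_power_left_module[OF assms(1), of n]
  obtain V \<pi> where "submodule V R (mod_power X n)" and
    \<pi>: "lin R (mod_power X n) (submod (mod_power X n) U) \<pi>" "submodule U R (mod_power X n)"
    "\<And>u v. \<lbrakk>u \<in> U; v \<in> V\<rbrakk> \<Longrightarrow> \<pi> (u \<oplus>\<^bsub>mod_power X n\<^esub> v) = u" using summand_decomposition[OF P U] by metis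
  interpret P: left_module R "mod_power X n" by (rule P)
  have \<pi>U: "\<pi> u = u" if "u \<in> U" for u
    using \<pi>(3)[OF that submodD(2)[OF \<open>submodule V R _\<close>]] P.M.r_zero submodD(1)[OF \<pi>(2)] that by auto
  obtain g where g: "lin R (submod (mod_power X n) U) M g" "\<And>x. x \<in> carrier M \<Longrightarrow> g (f x) = x"
    using lin_inverse[OF f(1) M f(2)] by metis
  have "fac R X (mod_power X n) M (\<lambda>x. g (\<pi> x))"
    using fac_post[OF P P M mod_power_fac_id[OF assms(1)] lin_comp[OF \<pi>(1) g(1)]] .
  then have "fac R X M M (\<lambda>x. g (\<pi> (f x)))" using fac_pre lin_from_submod[OF f(1) \<pi>(2)] by fast
  then show ?thesis by (rule fac_cong) (use \<pi>U g(2) linD(1)[OF f(1)] in simp)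
qed

text \<open>Converse of \<open>add_cat_fac\<close>. The identity is \<open>\<sigma>\<close> after
  \<open>\<rho>\<close> through a power of \<open>X\<close>, so the image of \<open>\<rho>\<close>
  is a summand with the kernel of \<open>\<sigma>\<close> as complement. The copy has the element
  type that \<open>gen_cat\<close> and \<open>cogen_cat\<close> prescribe for the terms of a
  sequence.\<close>

lemma add_cat_copy:
  fixes X :: "('a, 'x) module" and M :: "('a, 'm) module"
  assumes "left_module R X" "fg_module R M" "fac R X M M (\<lambda>x. x)"
  obtains t :: "('a, nat \<Rightarrow> 'x) module" and f g where "t \<in> add_cat R X" "left_module R t" "lin R M t f"
    "lin R t M g" "\<And>x. x \<in> carrier M \<Longrightarrow> g (f x) = x" "\<And>x. x \<in> carrier t \<Longrightarrow> f (g x) = x"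
proof -
  have M: "left_module R M" "fgen R M" using assms(2) by (auto simp: fg_module_iff)
  obtain n \<rho> \<sigma> where *: "lin R M (mod_power X n) \<rho>" "lin R (mod_power X n) M \<sigma>"
    "\<And>x. x \<in> carrier M \<Longrightarrow> x = \<sigma> (\<rho> x)" using fac_power[OF assms(1) M(1) M(1) assms(3)] by metis
  note P = mod_power_left_module[OF assms(1), of n]
  interpret M: left_module R M by (rule M)
  interpret P: left_module R "mod_power X n" by (rule P)
  let ?P = "mod_power X n" and ?U = "\<rho> ` carrier M" and ?V = "{z \<in> carrier (mod_power X n). \<sigma> z = \<zero>\<^bsub>M\<^esub>}"
  have U: "submodule ?U R ?P" using range_submodule[OF M(1) P *(1)] .
  have V: "submodule ?V R ?P" using kernel_submodule[OF P M(1) *(2)] .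
  have "z \<in> ?U <+>\<^bsub>?P\<^esub> ?V" if z: "z \<in> carrier ?P" for z
  proof -
    have c: "\<sigma> z \<in> carrier M" "\<rho> (\<sigma> z) \<in> carrier ?P" using linD(1)[OF *(2) z] linD(1)[OF *(1)] by blast+
    have "\<sigma> (z \<ominus>\<^bsub>?P\<^esub> \<rho> (\<sigma> z)) = \<zero>\<^bsub>M\<^esub>"
      using lin_diff[OF P M(1) *(2) z c(2)] *(3)[OF c(1)] M.diff_self[OF c(1)] by simp
    moreover have "z \<ominus>\<^bsub>?P\<^esub> \<rho> (\<sigma> z) \<in> carrier ?P" using z c(2) P.M.minus_closed by blast
    moreover have "z = \<rho> (\<sigma> z) \<oplus>\<^bsub>?P\<^esub> (z \<ominus>\<^bsub>?P\<^esub> \<rho> (\<sigma> z))" using P.add_diff_cancel[OF c(2) z] by simp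
    ultimately show ?thesis using c(1) unfolding set_add_def' by blast
  qed
  moreover have "z \<in> carrier ?P" if z: "z \<in> ?U <+>\<^bsub>?P\<^esub> ?V" for z
  proof -
    obtain u v where "u \<in> ?U" "v \<in> ?V" "z = u \<oplus>\<^bsub>?P\<^esub> v" using z unfolding set_add_def' by blast
    then show ?thesis using submodD(1)[OF U] P.M.a_closed by blast
  qed
  moreover have "?U \<inter> ?V = {\<zero>\<^bsub>?P\<^esub>}"
  proof -
    have "\<rho> x = \<zero>\<^bsub>?P\<^esub>" if "x \<in> carrier M" "\<sigma> (\<rho> x) = \<zero>\<^bsub>M\<^esub>" for x
      using that *(3)[of x] lin_zero[OF M(1) P *(1)] by simp
    then show ?thesis using submodD(2)[OF U] submodD(2)[OF V] by blast
  qed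
  ultimately have "is_summand R ?P ?U" unfolding is_summand_def using U V by blast
  moreover have t: "left_module R (submod ?P ?U)" using P U by (rule submodule_left_module)
  moreover have r: "lin R M (submod ?P ?U) \<rho>" using *(1) by (rule lin_into_submod) auto
  moreover have "fgen R (submod ?P ?U)" using fgen_image[OF M(1) t r _ M(2)] by simp
  moreover have "mod_iso R (submod ?P ?U) (submod ?P ?U)"
    using mod_isoI[OF t lin_id] by (simp add: bij_betw_def)
  ultimately have "submod ?P ?U \<in> add_cat R X" unfolding add_cat_def fg_module_iff by blast
  then show thesis using t r lin_on_submod[OF *(2) submodD(1)[OF U]] *(3)
    by (intro that[of "submod ?P ?U" \<rho> \<sigma>]) auto
qed

section \<open>Modules over a finite-dimensional algebra\<close>

lemma with_smult_simps [simp]: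
  "carrier (with_smult M s) = carrier M" "\<zero>\<^bsub>with_smult M s\<^esub> = \<zero>\<^bsub>M\<^esub>"
  "x \<oplus>\<^bsub>with_smult M s\<^esub> y = x \<oplus>\<^bsub>M\<^esub> y" "a \<odot>\<^bsub>with_smult M s\<^esub> x = s a x"
  by (simp_all add: with_smult_def)

lemma restrict_scalars_simps [simp]:
  "carrier (restrict_scalars f M) = carrier M" "\<zero>\<^bsub>restrict_scalars f M\<^esub> = \<zero>\<^bsub>M\<^esub>"
  "x \<oplus>\<^bsub>restrict_scalars f M\<^esub> y = x \<oplus>\<^bsub>M\<^esub> y" "a \<odot>\<^bsub>restrict_scalars f M\<^esub> x = f a \<odot>\<^bsub>M\<^esub> x"
  by (simp_all add: restrict_scalars_def)

lemma K_space_simps [simp]: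
  "carrier (K_space A M) = carrier M" "\<zero>\<^bsub>K_space A M\<^esub> = \<zero>\<^bsub>M\<^esub>" "x \<oplus>\<^bsub>K_space A M\<^esub> y = x \<oplus>\<^bsub>M\<^esub> y"
  "c \<odot>\<^bsub>K_space A M\<^esub> x = (c \<odot>\<^bsub>A\<^esub> \<one>\<^bsub>A\<^esub>) \<odot>\<^bsub>M\<^esub> x"
  by (simp_all add: K_space_def)

lemma K_space_submod: "K_space A (submod M U) = submod (K_space A M) U"
  by (simp add: K_space_def restrict_scalars_def with_smult_def submod_def)

text \<open>Covers restriction of scalars along \<open>f\<close> and, with the identity for
  \<open>f\<close>, the passage between records that agree in the fields relevant for a
  module.\<close>

lemma left_module_transfer:
  assumes "left_module R M" "ring S" "carrier M' = carrier M" "\<zero>\<^bsub>M'\<^esub> = \<zero>\<^bsub>M\<^esub>"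
    "\<And>x y. \<lbrakk>x \<in> carrier M; y \<in> carrier M\<rbrakk> \<Longrightarrow> x \<oplus>\<^bsub>M'\<^esub> y = x \<oplus>\<^bsub>M\<^esub> y"
    and f: "\<And>a. a \<in> carrier S \<Longrightarrow> f a \<in> carrier R"
    "\<And>a b. \<lbrakk>a \<in> carrier S; b \<in> carrier S\<rbrakk> \<Longrightarrow> f (a \<oplus>\<^bsub>S\<^esub> b) = f a \<oplus>\<^bsub>R\<^esub> f b"
    "\<And>a b. \<lbrakk>a \<in> carrier S; b \<in> carrier S\<rbrakk> \<Longrightarrow> f (a \<otimes>\<^bsub>S\<^esub> b) = f a \<otimes>\<^bsub>R\<^esub> f b"
    "f \<one>\<^bsub>S\<^esub> = \<one>\<^bsub>R\<^esub>"
    "\<And>a x. \<lbrakk>a \<in> carrier S; x \<in> carrier M\<rbrakk> \<Longrightarrow> a \<odot>\<^bsub>M'\<^esub> x = f a \<odot>\<^bsub>M\<^esub> x"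
  shows "left_module S M'"
proof -
  interpret left_module R M by fact
  interpret S: ring S by fact
  have "abelian_group M'"
  proof (rule abelian_groupI)
    fix x assume "x \<in> carrier M'"
    then show "\<exists>y\<in>carrier M'. y \<oplus>\<^bsub>M'\<^esub> x = \<zero>\<^bsub>M'\<^esub>"
      using assms(3-5) by (intro bexI[of _ "\<ominus>\<^bsub>M\<^esub> x"]) (auto simp: M.l_neg)
  qed (auto simp: assms(3-5) M.a_ac)
  then show ?thesis
    by (intro left_module.intro left_module_axioms.intro S.ring_axioms)
      (auto simp: assms(3-5) f smult_closed smult_l_distr smult_r_distr smult_assoc1 smult_one)
qed

locale fdalg =
  fixes K :: "'k ring" and A :: "('k, 'a) module"
  assumes fd_algebra: "fd_algebra K A"
begin

lemma field_K: "field K" and ring_A: "ring A" and K_module_A: "module K A"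
  and smult_mult: "\<lbrakk>c \<in> carrier K; x \<in> carrier A; y \<in> carrier A\<rbrakk> \<Longrightarrow> (c \<odot>\<^bsub>A\<^esub> x) \<otimes>\<^bsub>A\<^esub> y = c \<odot>\<^bsub>A\<^esub> (x \<otimes>\<^bsub>A\<^esub> y)"
    "\<lbrakk>c \<in> carrier K; x \<in> carrier A; y \<in> carrier A\<rbrakk> \<Longrightarrow> x \<otimes>\<^bsub>A\<^esub> (c \<odot>\<^bsub>A\<^esub> y) = c \<odot>\<^bsub>A\<^esub> (x \<otimes>\<^bsub>A\<^esub> y)"
  using fd_algebra by (auto simp: fd_algebra_def)

lemma ring_K: "ring K"
proof -
  interpret field K by (rule field_K)
  show ?thesis by (rule ring_axioms)
qed

lemma scalar_closed: "\<lbrakk>c \<in> carrier K; x \<in> carrier A\<rbrakk> \<Longrightarrow> c \<odot>\<^bsub>A\<^esub> x \<in> carrier A"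
  using module.smult_closed[OF K_module_A] .

lemma scalar:
  shows "c \<in> carrier K \<Longrightarrow> c \<odot>\<^bsub>A\<^esub> \<one>\<^bsub>A\<^esub> \<in> carrier A"
    "\<lbrakk>c \<in> carrier K; d \<in> carrier K\<rbrakk> \<Longrightarrow> (c \<oplus>\<^bsub>K\<^esub> d) \<odot>\<^bsub>A\<^esub> \<one>\<^bsub>A\<^esub> = c \<odot>\<^bsub>A\<^esub> \<one>\<^bsub>A\<^esub> \<oplus>\<^bsub>A\<^esub> d \<odot>\<^bsub>A\<^esub> \<one>\<^bsub>A\<^esub>"
    "\<lbrakk>c \<in> carrier K; d \<in> carrier K\<rbrakk> \<Longrightarrow> (c \<otimes>\<^bsub>K\<^esub> d) \<odot>\<^bsub>A\<^esub> \<one>\<^bsub>A\<^esub> = (c \<odot>\<^bsub>A\<^esub> \<one>\<^bsub>A\<^esub>) \<otimes>\<^bsub>A\<^esub> (d \<odot>\<^bsub>A\<^esub> \<one>\<^bsub>A\<^esub>)"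
    "\<one>\<^bsub>K\<^esub> \<odot>\<^bsub>A\<^esub> \<one>\<^bsub>A\<^esub> = \<one>\<^bsub>A\<^esub>"
    "\<lbrakk>c \<in> carrier K; x \<in> carrier A\<rbrakk> \<Longrightarrow> (c \<odot>\<^bsub>A\<^esub> \<one>\<^bsub>A\<^esub>) \<otimes>\<^bsub>A\<^esub> x = c \<odot>\<^bsub>A\<^esub> x"
    "\<lbrakk>c \<in> carrier K; x \<in> carrier A\<rbrakk> \<Longrightarrow> x \<otimes>\<^bsub>A\<^esub> (c \<odot>\<^bsub>A\<^esub> \<one>\<^bsub>A\<^esub>) = c \<odot>\<^bsub>A\<^esub> x"
proof -
  interpret A: ring A by (rule ring_A)
  interpret m: module K A by (rule K_module_A)
  show "c \<in> carrier K \<Longrightarrow> c \<odot>\<^bsub>A\<^esub> \<one>\<^bsub>A\<^esub> \<in> carrier A"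
    "\<lbrakk>c \<in> carrier K; d \<in> carrier K\<rbrakk> \<Longrightarrow> (c \<oplus>\<^bsub>K\<^esub> d) \<odot>\<^bsub>A\<^esub> \<one>\<^bsub>A\<^esub> = c \<odot>\<^bsub>A\<^esub> \<one>\<^bsub>A\<^esub> \<oplus>\<^bsub>A\<^esub> d \<odot>\<^bsub>A\<^esub> \<one>\<^bsub>A\<^esub>"
    "\<lbrakk>c \<in> carrier K; d \<in> carrier K\<rbrakk> \<Longrightarrow> (c \<otimes>\<^bsub>K\<^esub> d) \<odot>\<^bsub>A\<^esub> \<one>\<^bsub>A\<^esub> = (c \<odot>\<^bsub>A\<^esub> \<one>\<^bsub>A\<^esub>) \<otimes>\<^bsub>A\<^esub> (d \<odot>\<^bsub>A\<^esub> \<one>\<^bsub>A\<^esub>)"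
    "\<one>\<^bsub>K\<^esub> \<odot>\<^bsub>A\<^esub> \<one>\<^bsub>A\<^esub> = \<one>\<^bsub>A\<^esub>"
    "\<lbrakk>c \<in> carrier K; x \<in> carrier A\<rbrakk> \<Longrightarrow> (c \<odot>\<^bsub>A\<^esub> \<one>\<^bsub>A\<^esub>) \<otimes>\<^bsub>A\<^esub> x = c \<odot>\<^bsub>A\<^esub> x"
    by (simp_all add: m.smult_l_distr m.smult_assoc1 smult_mult(1))
  show "\<lbrakk>c \<in> carrier K; x \<in> carrier A\<rbrakk> \<Longrightarrow> x \<otimes>\<^bsub>A\<^esub> (c \<odot>\<^bsub>A\<^esub> \<one>\<^bsub>A\<^esub>) = c \<odot>\<^bsub>A\<^esub> x"
    by (simp add: smult_mult(2))
qed

lemma left_module_K_A: "left_module K A"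
proof -
  interpret m: module K A by (rule K_module_A)
  show ?thesis by (intro left_module.intro left_module_axioms.intro ring_K)
      (auto simp: m.smult_l_distr m.smult_r_distr m.smult_assoc1 m.abelian_group_axioms)
qed

lemma fgen_K_A: "fgen K A"
  using fd_algebra finitely_generated_iff_fgen[OF left_module_K_A] by (simp add: fd_algebra_def)

lemma K_space_left_module: "left_module A M \<Longrightarrow> left_module K (K_space A M)"
  by (erule left_module_transfer[where f = "\<lambda>c. c \<odot>\<^bsub>A\<^esub> \<one>\<^bsub>A\<^esub>"]) (auto simp: scalar ring_K)

lemma K_space_submodule: "left_module A M \<Longrightarrow> submodule U A M \<Longrightarrow> submodule U K (K_space A M)"
  using submodD[of U A M] scalar(1) by (intro left_module.submodI[OF K_space_left_module]) auto

lemma K_space_lin: "lin A M N f \<Longrightarrow> lin K (K_space A M) (K_space A N) f"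
  using linD[of A M N f] scalar(1) by (intro linI) auto

text \<open>Products of \<open>K\<close>-generators of \<open>A\<close> with
  \<open>A\<close>-generators of \<open>M\<close> generate \<open>M\<close> over
  \<open>K\<close>.\<close>

lemma K_space_fgen:
  assumes "left_module A M" "fgen A M" shows "fgen K (K_space A M)"
proof -
  interpret M: left_module A M by fact
  interpret KM: left_module K "K_space A M" using assms(1) by (rule K_space_left_module)
  obtain S where S: "finite S" "S \<subseteq> carrier M" "\<And>U. submodule U A M \<Longrightarrow> S \<subseteq> U \<Longrightarrow> U = carrier M"
    using assms(2) by (auto simp: fgen_def)
  obtain G where G: "finite G" "G \<subseteq> carrier A" "\<And>U. submodule U K A \<Longrightarrow> G \<subseteq> U \<Longrightarrow> U = carrier A"
    using fgen_K_A by (auto simp: fgen_def)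
  let ?F = "(\<lambda>(a, s). a \<odot>\<^bsub>M\<^esub> s) ` (G \<times> S)"
  have "U = carrier M" if U: "submodule U K (K_space A M)" "?F \<subseteq> U" for U
  proof -
    note U' = submodD[OF U(1), simplified]
    have *: "a \<odot>\<^bsub>M\<^esub> s \<in> U" if "s \<in> S" "a \<in> carrier A" for s a
    proof -
      have s: "s \<in> carrier M" using that S by auto
      have "{a \<in> carrier A. a \<odot>\<^bsub>M\<^esub> s \<in> U} = carrier A"
      proof (rule G(3))
        show "submodule {a \<in> carrier A. a \<odot>\<^bsub>M\<^esub> s \<in> U} K A"
        proof (rule left_module.submodI[OF left_module_K_A])
          fix c x assume c: "c \<in> carrier K" "x \<in> {a \<in> carrier A. a \<odot>\<^bsub>M\<^esub> s \<in> U}"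
          then have "(c \<odot>\<^bsub>A\<^esub> x) \<odot>\<^bsub>M\<^esub> s = (c \<odot>\<^bsub>A\<^esub> \<one>\<^bsub>A\<^esub>) \<odot>\<^bsub>M\<^esub> (x \<odot>\<^bsub>M\<^esub> s)"
            using s by (simp add: scalar flip: M.smult_assoc1)
          then show "c \<odot>\<^bsub>A\<^esub> x \<in> {a \<in> carrier A. a \<odot>\<^bsub>M\<^esub> s \<in> U}" using c U'(4)[of c "x \<odot>\<^bsub>M\<^esub> s"]
            by (simp add: scalar_closed)
        qed (use U' s in \<open>auto simp: M.smult_zero_left M.smult_l_distr\<close>)
        show "G \<subseteq> {a \<in> carrier A. a \<odot>\<^bsub>M\<^esub> s \<in> U}" using G(2) U(2) that by auto
      qed
      then show ?thesis using that by blast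
    qed
    \<comment> \<open>The largest \<open>A\<close>-submodule inside the subspace \<open>U\<close>;
      it contains the generators of \<open>M\<close>.\<close>
    have "{x \<in> carrier M. \<forall>a\<in>carrier A. a \<odot>\<^bsub>M\<^esub> x \<in> U} = carrier M"
    proof (rule S(3))
      show "submodule {x \<in> carrier M. \<forall>a\<in>carrier A. a \<odot>\<^bsub>M\<^esub> x \<in> U} A M"
        using U' by (intro M.submodI) (auto simp: M.smult_closed M.smult_r_distr M.smult_zero_right
          simp flip: M.smult_assoc1)
      show "S \<subseteq> {x \<in> carrier M. \<forall>a\<in>carrier A. a \<odot>\<^bsub>M\<^esub> x \<in> U}" using S(2) * by auto
    qed
    then have "x \<in> U" if "x \<in> carrier M" for x using that M.smult_one[OF that] M.R.one_closed by force
    then show ?thesis using U'(1) by auto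
  qed
  then show ?thesis unfolding fgen_def using S(1,2) G(1,2)
    by (intro exI[of _ ?F]) (auto intro!: M.smult_closed)
qed

lemma fgen_if_K_space:
  assumes "left_module A M" "fgen K (K_space A M)" shows "fgen A M"
proof -
  obtain S where S: "finite S" "S \<subseteq> carrier M" "\<And>U. submodule U K (K_space A M) \<Longrightarrow> S \<subseteq> U \<Longrightarrow> U = carrier M"
    using assms(2) by (auto simp: fgen_def)
  then show ?thesis unfolding fgen_def
    using K_space_submodule[OF assms(1)] by (intro exI[of _ S]) blast
qed

text \<open>Finite generation over \<open>A\<close> amounts to finite dimension over
  \<open>K\<close>. It is therefore inherited by submodules, which keeps all kernels and images
  below finitely generated.\<close>

lemma fg_iff: "fg_module A M \<longleftrightarrow> left_module A M \<and> fgen K (K_space A M)"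
  using K_space_fgen fgen_if_K_space by (auto simp: fg_module_iff)

lemma fgD: "fg_module A M \<Longrightarrow> left_module A M"
  by (simp add: fg_iff)

lemma fg_submod: assumes "fg_module A M" "submodule U A M" shows "fg_module A (submod M U)"
proof -
  have M: "left_module A M" "fgen K (K_space A M)" using assms(1) by (auto simp: fg_iff)
  then show ?thesis
    using fgen_subspace[OF field_K K_space_left_module[OF M(1)] M(2) K_space_submodule[OF M(1) assms(2)]]
      submodule_left_module[OF M(1) assms(2)] by (simp add: fg_iff K_space_submod)
qed

lemma fg_image:
  "\<lbrakk>fg_module A M; left_module A N; lin A M N f; f ` carrier M = carrier N\<rbrakk> \<Longrightarrow> fg_module A N"
  using fgen_image[of A M N f] by (simp add: fg_module_iff)

lemma fg_range:
  assumes "fg_module A M" "fg_module A N" "lin A M N f" shows "fg_module A (submod N (f ` carrier M))"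
  using fg_submod[OF assms(2) range_submodule[OF fgD[OF assms(1)] fgD[OF assms(2)] assms(3)]] .

lemma fg_regular: "fg_module A (regular A)"
  by (simp add: fg_module_iff regular_left_module regular_fgen ring_A)

lemma fg_power:
  assumes "fg_module A M" shows "fg_module A (mod_power M n)"
proof -
  have M: "left_module A M" "fgen K (K_space A M)" using assms by (auto simp: fg_iff)
  have P: "left_module A (mod_power M n)" using M(1) by (rule mod_power_left_module)
  have "fgen K (K_space A (mod_power M n))"
  proof (rule fgen_joint_injective[OF field_K K_space_left_module[OF P] K_space_left_module[OF M(1)] M(2),
      of "(\<lambda>i z. z i) ` {..<n}"])
    show "lin K (K_space A (mod_power M n)) (K_space A M) f" if "f \<in> (\<lambda>i z. z i) ` {..<n}" for f
      using that mod_power_proj by (auto intro!: K_space_lin)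
    show "x = \<zero>\<^bsub>K_space A (mod_power M n)\<^esub>" if "x \<in> carrier (K_space A (mod_power M n))"
      "\<forall>f\<in>(\<lambda>i z. z i) ` {..<n}. f x = \<zero>\<^bsub>K_space A M\<^esub>" for x
      using that by (auto simp: fun_eq_iff PiE_iff extensional_def)
  qed simp
  then show ?thesis using P by (simp add: fg_iff)
qed

section \<open>Copies of finitely generated modules in the universe\<close>

definition copy_along :: "('m \<Rightarrow> 'u) \<Rightarrow> ('a, 'm) module \<Rightarrow> ('a, 'u) module" where
  "copy_along \<iota> M = (let i = inv_into (carrier M) \<iota> in
    \<lparr>carrier = \<iota> ` carrier M, monoid.mult = undefined, monoid.one = undefined,
     ring.zero = \<iota> \<zero>\<^bsub>M\<^esub>, ring.add = (\<lambda>x y. \<iota> (i x \<oplus>\<^bsub>M\<^esub> i y)), smult = (\<lambda>a x. \<iota> (a \<odot>\<^bsub>M\<^esub> i x))\<rparr>)"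

lemma copy_along:
  assumes "left_module A M" "inj_on \<iota> (carrier M)"
  shows "left_module A (copy_along \<iota> M)" "lin A M (copy_along \<iota> M) \<iota>"
    "lin A (copy_along \<iota> M) M (inv_into (carrier M) \<iota>)"
proof -
  interpret left_module A M by fact
  have s: "carrier (copy_along \<iota> M) = \<iota> ` carrier M" "\<zero>\<^bsub>copy_along \<iota> M\<^esub> = \<iota> \<zero>\<^bsub>M\<^esub>"
    "\<And>x y. x \<oplus>\<^bsub>copy_along \<iota> M\<^esub> y = \<iota> (inv_into (carrier M) \<iota> x \<oplus>\<^bsub>M\<^esub> inv_into (carrier M) \<iota> y)"
    "\<And>a x. a \<odot>\<^bsub>copy_along \<iota> M\<^esub> x = \<iota> (a \<odot>\<^bsub>M\<^esub> inv_into (carrier M) \<iota> x)"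
    by (auto simp: copy_along_def Let_def)
  have i[simp]: "x \<in> carrier M \<Longrightarrow> inv_into (carrier M) \<iota> (\<iota> x) = x" for x
    using assms(2) by (rule inv_into_f_f)
  have "abelian_group (copy_along \<iota> M)"
  proof (rule abelian_groupI)
    fix x assume "x \<in> carrier (copy_along \<iota> M)"
    then obtain y where "y \<in> carrier M" "x = \<iota> y" by (auto simp: s)
    then show "\<exists>y\<in>carrier (copy_along \<iota> M). y \<oplus>\<^bsub>copy_along \<iota> M\<^esub> x = \<zero>\<^bsub>copy_along \<iota> M\<^esub>"
      by (intro bexI[of _ "\<iota> (\<ominus>\<^bsub>M\<^esub> y)"]) (auto simp: s M.l_neg)
  qed (auto simp: s M.a_ac)
  then show "left_module A (copy_along \<iota> M)"
    by (intro left_module.intro left_module_axioms.intro R.ring_axioms)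
      (auto simp: s smult_closed smult_l_distr smult_r_distr smult_assoc1 smult_one)
  show "lin A M (copy_along \<iota> M) \<iota>" "lin A (copy_along \<iota> M) M (inv_into (carrier M) \<iota>)"
    by (auto intro!: linI simp: s smult_closed)
qed

text \<open>A chosen expression by \<open>K\<close>-generators, numbered by \<open>h\<close>,
  provides coordinates, and elements with equal coordinates are equal sums. This justifies
  coordinate sequences as the universe.\<close>

lemma universe_injection:
  fixes M :: "('a, 'm) module"
  assumes "fg_module A M"
  obtains \<iota> :: "'m \<Rightarrow> nat \<Rightarrow> 'k" where "inj_on \<iota> (carrier M)"
proof -
  let ?V = "K_space A M"
  have V: "left_module K ?V" using assms K_space_left_module by (auto simp: fg_iff)
  then have "finitely_generated K ?V" using assms by (simp add: fg_iff finitely_generated_iff_fgen)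
  then obtain S where S: "finite S" "\<forall>x\<in>carrier M. \<exists>c\<in>S \<rightarrow> carrier K. x = (\<Oplus>\<^bsub>?V\<^esub>s\<in>S. c s \<odot>\<^bsub>?V\<^esub> s)"
    "S \<subseteq> carrier M" unfolding finitely_generated_def K_space_simps(1) by blast
  then obtain c where c: "\<And>x. x \<in> carrier M \<Longrightarrow> c x \<in> S \<rightarrow> carrier K \<and> x = (\<Oplus>\<^bsub>?V\<^esub>s\<in>S. c x s \<odot>\<^bsub>?V\<^esub> s)"
    by metis
  obtain h where h: "bij_betw h {..<card S} S" using ex_bij_betw_nat_finite[OF S(1)] by (metis atLeast0LessThan)
  interpret V: left_module K ?V by (rule V)
  have "inj_on (\<lambda>x i. c x (h i)) (carrier M)"
  proof (rule inj_onI)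
    fix x y assume xy: "x \<in> carrier M" "y \<in> carrier M" "(\<lambda>i. c x (h i)) = (\<lambda>i. c y (h i))"
    have "c x s = c y s" if s: "s \<in> S" for s
    proof -
      obtain i where "s = h i" using h s by (auto simp: bij_betw_def)
      then show ?thesis using fun_cong[OF xy(3), of i] by simp
    qed
    then have "(\<Oplus>\<^bsub>?V\<^esub>s\<in>S. c x s \<odot>\<^bsub>?V\<^esub> s) = (\<Oplus>\<^bsub>?V\<^esub>s\<in>S. c y s \<odot>\<^bsub>?V\<^esub> s)"
      using c[OF xy(2)] S(3) by (intro V.M.finsum_cong') (auto intro!: V.smult_closed[simplified])
    then show "x = y" using c[OF xy(1)] c[OF xy(2)] by simp
  qed
  then show thesis using that by blast
qed

lemma universe_copy:
  fixes M :: "('a, 'm) module"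
  assumes "fg_module A M"
  obtains M' :: "('a, nat \<Rightarrow> 'k) module" and f g where "fg_module A M'" "lin A M M' f" "lin A M' M g"
    "\<And>x. x \<in> carrier M \<Longrightarrow> g (f x) = x" "\<And>x. x \<in> carrier M' \<Longrightarrow> f (g x) = x"
proof -
  obtain \<iota> :: "'m \<Rightarrow> nat \<Rightarrow> 'k" where i: "inj_on \<iota> (carrier M)" using universe_injection[OF assms] .
  note c = copy_along[OF fgD[OF assms] i]
  have 1: "carrier (copy_along \<iota> M) = \<iota> ` carrier M" by (simp add: copy_along_def Let_def)
  have 2: "inv_into (carrier M) \<iota> (\<iota> x) = x" if "x \<in> carrier M" for x using i that by (rule inv_into_f_f)
  have "fg_module A (copy_along \<iota> M)" using fg_image[OF assms c(1,2)] 1 by simp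
  then show thesis using c(2,3) 1 2 by (intro that) auto
qed

section \<open>Lifting and extension properties\<close>

abbreviation "proj \<equiv> projective TYPE(nat \<Rightarrow> 'k) A"
abbreviation "inje \<equiv> injective TYPE(nat \<Rightarrow> 'k) A"

lemma proj_fg: "proj P \<Longrightarrow> fg_module A P" and inje_fg: "inje I \<Longrightarrow> fg_module A I"
  by (simp_all add: projective_def injective_def)

text \<open>Frees the defining property from two restrictions. Surjectivity of \<open>f\<close>
  becomes the condition that \<open>g\<close> lands in its image, by taking that image as the
  target; modules of arbitrary type are replaced by copies in the universe.\<close>

lemma proj_lift:
  assumes P: "proj P" and M: "fg_module A M" and N: "fg_module A N" and f: "lin A M N f" and g: "lin A P N g"
    and fg: "\<And>x. x \<in> carrier P \<Longrightarrow> g x \<in> f ` carrier M"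
  obtains h where "lin A P M h" "\<And>x. x \<in> carrier P \<Longrightarrow> f (h x) = g x"
proof -
  let ?J = "submod N (f ` carrier M)"
  have J: "fg_module A ?J" using M N f by (rule fg_range)
  obtain M' :: "('a, nat \<Rightarrow> 'k) module" and a b where M': "fg_module A M'" and a: "lin A M M' a" "lin A M' M b"
    "\<And>x. x \<in> carrier M \<Longrightarrow> b (a x) = x" using universe_copy[OF M] by metis
  obtain J' :: "('a, nat \<Rightarrow> 'k) module" and c d where J': "fg_module A J'" and c: "lin A ?J J' c" "lin A J' ?J d"
    "\<And>x. x \<in> carrier ?J \<Longrightarrow> d (c x) = x" "\<And>x. x \<in> carrier J' \<Longrightarrow> c (d x) = x" using universe_copy[OF J] by metis
  have P': "left_module A P" using proj_fg[OF P] by (rule fgD)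
  have f': "lin A M' J' (\<lambda>x. c (f (b x)))"
    using lin_comp[OF a(2) lin_comp[OF lin_into_submod[OF f, of "f ` carrier M"] c(1)]] by auto
  have g': "lin A P J' (\<lambda>x. c (g x))" using lin_comp[OF lin_into_submod[OF g fg] c(1)] .
  have s: "(\<lambda>x\<in>carrier M'. c (f (b x))) ` carrier M' = carrier J'"
  proof
    show "(\<lambda>x\<in>carrier M'. c (f (b x))) ` carrier M' \<subseteq> carrier J'" using linD(1)[OF f'] by auto
    show "carrier J' \<subseteq> (\<lambda>x\<in>carrier M'. c (f (b x))) ` carrier M'"
    proof
      fix y assume y: "y \<in> carrier J'"
      then obtain m where m: "m \<in> carrier M" "d y = f m" using linD(1)[OF c(2)] by auto
      then have "c (f (b (a m))) = y" using a(3) c(4) y by metis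
      then show "y \<in> (\<lambda>x\<in>carrier M'. c (f (b x))) ` carrier M'" using linD(1)[OF a(1) m(1)] by force
    qed
  qed
  obtain h where h: "h \<in> mod_hom A P M'"
    "compose (carrier P) (\<lambda>x\<in>carrier M'. c (f (b x))) h = (\<lambda>x\<in>carrier P. c (g x))"
    using P M' J' lin_restrict[OF fgD[OF M'] f'] s lin_restrict[OF P' g'] unfolding projective_def by blast
  show thesis
  proof (rule that)
    show "lin A P M (\<lambda>x. b (h x))" using lin_comp[OF mod_homD[OF h(1)] a(2)] .
    fix x assume x: "x \<in> carrier P"
    have hx: "h x \<in> carrier M'" using linD(1)[OF mod_homD[OF h(1)] x] .
    have "c (f (b (h x))) = c (g x)" using fun_cong[OF h(2), of x] x hx by (simp add: compose_def)
    moreover have 1: "f (b (h x)) \<in> carrier ?J" using linD(1)[OF a(2) hx] by simp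
    moreover have 2: "g x \<in> carrier ?J" using fg[OF x] by simp
    ultimately show "f (b (h x)) = g x" using c(3)[OF 1] c(3)[OF 2] by metis
  qed
qed

text \<open>Injectivity of \<open>f\<close> is weakened to a condition on kernels: \<open>g\<close>
  first descends to the image of \<open>f\<close>, and the extension takes place along the inclusion
  of that image, again on copies in the universe.\<close>

lemma inje_extend:
  assumes I: "inje I" and M: "fg_module A M" and N: "fg_module A N" and f: "lin A M N f" and g: "lin A M I g"
    and fg: "\<And>x. \<lbrakk>x \<in> carrier M; f x = \<zero>\<^bsub>N\<^esub>\<rbrakk> \<Longrightarrow> g x = \<zero>\<^bsub>I\<^esub>"
  obtains h where "lin A N I h" "\<And>x. x \<in> carrier M \<Longrightarrow> h (f x) = g x"
proof -
  let ?J = "submod N (f ` carrier M)"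
  have J: "fg_module A ?J" using M N f by (rule fg_range)
  have I': "left_module A I" using inje_fg[OF I] by (rule fgD)
  obtain g0 where g0: "lin A ?J I g0" "\<And>x. x \<in> carrier M \<Longrightarrow> g0 (f x) = g x"
  proof (rule lin_factor[OF fgD[OF M] fgD[OF J] I' _ _ g])
    show "lin A M ?J f" using f by (rule lin_into_submod) auto
  qed (use fg in simp_all)
  obtain N' :: "('a, nat \<Rightarrow> 'k) module" and a b where N': "fg_module A N'" and a: "lin A N N' a" "lin A N' N b"
    "\<And>x. x \<in> carrier N \<Longrightarrow> b (a x) = x" using universe_copy[OF N] by metis
  obtain J' :: "('a, nat \<Rightarrow> 'k) module" and c d where J': "fg_module A J'" and c: "lin A ?J J' c" "lin A J' ?J d"
    "\<And>x. x \<in> carrier ?J \<Longrightarrow> d (c x) = x" "\<And>x. x \<in> carrier J' \<Longrightarrow> c (d x) = x" using universe_copy[OF J] by metis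
  have dN: "d x \<in> carrier N" if "x \<in> carrier J'" for x
    using linD(1)[OF c(2) that] linD(1)[OF f] by auto
  have f': "lin A J' N' (\<lambda>x. a (d x))"
    using lin_comp[OF lin_from_submod[OF c(2) range_submodule[OF fgD[OF M] fgD[OF N] f]] a(1)] .
  have inj: "inj_on (\<lambda>x\<in>carrier J'. a (d x)) (carrier J')"
    by (rule inj_onI) (simp, metis a(3) c(4) dN)
  have g': "lin A J' I (\<lambda>x. g0 (d x))" using lin_comp[OF c(2) g0(1)] .
  obtain h where h: "h \<in> mod_hom A N' I"
    "compose (carrier J') h (\<lambda>x\<in>carrier J'. a (d x)) = (\<lambda>x\<in>carrier J'. g0 (d x))"
    using I N' J' lin_restrict[OF fgD[OF J'] f'] inj lin_restrict[OF fgD[OF J'] g'] unfolding injective_def by blast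
  show thesis
  proof (rule that)
    show "lin A N I (\<lambda>x. h (a x))" using lin_comp[OF a(1) mod_homD[OF h(1)]] .
    fix x assume x: "x \<in> carrier M"
    then have y: "f x \<in> carrier ?J" by simp
    have "h (a (d (c (f x)))) = g0 (d (c (f x)))"
      using fun_cong[OF h(2), of "c (f x)"] linD(1)[OF c(1) y] by (simp add: compose_def)
    then show "h (a (f x)) = g x" using c(3)[OF y] g0(2)[OF x] by simp
  qed
qed

text \<open>Lifts \<open>g\<close> after a sum \<open>e\<close> of maps through \<open>Z\<close>.
  Leaving \<open>e\<close> general, instead of taking the identity, allows the identity of
  \<open>Y\<close> to be distributed over two projectives.\<close>

lemma fac_lift:
  assumes "proj Z" "fg_module A Y" "fg_module A M" "fg_module A N" "lin A M N f" "f ` carrier M = carrier N"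
    "lin A Y N g" "fac A Z Y Y e"
  shows "\<exists>h. lin A Y M h \<and> (\<forall>x\<in>carrier Y. f (h x) = g (e x))"
  using assms(8)
proof induction
  case (fac_zero e)
  then show ?case using lin_const_zero[OF fgD[OF assms(3)], of Y] lin_zero[OF fgD fgD assms(5)]
      lin_zero[OF fgD fgD assms(7)] assms(2-4) by (intro exI[of _ "\<lambda>_. \<zero>\<^bsub>M\<^esub>"]) auto
next
  case (fac_step e r s e')
  then obtain h where h: "lin A Y M h" "\<forall>x\<in>carrier Y. f (h x) = g (e x)" by auto
  have gs: "lin A Z N (\<lambda>x. g (s x))" using lin_comp[OF fac_step.hyps(3) assms(7)] .
  obtain k where k: "lin A Z M k" "\<And>x. x \<in> carrier Z \<Longrightarrow> f (k x) = g (s x)"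
    using proj_lift[OF assms(1,3,4,5) gs] linD(1)[OF gs] assms(6) by metis
  have e: "lin A Y Y e" using fac_lin[OF fgD fgD fac_step.hyps(1)] assms(2) by auto
  show ?case
  proof (intro exI conjI ballI)
    show "lin A Y M (\<lambda>x. h x \<oplus>\<^bsub>M\<^esub> k (r x))"
      using lin_sum[OF fgD[OF assms(3)] h(1) lin_comp[OF fac_step.hyps(2) k(1)]] .
    show "f (h x \<oplus>\<^bsub>M\<^esub> k (r x)) = g (e' x)" if "x \<in> carrier Y" for x
      using that h k fac_step.hyps(4) linD[OF assms(5)] linD[OF assms(7)] linD[OF fac_step.hyps(2)]
        linD[OF fac_step.hyps(3)] linD[OF h(1)] linD[OF k(1)] linD[OF e] by simp
  qed
qed

lemma fac_extend:
  assumes "inje Z" "fg_module A Y" "fg_module A M" "fg_module A N" "lin A M N f" "inj_on f (carrier M)"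
    "lin A M Y g" "fac A Z Y Y e"
  shows "\<exists>h. lin A N Y h \<and> (\<forall>x\<in>carrier M. h (f x) = e (g x))"
  using assms(8)
proof induction
  case (fac_zero e)
  then show ?case using lin_const_zero[OF fgD[OF assms(2)], of N] linD(1)[OF assms(7)]
    by (intro exI[of _ "\<lambda>_. \<zero>\<^bsub>Y\<^esub>"]) auto
next
  case (fac_step e r s e')
  then obtain h where h: "lin A N Y h" "\<forall>x\<in>carrier M. h (f x) = e (g x)" by auto
  have rg: "lin A M Z (\<lambda>x. r (g x))" using lin_comp[OF assms(7) fac_step.hyps(2)] .
  have z: "x = \<zero>\<^bsub>M\<^esub>" if "x \<in> carrier M" "f x = \<zero>\<^bsub>N\<^esub>" for x
    using that lin_zero[OF fgD[OF assms(3)] fgD[OF assms(4)] assms(5)] assms(6)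
      submodD(2)[OF left_module.submod_carrier[OF fgD[OF assms(3)]]] by (metis inj_onD)
  obtain k where k: "lin A N Z k" "\<And>x. x \<in> carrier M \<Longrightarrow> k (f x) = r (g x)"
    using inje_extend[OF assms(1,3,4,5) rg] z lin_zero[OF fgD[OF assms(3)] fgD[OF inje_fg[OF assms(1)]] rg]
    by metis
  show ?case
  proof (intro exI conjI ballI)
    show "lin A N Y (\<lambda>x. h x \<oplus>\<^bsub>Y\<^esub> s (k x))"
      using lin_sum[OF fgD[OF assms(2)] h(1) lin_comp[OF k(1) fac_step.hyps(3)]] .
    show "h (f x) \<oplus>\<^bsub>Y\<^esub> s (k (f x)) = e' (g x)" if "x \<in> carrier M" for x
      using that h k fac_step.hyps(4) linD(1)[OF assms(7)] by simp
  qed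
qed

text \<open>The lifts of the two parts of the identity add up. \<open>Z\<close> and
  \<open>Z'\<close> may have different element types; in the application they are the summand
  \<open>X\<close> and a module \<open>I\<close> of which another part of \<open>Y\<close> is a
  retract.\<close>

lemma proj_fac2:
  assumes "proj Z" "proj Z'" "fg_module A Y" "fac A Z Y Y e" "fac A Z' Y Y e'"
    "\<And>x. x \<in> carrier Y \<Longrightarrow> x = e x \<oplus>\<^bsub>Y\<^esub> e' x"
  shows "proj Y"
  unfolding projective_def
proof (intro conjI allI impI assms(3))
  fix M N :: "('a, nat \<Rightarrow> 'k) module" and f g
  assume *: "fg_module A M \<and> fg_module A N \<and> f \<in> mod_hom A M N \<and> f ` carrier M = carrier N \<and> g \<in> mod_hom A Y N"
  then have M: "fg_module A M" "fg_module A N" and f: "lin A M N f" "f ` carrier M = carrier N"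
    and g: "lin A Y N g" by (auto dest: mod_homD)
  obtain h where h: "lin A Y M h" "\<forall>x\<in>carrier Y. f (h x) = g (e x)"
    using fac_lift[OF assms(1,3) M f g assms(4)] by auto
  obtain h' where h': "lin A Y M h'" "\<forall>x\<in>carrier Y. f (h' x) = g (e' x)"
    using fac_lift[OF assms(2,3) M f g assms(5)] by auto
  have Y: "left_module A Y" using assms(3) by (rule fgD)
  note e = linD(1)[OF fac_lin[OF Y Y assms(4)]] linD(1)[OF fac_lin[OF Y Y assms(5)]]
  show "\<exists>h\<in>mod_hom A Y M. compose (carrier Y) f h = g"
  proof (rule bexI[OF _ lin_restrict[OF Y lin_sum[OF fgD[OF M(1)] h(1) h'(1)]]])
    have "f (h x \<oplus>\<^bsub>M\<^esub> h' x) = g x" if x: "x \<in> carrier Y" for x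
    proof -
      have "f (h x \<oplus>\<^bsub>M\<^esub> h' x) = g (e x) \<oplus>\<^bsub>N\<^esub> g (e' x)"
        using x h(2) h'(2) linD(2)[OF f(1)] linD(1)[OF h(1)] linD(1)[OF h'(1)] by simp
      also have "\<dots> = g (e x \<oplus>\<^bsub>Y\<^esub> e' x)" using linD(2)[OF g] e x by simp
      finally show ?thesis using assms(6)[OF x] by simp
    qed
    then show "compose (carrier Y) f (\<lambda>x\<in>carrier Y. h x \<oplus>\<^bsub>M\<^esub> h' x) = g"
      using * by (auto simp: compose_def mod_hom_iff extensional_def fun_eq_iff)
  qed
qed

lemma inje_fac2:
  assumes "inje Z" "inje Z'" "fg_module A Y" "fac A Z Y Y e" "fac A Z' Y Y e'"
    "\<And>x. x \<in> carrier Y \<Longrightarrow> x = e x \<oplus>\<^bsub>Y\<^esub> e' x"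
  shows "inje Y"
  unfolding injective_def
proof (intro conjI allI impI assms(3))
  fix M N :: "('a, nat \<Rightarrow> 'k) module" and f g
  assume *: "fg_module A M \<and> fg_module A N \<and> f \<in> mod_hom A M N \<and> inj_on f (carrier M) \<and> g \<in> mod_hom A M Y"
  then have M: "fg_module A M" "fg_module A N" and f: "lin A M N f" "inj_on f (carrier M)"
    and g: "lin A M Y g" by (auto dest: mod_homD)
  obtain h where h: "lin A N Y h" "\<forall>x\<in>carrier M. h (f x) = e (g x)"
    using fac_extend[OF assms(1,3) M f g assms(4)] by auto
  obtain h' where h': "lin A N Y h'" "\<forall>x\<in>carrier M. h' (f x) = e' (g x)"
    using fac_extend[OF assms(2,3) M f g assms(5)] by auto
  have Y: "left_module A Y" using assms(3) by (rule fgD)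
  show "\<exists>h\<in>mod_hom A N Y. compose (carrier M) h f = g"
  proof (rule bexI[OF _ lin_restrict[OF fgD[OF M(2)] lin_sum[OF Y h(1) h'(1)]]])
    have "h (f x) \<oplus>\<^bsub>Y\<^esub> h' (f x) = g x" if x: "x \<in> carrier M" for x
      using x h(2) h'(2) assms(6)[OF linD(1)[OF g x]] by simp
    then show "compose (carrier M) (\<lambda>x\<in>carrier N. h x \<oplus>\<^bsub>Y\<^esub> h' x) f = g"
      using * linD(1)[OF f(1)] by (auto simp: compose_def mod_hom_iff extensional_def fun_eq_iff)
  qed
qed

lemma proj_fac: assumes "proj Z" "fg_module A Y" "fac A Z Y Y (\<lambda>x. x)" shows "proj Y"
proof -
  interpret Y: left_module A Y using assms(2) by (rule fgD)
  show ?thesis by (rule proj_fac2[OF assms(1,1,2,3) fac_zero[of Y "\<lambda>_. \<zero>\<^bsub>Y\<^esub>"]]) auto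
qed

lemma inje_fac: assumes "inje Z" "fg_module A Y" "fac A Z Y Y (\<lambda>x. x)" shows "inje Y"
proof -
  interpret Y: left_module A Y using assms(2) by (rule fgD)
  show ?thesis by (rule inje_fac2[OF assms(1,1,2,3) fac_zero[of Y "\<lambda>_. \<zero>\<^bsub>Y\<^esub>"]]) auto
qed

end

section \<open>Projective-injective modules\<close>

text \<open>Insert \<open>1 = i \<pi> + j \<rho>\<close> in the middle of each summand and collect
  terms.\<close>

lemma fac_split:
  assumes "left_module R M" "left_module R N" "left_module R G" "lin R G X \<pi>" "lin R G Y \<rho>" "lin R X G i" "lin R Y G j"
    "\<And>x. x \<in> carrier G \<Longrightarrow> x = i (\<pi> x) \<oplus>\<^bsub>G\<^esub> j (\<rho> x)" "fac R G M N f"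
  obtains f1 f2 where "fac R X M N f1" "fac R Y M N f2" "\<And>x. x \<in> carrier M \<Longrightarrow> f x = f1 x \<oplus>\<^bsub>N\<^esub> f2 x"
proof -
  interpret N: left_module R N by fact
  have "\<exists>f1 f2. fac R X M N f1 \<and> fac R Y M N f2 \<and> (\<forall>x\<in>carrier M. f x = f1 x \<oplus>\<^bsub>N\<^esub> f2 x)" using assms(9)
  proof induction
    case (fac_zero f)
    show ?case
      by (rule exI[of _ "\<lambda>_. \<zero>\<^bsub>N\<^esub>"], rule exI[of _ "\<lambda>_. \<zero>\<^bsub>N\<^esub>"]) (auto intro!: fac.fac_zero simp: fac_zero)
  next
    case (fac_step f r s h)
    then obtain f1 f2 where f: "fac R X M N f1" "fac R Y M N f2" "\<forall>x\<in>carrier M. f x = f1 x \<oplus>\<^bsub>N\<^esub> f2 x" by auto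
    note f1 = linD(1)[OF fac_lin[OF assms(1,2) f(1)]] and f2 = linD(1)[OF fac_lin[OF assms(1,2) f(2)]]
    have 1: "fac R X M N (\<lambda>x. f1 x \<oplus>\<^bsub>N\<^esub> s (i (\<pi> (r x))))"
      by (rule fac.fac_step[OF f(1) lin_comp[OF fac_step.hyps(2) assms(4)] lin_comp[OF assms(6) fac_step.hyps(3)]]) simp
    have 2: "fac R Y M N (\<lambda>x. f2 x \<oplus>\<^bsub>N\<^esub> s (j (\<rho> (r x))))"
      by (rule fac.fac_step[OF f(2) lin_comp[OF fac_step.hyps(2) assms(5)] lin_comp[OF assms(7) fac_step.hyps(3)]]) simp
    have "h x = (f1 x \<oplus>\<^bsub>N\<^esub> s (i (\<pi> (r x)))) \<oplus>\<^bsub>N\<^esub> (f2 x \<oplus>\<^bsub>N\<^esub> s (j (\<rho> (r x))))" if x: "x \<in> carrier M" for x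
    proof -
      have r: "r x \<in> carrier G" using linD(1)[OF fac_step.hyps(2) x] .
      have ij: "i (\<pi> (r x)) \<in> carrier G" "j (\<rho> (r x)) \<in> carrier G"
        using linD(1)[OF assms(6) linD(1)[OF assms(4) r]] linD(1)[OF assms(7) linD(1)[OF assms(5) r]] .
      have "s (r x) = s (i (\<pi> (r x))) \<oplus>\<^bsub>N\<^esub> s (j (\<rho> (r x)))"
        using linD(2)[OF fac_step.hyps(3) ij] assms(8)[OF r] by simp
      then show ?thesis using x f(3) f1 f2 ij linD(1)[OF fac_step.hyps(3)] fac_step.hyps(4)
        by (simp add: N.M.a_ac)
    qed
    with 1 2 show ?case by blast
  qed
  then show thesis using that by blast
qed

text \<open>The geometric series of \<open>\<gamma>\<close>, which is finite. Its partial sum of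
  length \<open>m\<close> leaves the error term given by the \<open>m\<close>-th power of
  \<open>\<gamma>\<close>.\<close>

lemma nilpotent_left_inverse:
  assumes "left_module R M" "lin R M M \<gamma>" "\<And>x. x \<in> carrier M \<Longrightarrow> (\<gamma> ^^ n) x = \<zero>\<^bsub>M\<^esub>"
  obtains v where "lin R M M v" "\<And>x. x \<in> carrier M \<Longrightarrow> v (x \<ominus>\<^bsub>M\<^esub> \<gamma> x) = x"
proof -
  interpret left_module R M by fact
  note g = linD(1)[OF assms(2)]
  have "\<exists>v. lin R M M v \<and> (\<forall>x\<in>carrier M. v (x \<ominus>\<^bsub>M\<^esub> \<gamma> x) = x \<ominus>\<^bsub>M\<^esub> (\<gamma> ^^ m) x)" for m
  proof (induction m)
    case 0
    show ?case using lin_const_zero[OF assms(1), of M] diff_self by (intro exI[of _ "\<lambda>_. \<zero>\<^bsub>M\<^esub>"]) auto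
  next
    case (Suc m)
    then obtain v where v: "lin R M M v" "\<forall>x\<in>carrier M. v (x \<ominus>\<^bsub>M\<^esub> \<gamma> x) = x \<ominus>\<^bsub>M\<^esub> (\<gamma> ^^ m) x" by auto
    note p = funpow_lin[OF assms(2), of m]
    show ?case
    proof (intro exI conjI ballI)
      show "lin R M M (\<lambda>x. v x \<oplus>\<^bsub>M\<^esub> (\<gamma> ^^ m) x)" using lin_sum[OF assms(1) v(1) p] .
      fix x assume x: "x \<in> carrier M"
      have "(\<gamma> ^^ m) (x \<ominus>\<^bsub>M\<^esub> \<gamma> x) = (\<gamma> ^^ m) x \<ominus>\<^bsub>M\<^esub> (\<gamma> ^^ Suc m) x"
        using lin_diff[OF assms(1,1) p x g[OF x]] by (simp add: funpow_swap1)
      moreover have c: "(\<gamma> ^^ m) x \<in> carrier M" "(\<gamma> ^^ Suc m) x \<in> carrier M"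
        using linD(1)[OF p x] linD(1)[OF funpow_lin[OF assms(2), of "Suc m"] x] by auto
      ultimately have "v (x \<ominus>\<^bsub>M\<^esub> \<gamma> x) \<oplus>\<^bsub>M\<^esub> (\<gamma> ^^ m) (x \<ominus>\<^bsub>M\<^esub> \<gamma> x)
          = (x \<ominus>\<^bsub>M\<^esub> (\<gamma> ^^ m) x) \<oplus>\<^bsub>M\<^esub> ((\<gamma> ^^ m) x \<ominus>\<^bsub>M\<^esub> (\<gamma> ^^ Suc m) x)" using v(2) x by simp
      also have "\<dots> = ((x \<ominus>\<^bsub>M\<^esub> (\<gamma> ^^ m) x) \<oplus>\<^bsub>M\<^esub> (\<gamma> ^^ m) x) \<ominus>\<^bsub>M\<^esub> (\<gamma> ^^ Suc m) x"
        using x c by (simp add: M.minus_eq M.a_assoc)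
      also have "\<dots> = x \<ominus>\<^bsub>M\<^esub> (\<gamma> ^^ Suc m) x" using diff_add_cancel[OF x c(1)] by simp
      finally show "v (x \<ominus>\<^bsub>M\<^esub> \<gamma> x) \<oplus>\<^bsub>M\<^esub> (\<gamma> ^^ m) (x \<ominus>\<^bsub>M\<^esub> \<gamma> x) = x \<ominus>\<^bsub>M\<^esub> (\<gamma> ^^ Suc m) x" .
    qed
  qed
  then obtain v where v: "lin R M M v" "\<forall>x\<in>carrier M. v (x \<ominus>\<^bsub>M\<^esub> \<gamma> x) = x \<ominus>\<^bsub>M\<^esub> (\<gamma> ^^ n) x" by blast
  have "v (x \<ominus>\<^bsub>M\<^esub> \<gamma> x) = x" if "x \<in> carrier M" for x
    using v(2) that assms(3)[OF that] by (simp add: M.minus_eq)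
  then show thesis using that v(1) by blast
qed

text \<open>Carries nilpotency of \<open>\<alpha> \<beta>\<close> over to
  \<open>\<beta> \<alpha>\<close>.\<close>

lemma funpow_composite:
  "((\<lambda>x. \<beta> (\<alpha> x)) ^^ Suc n) x = \<beta> (((\<lambda>v. \<alpha> (\<beta> v)) ^^ n) (\<alpha> x))"
  by (induction n) simp_all

context fdalg
begin

text \<open>Otherwise the Fitting decomposition would split off from the complement \<open>V\<close> of the maximal
  projective-injective summand a nonzero summand that is a retract of \<open>I\<close>, hence projective-injective.\<close>

lemma complement_nilpotent:
  assumes max: "max_proj_inj_summand TYPE(nat \<Rightarrow> 'k) A X"
    and V: "submodule V A (regular A)" "X \<inter> V = {\<zero>\<^bsub>A\<^esub>}"
    and \<pi>: "lin A (regular A) (submod (regular A) X) \<pi>" and \<rho>: "lin A (regular A) (submod (regular A) V) \<rho>"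
    and dec: "\<And>x. x \<in> carrier A \<Longrightarrow> x = \<pi> x \<oplus>\<^bsub>A\<^esub> \<rho> x"
      "\<And>u v. \<lbrakk>u \<in> X; v \<in> V\<rbrakk> \<Longrightarrow> \<pi> (u \<oplus>\<^bsub>A\<^esub> v) = u \<and> \<rho> (u \<oplus>\<^bsub>A\<^esub> v) = v"
    and I: "proj I" "inje I" and \<alpha>: "lin A I (submod (regular A) V) \<alpha>" and \<beta>: "lin A (submod (regular A) V) I \<beta>"
  obtains n where "\<And>v. v \<in> V \<Longrightarrow> ((\<lambda>v. \<alpha> (\<beta> v)) ^^ n) v = \<zero>\<^bsub>A\<^esub>"
proof -
  let ?G = "regular A" and ?c = "\<lambda>v. \<alpha> (\<beta> v)"
  let ?V = "submod ?G V" and ?X = "submod ?G X"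
  have X: "submodule X A ?G" "proj ?X" "inje ?X"
    and maxX: "\<And>Y. \<lbrakk>is_summand A ?G Y; proj (submod ?G Y); inje (submod ?G Y); X \<subseteq> Y\<rbrakk> \<Longrightarrow> Y = X"
    using max by (auto simp: max_proj_inj_summand_def is_summand_def)
  note G = fgD[OF fg_regular]
  interpret G: left_module A ?G by (rule G)
  have Vfg: "fg_module A ?V" using fg_submod[OF fg_regular V(1)] .
  note V' = submodD[OF V(1), simplified] and X' = submodD[OF X(1), simplified]
  have Vl: "left_module A ?V" and Il: "left_module A I"
    using fgD[OF Vfg] fgD[OF inje_fg[OF I(2)]] .
  interpret V: left_module A ?V by (rule Vl)
  have c: "lin A ?V ?V ?c" using lin_comp[OF \<beta> \<alpha>] .
  note cp = funpow_lin[OF c]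
  obtain N where N: "\<And>n. n \<ge> N \<Longrightarrow> (?c ^^ n) ` V = (?c ^^ N) ` V"
    "\<And>n x. \<lbrakk>n \<ge> N; x \<in> V; (?c ^^ n) x = \<zero>\<^bsub>A\<^esub>\<rbrakk> \<Longrightarrow> (?c ^^ N) x = \<zero>\<^bsub>A\<^esub>"
    using fitting[OF field_K K_space_left_module[OF Vl] _ K_space_lin[OF c]] Vfg by (auto simp: fg_iff)
  \<comment> \<open>Stable image and stable kernel of the composite. By \<open>LW0\<close> and
    \<open>LW\<close> below, \<open>V\<close> is their direct sum.\<close>
  define L where "L = (?c ^^ N) ` V"
  define W where "W = {v \<in> V. (?c ^^ N) v = \<zero>\<^bsub>A\<^esub>}"
  have LV: "submodule L A ?V" "submodule W A ?V"
    using range_submodule[OF Vl Vl cp[of N]] kernel_submodule[OF Vl Vl cp[of N]] by (simp_all add: L_def W_def)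
  then have L: "submodule L A ?G" "L \<subseteq> V" and W: "submodule W A ?G" "W \<subseteq> V"
    using submodule_of_submod[OF G V(1)] by auto
  note L' = submodD[OF L(1), simplified] and W' = submodD[OF W(1), simplified]
  have add: "(?c ^^ (m + n)) x = (?c ^^ m) ((?c ^^ n) x)" for m n x by (simp add: funpow_add)
  have LW0: "x = \<zero>\<^bsub>A\<^esub>" if x: "x \<in> L" "(?c ^^ m) x = \<zero>\<^bsub>A\<^esub>" for x m
  proof -
    obtain y where y: "y \<in> V" "x = (?c ^^ N) y" using x(1) by (auto simp: L_def)
    then have "(?c ^^ (m + N)) y = \<zero>\<^bsub>A\<^esub>" using x(2) add by simp
    then show ?thesis using N(2)[of "m + N" y] y by simp
  qed
  have LW: "\<exists>l\<in>L. \<exists>w\<in>W. v = l \<oplus>\<^bsub>A\<^esub> w" if v: "v \<in> V" for v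
  proof -
    have "(?c ^^ N) v \<in> (?c ^^ (N + N)) ` V" using N(1)[of "N + N"] v by auto
    then obtain y where y: "y \<in> V" "(?c ^^ N) v = (?c ^^ N) ((?c ^^ N) y)" using add by auto
    let ?l = "(?c ^^ N) y"
    have l: "?l \<in> L" using y by (auto simp: L_def)
    then have lV: "?l \<in> V" using L by auto
    have "(?c ^^ N) (v \<ominus>\<^bsub>?V\<^esub> ?l) = \<zero>\<^bsub>?V\<^esub>"
      using lin_diff[OF Vl Vl cp[of N]] v lV y(2) V.diff_self[of "(?c ^^ N) v"] linD(1)[OF cp[of N], of v] by simp
    moreover have "v \<ominus>\<^bsub>?V\<^esub> ?l \<in> V" using V.M.minus_closed[of v ?l] v lV by simp
    ultimately have "v \<ominus>\<^bsub>?V\<^esub> ?l \<in> W" by (simp add: W_def)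
    moreover have "v = ?l \<oplus>\<^bsub>A\<^esub> (v \<ominus>\<^bsub>?V\<^esub> ?l)" using V.add_diff_cancel[of ?l v] v lV by simp
    ultimately show ?thesis using l by blast
  qed
  \<comment> \<open>The candidate that would enlarge \<open>X\<close> unless \<open>L\<close>
    vanishes.\<close>
  define Y where "Y = {x \<oplus>\<^bsub>A\<^esub> l | x l. x \<in> X \<and> l \<in> L}"
  have Y: "submodule Y A ?G"
  proof (rule G.submodI)
    show "Y \<subseteq> carrier ?G" using X'(1) L'(1) G.M.a_closed by (auto simp: Y_def)
    show "\<zero>\<^bsub>?G\<^esub> \<in> Y" using X'(2) L'(2) G.M.l_zero[of "\<zero>\<^bsub>A\<^esub>"] by (force simp: Y_def)
    show "a \<oplus>\<^bsub>?G\<^esub> b \<in> Y" if ab: "a \<in> Y" "b \<in> Y" for a b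
    proof -
      obtain x l x' l' where *: "a = x \<oplus>\<^bsub>A\<^esub> l" "b = x' \<oplus>\<^bsub>A\<^esub> l'" "x \<in> X" "x' \<in> X" "l \<in> L" "l' \<in> L"
        using ab unfolding Y_def by blast
      then have "x \<in> carrier A" "x' \<in> carrier A" "l \<in> carrier A" "l' \<in> carrier A" using X'(1) L'(1) by auto
      then have "a \<oplus>\<^bsub>?G\<^esub> b = (x \<oplus>\<^bsub>A\<^esub> x') \<oplus>\<^bsub>A\<^esub> (l \<oplus>\<^bsub>A\<^esub> l')" using * by (simp add: G.R.a_ac)
      then show ?thesis using X'(3) L'(3) * unfolding Y_def by blast
    qed
    show "c \<odot>\<^bsub>?G\<^esub> a \<in> Y" if ca: "c \<in> carrier A" "a \<in> Y" for c a
    proof -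
      obtain x l where *: "a = x \<oplus>\<^bsub>A\<^esub> l" "x \<in> X" "l \<in> L" using ca unfolding Y_def by blast
      then have "x \<in> carrier A" "l \<in> carrier A" using X'(1) L'(1) by auto
      then have "c \<odot>\<^bsub>?G\<^esub> a = (c \<otimes>\<^bsub>A\<^esub> x) \<oplus>\<^bsub>A\<^esub> (c \<otimes>\<^bsub>A\<^esub> l)" using * ca by (simp add: G.R.r_distr)
      then show ?thesis using X'(4) L'(4) * ca unfolding Y_def by blast
    qed
  qed
  note Y' = submodD[OF Y, simplified]
  have XY: "X \<subseteq> Y" using L'(2) X'(1) unfolding Y_def by (force intro: exI[of _ "\<zero>\<^bsub>A\<^esub>"])
  have LY: "L \<subseteq> Y" using X'(2) L'(1) unfolding Y_def by (force intro: exI[of _ "\<zero>\<^bsub>A\<^esub>"])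
  \<comment> \<open>The stable kernel \<open>W\<close> is a complement of
    \<open>X + L\<close>.\<close>
  have "is_summand A ?G Y"
    unfolding is_summand_def
  proof (intro conjI exI[of _ W] Y W(1))
    have "z = \<zero>\<^bsub>A\<^esub>" if z: "z \<in> Y" "z \<in> W" for z
    proof -
      obtain x l where *: "z = x \<oplus>\<^bsub>A\<^esub> l" "x \<in> X" "l \<in> L" using z unfolding Y_def by blast
      have "z = \<zero>\<^bsub>A\<^esub> \<oplus>\<^bsub>A\<^esub> z" using z W'(1) by (auto simp: subset_iff)
      then have "\<rho> z = z" using dec(2)[OF X'(2), of z] z W(2) by auto
      moreover have "\<rho> z = l" using * dec(2)[OF *(2), of l] L(2) by auto
      ultimately show ?thesis using LW0[OF *(3), of N] z by (auto simp: W_def)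
    qed
    then have "Y \<inter> W \<subseteq> {\<zero>\<^bsub>?G\<^esub>}" by (intro subsetI) simp
    moreover have "{\<zero>\<^bsub>?G\<^esub>} \<subseteq> Y \<inter> W" using Y'(2) W'(2) by simp
    ultimately show "Y \<inter> W = {\<zero>\<^bsub>?G\<^esub>}" by (rule subset_antisym)
    show "Y <+>\<^bsub>?G\<^esub> W = carrier ?G"
    proof
      show "Y <+>\<^bsub>?G\<^esub> W \<subseteq> carrier ?G" using Y'(1) W'(1) unfolding set_add_def' by auto
      show "carrier ?G \<subseteq> Y <+>\<^bsub>?G\<^esub> W"
      proof
        fix z assume z: "z \<in> carrier ?G"
        then have zz: "\<pi> z \<in> X" "\<rho> z \<in> V" using linD(1)[OF \<pi>] linD(1)[OF \<rho>] by auto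
        obtain l w where lw: "l \<in> L" "w \<in> W" "\<rho> z = l \<oplus>\<^bsub>A\<^esub> w" using LW[OF zz(2)] by blast
        have "z = (\<pi> z \<oplus>\<^bsub>A\<^esub> l) \<oplus>\<^bsub>A\<^esub> w" using dec(1)[of z] z lw zz X'(1) L'(1) W'(1)
          by (simp add: subset_iff G.R.a_assoc)
        moreover have "\<pi> z \<oplus>\<^bsub>A\<^esub> l \<in> Y" using zz lw unfolding Y_def by blast
        ultimately show "z \<in> Y <+>\<^bsub>?G\<^esub> W" using lw(2) unfolding set_add_def' regular_simps by blast
      qed
    qed
  qed
  \<comment> \<open>\<open>L\<close> is a retract of \<open>I\<close>. The composite
    \<open>c\<close> is bijective on \<open>L\<close>; if \<open>g\<close> inverts
    \<open>c^(N + 1)\<close> there, then \<open>g c^N \<alpha>\<close> undoes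
    \<open>\<beta>\<close>, because \<open>c^N \<alpha> \<beta> = c^(N + 1)\<close>.\<close>
  moreover obtain s where s: "lin A I (submod ?V L) s" "\<And>l. l \<in> L \<Longrightarrow> s (\<beta> l) = l"
  proof -
    let ?L = "submod ?V L"
    have cL0: "lin A ?L ?V (?c ^^ Suc N)"
      by (rule lin_on_submod[OF cp]) (simp add: L(2))
    have cL: "lin A ?L ?L (?c ^^ Suc N)"
    proof (rule lin_into_submod[OF cL0])
      fix x assume "x \<in> carrier ?L"
      then have "x \<in> V" using L(2) by auto
      then have "(?c ^^ Suc N) x \<in> (?c ^^ Suc N) ` V" by blast
      then show "(?c ^^ Suc N) x \<in> L" using N(1)[of "Suc N"] by (simp add: L_def)
    qed
    have Ll: "left_module A ?L" using submodule_left_module[OF Vl LV(1)] .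
    have "inj_on (?c ^^ Suc N) L"
    proof (rule inj_onI)
      interpret L: left_module A ?L by (rule Ll)
      fix x y assume xy: "x \<in> L" "y \<in> L" "(?c ^^ Suc N) x = (?c ^^ Suc N) y"
      have d: "x \<ominus>\<^bsub>?L\<^esub> y \<in> L" using L.M.minus_closed[of x y] xy by simp
      have "(?c ^^ Suc N) (x \<ominus>\<^bsub>?L\<^esub> y) = \<zero>\<^bsub>A\<^esub>"
        using lin_diff[OF Ll Ll cL, of x y] xy L.diff_self[of "(?c ^^ Suc N) y"] linD(1)[OF cL, of y] by simp
      from LW0[OF d this] show "x = y" using L.eq_by_diff[of x y] xy by simp
    qed
    moreover have "(?c ^^ Suc N) ` L = L"
    proof -
      have "(?c ^^ Suc N) ` L = (?c ^^ (Suc N + N)) ` V" unfolding L_def image_image add ..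
      then show ?thesis using N(1)[of "Suc N + N"] by (simp add: L_def)
    qed
    ultimately have b: "bij_betw (?c ^^ Suc N) (carrier ?L) (carrier ?L)" by (simp add: bij_betw_def)
    obtain g where g: "lin A ?L ?L g" "\<And>x. x \<in> L \<Longrightarrow> g ((?c ^^ Suc N) x) = x"
      using lin_inverse[OF cL Ll b, unfolded submod_simps(1)] by metis
    have "lin A I ?L (\<lambda>x. (?c ^^ N) (\<alpha> x))"
    proof (rule lin_into_submod[OF lin_comp[OF \<alpha> cp[of N]]])
      show "(?c ^^ N) (\<alpha> x) \<in> L" if "x \<in> carrier I" for x
        using linD(1)[OF \<alpha> that] by (simp add: L_def)
    qed
    then have "lin A I ?L (\<lambda>x. g ((?c ^^ N) (\<alpha> x)))" using g(1) by (rule lin_comp)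
    moreover have "g ((?c ^^ N) (\<alpha> (\<beta> l))) = l" if "l \<in> L" for l
      using g(2)[OF that] by (simp add: funpow_Suc_right del: funpow.simps(2))
    ultimately show thesis using that by blast
  qed
  let ?Y = "submod ?G Y"
  have Yfg: "fg_module A ?Y" using fg_submod[OF fg_regular Y] .
  have YG: "lin A ?Y ?G (\<lambda>x. x)" using lin_incl[OF Y] .
  have XYl: "lin A ?X ?Y (\<lambda>x. x)" using XY by (auto simp: lin_def)
  have LYl: "lin A (submod ?V L) ?Y (\<lambda>x. x)" using LY by (auto simp: lin_def)
  have fX: "fac A ?X ?Y ?Y (\<lambda>x. \<pi> x)" using fac_through[OF fgD[OF Yfg] lin_comp[OF YG \<pi>] XYl] .
  have fI: "fac A I ?Y ?Y (\<lambda>x. s (\<beta> (\<rho> x)))"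
    using fac_through[OF fgD[OF Yfg] lin_comp[OF lin_comp[OF YG \<rho>] \<beta>] lin_comp[OF s(1) LYl]] .
  \<comment> \<open>The identity of \<open>Y\<close> is the projection to \<open>X\<close> plus a
    map through \<open>I\<close>, which is the situation of \<open>proj_fac2\<close> and
    \<open>inje_fac2\<close>.\<close>
  have sum: "x = \<pi> x \<oplus>\<^bsub>?Y\<^esub> s (\<beta> (\<rho> x))" if x: "x \<in> carrier ?Y" for x
  proof -
    obtain y l where *: "x = y \<oplus>\<^bsub>A\<^esub> l" "y \<in> X" "l \<in> L" using x by (auto simp: Y_def)
    then show ?thesis using dec(2)[of y l] L(2) s(2) by auto
  qed
  have "proj ?Y" using proj_fac2[OF X(2) I(1) Yfg fX fI sum] .
  moreover have "inje ?Y" using inje_fac2[OF X(3) I(2) Yfg fX fI sum] .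
  \<comment> \<open>Maximality forces \<open>L = 0\<close>; a vanishing stable image means that the
    composite is nilpotent.\<close>
  ultimately have "Y = X" using maxX XY by blast
  then have "L \<subseteq> {\<zero>\<^bsub>A\<^esub>}" using LY L(2) V(2) by auto
  then have "(?c ^^ N) v = \<zero>\<^bsub>A\<^esub>" if "v \<in> V" for v using that by (auto simp: L_def)
  then show thesis using that by blast
qed

lemma fg_power_cover:
  assumes "fg_module A M"
  obtains n p where "lin A (mod_power (regular A) n) M p" "p ` carrier (mod_power (regular A) n) = carrier M"
proof -
  interpret M: left_module A M using assms by (rule fgD)
  have "\<exists>g. lin A (regular A) M g \<and> x \<in> g ` carrier (regular A)" if "x \<in> carrier M" for x
    using that by (intro exI[of _ "\<lambda>a. a \<odot>\<^bsub>M\<^esub> x"] conjI linI)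
      (auto simp: M.smult_l_distr M.smult_assoc1 M.smult_closed image_iff M.smult_one intro!: bexI[of _ "\<one>\<^bsub>A\<^esub>"])
  then show thesis using power_cover[OF fgD[OF fg_regular] fgD[OF assms]] assms that
    by (metis fg_module_iff)
qed

text \<open>A cover by a power of the regular module splits.\<close>

lemma proj_fac_regular: assumes "proj P" shows "fac A (regular A) P P (\<lambda>x. x)"
proof -
  note P = proj_fg[OF assms] and G = fgD[OF fg_regular]
  obtain n p where p: "lin A (mod_power (regular A) n) P p" "p ` carrier (mod_power (regular A) n) = carrier P"
    using fg_power_cover[OF P] .
  obtain h where h: "lin A P (mod_power (regular A) n) h" "\<And>x. x \<in> carrier P \<Longrightarrow> p (h x) = x"
    using proj_lift[OF assms fg_power[OF fg_regular] P p(1) lin_id] p(2) by metis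
  have "fac A (regular A) P P (\<lambda>x. p (h x))"
    using fac_post[OF mod_power_left_module[OF G] mod_power_left_module[OF G] fgD[OF P] mod_power_fac_id[OF G] p(1),
      THEN fac_pre[OF _ h(1)]] .
  then show ?thesis by (rule fac_cong) (simp add: h(2))
qed

text \<open>Split the identity of \<open>I\<close> into \<open>f1\<close> through the maximal
  summand and \<open>f2\<close> through its complement \<open>V\<close>. Composites
  \<open>I \<rightarrow> V \<rightarrow> I\<close> are nilpotent, so the identity minus such a
  composite is left invertible. Removing all terms of \<open>f2\<close> shows that \<open>f1\<close>
  has a left inverse \<open>w\<close>, and \<open>w f1 = 1\<close> is a sum through the maximal
  summand.\<close>

lemma proj_inj_fac:
  assumes max: "max_proj_inj_summand TYPE(nat \<Rightarrow> 'k) A X" and I: "proj I" "inje I"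
  shows "fac A (submod (regular A) X) I I (\<lambda>x. x)"
proof -
  let ?G = "regular A"
  note G = fgD[OF fg_regular] and Il = fgD[OF proj_fg[OF I(1)]]
  interpret I: left_module A I by (rule Il)
  have "is_summand A ?G X" using max by (simp add: max_proj_inj_summand_def)
  then obtain V \<pi> \<rho> where XV: "submodule X A ?G" "submodule V A ?G" "X \<inter> V = {\<zero>\<^bsub>A\<^esub>}"
    and \<pi>\<rho>: "lin A ?G (submod ?G X) \<pi>" "lin A ?G (submod ?G V) \<rho>"
    and dec: "\<And>x. x \<in> carrier A \<Longrightarrow> x = \<pi> x \<oplus>\<^bsub>A\<^esub> \<rho> x"
      "\<And>u v. \<lbrakk>u \<in> X; v \<in> V\<rbrakk> \<Longrightarrow> \<pi> (u \<oplus>\<^bsub>A\<^esub> v) = u \<and> \<rho> (u \<oplus>\<^bsub>A\<^esub> v) = v"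
    using summand_decomposition[OF G, of X, unfolded regular_simps] by metis
  let ?V = "submod ?G V"
  have dec1: "x = \<pi> x \<oplus>\<^bsub>?G\<^esub> \<rho> x" if "x \<in> carrier ?G" for x using dec(1) that by simp
  obtain f1 f2 where f: "fac A (submod ?G X) I I f1" "fac A ?V I I f2" "\<And>x. x \<in> carrier I \<Longrightarrow> x = f1 x \<oplus>\<^bsub>I\<^esub> f2 x"
    using fac_split[OF Il Il G \<pi>\<rho> lin_incl[OF XV(1)] lin_incl[OF XV(2)] dec1 proj_fac_regular[OF I(1)]] by metis
  note f12 = linD(1)[OF fac_lin[OF Il Il f(1)]] linD(1)[OF fac_lin[OF Il Il f(2)]]
  have one: "\<exists>v. lin A I I v \<and> (\<forall>x\<in>carrier I. v (x \<ominus>\<^bsub>I\<^esub> \<beta> (\<alpha> x)) = x)"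
    if ab: "lin A I ?V \<alpha>" "lin A ?V I \<beta>" for \<alpha> \<beta>
  proof -
    obtain n where n: "\<And>v. v \<in> V \<Longrightarrow> ((\<lambda>v. \<alpha> (\<beta> v)) ^^ n) v = \<zero>\<^bsub>A\<^esub>"
      using complement_nilpotent[OF max XV(2,3) \<pi>\<rho> dec I ab] by blast
    have Vl: "left_module A ?V" using submodule_left_module[OF G XV(2)] .
    have "((\<lambda>x. \<beta> (\<alpha> x)) ^^ Suc n) x = \<zero>\<^bsub>I\<^esub>" if "x \<in> carrier I" for x
      using n[of "\<alpha> x"] linD(1)[OF ab(1) that] lin_zero[OF Vl Il ab(2)] unfolding funpow_composite by simp
    then show ?thesis using nilpotent_left_inverse[OF Il lin_comp[OF ab]] by metis
  qed
  \<comment> \<open>The terms of \<open>f2\<close> are removed one at a time. Once \<open>w\<close>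
    inverts \<open>1 - f\<close>, it remains to invert \<open>1 - w s r\<close>, which has the same
    shape because \<open>w s\<close> is again a map from \<open>V\<close> to
    \<open>I\<close>.\<close>
  have "\<exists>w. lin A I I w \<and> (\<forall>x\<in>carrier I. w (x \<ominus>\<^bsub>I\<^esub> f2 x) = x)" using f(2)
  proof induction
    case (fac_zero f)
    then show ?case using lin_id[of A I] by (intro exI[of _ "\<lambda>x. x"]) (simp add: I.M.minus_eq)
  next
    case (fac_step f r s h)
    then obtain w where w: "lin A I I w" "\<forall>x\<in>carrier I. w (x \<ominus>\<^bsub>I\<^esub> f x) = x" by auto
    obtain v where v: "lin A I I v" "\<forall>x\<in>carrier I. v (x \<ominus>\<^bsub>I\<^esub> w (s (r x))) = x"
      using one[OF fac_step.hyps(2) lin_comp[OF fac_step.hyps(3) w(1)]] by auto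
    have "v (w (x \<ominus>\<^bsub>I\<^esub> h x)) = x" if x: "x \<in> carrier I" for x
    proof -
      have c: "f x \<in> carrier I" "s (r x) \<in> carrier I"
        using linD(1)[OF fac_lin[OF Il Il fac_step.hyps(1)] x]
          linD(1)[OF fac_step.hyps(3) linD(1)[OF fac_step.hyps(2) x]] .
      have "x \<ominus>\<^bsub>I\<^esub> h x = (x \<ominus>\<^bsub>I\<^esub> f x) \<ominus>\<^bsub>I\<^esub> s (r x)"
        using c x fac_step.hyps(4)[OF x] by (simp add: I.M.minus_eq I.M.minus_add I.M.a_assoc)
      then have "w (x \<ominus>\<^bsub>I\<^esub> h x) = x \<ominus>\<^bsub>I\<^esub> w (s (r x))"
        using lin_diff[OF Il Il w(1) I.M.minus_closed[OF x c(1)] c(2)] w(2) x by simp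
      then show ?thesis using v(2) x by simp
    qed
    then show ?case using lin_comp[OF w(1) v(1)] by blast
  qed
  then obtain w where w: "lin A I I w" "\<And>x. x \<in> carrier I \<Longrightarrow> w (x \<ominus>\<^bsub>I\<^esub> f2 x) = x" by blast
  have "w (f1 x) = x" if x: "x \<in> carrier I" for x
  proof -
    have "x \<oplus>\<^bsub>I\<^esub> \<zero>\<^bsub>I\<^esub> = f2 x \<oplus>\<^bsub>I\<^esub> f1 x" using f(3)[OF x] x f12 by (simp add: I.M.a_comm)
    then have "x \<ominus>\<^bsub>I\<^esub> f2 x = f1 x \<ominus>\<^bsub>I\<^esub> \<zero>\<^bsub>I\<^esub>" using x f12 by (intro I.add_eq_imp_diff_eq) auto
    then have "f1 x = x \<ominus>\<^bsub>I\<^esub> f2 x" using f12(1)[OF x] by (simp add: I.M.minus_eq)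
    then show ?thesis using w(2)[OF x] by simp
  qed
  then show ?thesis by (intro fac_cong[OF fac_post[OF Il Il Il f(1) w(1)]]) simp
qed

end

section \<open>Duality\<close>

lemma hom_struct_simps [simp]:
  "carrier (hom_struct R M N s) = mod_hom R M N" "\<zero>\<^bsub>hom_struct R M N s\<^esub> = (\<lambda>x\<in>carrier M. \<zero>\<^bsub>N\<^esub>)"
  "f \<oplus>\<^bsub>hom_struct R M N s\<^esub> g = (\<lambda>x\<in>carrier M. f x \<oplus>\<^bsub>N\<^esub> g x)" "b \<odot>\<^bsub>hom_struct R M N s\<^esub> f = s b f"
  by (simp_all add: hom_struct_def)

lemma mod_homI:
  assumes "left_module R M" "lin R M N f" "\<And>x. x \<notin> carrier M \<Longrightarrow> f x = undefined"
  shows "f \<in> mod_hom R M N"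
  using assms by (auto simp: mod_hom_iff extensional_def)

lemma mod_hom_ext:
  "\<lbrakk>f \<in> mod_hom R M N; g \<in> mod_hom R M N'; \<And>x. x \<in> carrier M \<Longrightarrow> f x = g x\<rbrakk> \<Longrightarrow> f = g"
  by (auto simp: mod_hom_iff intro: extensionalityI)

text \<open>The module axioms are tested pointwise for an arbitrary action \<open>s\<close>; spaces
  of homomorphisms, duals and the modules over endomorphism algebras are all instances.\<close>

lemma hom_struct_left_module:
  assumes M: "left_module R M" and N: "left_module R N" and S: "ring S"
    and s: "\<And>b f. \<lbrakk>b \<in> carrier S; f \<in> mod_hom R M N\<rbrakk> \<Longrightarrow> s b f \<in> mod_hom R M N"
    "\<And>b f g x. \<lbrakk>b \<in> carrier S; f \<in> mod_hom R M N; g \<in> mod_hom R M N; x \<in> carrier M\<rbrakk> \<Longrightarrow>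
      s b (\<lambda>x\<in>carrier M. f x \<oplus>\<^bsub>N\<^esub> g x) x = s b f x \<oplus>\<^bsub>N\<^esub> s b g x"
    "\<And>b c f x. \<lbrakk>b \<in> carrier S; c \<in> carrier S; f \<in> mod_hom R M N; x \<in> carrier M\<rbrakk> \<Longrightarrow>
      s (b \<oplus>\<^bsub>S\<^esub> c) f x = s b f x \<oplus>\<^bsub>N\<^esub> s c f x"
    "\<And>b c f x. \<lbrakk>b \<in> carrier S; c \<in> carrier S; f \<in> mod_hom R M N; x \<in> carrier M\<rbrakk> \<Longrightarrow>
      s (b \<otimes>\<^bsub>S\<^esub> c) f x = s b (s c f) x"
    "\<And>f x. \<lbrakk>f \<in> mod_hom R M N; x \<in> carrier M\<rbrakk> \<Longrightarrow> s \<one>\<^bsub>S\<^esub> f x = f x"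
  shows "left_module S (hom_struct R M N s)"
proof -
  interpret S: ring S by fact
  interpret N: left_module R N by fact
  let ?H = "hom_struct R M N s"
  have plus: "(\<lambda>x\<in>carrier M. f x \<oplus>\<^bsub>N\<^esub> g x) \<in> mod_hom R M N"
    if "f \<in> mod_hom R M N" "g \<in> mod_hom R M N" for f g
    using lin_restrict[OF M lin_sum[OF N mod_homD[OF that(1)] mod_homD[OF that(2)]]] .
  have zero: "(\<lambda>x\<in>carrier M. \<zero>\<^bsub>N\<^esub>) \<in> mod_hom R M N"
    using lin_restrict[OF M lin_const_zero[OF N]] .
  have c: "f x \<in> carrier N" if "f \<in> mod_hom R M N" "x \<in> carrier M" for f x
    using linD(1)[OF mod_homD[OF that(1)] that(2)] .
  have abg: "abelian_group ?H"
  proof (rule abelian_groupI)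
    fix f assume f: "f \<in> carrier ?H"
    have "(\<lambda>x\<in>carrier M. \<zero>\<^bsub>N\<^esub> \<ominus>\<^bsub>N\<^esub> f x) \<in> mod_hom R M N"
      using lin_restrict[OF M lin_difference[OF N lin_const_zero[OF N] mod_homD]] f by simp
    moreover have "(\<lambda>x\<in>carrier M. (\<lambda>x\<in>carrier M. \<zero>\<^bsub>N\<^esub> \<ominus>\<^bsub>N\<^esub> f x) x \<oplus>\<^bsub>N\<^esub> f x) = (\<lambda>x\<in>carrier M. \<zero>\<^bsub>N\<^esub>)"
      using f c by (intro restrict_ext) (simp add: N.M.minus_eq N.M.l_neg)
    ultimately show "\<exists>g\<in>carrier ?H. g \<oplus>\<^bsub>?H\<^esub> f = \<zero>\<^bsub>?H\<^esub>" unfolding hom_struct_simps by (intro bexI[of _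
        "\<lambda>x\<in>carrier M. \<zero>\<^bsub>N\<^esub> \<ominus>\<^bsub>N\<^esub> f x"])
  next
    fix f g h assume *: "f \<in> carrier ?H" "g \<in> carrier ?H" "h \<in> carrier ?H"
    then show "f \<oplus>\<^bsub>?H\<^esub> g \<oplus>\<^bsub>?H\<^esub> h = f \<oplus>\<^bsub>?H\<^esub> (g \<oplus>\<^bsub>?H\<^esub> h)"
      using c by (auto intro!: restrict_ext simp: N.M.a_assoc)
  next
    fix f g assume *: "f \<in> carrier ?H" "g \<in> carrier ?H"
    then show "f \<oplus>\<^bsub>?H\<^esub> g = g \<oplus>\<^bsub>?H\<^esub> f"
      using c by (auto intro!: restrict_ext simp: N.M.a_comm)
  next
    fix f assume f: "f \<in> carrier ?H"
    have "(\<lambda>x\<in>carrier M. (\<lambda>x\<in>carrier M. \<zero>\<^bsub>N\<^esub>) x \<oplus>\<^bsub>N\<^esub> f x) = f"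
      by (rule mod_hom_ext[OF plus[OF zero]]) (use f c in auto)
    then show "\<zero>\<^bsub>?H\<^esub> \<oplus>\<^bsub>?H\<^esub> f = f" by simp
  qed (simp_all add: plus zero)
  show ?thesis
  proof (intro left_module.intro left_module_axioms.intro S abg)
    fix b c f assume *: "b \<in> carrier S" "c \<in> carrier S" "f \<in> carrier ?H"
    then show "(b \<oplus>\<^bsub>S\<^esub> c) \<odot>\<^bsub>?H\<^esub> f = b \<odot>\<^bsub>?H\<^esub> f \<oplus>\<^bsub>?H\<^esub> c \<odot>\<^bsub>?H\<^esub> f"
      by (auto intro!: mod_hom_ext[OF s(1) plus[OF s(1) s(1)]] simp: s(3))
    show "(b \<otimes>\<^bsub>S\<^esub> c) \<odot>\<^bsub>?H\<^esub> f = b \<odot>\<^bsub>?H\<^esub> (c \<odot>\<^bsub>?H\<^esub> f)"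
      using * by (auto intro!: mod_hom_ext[OF s(1) s(1)] simp: s(1,4))
  next
    fix b f g assume *: "b \<in> carrier S" "f \<in> carrier ?H" "g \<in> carrier ?H"
    then show "b \<odot>\<^bsub>?H\<^esub> (f \<oplus>\<^bsub>?H\<^esub> g) = b \<odot>\<^bsub>?H\<^esub> f \<oplus>\<^bsub>?H\<^esub> b \<odot>\<^bsub>?H\<^esub> g"
      by (auto intro!: mod_hom_ext[OF s(1) plus[OF s(1) s(1)]] simp: s(1,2) plus)
  next
    fix f assume "f \<in> carrier ?H"
    then show "\<one>\<^bsub>S\<^esub> \<odot>\<^bsub>?H\<^esub> f = f" by (auto intro!: mod_hom_ext[OF s(1)] simp: s(5))
  qed (simp add: s(1))
qed

lemma op_alg_simps [simp]:
  "carrier (op_alg A) = carrier A" "\<one>\<^bsub>op_alg A\<^esub> = \<one>\<^bsub>A\<^esub>" "\<zero>\<^bsub>op_alg A\<^esub> = \<zero>\<^bsub>A\<^esub>"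
  "x \<oplus>\<^bsub>op_alg A\<^esub> y = x \<oplus>\<^bsub>A\<^esub> y" "x \<otimes>\<^bsub>op_alg A\<^esub> y = y \<otimes>\<^bsub>A\<^esub> x" "c \<odot>\<^bsub>op_alg A\<^esub> x = c \<odot>\<^bsub>A\<^esub> x"
  by (simp_all add: op_alg_def)

lemma op_alg_op_alg [simp]: "op_alg (op_alg A) = A"
  by (simp add: op_alg_def)

lemma op_alg_ring: assumes "ring A" shows "ring (op_alg A)"
proof -
  interpret ring A by fact
  show ?thesis
  proof (rule ringI)
    show "abelian_group (op_alg A)"
      by (rule abelian_groupI) (auto simp: a_ac intro: bexI[of _ "\<ominus>\<^bsub>A\<^esub> x" for x] l_neg)
    show "Group.monoid (op_alg A)" by (rule Group.monoidI) (auto simp: m_assoc)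
  qed (auto simp: l_distr r_distr)
qed

text \<open>Finite sums see only the additive structure, which the opposite algebra shares.\<close>

lemma finitely_generated_op_alg: "finitely_generated K (op_alg A) \<longleftrightarrow> finitely_generated K A"
  by (simp add: finitely_generated_def finsum_def finprod_def op_alg_def)

lemma dual_simps [simp]:
  "carrier (dual K A M) = mod_hom K (K_space A M) (regular K)" "\<zero>\<^bsub>dual K A M\<^esub> = (\<lambda>x\<in>carrier M. \<zero>\<^bsub>K\<^esub>)"
  "f \<oplus>\<^bsub>dual K A M\<^esub> g = (\<lambda>x\<in>carrier M. f x \<oplus>\<^bsub>K\<^esub> g x)" "a \<odot>\<^bsub>dual K A M\<^esub> f = (\<lambda>x\<in>carrier M. f (a \<odot>\<^bsub>M\<^esub> x))"
  unfolding dual_def hom_struct_simps by simp_all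

context fdalg
begin

lemma op_fdalg: "fdalg K (op_alg A)"
proof
  interpret K: field K by (rule field_K)
  interpret R: ring A by (rule ring_A)
  interpret A: module K A by (rule K_module_A)
  have "abelian_group (op_alg A)"
    by (rule abelian_groupI) (auto simp: R.a_ac intro: bexI[of _ "\<ominus>\<^bsub>A\<^esub> x" for x] R.l_neg)
  then have "module K (op_alg A)"
    by (intro module.intro module_axioms.intro)
      (auto simp: A.smult_l_distr A.smult_r_distr A.smult_assoc1 K.cring_axioms K.is_cring)
  then show "fd_algebra K (op_alg A)"
    using fd_algebra op_alg_ring[OF ring_A] by (auto simp: fd_algebra_def finitely_generated_op_alg)
qed

lemma K_space_lin_functional:
  assumes "lin K (K_space A M) (regular K) \<phi>" "c \<in> carrier K" "x \<in> carrier M"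
  shows "\<phi> ((c \<odot>\<^bsub>A\<^esub> \<one>\<^bsub>A\<^esub>) \<odot>\<^bsub>M\<^esub> x) = c \<otimes>\<^bsub>K\<^esub> \<phi> x"
  using linD(3)[OF assms(1,2), of x] assms(3) by simp

lemma act_functional:
  assumes "left_module A M" "lin K (K_space A M) (regular K) \<phi>" "a \<in> carrier A"
  shows "lin K (K_space A M) (regular K) (\<lambda>x. \<phi> (a \<odot>\<^bsub>M\<^esub> x))"
proof -
  interpret M: left_module A M by fact
  show ?thesis
  proof (rule linI)
    fix c x assume c: "c \<in> carrier K" and x: "x \<in> carrier (K_space A M)"
    have "a \<odot>\<^bsub>M\<^esub> ((c \<odot>\<^bsub>A\<^esub> \<one>\<^bsub>A\<^esub>) \<odot>\<^bsub>M\<^esub> x) = (c \<odot>\<^bsub>A\<^esub> \<one>\<^bsub>A\<^esub>) \<odot>\<^bsub>M\<^esub> (a \<odot>\<^bsub>M\<^esub> x)"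
      using c x assms(3) scalar by (simp flip: M.smult_assoc1)
    then show "\<phi> (a \<odot>\<^bsub>M\<^esub> (c \<odot>\<^bsub>K_space A M\<^esub> x)) = c \<odot>\<^bsub>regular K\<^esub> \<phi> (a \<odot>\<^bsub>M\<^esub> x)"
      using K_space_lin_functional[OF assms(2) c] x assms(3) by (simp add: M.smult_closed)
  qed (use linD[OF assms(2)] assms(3) in \<open>auto simp: M.smult_closed M.smult_r_distr\<close>)
qed

lemma dual_left_module:
  assumes "left_module A M" shows "left_module (op_alg A) (dual K A M)"
proof -
  interpret M: left_module A M by fact
  note V = K_space_left_module[OF assms]
  have "left_module (op_alg A) (hom_struct K (K_space A M) (regular K) (\<lambda>a f. \<lambda>x\<in>carrier M. f (a \<odot>\<^bsub>M\<^esub> x)))"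
  proof (rule hom_struct_left_module[OF V regular_left_module[OF ring_K] op_alg_ring[OF ring_A]])
    show "(\<lambda>x\<in>carrier M. f (a \<odot>\<^bsub>M\<^esub> x)) \<in> mod_hom K (K_space A M) (regular K)"
      if "a \<in> carrier (op_alg A)" "f \<in> mod_hom K (K_space A M) (regular K)" for a f
      using lin_restrict[OF V act_functional[OF assms mod_homD[OF that(2)]]] that(1) by simp
  qed (auto simp: M.smult_closed M.smult_l_distr M.smult_assoc1 M.smult_one mod_hom_iff lin_def)
  then show ?thesis by (simp add: dual_def)
qed

text \<open>Evaluations at finitely many \<open>K\<close>-generators of \<open>M\<close> are jointly
  injective on functionals.\<close>

lemma dual_fg:
  fixes M :: "('a, 'm) module"
  assumes "fg_module A M" shows "fg_module (op_alg A) (dual K A M)"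
proof -
  interpret O: fdalg K "op_alg A" by (rule op_fdalg)
  interpret K: field K by (rule field_K)
  have M: "left_module A M" using assms by (rule fgD)
  interpret M: left_module A M by (rule M)
  have D: "left_module (op_alg A) (dual K A M)" using M by (rule dual_left_module)
  obtain S where S: "finite S" "S \<subseteq> carrier M" "\<And>U. submodule U K (K_space A M) \<Longrightarrow> S \<subseteq> U \<Longrightarrow> U = carrier M"
    using assms by (auto simp: fg_iff fgen_def)
  have "fgen K (K_space (op_alg A) (dual K A M))"
  proof (rule fgen_joint_injective[OF field_K O.K_space_left_module[OF D] regular_left_module[OF ring_K]
        regular_fgen[OF ring_K], of "(\<lambda>s f. f s) ` S"])
    fix e :: "('m \<Rightarrow> 'k) \<Rightarrow> 'k" assume "e \<in> (\<lambda>s f. f s) ` S"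
    then obtain s where s: "s \<in> carrier M" "e = (\<lambda>f. f s)" using S(2) by auto
    show "lin K (K_space (op_alg A) (dual K A M)) (regular K) e"
    proof (rule linI)
      fix c f assume *: "c \<in> carrier K" "f \<in> carrier (K_space (op_alg A) (dual K A M))"
      then show "e (c \<odot>\<^bsub>K_space (op_alg A) (dual K A M)\<^esub> f) = c \<odot>\<^bsub>regular K\<^esub> e f"
        using s K_space_lin_functional[of M f c s] by (simp add: mod_hom_iff)
    qed (use s in \<open>auto simp: mod_hom_iff lin_def\<close>)
  next
    fix f assume f: "f \<in> carrier (K_space (op_alg A) (dual K A M))"
      "\<forall>e\<in>(\<lambda>s f. f s) ` S. e f = \<zero>\<^bsub>regular K\<^esub>"
    then have l: "lin K (K_space A M) (regular K) f" by (simp add: mod_hom_iff)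
    have "{x \<in> carrier M. f x = \<zero>\<^bsub>K\<^esub>} = carrier M"
      using S(3)[OF kernel_submodule[OF K_space_left_module[OF M] regular_left_module[OF ring_K] l, simplified]]
        f(2) S(2) by auto
    then have "f x = \<zero>\<^bsub>K\<^esub>" if "x \<in> carrier M" for x using that by blast
    then show "f = \<zero>\<^bsub>K_space (op_alg A) (dual K A M)\<^esub>" using f(1)
      by (auto simp: mod_hom_iff extensional_def fun_eq_iff)
  qed (use S in simp)
  then show ?thesis using D by (simp add: O.fg_iff)
qed

text \<open>\<open>N\<close> is a copy of the dual of the regular right module, \<open>\<epsilon>\<close> corresponds to the evaluation of
  functionals at \<open>1\<close>.\<close>

definition dualizing :: "('a, 'n) module \<Rightarrow> ('n \<Rightarrow> 'k) \<Rightarrow> bool" where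
  "dualizing N \<epsilon> \<longleftrightarrow> fg_module A N \<and> lin K (K_space A N) (regular K) \<epsilon> \<and>
    (\<forall>y\<in>carrier N. (\<forall>a\<in>carrier A. \<epsilon> (a \<odot>\<^bsub>N\<^esub> y) = \<zero>\<^bsub>K\<^esub>) \<longrightarrow> y = \<zero>\<^bsub>N\<^esub>) \<and>
    (\<forall>\<phi>. lin K A (regular K) \<phi> \<longrightarrow> (\<exists>y\<in>carrier N. \<forall>a\<in>carrier A. \<epsilon> (a \<odot>\<^bsub>N\<^esub> y) = \<phi> a))"

text \<open>The image of \<open>g\<close> is closed under the action, so \<open>\<epsilon>\<close>
  vanishes on all multiples of \<open>g x\<close> as well.\<close>

lemma dualizing_zero:
  assumes "dualizing N \<epsilon>" "left_module A M" "lin A M N g" "\<And>x. x \<in> carrier M \<Longrightarrow> \<epsilon> (g x) = \<zero>\<^bsub>K\<^esub>" "x \<in> carrier M"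
  shows "g x = \<zero>\<^bsub>N\<^esub>"
proof -
  interpret M: left_module A M by fact
  have "\<epsilon> (a \<odot>\<^bsub>N\<^esub> g x) = \<zero>\<^bsub>K\<^esub>" if "a \<in> carrier A" for a
    using assms(4)[of "a \<odot>\<^bsub>M\<^esub> x"] linD(3)[OF assms(3) that assms(5)] that assms(5) by (simp add: M.smult_closed)
  then show ?thesis using assms(1) linD(1)[OF assms(3,5)] by (auto simp: dualizing_def)
qed

lemma dualizing_eq:
  assumes "dualizing N \<epsilon>" "left_module A M" "lin A M N g" "lin A M N h"
    "\<And>x. x \<in> carrier M \<Longrightarrow> \<epsilon> (g x) = \<epsilon> (h x)" "x \<in> carrier M"
  shows "g x = h x"
proof -
  have N: "left_module A N" "lin K (K_space A N) (regular K) \<epsilon>" using assms(1) fgD by (auto simp: dualizing_def)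
  interpret N: left_module A N by (rule N)
  interpret K: ring K by (rule ring_K)
  have "g x \<ominus>\<^bsub>N\<^esub> h x = \<zero>\<^bsub>N\<^esub>"
  proof (rule dualizing_zero[OF assms(1,2) lin_difference[OF N(1) assms(3,4)] _ assms(6)])
    fix x assume x: "x \<in> carrier M"
    note gh = linD(1)[OF assms(3) x] linD(1)[OF assms(4) x]
    have "g x = (g x \<ominus>\<^bsub>N\<^esub> h x) \<oplus>\<^bsub>N\<^esub> h x" using N.diff_add_cancel gh by simp
    then have "\<epsilon> (g x) = \<epsilon> (g x \<ominus>\<^bsub>N\<^esub> h x) \<oplus>\<^bsub>K\<^esub> \<epsilon> (h x)"
      using linD(2)[OF N(2), of "g x \<ominus>\<^bsub>N\<^esub> h x" "h x"] gh N.M.minus_closed by simp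
    moreover have "\<epsilon> (g x \<ominus>\<^bsub>N\<^esub> h x) \<in> carrier K" "\<epsilon> (h x) \<in> carrier K"
      using linD(1)[OF N(2), of "g x \<ominus>\<^bsub>N\<^esub> h x"] linD(1)[OF N(2), of "h x"] gh N.M.minus_closed by simp_all
    ultimately show "\<epsilon> (g x \<ominus>\<^bsub>N\<^esub> h x) = \<zero>\<^bsub>K\<^esub>" using assms(5)[OF x] K.l_zero K.add.right_cancel K.zero_closed by metis
  qed
  then show ?thesis using N.eq_by_diff linD(1)[OF assms(3,6)] linD(1)[OF assms(4,6)] by simp
qed

text \<open>Together with \<open>dualizing_eq\<close> this is the bijection between maps from
  \<open>M\<close> to the dual of the algebra and functionals on \<open>M\<close>. The functional
  \<open>a \<mapsto> \<phi> (a x)\<close> is represented by an element \<open>g x\<close>;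
  uniqueness of the representing element makes \<open>g\<close> linear.\<close>

lemma dualizing_rep:
  assumes "dualizing N \<epsilon>" "left_module A M" "lin K (K_space A M) (regular K) \<phi>"
  obtains g where "lin A M N g" "\<And>x. x \<in> carrier M \<Longrightarrow> \<epsilon> (g x) = \<phi> x"
proof -
  have N: "left_module A N" using assms(1) fgD by (auto simp: dualizing_def)
  interpret M: left_module A M by fact
  interpret N: left_module A N by fact
  have ex: "\<exists>y\<in>carrier N. \<forall>a\<in>carrier A. \<epsilon> (a \<odot>\<^bsub>N\<^esub> y) = \<phi> (a \<odot>\<^bsub>M\<^esub> x)" if x: "x \<in> carrier M" for x
  proof -
    have "lin K A (regular K) (\<lambda>a. \<phi> (a \<odot>\<^bsub>M\<^esub> x))"
    proof (rule linI)
      fix c a assume *: "c \<in> carrier K" "a \<in> carrier A"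
      then have "(c \<odot>\<^bsub>A\<^esub> a) \<odot>\<^bsub>M\<^esub> x = (c \<odot>\<^bsub>A\<^esub> \<one>\<^bsub>A\<^esub>) \<odot>\<^bsub>M\<^esub> (a \<odot>\<^bsub>M\<^esub> x)"
        using x scalar by (simp flip: M.smult_assoc1)
      then show "\<phi> ((c \<odot>\<^bsub>A\<^esub> a) \<odot>\<^bsub>M\<^esub> x) = c \<odot>\<^bsub>regular K\<^esub> \<phi> (a \<odot>\<^bsub>M\<^esub> x)"
        using K_space_lin_functional[OF assms(3) *(1)] * x by (simp add: M.smult_closed)
    qed (use linD[OF assms(3)] x in \<open>auto simp: M.smult_closed M.smult_l_distr\<close>)
    then show ?thesis using assms(1) by (auto simp: dualizing_def)
  qed
  then obtain g where g: "\<And>x. x \<in> carrier M \<Longrightarrow> g x \<in> carrier N"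
    "\<And>x a. x \<in> carrier M \<Longrightarrow> a \<in> carrier A \<Longrightarrow> \<epsilon> (a \<odot>\<^bsub>N\<^esub> g x) = \<phi> (a \<odot>\<^bsub>M\<^esub> x)" by metis
  have eps: "lin K (K_space A N) (regular K) \<epsilon>" using assms(1) by (simp add: dualizing_def)
  have uniq: "y = z" if "y \<in> carrier N" "z \<in> carrier N"
    "\<And>a. a \<in> carrier A \<Longrightarrow> \<epsilon> (a \<odot>\<^bsub>N\<^esub> y) = \<epsilon> (a \<odot>\<^bsub>N\<^esub> z)" for y z
  proof -
    have r: "lin A (regular A) N (\<lambda>a. a \<odot>\<^bsub>N\<^esub> w)" if "w \<in> carrier N" for w
      using that by (auto intro!: linI simp: N.smult_closed N.smult_l_distr N.smult_assoc1)
    have "\<one>\<^bsub>A\<^esub> \<odot>\<^bsub>N\<^esub> y = \<one>\<^bsub>A\<^esub> \<odot>\<^bsub>N\<^esub> z"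
      using dualizing_eq[OF assms(1) fgD[OF fg_regular] r[OF that(1)] r[OF that(2)], of "\<one>\<^bsub>A\<^esub>"] that(3) by simp
    then show ?thesis using that by (simp add: N.smult_one)
  qed
  have "lin A M N g"
  proof (rule linI)
    fix x y assume "x \<in> carrier M" "y \<in> carrier M"
    then show "g (x \<oplus>\<^bsub>M\<^esub> y) = g x \<oplus>\<^bsub>N\<^esub> g y"
      using g linD(2)[OF eps] linD(2)[OF assms(3)]
      by (intro uniq) (auto simp: N.smult_closed N.smult_r_distr M.smult_r_distr M.smult_closed)
  next
    fix b x assume "b \<in> carrier A" "x \<in> carrier M"
    then show "g (b \<odot>\<^bsub>M\<^esub> x) = b \<odot>\<^bsub>N\<^esub> g x"
      using g by (intro uniq) (auto simp: N.smult_closed M.smult_closed simp flip: N.smult_assoc1 M.smult_assoc1)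
  qed (rule g(1))
  moreover have "\<epsilon> (g x) = \<phi> x" if "x \<in> carrier M" for x
    using g(2)[OF that, of "\<one>\<^bsub>A\<^esub>"] g(1)[OF that] that by (simp add: N.smult_one M.smult_one)
  ultimately show thesis using that by blast
qed

text \<open>Maps into \<open>N\<close> are the same as functionals, and functionals extend along
  injections.\<close>

lemma dualizing_inje:
  assumes "dualizing N \<epsilon>" shows "inje N"
  unfolding injective_def
proof (intro conjI allI impI)
  have N: "fg_module A N" and eps: "lin K (K_space A N) (regular K) \<epsilon>" using assms by (auto simp: dualizing_def)
  show "fg_module A N" by (rule N)
  fix M L :: "('a, nat \<Rightarrow> 'k) module" and f g
  assume *: "fg_module A M \<and> fg_module A L \<and> f \<in> mod_hom A M L \<and> inj_on f (carrier M) \<and> g \<in> mod_hom A M N"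
  then have M: "left_module A M" and L: "left_module A L" "fgen K (K_space A L)"
    and f: "lin A M L f" "inj_on f (carrier M)" and g: "lin A M N g" by (auto dest: mod_homD fgD simp: fg_iff)
  have eg: "lin K (K_space A M) (regular K) (\<lambda>x. \<epsilon> (g x))" using lin_comp[OF K_space_lin[OF g] eps] .
  interpret M: left_module A M by (rule M)
  obtain \<psi> where \<psi>: "lin K (K_space A L) (regular K) \<psi>" "\<And>x. x \<in> carrier (K_space A M) \<Longrightarrow> \<psi> (f x) = \<epsilon> (g x)"
  proof (rule functional_factor[OF field_K K_space_left_module[OF M] K_space_left_module[OF L(1)] L(2)
        K_space_lin[OF f(1)] eg])
    fix x assume x: "x \<in> carrier (K_space A M)" "f x = \<zero>\<^bsub>K_space A L\<^esub>"
    then have "x = \<zero>\<^bsub>M\<^esub>" using inj_onD[OF f(2), of x "\<zero>\<^bsub>M\<^esub>"] lin_zero[OF M L(1) f(1)] by simp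
    then show "\<epsilon> (g x) = \<zero>\<^bsub>K\<^esub>" using lin_zero[OF K_space_left_module[OF M] regular_left_module[OF ring_K] eg] by simp
  qed (rule that)
  obtain h where h: "lin A L N h" "\<And>x. x \<in> carrier L \<Longrightarrow> \<epsilon> (h x) = \<psi> x" using dualizing_rep[OF assms L(1) \<psi>(1)] by blast
  show "\<exists>h\<in>mod_hom A L N. compose (carrier M) h f = g"
  proof (rule bexI[OF _ lin_restrict[OF L(1) h(1)]])
    have "h (f x) = g x" if x: "x \<in> carrier M" for x
      using dualizing_eq[OF assms M lin_comp[OF f(1) h(1)] g _ x] h(2) \<psi>(2) linD(1)[OF f(1)] by simp
    then show "compose (carrier M) (\<lambda>x\<in>carrier L. h x) f = g"
      using * linD(1)[OF f(1)] by (auto simp: compose_def mod_hom_iff extensional_def fun_eq_iff)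
  qed
qed

text \<open>The dual of the regular right module, copied to the universe. The value of a functional
  at \<open>a\<close> is recovered by acting with \<open>a\<close> and evaluating at
  \<open>\<one>\<close>.\<close>

lemma dualizing_exists:
  obtains N :: "('a, nat \<Rightarrow> 'k) module" and \<epsilon> where "dualizing N \<epsilon>"
proof -
  interpret O: fdalg K "op_alg A" by (rule op_fdalg)
  interpret A: ring A by (rule ring_A)
  let ?G = "regular (op_alg A)"
  let ?D = "dual K (op_alg A) ?G"
  have D: "fg_module A ?D" using O.dual_fg[OF O.fg_regular] by simp
  interpret D: left_module A ?D using D by (rule fgD)
  obtain N :: "('a, nat \<Rightarrow> 'k) module" and f g where N: "fg_module A N" "lin A ?D N f" "lin A N ?D g"
    "\<And>x. x \<in> carrier ?D \<Longrightarrow> g (f x) = x" "\<And>x. x \<in> carrier N \<Longrightarrow> f (g x) = x" using universe_copy[OF D] by metis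
  interpret N: left_module A N using N(1) by (rule fgD)
  have val: "g (a \<odot>\<^bsub>N\<^esub> y) \<one>\<^bsub>A\<^esub> = g y a" if "a \<in> carrier A" "y \<in> carrier N" for a y
    using linD(3)[OF N(3) that] that by simp
  have gh: "g y \<in> mod_hom K (K_space (op_alg A) ?G) (regular K)" if "y \<in> carrier N" for y
    using linD(1)[OF N(3) that] by simp
  have "dualizing N (\<lambda>y. g y \<one>\<^bsub>A\<^esub>)"
    unfolding dualizing_def
  proof (intro conjI ballI allI impI N(1))
    show "lin K (K_space A N) (regular K) (\<lambda>y. g y \<one>\<^bsub>A\<^esub>)"
    proof (rule linI)
      fix c y assume *: "c \<in> carrier K" "y \<in> carrier (K_space A N)"
      then have "g ((c \<odot>\<^bsub>A\<^esub> \<one>\<^bsub>A\<^esub>) \<odot>\<^bsub>N\<^esub> y) \<one>\<^bsub>A\<^esub> = g y (c \<odot>\<^bsub>A\<^esub> \<one>\<^bsub>A\<^esub>)" using val scalar(1) by simp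
      also have "\<dots> = c \<otimes>\<^bsub>K\<^esub> g y \<one>\<^bsub>A\<^esub>"
        using O.K_space_lin_functional[of ?G "g y" c "\<one>\<^bsub>A\<^esub>"] mod_homD[OF gh] * scalar by simp
      finally show "g (c \<odot>\<^bsub>K_space A N\<^esub> y) \<one>\<^bsub>A\<^esub> = c \<odot>\<^bsub>regular K\<^esub> g y \<one>\<^bsub>A\<^esub>" by simp
    next
      fix y assume "y \<in> carrier (K_space A N)"
      then show "g y \<one>\<^bsub>A\<^esub> \<in> carrier (regular K)" using linD(1)[OF mod_homD[OF gh], of y "\<one>\<^bsub>A\<^esub>"] by simp
    qed (use linD(2)[OF N(3)] in simp)
    fix y assume y: "y \<in> carrier N" "\<forall>a\<in>carrier A. g (a \<odot>\<^bsub>N\<^esub> y) \<one>\<^bsub>A\<^esub> = \<zero>\<^bsub>K\<^esub>"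
    then have "g y a = \<zero>\<^bsub>K\<^esub>" if "a \<in> carrier A" for a using val[of a y] that by simp
    then have "g y = \<zero>\<^bsub>?D\<^esub>" using gh[OF y(1)] by (auto simp: mod_hom_iff extensional_def fun_eq_iff)
    then show "y = \<zero>\<^bsub>N\<^esub>" using N(5)[OF y(1)] lin_zero[OF fgD[OF D] fgD[OF N(1)] N(2)] by simp
  next
    fix \<phi> assume \<phi>: "lin K A (regular K) \<phi>"
    have "lin K (K_space (op_alg A) ?G) (regular K) \<phi>"
    proof (rule linI)
      fix c x assume "c \<in> carrier K" "x \<in> carrier (K_space (op_alg A) ?G)"
      then show "\<phi> (c \<odot>\<^bsub>K_space (op_alg A) ?G\<^esub> x) = c \<odot>\<^bsub>regular K\<^esub> \<phi> x"
        using linD(3)[OF \<phi>, of c x] scalar by simp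
    qed (use linD[OF \<phi>] in auto)
    then have "(\<lambda>x\<in>carrier A. \<phi> x) \<in> carrier ?D"
      using lin_restrict[OF O.K_space_left_module[OF O.fgD[OF O.fg_regular]]] by simp
    then show "\<exists>y\<in>carrier N. \<forall>a\<in>carrier A. g (a \<odot>\<^bsub>N\<^esub> y) \<one>\<^bsub>A\<^esub> = \<phi> a"
      using val N(4) linD(1)[OF N(2)] by (intro bexI[of _ "f (\<lambda>x\<in>carrier A. \<phi> x)"] ballI) auto
  qed
  then show thesis using that by blast
qed

end

section \<open>Dimension shifting\<close>

context fdalg
begin

text \<open>A power of \<open>J\<close>, copied to the universe so that the kernel of the cover has
  the same type as the next module to be covered.\<close>

lemma cover_exists:
  fixes N :: "('a, 'n) module"
  assumes "fg_module A J" "fg_module A N" "\<And>x. x \<in> carrier N \<Longrightarrow> \<exists>g. lin A J N g \<and> x \<in> g ` carrier J"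
  shows "\<exists>(t :: ('a, nat \<Rightarrow> 'k) module) p. fg_module A t \<and> fac A J t t (\<lambda>x. x) \<and> lin A t N p \<and> p ` carrier t = carrier N"
proof -
  note J = fgD[OF assms(1)]
  obtain n p where p: "lin A (mod_power J n) N p" "p ` carrier (mod_power J n) = carrier N"
    using power_cover[OF J fgD[OF assms(2)] _ assms(3)] assms(2) by (metis fg_module_iff)
  obtain t :: "('a, nat \<Rightarrow> 'k) module" and f g where t: "fg_module A t" "lin A (mod_power J n) t f"
    "lin A t (mod_power J n) g" "\<And>x. x \<in> carrier (mod_power J n) \<Longrightarrow> g (f x) = x" "\<And>x. x \<in> carrier t \<Longrightarrow> f (g x) = x"
    using universe_copy[OF fg_power[OF assms(1), of n]] by metis
  have "fac A J t t (\<lambda>x. f (g x))"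
    using fac_post[OF mod_power_left_module[OF J] mod_power_left_module[OF J] fgD[OF t(1)] mod_power_fac_id[OF J] t(2),
      THEN fac_pre[OF _ t(3)]] .
  then have 1: "fac A J t t (\<lambda>x. x)" by (rule fac_cong) (simp add: t(5))
  have 2: "lin A t N (\<lambda>x. p (g x))" using lin_comp[OF t(3) p(1)] .
  have "carrier N \<subseteq> (\<lambda>x. p (g x)) ` carrier t"
  proof
    fix y assume "y \<in> carrier N"
    then obtain x where "x \<in> carrier (mod_power J n)" "y = p x" using p(2) by blast
    then show "y \<in> (\<lambda>x. p (g x)) ` carrier t" using t(4) linD(1)[OF t(2)] by (intro image_eqI[of _ _ "f x"]) auto
  qed
  then have "(\<lambda>x. p (g x)) ` carrier t = carrier N" using linD(1)[OF 2] by auto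
  with t(1) 1 2 show ?thesis by blast
qed

text \<open>A partial resolution of \<open>N 0\<close> with terms in \<open>add J\<close>, stored
  syzygy by syzygy. As \<open>N (Suc i)\<close> is literally a submodule of \<open>t i\<close>, the
  map \<open>p (Suc i)\<close> also serves as the differential from \<open>t (Suc i)\<close> to
  \<open>t i\<close>.\<close>

definition tower :: "('a, 'j) module \<Rightarrow> nat \<Rightarrow> (nat \<Rightarrow> ('a, 'n) module) \<Rightarrow> (nat \<Rightarrow> ('a, 'n) module) \<Rightarrow>
    (nat \<Rightarrow> 'n \<Rightarrow> 'n) \<Rightarrow> bool" where
  "tower J m t N p \<longleftrightarrow> (\<forall>i\<le>m. fg_module A (N i) \<and> fg_module A (t i) \<and> fac A J (t i) (t i) (\<lambda>x. x) \<and>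
    lin A (t i) (N i) (p i) \<and> p i ` carrier (t i) = carrier (N i) \<and>
    N (Suc i) = submod (t i) {x \<in> carrier (t i). p i x = \<zero>\<^bsub>N i\<^esub>})"

lemma injective_resolutionD:
  assumes "injective_resolution TYPE(nat \<Rightarrow> 'k) A M j I d"
  shows "inje (I i)" "lin A M (I 0) j" "inj_on j (carrier M)" "lin A (I i) (I (Suc i)) (d i)"
    "j ` carrier M = {x \<in> carrier (I 0). d 0 x = \<zero>\<^bsub>I (Suc 0)\<^esub>}"
    "d i ` carrier (I i) = {x \<in> carrier (I (Suc i)). d (Suc i) x = \<zero>\<^bsub>I (Suc (Suc i))\<^esub>}"
proof -
  have 1: "\<And>n. left_exact A M j I d n" and I: "\<And>i. inje (I i)" using assms by (auto simp: injective_resolution_def)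
  show "inje (I i)" by (rule I)
  show "lin A M (I 0) j" "inj_on j (carrier M)" using 1[of 0] by (auto simp: left_exact_def dest: mod_homD)
  show "lin A (I i) (I (Suc i)) (d i)" using 1[of "Suc i"] by (auto simp: left_exact_def dest: mod_homD)
  show "j ` carrier M = {x \<in> carrier (I 0). d 0 x = \<zero>\<^bsub>I (Suc 0)\<^esub>}"
    using 1[of 1] by (auto simp: left_exact_def a_kernel_def')
  show "d i ` carrier (I i) = {x \<in> carrier (I (Suc i)). d (Suc i) x = \<zero>\<^bsub>I (Suc (Suc i))\<^esub>}"
    using 1[of "Suc (Suc i)"] by (simp add: left_exact_def a_kernel_def')
qed

lemma projective_resolutionD:
  assumes "projective_resolution TYPE(nat \<Rightarrow> 'k) A Q d q M"
  shows "proj (Q i)" "lin A (Q 0) M q" "q ` carrier (Q 0) = carrier M" "lin A (Q (Suc i)) (Q i) (d i)"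
    "d 0 ` carrier (Q (Suc 0)) = {x \<in> carrier (Q 0). q x = \<zero>\<^bsub>M\<^esub>}"
    "d (Suc i) ` carrier (Q (Suc (Suc i))) = {x \<in> carrier (Q (Suc i)). d i x = \<zero>\<^bsub>Q i\<^esub>}"
proof -
  have 1: "\<And>n. right_exact A Q d q M n" and Q: "\<And>i. proj (Q i)" using assms by (auto simp: projective_resolution_def)
  show "proj (Q i)" by (rule Q)
  show "lin A (Q 0) M q" "q ` carrier (Q 0) = carrier M" using 1[of 0] by (auto simp: right_exact_def dest: mod_homD)
  show "lin A (Q (Suc i)) (Q i) (d i)" using 1[of "Suc i"] by (auto simp: right_exact_def dest: mod_homD)
  show "d 0 ` carrier (Q (Suc 0)) = {x \<in> carrier (Q 0). q x = \<zero>\<^bsub>M\<^esub>}"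
    using 1[of 1] by (simp add: right_exact_def a_kernel_def')
  show "d (Suc i) ` carrier (Q (Suc (Suc i))) = {x \<in> carrier (Q (Suc i)). d i x = \<zero>\<^bsub>Q i\<^esub>}"
    using 1[of "Suc (Suc i)"] by (simp add: right_exact_def a_kernel_def')
qed

text \<open>A map from the \<open>c\<close>-th cosyzygy of the regular module to \<open>N (i + 1)\<close> extends to \<open>I c\<close> because it
  induces a map from the \<open>(c + 1)\<close>-st cosyzygy to \<open>N i\<close> that extends to \<open>I (c + 1)\<close>.  For \<open>c = 0\<close> the
  extension property says that \<open>N i\<close> is generated by \<open>I 0\<close>, so that the construction continues.\<close>

lemma codominant_tower:
  fixes N0 :: "('a, nat \<Rightarrow> 'k) module"
  assumes res: "injective_resolution TYPE(nat \<Rightarrow> 'k) A (regular A) j I d"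
    and P: "\<And>i. i \<le> m \<Longrightarrow> proj (I i)" and N0: "inje N0"
  shows "\<exists>t N p. N 0 = N0 \<and> tower (I 0) m t N p"
proof -
  note R = injective_resolutionD[OF res]
  let ?G = "regular A"
  have If: "fg_module A (I i)" for i using inje_fg[OF R(1)] .
  \<comment> \<open>The \<open>c\<close>-th cosyzygy of the regular module, realised inside
    \<open>I c\<close>; for \<open>c = 0\<close> it is the image of \<open>j\<close>.\<close>
  define Z where "Z c = {x \<in> carrier (I c). d c x = \<zero>\<^bsub>I (Suc c)\<^esub>}" for c
  have Z: "submodule (Z c) A (I c)" for c
    unfolding Z_def by (rule kernel_submodule[OF fgD[OF If] fgD[OF If] R(4)])
  have Zf: "fg_module A (submod (I c) (Z c))" for c using fg_submod[OF If Z] .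
  define good where "good M tp \<longleftrightarrow> fg_module A (fst tp) \<and> fac A (I 0) (fst tp) (fst tp) (\<lambda>x. x) \<and>
    lin A (fst tp) M (snd tp) \<and> snd tp ` carrier (fst tp) = carrier M"
    for M :: "('a, nat \<Rightarrow> 'k) module" and tp :: "('a, nat \<Rightarrow> 'k) module \<times> ((nat \<Rightarrow> 'k) \<Rightarrow> (nat \<Rightarrow> 'k))"
  \<comment> \<open>Covers are selected before their existence is known, so that \<open>N\<close>
    can be defined by plain recursion. Their properties follow level by level, once the extension
    property has been established there.\<close>
  define cov where "cov M = (SOME tp. good M tp)" for M
  define N where "N = rec_nat N0 (\<lambda>_ M. submod (fst (cov M)) {x \<in> carrier (fst (cov M)). snd (cov M) x = \<zero>\<^bsub>M\<^esub>})"
  have N_simps: "N 0 = N0" "N (Suc i) = submod (fst (cov (N i))) {x \<in> carrier (fst (cov (N i))). snd (cov (N i))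
      x = \<zero>\<^bsub>N i\<^esub>}" for i
    by (simp_all add: N_def)
  have good: "good (N i) (cov (N i))"
    if fg: "fg_module A (N i)" and ext: "\<And>f. lin A (submod (I 0) (Z 0)) (N i) f \<Longrightarrow> \<exists>F. lin A (I 0) (N i) F
        \<and> (\<forall>x\<in>Z 0. F x = f x)" for i
  proof -
    interpret Ni: left_module A "N i" using fg by (rule fgD)
    interpret G: left_module A ?G by (rule fgD[OF fg_regular])
    \<comment> \<open>The map \<open>a \<mapsto> a x\<close>, transported to the image of
      \<open>j\<close>, extends to \<open>I 0\<close>; at the image of \<open>\<one>\<close> the
      extension takes the value \<open>x\<close>.\<close>
    have gen: "\<exists>g. lin A (I 0) (N i) g \<and> x \<in> g ` carrier (I 0)" if x: "x \<in> carrier (N i)" for x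
    proof -
      have ax: "lin A ?G (N i) (\<lambda>a. a \<odot>\<^bsub>N i\<^esub> x)"
        using x by (intro linI) (auto simp: Ni.smult_closed Ni.smult_l_distr Ni.smult_assoc1)
      have jZ: "lin A ?G (submod (I 0) (Z 0)) j" "j ` carrier ?G = carrier (submod (I 0) (Z 0))"
        using lin_into_submod[OF R(2), of "Z 0"] R(5) by (auto simp: Z_def)
      obtain h where h: "lin A (submod (I 0) (Z 0)) (N i) h" "\<And>a. a \<in> carrier ?G \<Longrightarrow> h (j a) = a \<odot>\<^bsub>N i\<^esub> x"
      proof (rule lin_factor[OF fgD[OF fg_regular] fgD[OF Zf] fgD[OF fg] jZ ax])
        fix a assume a: "a \<in> carrier ?G" "j a = \<zero>\<^bsub>submod (I 0) (Z 0)\<^esub>"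
        then have "a = \<zero>\<^bsub>?G\<^esub>" using inj_onD[OF R(3), of a "\<zero>\<^bsub>?G\<^esub>"] lin_zero[OF fgD[OF fg_regular] fgD[OF If] R(2)]
          G.M.zero_closed by simp
        then show "a \<odot>\<^bsub>N i\<^esub> x = \<zero>\<^bsub>N i\<^esub>" using x by (simp add: Ni.smult_zero_left)
      qed (rule that)
      obtain F where F: "lin A (I 0) (N i) F" "\<forall>x\<in>Z 0. F x = h x" using ext[OF h(1)] by blast
      have "j \<one>\<^bsub>A\<^esub> \<in> Z 0" using jZ(2) by auto
      moreover have "F (j \<one>\<^bsub>A\<^esub>) = x" using F(2) h(2)[of "\<one>\<^bsub>A\<^esub>"] x calculation by (simp add: Ni.smult_one)
      ultimately show ?thesis using F(1) Z_def by blast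
    qed
    have "\<exists>tp. good (N i) tp" using cover_exists[OF If fg gen] unfolding good_def by auto
    then show ?thesis unfolding cov_def by (rule someI_ex)
  qed
  \<comment> \<open>Going from level \<open>i\<close> to level \<open>i + 1\<close> at cosyzygy
    \<open>c\<close> consumes the property at level \<open>i\<close> for cosyzygy
    \<open>c + 1\<close>; this explains the bound on \<open>c + i\<close>.\<close>
  have main: "fg_module A (N i) \<and> (\<forall>c f. c + i \<le> m \<and> lin A (submod (I c) (Z c)) (N i) f \<longrightarrow>
      (\<exists>F. lin A (I c) (N i) F \<and> (\<forall>x\<in>Z c. F x = f x)))" if "i \<le> m" for i
    using that
  proof (induction i)
    case 0
    have "\<exists>F. lin A (I c) N0 F \<and> (\<forall>x\<in>Z c. F x = f x)" if f: "lin A (submod (I c) (Z c)) N0 f" for c f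
    proof -
      have z: "f x = \<zero>\<^bsub>N0\<^esub>" if "x \<in> carrier (submod (I c) (Z c))" "x = \<zero>\<^bsub>I c\<^esub>" for x
        using lin_zero[OF fgD[OF Zf] fgD[OF inje_fg[OF N0]] f] that by simp
      obtain h where "lin A (I c) N0 h" "\<And>x. x \<in> carrier (submod (I c) (Z c)) \<Longrightarrow> h x = f x"
        using inje_extend[OF N0 Zf If lin_incl[OF Z] f z] by metis
      then show ?thesis by auto
    qed
    then show ?case using inje_fg[OF N0] by (simp add: N_simps)
  next
    case (Suc i)
    then have IH: "fg_module A (N i)" "\<And>c f. \<lbrakk>c + i \<le> m; lin A (submod (I c) (Z c)) (N i) f\<rbrakk> \<Longrightarrow>
      \<exists>F. lin A (I c) (N i) F \<and> (\<forall>x\<in>Z c. F x = f x)" by auto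
    define t p where "t = fst (cov (N i))" "p = snd (cov (N i))"
    have tp: "fg_module A t" "fac A (I 0) t t (\<lambda>x. x)" "lin A t (N i) p" "p ` carrier t = carrier (N i)"
      using good[OF IH(1) IH(2)[of 0]] Suc.prems by (auto simp: good_def t_p_def)
    have NS: "N (Suc i) = submod t {x \<in> carrier t. p x = \<zero>\<^bsub>N i\<^esub>}" by (simp add: N_simps t_p_def)
    interpret Ni: left_module A "N i" using IH(1) by (rule fgD)
    interpret t: left_module A t using tp(1) by (rule fgD)
    have ti: "inje t" using inje_fac[OF R(1) tp(1,2)] .
    have ker: "submodule {x \<in> carrier t. p x = \<zero>\<^bsub>N i\<^esub>} A t"
      using kernel_submodule[OF fgD[OF tp(1)] fgD[OF IH(1)] tp(3)] .
    have fgS: "fg_module A (N (Suc i))" unfolding NS using fg_submod[OF tp(1) ker] .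
    have "\<exists>F. lin A (I c) (N (Suc i)) F \<and> (\<forall>x\<in>Z c. F x = f x)"
      if c: "c + Suc i \<le> m" and f: "lin A (submod (I c) (Z c)) (N (Suc i)) f" for c f
    proof -
      have ft: "lin A (submod (I c) (Z c)) t f" using lin_from_submod[OF f[unfolded NS] ker] .
      have fk: "p (f x) = \<zero>\<^bsub>N i\<^esub>" if "x \<in> Z c" for x using linD(1)[OF f, of x] that by (simp add: NS)
      have z: "f x = \<zero>\<^bsub>t\<^esub>" if "x \<in> carrier (submod (I c) (Z c))" "x = \<zero>\<^bsub>I c\<^esub>" for x
        using lin_zero[OF fgD[OF Zf] fgD[OF tp(1)] ft] that by simp
      obtain F where F: "lin A (I c) t F" "\<And>x. x \<in> carrier (submod (I c) (Z c)) \<Longrightarrow> F x = f x"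
        using inje_extend[OF ti Zf If lin_incl[OF Z] ft z] by metis
      have pF: "lin A (I c) (N i) (\<lambda>x. p (F x))" using lin_comp[OF F(1) tp(3)] .
      have dZ: "lin A (I c) (submod (I (Suc c)) (Z (Suc c))) (d c)"
        "d c ` carrier (I c) = carrier (submod (I (Suc c)) (Z (Suc c)))"
        using lin_into_submod[OF R(4), of c "Z (Suc c)"] R(6)[of c] by (auto simp: Z_def)
      \<comment> \<open>On \<open>Z c\<close> the map \<open>F\<close> agrees with \<open>f\<close>,
        whose values lie in the kernel of \<open>p\<close>. Hence \<open>p\<close> after
        \<open>F\<close> descends along \<open>d c\<close> to the next cosyzygy.\<close>
      obtain g where g: "lin A (submod (I (Suc c)) (Z (Suc c))) (N i) g" "\<And>x. x \<in> carrier (I c) \<Longrightarrow> g (d c x) = p (F x)"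
      proof (rule lin_factor[OF fgD[OF If] fgD[OF Zf] fgD[OF IH(1)] dZ pF])
        show "p (F x) = \<zero>\<^bsub>N i\<^esub>" if "x \<in> carrier (I c)" "d c x = \<zero>\<^bsub>submod (I (Suc c)) (Z (Suc c))\<^esub>" for x
          using that F(2)[of x] fk[of x] by (simp add: Z_def)
      qed (rule that)
      obtain H where H: "lin A (I (Suc c)) (N i) H" "\<forall>x\<in>Z (Suc c). H x = g x" using IH(2)[of "Suc c", OF _ g(1)]
          c by auto
      \<comment> \<open>Here the term of the injective resolution has to be projective.\<close>
      obtain H' where H': "lin A (I (Suc c)) t H'" "\<And>x. x \<in> carrier (I (Suc c)) \<Longrightarrow> p (H' x) = H x"
        using proj_lift[OF P[of "Suc c"] tp(1) IH(1) tp(3) H(1)] c tp(4) linD(1)[OF H(1)]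
        by (metis Suc_leD add_Suc_right add_leD1 add_Suc)
      \<comment> \<open>The correction moves the values into the kernel of \<open>p\<close> and
        changes nothing on \<open>Z c\<close>, where \<open>d c\<close> vanishes.\<close>
      let ?F = "\<lambda>x. F x \<ominus>\<^bsub>t\<^esub> H' (d c x)"
      have Ft: "lin A (I c) t ?F" using lin_difference[OF fgD[OF tp(1)] F(1) lin_comp[OF R(4) H'(1)]] .
      have dc: "d c x \<in> carrier (I (Suc c))" "d c x \<in> Z (Suc c)" if "x \<in> carrier (I c)" for x
        using linD(1)[OF R(4) that] linD(1)[OF dZ(1) that] by auto
      have "p (?F x) = \<zero>\<^bsub>N i\<^esub>" if x: "x \<in> carrier (I c)" for x
        using lin_diff[OF fgD[OF tp(1)] fgD[OF IH(1)] tp(3) linD(1)[OF F(1) x] linD(1)[OF H'(1) dc(1)[OF x]]]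
          H'(2)[OF dc(1)[OF x]] H(2) dc(2)[OF x] g(2)[OF x] Ni.diff_self[OF linD(1)[OF pF x]] by simp
      then have "lin A (I c) (N (Suc i)) ?F" unfolding NS using linD(1)[OF Ft] by (intro lin_into_submod[OF Ft]) auto
      moreover have "?F x = f x" if x: "x \<in> Z c" for x
      proof -
        have "d c x = \<zero>\<^bsub>I (Suc c)\<^esub>" "x \<in> carrier (I c)" using x by (auto simp: Z_def)
        then show ?thesis using lin_zero[OF fgD[OF If] fgD[OF tp(1)] H'(1)] F(2)[of x] x linD(1)[OF ft, of x]
          by (simp add: t.M.minus_eq)
      qed
      ultimately show ?thesis by blast
    qed
    then show ?case using fgS by blast
  qed
  have "tower (I 0) m (\<lambda>i. fst (cov (N i))) N (\<lambda>i. snd (cov (N i)))"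
    unfolding tower_def
  proof (intro allI impI)
    fix i assume i: "i \<le> m"
    show "fg_module A (N i) \<and> fg_module A (fst (cov (N i))) \<and> fac A (I 0) (fst (cov (N i))) (fst (cov (N i))) (\<lambda>x. x) \<and>
       lin A (fst (cov (N i))) (N i) (snd (cov (N i))) \<and> snd (cov (N i)) ` carrier (fst (cov (N i))) = carrier (N i) \<and>
       N (Suc i) = submod (fst (cov (N i))) {x \<in> carrier (fst (cov (N i))). snd (cov (N i)) x = \<zero>\<^bsub>N i\<^esub>}"
      using main[OF i] good[of i] i N_simps(2)[of i] unfolding good_def by auto
  qed
  then show ?thesis using N_simps(1) by blast
qed

text \<open>The obstruction lies in \<open>Ext^1(T, N (i + 1))\<close>. Shifting along the injective
  terms \<open>t (i + 1), ..., t (i + k)\<close> turns it into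
  \<open>Ext^(k + 1)(T, N (i + k + 1))\<close>, which vanishes. The shift is carried out on cocycles
  with respect to a projective resolution \<open>Q\<close> of \<open>T\<close>.\<close>

lemma lift_along_tower:
  fixes t N :: "nat \<Rightarrow> ('a, 'n) module"
  assumes tower: "tower J m t N p" and J: "inje J" and pd: "pdim_le TYPE(nat \<Rightarrow> 'k) A k T" and T: "fg_module A T"
    and i: "i + k \<le> m" and f: "lin A T (N i) f"
  obtains g where "lin A T (t i) g" "\<And>x. x \<in> carrier T \<Longrightarrow> p i (g x) = f x"
proof -
  obtain Q \<delta> q where res: "projective_resolution TYPE(nat \<Rightarrow> 'k) A Q \<delta> q T"
    and Qk: "\<And>i. i > k \<Longrightarrow> carrier (Q i) = {\<zero>\<^bsub>Q i\<^esub>}" using pd by (auto simp: pdim_le_def)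
  note R = projective_resolutionD[OF res]
  have Qf: "fg_module A (Q i)" for i using proj_fg[OF R(1)] .
  have Tw: "fg_module A (N i)" "fg_module A (t i)" "fac A J (t i) (t i) (\<lambda>x. x)" "lin A (t i) (N i) (p i)"
    "p i ` carrier (t i) = carrier (N i)" "N (Suc i) = submod (t i) {x \<in> carrier (t i). p i x = \<zero>\<^bsub>N i\<^esub>}" if
        "i \<le> m" for i
    using tower that by (auto simp: tower_def)
  \<comment> \<open>Cocycles on \<open>Q a\<close> with values in \<open>N i\<close> lift to
    cocycles with values in \<open>t i\<close>. The induction moves along the resolution and along
    the tower simultaneously and stops at \<open>a = k\<close>, where every map is a cocycle because
    the next term of \<open>Q\<close> is zero.\<close>
  have main: "\<exists>h. lin A (Q a) (t i) h \<and> (\<forall>y\<in>carrier (Q (Suc a)). h (\<delta> a y) = \<zero>\<^bsub>t i\<^esub>)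
      \<and> (\<forall>x\<in>carrier (Q a). p i (h x) = g x)"
    if "a + b = k" "i + b \<le> m" "lin A (Q a) (N i) g" "\<forall>y\<in>carrier (Q (Suc a)). g (\<delta> a y) = \<zero>\<^bsub>N i\<^esub>" for a b i g
    using that
  proof (induction b arbitrary: a i g)
    case 0
    then have im: "i \<le> m" "a = k" by auto
    obtain h where h: "lin A (Q a) (t i) h" "\<And>x. x \<in> carrier (Q a) \<Longrightarrow> p i (h x) = g x"
      using proj_lift[OF R(1) Tw(2)[OF im(1)] Tw(1)[OF im(1)] Tw(4)[OF im(1)] 0(3)] linD(1)[OF 0(3)] Tw(5)[OF
          im(1)] by metis
    have "h (\<delta> a y) = \<zero>\<^bsub>t i\<^esub>" if "y \<in> carrier (Q (Suc a))" for y
    proof -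
      have "y = \<zero>\<^bsub>Q (Suc a)\<^esub>" using Qk[of "Suc a"] im that by auto
      then show ?thesis using lin_zero[OF fgD[OF Qf] fgD[OF Qf] R(4)] lin_zero[OF fgD[OF Qf] fgD[OF Tw(2)[OF
          im(1)]] h(1)] by simp
    qed
    with h show ?case by blast
  next
    case (Suc b)
    then have im: "i \<le> m" "Suc i \<le> m" by auto
    note W = Tw[OF im(1)] and W' = Tw[OF im(2)]
    have tl: "left_module A (t i)" and Nl: "left_module A (N i)" using fgD[OF W(2)] fgD[OF W(1)] .
    interpret ti: left_module A "t i" by (rule tl)
    interpret Ni: left_module A "N i" by (rule Nl)
    have ker: "submodule {x \<in> carrier (t i). p i x = \<zero>\<^bsub>N i\<^esub>} A (t i)" using kernel_submodule[OF tl Nl W(4)] .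
    have ti': "inje (t (Suc i))" using inje_fac[OF J W'(2,3)] .
    obtain h0 where h0: "lin A (Q a) (t i) h0" "\<And>x. x \<in> carrier (Q a) \<Longrightarrow> p i (h0 x) = g x"
      using proj_lift[OF R(1) W(2,1,4) Suc.prems(3)] linD(1)[OF Suc.prems(3)] W(5) by metis
    have \<delta>c: "\<delta> a y \<in> carrier (Q a)" if "y \<in> carrier (Q (Suc a))" for y a using linD(1)[OF R(4) that] .
    \<comment> \<open>The failure of \<open>h0\<close> to be a cocycle takes values in the kernel of
      \<open>p i\<close>, the next syzygy, and is a cocycle there.\<close>
    have h1: "lin A (Q (Suc a)) (N (Suc i)) (\<lambda>x. h0 (\<delta> a x))"
      unfolding W(6) using h0(2)[OF \<delta>c] Suc.prems(4) linD(1)[OF h0(1) \<delta>c]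
      by (intro lin_into_submod[OF lin_comp[OF R(4) h0(1)]]) auto
    have \<delta>\<delta>: "\<delta> a (\<delta> (Suc a) y) = \<zero>\<^bsub>Q a\<^esub>" if "y \<in> carrier (Q (Suc (Suc a)))" for y using R(6)[of a] that by blast
    have h1z: "h0 (\<delta> a (\<delta> (Suc a) y)) = \<zero>\<^bsub>N (Suc i)\<^esub>" if "y \<in> carrier (Q (Suc (Suc a)))" for y
      using \<delta>\<delta>[OF that] lin_zero[OF fgD[OF Qf] tl h0(1)] by (simp add: W(6))
    obtain h2 where h2: "lin A (Q (Suc a)) (t (Suc i)) h2"
        "\<forall>y\<in>carrier (Q (Suc (Suc a))). h2 (\<delta> (Suc a) y) = \<zero>\<^bsub>t (Suc i)\<^esub>"
      "\<forall>x\<in>carrier (Q (Suc a)). p (Suc i) (h2 x) = h0 (\<delta> a x)"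
      using Suc.IH[of "Suc a" "Suc i", OF _ _ h1] Suc.prems(1,2) h1z by auto
    \<comment> \<open>As a cocycle, \<open>h2\<close> vanishes on the kernel of
      \<open>\<delta> a\<close>, so injectivity of \<open>t (Suc i)\<close> lets it extend along
      \<open>\<delta> a\<close>. Subtracting \<open>p (Suc i)\<close> after \<open>u\<close> then
      makes \<open>h0\<close> a cocycle without affecting its composite with
      \<open>p i\<close>.\<close>
    obtain u where u: "lin A (Q a) (t (Suc i)) u" "\<And>x. x \<in> carrier (Q (Suc a)) \<Longrightarrow> u (\<delta> a x) = h2 x"
    proof (rule inje_extend[OF ti' Qf Qf R(4) h2(1)])
      fix x assume "x \<in> carrier (Q (Suc a))" "\<delta> a x = \<zero>\<^bsub>Q a\<^esub>"
      then obtain y where "y \<in> carrier (Q (Suc (Suc a)))" "x = \<delta> (Suc a) y" using R(6)[of a] by blast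
      then show "h2 x = \<zero>\<^bsub>t (Suc i)\<^esub>" using h2(2) by simp
    qed (rule that)
    have pu: "lin A (Q a) (N (Suc i)) (\<lambda>x. p (Suc i) (u x))" using lin_comp[OF u(1) W'(4)] .
    have put: "lin A (Q a) (t i) (\<lambda>x. p (Suc i) (u x))" using lin_from_submod[OF pu[unfolded W(6)] ker] .
    have pp: "p i (p (Suc i) (u x)) = \<zero>\<^bsub>N i\<^esub>" if "x \<in> carrier (Q a)" for x using linD(1)[OF pu that] by (simp add: W(6))
    let ?h = "\<lambda>x. h0 x \<ominus>\<^bsub>t i\<^esub> p (Suc i) (u x)"
    have "lin A (Q a) (t i) ?h" using lin_difference[OF tl h0(1) put] .
    moreover have "?h (\<delta> a y) = \<zero>\<^bsub>t i\<^esub>" if y: "y \<in> carrier (Q (Suc a))" for y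
      using u(2)[OF y] h2(3) y ti.diff_self[OF linD(1)[OF h0(1) \<delta>c[OF y]]] by simp
    moreover have "p i (?h x) = g x" if x: "x \<in> carrier (Q a)" for x
      using lin_diff[OF tl Nl W(4) linD(1)[OF h0(1) x] linD(1)[OF put x]] pp[OF x] h0(2)[OF x] linD(1)[OF
          Suc.prems(3) x]
      by (simp add: Ni.M.minus_eq)
    ultimately show ?case by blast
  qed
  have im: "i \<le> m" using i by simp
  have fq: "lin A (Q 0) (N i) (\<lambda>x. f (q x))" using lin_comp[OF R(2) f] .
  have "\<forall>y\<in>carrier (Q (Suc 0)). f (q (\<delta> 0 y)) = \<zero>\<^bsub>N i\<^esub>"
  proof
    fix y assume "y \<in> carrier (Q (Suc 0))"
    then have "q (\<delta> 0 y) = \<zero>\<^bsub>T\<^esub>" using R(5) by blast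
    then show "f (q (\<delta> 0 y)) = \<zero>\<^bsub>N i\<^esub>" using lin_zero[OF fgD[OF T] fgD[OF Tw(1)[OF im]] f] by simp
  qed
  then obtain h where h: "lin A (Q 0) (t i) h" "\<forall>y\<in>carrier (Q (Suc 0)). h (\<delta> 0 y) = \<zero>\<^bsub>t i\<^esub>"
    "\<forall>x\<in>carrier (Q 0). p i (h x) = f (q x)" using main[of 0 k i, OF _ i fq] by auto
  obtain g where g: "lin A T (t i) g" "\<And>x. x \<in> carrier (Q 0) \<Longrightarrow> g (q x) = h x"
  proof (rule lin_factor[OF fgD[OF Qf] fgD[OF T] fgD[OF Tw(2)[OF im]] R(2,3) h(1)])
    fix x assume "x \<in> carrier (Q 0)" "q x = \<zero>\<^bsub>T\<^esub>"
    then obtain y where "y \<in> carrier (Q (Suc 0))" "x = \<delta> 0 y" using R(5) by blast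
    then show "h x = \<zero>\<^bsub>t i\<^esub>" using h(2) by simp
  qed (rule that)
  have "p i (g x) = f x" if x: "x \<in> carrier T" for x
  proof -
    obtain y where "y \<in> carrier (Q 0)" "x = q y" using R(3) x by blast
    then show ?thesis using g(2) h(3) by simp
  qed
  then show thesis using g(1) that by blast
qed

end

lemma (in left_module) diff_zero: assumes "x \<in> carrier M" shows "x \<ominus>\<^bsub>M\<^esub> \<zero>\<^bsub>M\<^esub> = x"
  using add_diff_cancel[of "\<zero>\<^bsub>M\<^esub>" x] assms by simp

section \<open>Comparison of syzygies\<close>

context fdalg
begin

text \<open>Each summand \<open>M \<rightarrow> L \<rightarrow> M\<close> of \<open>\<phi>\<close>
  lifts to maps \<open>r'\<close> and \<open>s'\<close> between the projectives \<open>W\<close> and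
  \<open>Q\<close>. The lifts restrict to the kernels, so on \<open>M'\<close> the map
  \<open>\<psi>\<close> is a sum through \<open>L'\<close>. A map \<open>g\<close> to
  \<open>T\<close>, composed with \<open>s'\<close>, extends from \<open>L'\<close> to
  \<open>Q\<close>, and composition with \<open>r'\<close> then yields the extension to
  \<open>W\<close>.\<close>

lemma syzygy_fac_step:
  assumes W: "proj W" and Q: "proj Q" and M: "fg_module A M" and L: "fg_module A L" and T: "left_module A T"
    and \<pi>: "lin A W M \<pi>" "\<pi> ` carrier W = carrier M" and \<rho>: "lin A Q L \<rho>" "\<rho> ` carrier Q = carrier L"
    and M': "M' = {x \<in> carrier W. \<pi> x = \<zero>\<^bsub>M\<^esub>}" and L': "L' = {x \<in> carrier Q. \<rho> x = \<zero>\<^bsub>L\<^esub>}"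
    and ext: "\<And>g. lin A (submod Q L') T g \<Longrightarrow> \<exists>h. lin A Q T h \<and> (\<forall>x\<in>L'. h x = g x)"
    and \<phi>: "fac A L M M \<phi>"
  shows "\<exists>\<psi>. lin A W W \<psi> \<and> (\<forall>x\<in>carrier W. \<pi> (\<psi> x) = \<phi> (\<pi> x)) \<and>
    fac A (submod Q L') (submod W M') (submod W M') \<psi> \<and>
    (\<forall>g. lin A (submod W M') T g \<longrightarrow> (\<exists>h. lin A W T h \<and> (\<forall>x\<in>M'. h x = g (\<psi> x))))"
  using \<phi>
proof induction
  case (fac_zero \<phi>)
  note Wl = fgD[OF proj_fg[OF W]] and Ml = fgD[OF M]
  have "submodule M' A W" unfolding M' using kernel_submodule[OF Wl Ml \<pi>(1)] .
  then have M'l: "left_module A (submod W M')" using submodule_left_module[OF Wl] by blast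
  show ?case
  proof (intro exI[of _ "\<lambda>_. \<zero>\<^bsub>W\<^esub>"] conjI ballI allI impI)
    show "lin A W W (\<lambda>_. \<zero>\<^bsub>W\<^esub>)" using lin_const_zero[OF Wl] .
    show "\<pi> \<zero>\<^bsub>W\<^esub> = \<phi> (\<pi> x)" if "x \<in> carrier W" for x
      using fac_zero[OF linD(1)[OF \<pi>(1) that]] lin_zero[OF Wl Ml \<pi>(1)] by simp
    show "fac A (submod Q L') (submod W M') (submod W M') (\<lambda>_. \<zero>\<^bsub>W\<^esub>)" by (rule fac.fac_zero) simp
    show "\<exists>h. lin A W T h \<and> (\<forall>x\<in>M'. h x = g \<zero>\<^bsub>W\<^esub>)" if "lin A (submod W M') T g" for g
      using lin_const_zero[OF T] lin_zero[OF M'l T that] by (intro exI[of _ "\<lambda>_. \<zero>\<^bsub>T\<^esub>"]) simp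
  qed
next
  case (fac_step \<phi> r s \<phi>')
  note Wl = fgD[OF proj_fg[OF W]] and Ml = fgD[OF M] and Ql = fgD[OF proj_fg[OF Q]] and Ll = fgD[OF L]
  interpret W: left_module A W by (rule Wl)
  interpret T: left_module A T by fact
  have M's: "submodule M' A W" unfolding M' using kernel_submodule[OF Wl Ml \<pi>(1)] .
  have L's: "submodule L' A Q" unfolding L' using kernel_submodule[OF Ql Ll \<rho>(1)] .
  obtain \<psi> where \<psi>: "lin A W W \<psi>" "\<forall>x\<in>carrier W. \<pi> (\<psi> x) = \<phi> (\<pi> x)" "fac A (submod Q L') (submod W M') (submod W M') \<psi>"
    and \<psi>T: "\<And>g. lin A (submod W M') T g \<Longrightarrow> \<exists>h. lin A W T h \<and> (\<forall>x\<in>M'. h x = g (\<psi> x))"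
    using fac_step.IH by blast
  have r\<pi>: "lin A W L (\<lambda>x. r (\<pi> x))" using lin_comp[OF \<pi>(1) fac_step.hyps(2)] .
  obtain r' where r': "lin A W Q r'" "\<And>x. x \<in> carrier W \<Longrightarrow> \<rho> (r' x) = r (\<pi> x)"
    using proj_lift[OF W proj_fg[OF Q] L \<rho>(1) r\<pi>] \<rho>(2) linD(1)[OF r\<pi>] by metis
  have s\<rho>: "lin A Q M (\<lambda>x. s (\<rho> x))" using lin_comp[OF \<rho>(1) fac_step.hyps(3)] .
  obtain s' where s': "lin A Q W s'" "\<And>x. x \<in> carrier Q \<Longrightarrow> \<pi> (s' x) = s (\<rho> x)"
    using proj_lift[OF Q proj_fg[OF W] M \<pi>(1) s\<rho>] \<pi>(2) linD(1)[OF s\<rho>] by metis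
  have r0: "r \<zero>\<^bsub>M\<^esub> = \<zero>\<^bsub>L\<^esub>" and s0: "s \<zero>\<^bsub>L\<^esub> = \<zero>\<^bsub>M\<^esub>"
    using lin_zero[OF Ml Ll fac_step.hyps(2)] lin_zero[OF Ll Ml fac_step.hyps(3)] .
  have r'': "lin A (submod W M') (submod Q L') r'"
    by (rule lin_into_submod[OF lin_on_submod[OF r'(1)]]) (use r' r0 linD(1)[OF r'(1)] in \<open>auto simp: M' L'\<close>)
  have s'': "lin A (submod Q L') (submod W M') s'"
    by (rule lin_into_submod[OF lin_on_submod[OF s'(1)]]) (use s' s0 linD(1)[OF s'(1)] in \<open>auto simp: M' L'\<close>)
  let ?\<psi> = "\<lambda>x. \<psi> x \<oplus>\<^bsub>W\<^esub> s' (r' x)"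
  have 1: "lin A W W ?\<psi>" using lin_sum[OF Wl \<psi>(1) lin_comp[OF r'(1) s'(1)]] .
  have 2: "\<pi> (?\<psi> x) = \<phi>' (\<pi> x)" if x: "x \<in> carrier W" for x
    using linD(2)[OF \<pi>(1) linD(1)[OF \<psi>(1) x] linD(1)[OF s'(1) linD(1)[OF r'(1) x]]] \<psi>(2) x
      s'(2)[OF linD(1)[OF r'(1) x]] r'(2)[OF x] fac_step.hyps(4)[OF linD(1)[OF \<pi>(1) x]] by simp
  have 3: "fac A (submod Q L') (submod W M') (submod W M') ?\<psi>"
    by (rule fac.fac_step[OF \<psi>(3) r'' s'']) simp
  have 4: "\<exists>h. lin A W T h \<and> (\<forall>x\<in>M'. h x = g (?\<psi> x))" if g: "lin A (submod W M') T g" for g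
  proof -
    obtain h where h: "lin A W T h" "\<forall>x\<in>M'. h x = g (\<psi> x)" using \<psi>T[OF g] by blast
    obtain k where k: "lin A Q T k" "\<forall>x\<in>L'. k x = g (s' x)" using ext[OF lin_comp[OF s'' g]] by blast
    have "h x \<oplus>\<^bsub>T\<^esub> k (r' x) = g (?\<psi> x)" if x: "x \<in> M'" for x
    proof -
      have rx: "r' x \<in> L'" using linD(1)[OF r'', of x] x by simp
      have sx: "s' (r' x) \<in> M'" using linD(1)[OF s'', of "r' x"] rx by simp
      have px: "\<psi> x \<in> M'" using linD(1)[OF fac_lin[OF submodule_left_module[OF Wl M's] submodule_left_module[OF
          Wl M's] \<psi>(3)], of x] x by simp
      show ?thesis using linD(2)[OF g, of "\<psi> x" "s' (r' x)"] px sx h(2) k(2) x rx by simp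
    qed
    then show ?thesis using lin_sum[OF T h(1) lin_comp[OF r'(1) k(1)]] by blast
  qed
  show ?case using 1 2 3 4 by blast
qed

text \<open>If \<open>id_M\<close> is, up to maps through a projective module, a sum of maps factoring through \<open>L\<close>,
  then the same holds for the syzygies.\<close>

lemma syzygy_step:
  assumes W: "proj W" and Q: "proj Q" and M: "fg_module A M" and L: "fg_module A L" and T: "left_module A T"
    and \<pi>: "lin A W M \<pi>" "\<pi> ` carrier W = carrier M" and \<rho>: "lin A Q L \<rho>" "\<rho> ` carrier Q = carrier L"
    and M': "M' = {x \<in> carrier W. \<pi> x = \<zero>\<^bsub>M\<^esub>}" and L': "L' = {x \<in> carrier Q. \<rho> x = \<zero>\<^bsub>L\<^esub>}"
    and ext: "\<And>g. lin A (submod Q L') T g \<Longrightarrow> \<exists>h. lin A Q T h \<and> (\<forall>x\<in>L'. h x = g x)"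
    and \<phi>: "fac A L M M \<phi>" and W'': "proj W''" and \<iota>: "lin A M W'' \<iota>" and u: "lin A W'' M u"
    and dec: "\<And>x. x \<in> carrier M \<Longrightarrow> x = \<phi> x \<oplus>\<^bsub>M\<^esub> u (\<iota> x)"
  obtains \<phi>' u' where "fac A (submod Q L') (submod W M') (submod W M') \<phi>'" "lin A W (submod W M') u'"
    "\<And>x. x \<in> M' \<Longrightarrow> x = \<phi>' x \<oplus>\<^bsub>W\<^esub> u' x"
    "\<And>g. lin A (submod W M') T g \<Longrightarrow> \<exists>h. lin A W T h \<and> (\<forall>x\<in>M'. h x = g x)"
proof -
  note Wl = fgD[OF proj_fg[OF W]] and Ml = fgD[OF M]
  interpret W: left_module A W by (rule Wl)
  interpret M: left_module A M by (rule Ml)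
  have M's: "submodule M' A W" unfolding M' using kernel_submodule[OF Wl Ml \<pi>(1)] .
  obtain \<psi> where \<psi>: "lin A W W \<psi>" "\<forall>x\<in>carrier W. \<pi> (\<psi> x) = \<phi> (\<pi> x)" "fac A (submod Q L') (submod W M') (submod W M') \<psi>"
    and \<psi>T: "\<And>g. lin A (submod W M') T g \<Longrightarrow> \<exists>h. lin A W T h \<and> (\<forall>x\<in>M'. h x = g (\<psi> x))"
    using syzygy_fac_step[OF W Q M L T \<pi> \<rho> M' L' ext \<phi>] by blast
  obtain v where v: "lin A W'' W v" "\<And>x. x \<in> carrier W'' \<Longrightarrow> \<pi> (v x) = u x"
    using proj_lift[OF W'' proj_fg[OF W] M \<pi>(1) u] \<pi>(2) linD(1)[OF u] by metis
  have v\<iota>: "lin A W W (\<lambda>x. v (\<iota> (\<pi> x)))" using lin_comp[OF lin_comp[OF \<pi>(1) \<iota>] v(1)] .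
  have l\<psi>: "lin A W W (\<lambda>x. x \<ominus>\<^bsub>W\<^esub> \<psi> x)" using lin_difference[OF Wl lin_id \<psi>(1)] .
  \<comment> \<open>\<open>\<psi>\<close> and \<open>v \<iota> \<pi>\<close> lift the two parts of
    the identity of \<open>M\<close>; what they miss of the identity of \<open>W\<close> has values
    in \<open>M'\<close>. On \<open>M'\<close> itself the term with \<open>v\<close> vanishes, so
    there \<open>x\<close> is the sum of \<open>\<psi> x\<close> and \<open>?u x\<close>.\<close>
  let ?u = "\<lambda>x. (x \<ominus>\<^bsub>W\<^esub> \<psi> x) \<ominus>\<^bsub>W\<^esub> v (\<iota> (\<pi> x))"
  have U: "lin A W W ?u" using lin_difference[OF Wl l\<psi> v\<iota>] .
  have "\<pi> (?u x) = \<zero>\<^bsub>M\<^esub>" if x: "x \<in> carrier W" for x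
  proof -
    have c: "\<pi> x \<in> carrier M" "\<phi> (\<pi> x) \<in> carrier M" "u (\<iota> (\<pi> x)) \<in> carrier M"
      using linD(1)[OF \<pi>(1) x] linD(1)[OF fac_lin[OF Ml Ml \<phi>] linD(1)[OF \<pi>(1) x]]
        linD(1)[OF u linD(1)[OF \<iota> linD(1)[OF \<pi>(1) x]]] .
    have "\<pi> (?u x) = (\<pi> x \<ominus>\<^bsub>M\<^esub> \<phi> (\<pi> x)) \<ominus>\<^bsub>M\<^esub> u (\<iota> (\<pi> x))"
      using lin_diff[OF Wl Ml \<pi>(1) linD(1)[OF l\<psi> x] linD(1)[OF v\<iota> x]] lin_diff[OF Wl Ml \<pi>(1) x linD(1)[OF \<psi>(1) x]]
        \<psi>(2) x v(2)[OF linD(1)[OF \<iota> c(1)]] by simp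
    moreover have "\<pi> x \<ominus>\<^bsub>M\<^esub> \<phi> (\<pi> x) = u (\<iota> (\<pi> x)) \<ominus>\<^bsub>M\<^esub> \<zero>\<^bsub>M\<^esub>"
      using dec[OF c(1)] c by (intro M.add_eq_imp_diff_eq) auto
    ultimately show ?thesis using c M.diff_self M.diff_zero by simp
  qed
  then have 1: "lin A W (submod W M') ?u"
    using linD(1)[OF U] by (intro lin_into_submod[OF U]) (simp add: M')
  have 2: "x = \<psi> x \<oplus>\<^bsub>W\<^esub> ?u x" if x: "x \<in> M'" for x
  proof -
    have xW: "x \<in> carrier W" "\<pi> x = \<zero>\<^bsub>M\<^esub>" using x by (auto simp: M')
    have "v (\<iota> (\<pi> x)) = \<zero>\<^bsub>W\<^esub>" using xW(2) lin_zero[OF Ml fgD[OF proj_fg[OF W'']] \<iota>]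
      lin_zero[OF fgD[OF proj_fg[OF W'']] Wl v(1)] by simp
    then show ?thesis using W.add_diff_cancel[OF linD(1)[OF \<psi>(1) xW(1)] xW(1)] linD(1)[OF l\<psi> xW(1)]
      by (simp add: W.diff_zero)
  qed
  \<comment> \<open>\<open>g\<close> after \<open>?u\<close> is already defined on all of
    \<open>W\<close>; only \<open>g\<close> after \<open>\<psi>\<close> has to be extended.\<close>
  have 3: "\<exists>h. lin A W T h \<and> (\<forall>x\<in>M'. h x = g x)" if g: "lin A (submod W M') T g" for g
  proof -
    obtain h where h: "lin A W T h" "\<forall>x\<in>M'. h x = g (\<psi> x)" using \<psi>T[OF g] by blast
    have "h x \<oplus>\<^bsub>T\<^esub> g (?u x) = g x" if x: "x \<in> M'" for x
    proof -
      have xW: "x \<in> carrier W" using x by (auto simp: M')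
      have ux: "?u x \<in> M'" using linD(1)[OF 1 xW] by simp
      have px: "\<psi> x \<in> M'" using linD(1)[OF fac_lin[OF submodule_left_module[OF Wl M's] submodule_left_module[OF
          Wl M's] \<psi>(3)], of x] x by simp
      have "g (\<psi> x \<oplus>\<^bsub>W\<^esub> ?u x) = g (\<psi> x) \<oplus>\<^bsub>T\<^esub> g (?u x)" using linD(2)[OF g, of "\<psi> x" "?u x"] px ux by simp
      then show ?thesis using 2[OF x] h(2) x by simp
    qed
    then show ?thesis using lin_sum[OF T h(1) lin_comp[OF 1 g]] by blast
  qed
  show thesis using that[OF \<psi>(3) 1 2 3] .
qed

text \<open>\<open>g\<close> after \<open>\<delta> i\<close> is a cocycle in degree
  \<open>i + 1\<close>, hence of the form \<open>h\<close> after \<open>\<delta> i\<close> with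
  \<open>h\<close> defined on \<open>Q i\<close>; on the image of \<open>\<delta> i\<close> the maps
  \<open>h\<close> and \<open>g\<close> coincide.\<close>

lemma Ext_vanishes_extend:
  assumes res: "projective_resolution TYPE(nat \<Rightarrow> 'k) A Q \<delta> q M" and N: "left_module A N"
    and E: "Ext_vanishes TYPE(nat \<Rightarrow> 'k) A (Suc i) M N"
    and Z: "Z = \<delta> i ` carrier (Q (Suc i))"
    and g: "lin A (submod (Q i) Z) N g"
  shows "\<exists>h. lin A (Q i) N h \<and> (\<forall>x\<in>Z. h x = g x)"
proof -
  note R = projective_resolutionD[OF res]
  have Ql: "left_module A (Q i)" for i using fgD[OF proj_fg[OF R(1)]] .
  interpret N: left_module A N by fact
  have \<delta>Z: "lin A (Q (Suc i)) (submod (Q i) Z) (\<delta> i)" using R(4) by (rule lin_into_submod) (auto simp: Z)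
  have Zl: "left_module A (submod (Q i) Z)"
    unfolding Z using submodule_left_module[OF Ql range_submodule[OF Ql Ql R(4)]] .
  let ?f = "\<lambda>x\<in>carrier (Q (Suc i)). g (\<delta> i x)"
  have f: "?f \<in> mod_hom A (Q (Suc i)) N" using lin_restrict[OF Ql lin_comp[OF \<delta>Z g]] .
  have "\<delta> i (\<delta> (Suc i) y) = \<zero>\<^bsub>Q i\<^esub>" if "y \<in> carrier (Q (Suc (Suc i)))" for y using R(6)[of i] that by blast
  then have "g (\<delta> i (\<delta> (Suc i) y)) = \<zero>\<^bsub>N\<^esub>" if "y \<in> carrier (Q (Suc (Suc i)))" for y
    using that lin_zero[OF Zl N g] by simp
  then have "?f \<in> a_kernel (Hom A (Q (Suc i)) N) (Hom A (Q (Suc (Suc i))) N)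
      (precomp A (Q (Suc (Suc i))) (Q (Suc i)) N (\<delta> (Suc i)))"
    using f linD(1)[OF R(4), of _ "Suc i"]
    by (auto simp: a_kernel_def' Hom_def precomp_def compose_def fun_eq_iff)
  moreover have "precomp A (Q (Suc i)) (Q i) N (\<delta> i) ` mod_hom A (Q i) N =
    a_kernel (Hom A (Q (Suc i)) N) (Hom A (Q (Suc (Suc i))) N) (precomp A (Q (Suc (Suc i))) (Q (Suc i)) N (\<delta> (Suc i)))"
    using E res unfolding Ext_vanishes_def by fastforce
  ultimately obtain h where h: "h \<in> mod_hom A (Q i) N" "?f = precomp A (Q (Suc i)) (Q i) N (\<delta> i) h" by blast
  have "h x = g x" if x: "x \<in> Z" for x
  proof -
    obtain y where y: "y \<in> carrier (Q (Suc i))" "x = \<delta> i y" using x Z by auto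
    have "?f y = h (\<delta> i y)" using h y(1) by (simp add: precomp_def compose_def)
    then show ?thesis using y by simp
  qed
  then show ?thesis using mod_homD[OF h(1)] by blast
qed

lemma tilting_coresolutionD:
  assumes "tilting_coresolution A k T j t d"
  shows "\<And>i. i \<le> k \<Longrightarrow> t i \<in> add_cat A T" "carrier (t (Suc k)) = {\<zero>\<^bsub>t (Suc k)\<^esub>}" "left_module A (t (Suc k))"
    "lin A (regular A) (t 0) j" "inj_on j (carrier A)" "\<And>i. i \<le> k \<Longrightarrow> lin A (t i) (t (Suc i)) (d i)"
    "j ` carrier A = {x \<in> carrier (t 0). d 0 x = \<zero>\<^bsub>t (Suc 0)\<^esub>}"
    "\<And>i. i < k \<Longrightarrow> d i ` carrier (t i) = {x \<in> carrier (t (Suc i)). d (Suc i) x = \<zero>\<^bsub>t (Suc (Suc i))\<^esub>}"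
  using assms by (auto simp: tilting_coresolution_def left_exact_def a_kernel_def' less_Suc_eq_le dest: mod_homD)

text \<open>This is what keeps the coresolution exact under \<open>Hom(-, T)\<close>. Its last term
  is in \<open>add T\<close>, so the kernels, counted from the right end, can be compared with the
  syzygies of \<open>T\<close>. From the latter, maps to \<open>T\<close> extend because the
  self-extensions vanish, and \<open>syzygy_step\<close> transports this property.\<close>

lemma special_coresolution_extend:
  assumes T: "fg_module A T" and pd: "pdim_le TYPE(nat \<Rightarrow> 'k) A n T"
    and E: "\<And>i. i > 0 \<Longrightarrow> Ext_vanishes TYPE(nat \<Rightarrow> 'k) A i T T"
    and tc: "tilting_coresolution A k T j t d" and P: "\<And>i. i < k \<Longrightarrow> proj (t i)"
    and c: "c < k" and g: "lin A (submod (t c) {x \<in> carrier (t c). d c x = \<zero>\<^bsub>t (Suc c)\<^esub>}) T g"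
  shows "\<exists>h. lin A (t c) T h \<and> (\<forall>x \<in> carrier (t c). d c x = \<zero>\<^bsub>t (Suc c)\<^esub> \<longrightarrow> h x = g x)"
proof -
  obtain Q \<delta> q where res: "projective_resolution TYPE(nat \<Rightarrow> 'k) A Q \<delta> q T" using pd by (auto simp: pdim_le_def)
  note R = projective_resolutionD[OF res] and D = tilting_coresolutionD[OF tc]
  have Tl: "left_module A T" using T by (rule fgD)
  have Qf: "fg_module A (Q i)" for i using proj_fg[OF R(1)] .
  have tf: "fg_module A (t i)" if "i \<le> k" for i using D(1)[OF that] by (auto simp: add_cat_def)
  define Z where "Z c = {x \<in> carrier (t c). d c x = \<zero>\<^bsub>t (Suc c)\<^esub>}" for c
  define Y where "Y i = \<delta> i ` carrier (Q (Suc i))" for i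
  have tl: "left_module A (t i)" if "i \<le> Suc k" for i using fgD[OF tf] D(3) that by (cases "i = Suc k") auto
  have Zs: "submodule (Z i) A (t i)" if "i \<le> k" for i
    unfolding Z_def using kernel_submodule[OF tl tl D(6)] that by simp
  have Ys: "submodule (Y i) A (Q i)" for i unfolding Y_def using range_submodule[OF fgD[OF Qf] fgD[OF Qf] R(4)] .
  have ext: "\<exists>h. lin A (Q i) T h \<and> (\<forall>x\<in>Y i. h x = g x)" if "lin A (submod (Q i) (Y i)) T g" for i g
    using Ext_vanishes_extend[OF res Tl E Y_def that] by simp
  \<comment> \<open>\<open>n\<close> counts from the right: the kernel of
    \<open>d (k - Suc n)\<close> is matched with \<open>Y n\<close>, the syzygy of \<open>T\<close>
    of order \<open>n + 1\<close>. The decomposition of the identity is carried along since it is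
    the input of the next step.\<close>
  have main: "(\<exists>\<phi> u. fac A (submod (Q n) (Y n)) (submod (t (k - Suc n)) (Z (k - Suc n))) (submod (t (k - Suc n))
      (Z (k - Suc n))) \<phi> \<and>
      lin A (t (k - Suc n)) (submod (t (k - Suc n)) (Z (k - Suc n))) u \<and>
      (\<forall>x\<in>Z (k - Suc n). x = \<phi> x \<oplus>\<^bsub>t (k - Suc n)\<^esub> u x)) \<and>
    (\<forall>g. lin A (submod (t (k - Suc n)) (Z (k - Suc n))) T g \<longrightarrow>
      (\<exists>h. lin A (t (k - Suc n)) T h \<and> (\<forall>x\<in>Z (k - Suc n). h x = g x)))" if "n < k" for n
    using that
  proof (induction n)
    case 0
    define c where "c = k - Suc 0"
    have ck: "c < k" "Suc c = k" using 0 by (auto simp: c_def)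
    have tk: "fg_module A (t k)" using tf by simp
    interpret tk: left_module A "t k" using tk by (rule fgD)
    have "d k x = \<zero>\<^bsub>t (Suc k)\<^esub>" if "x \<in> carrier (t k)" for x using linD(1)[OF D(6)[of k] that] D(2) by simp
    then have surj: "d c ` carrier (t c) = carrier (t k)" using D(8)[OF ck(1)] ck(2) by auto
    have dc: "lin A (t c) (t k) (d c)" using D(6)[of c] ck by simp
    have kc: "Z c = {x \<in> carrier (t c). d c x = \<zero>\<^bsub>t k\<^esub>}" using ck by (simp add: Z_def)
    \<comment> \<open>At the right end the identity of \<open>t k\<close> is itself a sum through
      \<open>T\<close>. The projective part is zero, with \<open>t c\<close> merely filling the
      place of the projective module.\<close>
    have id: "x = x \<oplus>\<^bsub>t k\<^esub> (\<lambda>_. \<zero>\<^bsub>t k\<^esub>) ((\<lambda>_. \<zero>\<^bsub>t c\<^esub>) x)" if "x \<in> carrier (t k)" for x using that by simp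
    show ?case
      by (rule syzygy_step[OF P[OF ck(1)] R(1) tk T Tl dc surj R(2,3) kc R(5)[folded Y_def] ext
          add_cat_fac[OF Tl D(1)[OF order_refl]] P[OF ck(1)] lin_const_zero[OF tl] lin_const_zero[OF fgD[OF tk]] id])
        (use ck in \<open>auto simp flip: c_def\<close>)
  next
    case (Suc n)
    define c where "c = k - Suc (Suc n)"
    have ck: "c < k" "Suc c < k" "k - Suc n = Suc c" using Suc.prems by (auto simp: c_def)
    obtain \<phi> u where \<phi>: "fac A (submod (Q n) (Y n)) (submod (t (Suc c)) (Z (Suc c))) (submod (t (Suc c)) (Z (Suc c))) \<phi>"
      and u: "lin A (t (Suc c)) (submod (t (Suc c)) (Z (Suc c))) u" and dec: "\<forall>x\<in>Z (Suc c). x = \<phi> x \<oplus>\<^bsub>t (Suc c)\<^esub> u x"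
      using Suc.IH Suc.prems ck by auto
    have Zf: "fg_module A (submod (t (Suc c)) (Z (Suc c)))" using fg_submod[OF tf Zs] ck by simp
    have Yf: "fg_module A (submod (Q n) (Y n))" using fg_submod[OF Qf Ys] .
    have dc: "lin A (t c) (submod (t (Suc c)) (Z (Suc c))) (d c)"
        "d c ` carrier (t c) = carrier (submod (t (Suc c)) (Z (Suc c)))"
      using lin_into_submod[OF D(6)[of c], of "Z (Suc c)"] D(8)[of c] ck by (auto simp: Z_def)
    have \<delta>n: "lin A (Q (Suc n)) (submod (Q n) (Y n)) (\<delta> n)" "\<delta> n ` carrier (Q (Suc n)) = carrier (submod (Q n) (Y n))"
      using lin_into_submod[OF R(4), of n "Y n"] by (auto simp: Y_def)
    have kc: "Z c = {x \<in> carrier (t c). d c x = \<zero>\<^bsub>submod (t (Suc c)) (Z (Suc c))\<^esub>}" by (simp add: Z_def)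
    have kY: "Y (Suc n) = {x \<in> carrier (Q (Suc n)). \<delta> n x = \<zero>\<^bsub>submod (Q n) (Y n)\<^esub>}" using R(6)[of n] by (simp
        add: Y_def)
    \<comment> \<open>The previous \<open>u\<close> is defined on the whole projective
      \<open>t (Suc c)\<close>; on the kernel it therefore factors through the inclusion into that
      module, as the next comparison requires.\<close>
    have dec': "x = \<phi> x \<oplus>\<^bsub>submod (t (Suc c)) (Z (Suc c))\<^esub> u x" if "x \<in> carrier (submod (t (Suc c)) (Z (Suc c)))" for x
      using dec that by simp
    show ?case unfolding c_def[symmetric]
      by (rule syzygy_step[where \<iota> = "\<lambda>x. x" and u = u and \<phi> = \<phi>,
            OF P[OF ck(1)] R(1) Zf Yf Tl dc \<delta>n kc kY ext \<phi> P[OF ck(2)] lin_incl[OF Zs[OF less_imp_le[OF ck(2)]]]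
                u dec'])
        (use ck in auto)
  qed
  have "k - Suc (k - Suc c) = c" "k - Suc c < k" using c by auto
  then have "\<exists>h. lin A (t c) T h \<and> (\<forall>x\<in>Z c. h x = g x)" using main[of "k - Suc c"] g by (simp add: Z_def)
  then show ?thesis by (auto simp: Z_def)
qed

end

section \<open>Homomorphisms and endomorphism algebras\<close>

lemma Hom_simps [simp]:
  "carrier (Hom A M N) = mod_hom A M N" "\<zero>\<^bsub>Hom A M N\<^esub> = (\<lambda>x\<in>carrier M. \<zero>\<^bsub>N\<^esub>)"
  "f \<oplus>\<^bsub>Hom A M N\<^esub> g = (\<lambda>x\<in>carrier M. f x \<oplus>\<^bsub>N\<^esub> g x)"
  "c \<odot>\<^bsub>Hom A M N\<^esub> f = (\<lambda>x\<in>carrier M. (c \<odot>\<^bsub>A\<^esub> \<one>\<^bsub>A\<^esub>) \<odot>\<^bsub>N\<^esub> f x)"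
  unfolding Hom_def hom_struct_simps by simp_all

lemma End_alg_simps [simp]:
  "carrier (End_alg A M) = mod_hom A M M" "\<zero>\<^bsub>End_alg A M\<^esub> = (\<lambda>x\<in>carrier M. \<zero>\<^bsub>M\<^esub>)"
  "f \<oplus>\<^bsub>End_alg A M\<^esub> g = (\<lambda>x\<in>carrier M. f x \<oplus>\<^bsub>M\<^esub> g x)"
  "f \<otimes>\<^bsub>End_alg A M\<^esub> g = compose (carrier M) f g" "\<one>\<^bsub>End_alg A M\<^esub> = (\<lambda>x\<in>carrier M. x)"
  "c \<odot>\<^bsub>End_alg A M\<^esub> f = (\<lambda>x\<in>carrier M. (c \<odot>\<^bsub>A\<^esub> \<one>\<^bsub>A\<^esub>) \<odot>\<^bsub>M\<^esub> f x)"
  unfolding End_alg_def by (simp_all add: Hom_def hom_struct_def)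

lemma eval_module_simps [simp]:
  "carrier (eval_module M) = carrier M" "\<zero>\<^bsub>eval_module M\<^esub> = \<zero>\<^bsub>M\<^esub>" "x \<oplus>\<^bsub>eval_module M\<^esub> y = x \<oplus>\<^bsub>M\<^esub> y"
  "f \<odot>\<^bsub>eval_module M\<^esub> x = f x"
  by (simp_all add: eval_module_def)

lemma Hom_End_source_simps [simp]:
  "carrier (Hom_End_source A M N) = mod_hom A M N" "\<zero>\<^bsub>Hom_End_source A M N\<^esub> = (\<lambda>x\<in>carrier M. \<zero>\<^bsub>N\<^esub>)"
  "f \<oplus>\<^bsub>Hom_End_source A M N\<^esub> g = (\<lambda>x\<in>carrier M. f x \<oplus>\<^bsub>N\<^esub> g x)"
  "b \<odot>\<^bsub>Hom_End_source A M N\<^esub> f = compose (carrier M) f b"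
  unfolding Hom_End_source_def hom_struct_simps by simp_all

lemma Hom_End_target_simps [simp]:
  "carrier (Hom_End_target A M N) = mod_hom A M N" "\<zero>\<^bsub>Hom_End_target A M N\<^esub> = (\<lambda>x\<in>carrier M. \<zero>\<^bsub>N\<^esub>)"
  "f \<oplus>\<^bsub>Hom_End_target A M N\<^esub> g = (\<lambda>x\<in>carrier M. f x \<oplus>\<^bsub>N\<^esub> g x)"
  "b \<odot>\<^bsub>Hom_End_target A M N\<^esub> f = compose (carrier M) b f"
  unfolding Hom_End_target_def hom_struct_simps by simp_all

lemma mod_hom_closed: "f \<in> mod_hom R M N \<Longrightarrow> x \<in> carrier M \<Longrightarrow> f x \<in> carrier N"
  by (auto simp: mod_hom_iff lin_def)

lemma mod_hom_undefined: "f \<in> mod_hom R M N \<Longrightarrow> x \<notin> carrier M \<Longrightarrow> f x = undefined"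
  by (auto simp: mod_hom_iff extensional_def)

lemma mod_hom_compose:
  assumes "left_module R L" "f \<in> mod_hom R M N" "g \<in> mod_hom R L M"
  shows "compose (carrier L) f g \<in> mod_hom R L N"
  using lin_restrict[OF assms(1) lin_comp[OF mod_homD[OF assms(3)] mod_homD[OF assms(2)]]] by (simp add: compose_def)

lemma compose_id_right: "f \<in> mod_hom R M N \<Longrightarrow> compose (carrier M) f (\<lambda>x\<in>carrier M. x) = f"
  by (rule ext) (simp add: compose_def mod_hom_undefined[of f R M N])

lemma compose_id_left: "f \<in> mod_hom R M N \<Longrightarrow> compose (carrier M) (\<lambda>x\<in>carrier N. x) f = f"
  by (rule ext) (simp add: compose_def mod_hom_undefined[of f R M N] mod_hom_closed[of f R M N])

lemma compose_apply [simp]: "x \<in> C \<Longrightarrow> compose C f g x = f (g x)"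
  by (simp add: compose_def)

context fdalg
begin

lemma scalar_lin:
  assumes "left_module A M" "c \<in> carrier K" shows "lin A M M (\<lambda>x. (c \<odot>\<^bsub>A\<^esub> \<one>\<^bsub>A\<^esub>) \<odot>\<^bsub>M\<^esub> x)"
proof -
  interpret M: left_module A M by fact
  show ?thesis using assms(2) scalar
    by (intro linI) (auto simp: M.smult_closed M.smult_r_distr simp flip: M.smult_assoc1)
qed

lemma Hom_left_module:
  assumes M: "left_module A M" and N: "left_module A N" shows "left_module K (Hom A M N)"
proof -
  interpret N: left_module A N by fact
  show ?thesis unfolding Hom_def
  proof (rule hom_struct_left_module[OF M N ring_K])
    show "(\<lambda>x\<in>carrier M. (c \<odot>\<^bsub>A\<^esub> \<one>\<^bsub>A\<^esub>) \<odot>\<^bsub>N\<^esub> f x) \<in> mod_hom A M N" if "c \<in> carrier K" "f \<in> mod_hom A M N" for c f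
      using lin_restrict[OF M lin_comp[OF mod_homD[OF that(2)] scalar_lin[OF N that(1)]]] .
  qed (use scalar in \<open>auto simp: mod_hom_closed N.smult_r_distr N.smult_l_distr N.smult_one
      simp flip: N.smult_assoc1 intro: N.smult_closed\<close>)
qed

lemma vanishing_on_generators:
  assumes "left_module A M" "left_module A N" "f \<in> mod_hom A M N"
    and S: "S \<subseteq> carrier M" "\<And>U. submodule U A M \<Longrightarrow> S \<subseteq> U \<Longrightarrow> U = carrier M"
    and "\<And>s. s \<in> S \<Longrightarrow> f s = \<zero>\<^bsub>N\<^esub>"
  shows "f = (\<lambda>x\<in>carrier M. \<zero>\<^bsub>N\<^esub>)"
proof -
  have "{x \<in> carrier M. f x = \<zero>\<^bsub>N\<^esub>} = carrier M"
    using S(2)[OF kernel_submodule[OF assms(1,2) mod_homD[OF assms(3)]]] S(1) assms(6) by auto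
  then show ?thesis using mod_hom_undefined[OF assms(3)] by (auto simp: fun_eq_iff)
qed

text \<open>A homomorphism is determined by its values on generators of \<open>M\<close>. The record
  \<open>H\<close> is left open because endomorphism algebras and the modules \<open>HS\<close> and
  \<open>HT\<close> carry different structures on such spaces.\<close>

lemma fgen_hom_by_evaluation:
  fixes M :: "('a, 'm) module" and N :: "('a, 'n) module" and H :: "('k, 'm \<Rightarrow> 'n) module"
  assumes M: "fg_module A M" and N: "fg_module A N" and H: "left_module K H" "carrier H = mod_hom A M N"
    "\<zero>\<^bsub>H\<^esub> = (\<lambda>x\<in>carrier M. \<zero>\<^bsub>N\<^esub>)" "\<And>f g. f \<oplus>\<^bsub>H\<^esub> g = (\<lambda>x\<in>carrier M. f x \<oplus>\<^bsub>N\<^esub> g x)"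
    "\<And>c f x. \<lbrakk>c \<in> carrier K; f \<in> mod_hom A M N; x \<in> carrier M\<rbrakk> \<Longrightarrow> (c \<odot>\<^bsub>H\<^esub> f) x = (c \<odot>\<^bsub>A\<^esub> \<one>\<^bsub>A\<^esub>) \<odot>\<^bsub>N\<^esub> f x"
  shows "fgen K H"
proof -
  obtain S where S: "finite S" "S \<subseteq> carrier M" "\<And>U. submodule U A M \<Longrightarrow> S \<subseteq> U \<Longrightarrow> U = carrier M"
    using M by (auto simp: fg_module_iff fgen_def)
  show ?thesis
  proof (rule fgen_joint_injective[OF field_K H(1) K_space_left_module[OF fgD[OF N]] _ finite_imageI[OF S(1)],
        of "\<lambda>s f. f s"])
    show "fgen K (K_space A N)" using N by (simp add: fg_iff)
    show "lin K H (K_space A N) e" if "e \<in> (\<lambda>s f. f s) ` S" for e :: "('m \<Rightarrow> 'n) \<Rightarrow> 'n"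
      using that S(2) H by (auto intro!: linI simp: mod_hom_closed)
    show "f = \<zero>\<^bsub>H\<^esub>" if "f \<in> carrier H" "\<forall>e\<in>(\<lambda>s f. f s) ` S. e f = \<zero>\<^bsub>K_space A N\<^esub>" for f
      using vanishing_on_generators[OF fgD[OF M] fgD[OF N] _ S(2,3), of f] that H by auto
  qed
qed

lemma dual_lin:
  assumes "left_module A M" "left_module A N" "lin A M N f"
  shows "lin (op_alg A) (dual K A N) (dual K A M) (\<lambda>\<xi>. \<lambda>x\<in>carrier M. \<xi> (f x))"
proof (rule linI)
  interpret M: left_module A M by fact
  fix \<xi> assume "\<xi> \<in> carrier (dual K A N)"
  then show "(\<lambda>x\<in>carrier M. \<xi> (f x)) \<in> carrier (dual K A M)"
    using lin_restrict[OF K_space_left_module[OF assms(1)] lin_comp[OF K_space_lin[OF assms(3)] mod_homD, of \<xi>]] by simp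
next
  fix \<xi> \<eta> assume "\<xi> \<in> carrier (dual K A N)" "\<eta> \<in> carrier (dual K A N)"
  then show "(\<lambda>x\<in>carrier M. (\<xi> \<oplus>\<^bsub>dual K A N\<^esub> \<eta>) (f x)) = (\<lambda>x\<in>carrier M. \<xi> (f x)) \<oplus>\<^bsub>dual K A M\<^esub> (\<lambda>x\<in>carrier M. \<eta> (f x))"
    using linD(1)[OF assms(3)] by (auto simp: fun_eq_iff)
next
  interpret M: left_module A M by fact
  fix a \<xi> assume "a \<in> carrier (op_alg A)" "\<xi> \<in> carrier (dual K A N)"
  then show "(\<lambda>x\<in>carrier M. (a \<odot>\<^bsub>dual K A N\<^esub> \<xi>) (f x)) = a \<odot>\<^bsub>dual K A M\<^esub> (\<lambda>x\<in>carrier M. \<xi> (f x))"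
    using linD(1,3)[OF assms(3)] by (auto simp: fun_eq_iff M.smult_closed)
qed

end

section \<open>The endomorphism algebra and the functors \<open>Hom(T, -)\<close> and
  \<open>D Hom(-, T)\<close>\<close>

locale endo = fdalg K A for K :: "'k ring" and A :: "('k, 'a) module" +
  fixes T :: "('a, 't) module"
  assumes T: "fg_module A T"
begin

abbreviation "S \<equiv> End_alg A T"
abbreviation "B \<equiv> op_alg (End_alg A T)"
abbreviation "HS \<equiv> Hom_End_source A T"
abbreviation "HT \<equiv> \<lambda>X. Hom_End_target A X T"
abbreviation "DHT \<equiv> \<lambda>X. dual K (End_alg A T) (Hom_End_target A X T)"

lemma Tl: "left_module A T"
  using T by (rule fgD)

sublocale T: left_module A T
  by (rule Tl)

lemma one_S: "(\<lambda>x\<in>carrier T. x) \<in> mod_hom A T T"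
  using lin_restrict[OF Tl lin_id] .

lemma S_left_module: "left_module K S"
  using Hom_left_module[OF Tl Tl] ring_K
  by (rule left_module_transfer[where f = "\<lambda>x. x"]) auto

lemma S_ring: "ring S"
proof -
  interpret S: left_module K S by (rule S_left_module)
  show ?thesis
  proof (rule ringI)
    show "abelian_group S" by (rule S.M.abelian_group_axioms)
    show "Group.monoid S"
    proof (rule Group.monoidI)
      fix f g h assume *: "f \<in> carrier S" "g \<in> carrier S" "h \<in> carrier S"
      then show "f \<otimes>\<^bsub>S\<^esub> g \<otimes>\<^bsub>S\<^esub> h = f \<otimes>\<^bsub>S\<^esub> (g \<otimes>\<^bsub>S\<^esub> h)"
        using mod_hom_closed[of h A T T] by (intro ext) (simp add: compose_def)
    qed (use mod_hom_compose[OF Tl] one_S compose_id_left compose_id_right in simp_all)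
    fix f g h assume *: "f \<in> carrier S" "g \<in> carrier S" "h \<in> carrier S"
    then show "(f \<oplus>\<^bsub>S\<^esub> g) \<otimes>\<^bsub>S\<^esub> h = f \<otimes>\<^bsub>S\<^esub> h \<oplus>\<^bsub>S\<^esub> g \<otimes>\<^bsub>S\<^esub> h" "h \<otimes>\<^bsub>S\<^esub> (f \<oplus>\<^bsub>S\<^esub> g) = h \<otimes>\<^bsub>S\<^esub> f \<oplus>\<^bsub>S\<^esub> h \<otimes>\<^bsub>S\<^esub> g"
      using mod_hom_closed[of f A T T] mod_hom_closed[of g A T T] mod_hom_closed[of h A T T] linD(2)[OF
          mod_homD, of h A T T]
      by (auto intro!: ext simp: compose_def)
  qed
qed

lemma S_fdalg: "fdalg K S"
proof
  interpret S: left_module K S by (rule S_left_module)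
  interpret K: field K by (rule field_K)
  have m: "module K S"
    by (intro module.intro module_axioms.intro K.is_cring S.M.abelian_group_axioms)
      (rule S.smult_closed S.smult_l_distr S.smult_r_distr S.smult_assoc1 S.smult_one; assumption)+
  have "fgen K S"
    by (rule fgen_hom_by_evaluation[OF T T S_left_module]) auto
  then have "finitely_generated K S" by (simp add: finitely_generated_iff_fgen[OF S_left_module])
  moreover have "compose (carrier T) (c \<odot>\<^bsub>S\<^esub> f) g = c \<odot>\<^bsub>S\<^esub> (compose (carrier T) f g)"
      "compose (carrier T) f (c \<odot>\<^bsub>S\<^esub> g) = c \<odot>\<^bsub>S\<^esub> (compose (carrier T) f g)"
    if "c \<in> carrier K" "f \<in> mod_hom A T T" "g \<in> mod_hom A T T" for c f g
    using that scalar(1) linD(3)[OF mod_homD[OF that(2)]] by (auto simp: fun_eq_iff compose_def mod_hom_closed)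
  ultimately show "fd_algebra K S" unfolding fd_algebra_def using m field_K S_ring by simp
qed

sublocale S: fdalg K S
  by (rule S_fdalg)

lemma B_fdalg: "fdalg K B"
  by (rule S.op_fdalg)

sublocale B: fdalg K B
  by (rule B_fdalg)

lemma HS_left_module: assumes "left_module A X" shows "left_module B (HS X)"
  unfolding Hom_End_source_def
proof (rule hom_struct_left_module[OF Tl assms B.ring_A])
  fix b c f x assume *: "b \<in> carrier B" "c \<in> carrier B" "f \<in> mod_hom A T X" "x \<in> carrier T"
  then have bc: "b x \<in> carrier T" "c x \<in> carrier T"
    using mod_hom_closed[of b A T T x] mod_hom_closed[of c A T T x] by simp_all
  show "compose (carrier T) f (b \<oplus>\<^bsub>B\<^esub> c) x = compose (carrier T) f b x \<oplus>\<^bsub>X\<^esub> compose (carrier T) f c x"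
    using *(4) bc linD(2)[OF mod_homD[OF *(3)]] by simp
  show "compose (carrier T) f (b \<otimes>\<^bsub>B\<^esub> c) x = compose (carrier T) (compose (carrier T) f c) b x"
    using *(4) bc by simp
next
  fix b f g x assume *: "b \<in> carrier B" "f \<in> mod_hom A T X" "g \<in> mod_hom A T X" "x \<in> carrier T"
  then show "compose (carrier T) (\<lambda>x\<in>carrier T. f x \<oplus>\<^bsub>X\<^esub> g x) b x =
      compose (carrier T) f b x \<oplus>\<^bsub>X\<^esub> compose (carrier T) g b x"
    using mod_hom_closed[of b A T T x] by simp
qed (use mod_hom_compose[OF Tl] in simp_all)

lemma HT_left_module: assumes "left_module A X" shows "left_module S (HT X)"
  unfolding Hom_End_target_def
proof (rule hom_struct_left_module[OF assms Tl S.ring_A])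
  fix b f g x assume *: "b \<in> carrier S" "f \<in> mod_hom A X T" "g \<in> mod_hom A X T" "x \<in> carrier X"
  then show "compose (carrier X) b (\<lambda>x\<in>carrier X. f x \<oplus>\<^bsub>T\<^esub> g x) x =
      compose (carrier X) b f x \<oplus>\<^bsub>T\<^esub> compose (carrier X) b g x"
    using mod_hom_closed[of f A X T x] mod_hom_closed[of g A X T x] linD(2)[OF mod_homD, of b A T T] by simp
qed (use mod_hom_compose[OF assms] mod_hom_closed[of _ A X T] in simp_all)

lemma HS_fg: assumes "fg_module A X" shows "fg_module B (HS X)"
proof -
  have X: "left_module A X" using assms by (rule fgD)
  have "fgen K (K_space B (HS X))"
    by (rule fgen_hom_by_evaluation[OF T assms B.K_space_left_module[OF HS_left_module[OF X]]])
      (use scalar(1) linD(3)[OF mod_homD, of _ A T X] T.smult_closed in simp_all)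
  then show ?thesis using HS_left_module[OF X] by (simp add: B.fg_iff)
qed

lemma HT_fg: assumes "fg_module A X" shows "fg_module S (HT X)"
proof -
  have X: "left_module A X" using assms by (rule fgD)
  have "fgen K (K_space S (HT X))"
    by (rule fgen_hom_by_evaluation[OF assms T S.K_space_left_module[OF HT_left_module[OF X]]])
      (use mod_hom_closed[of _ A X T] in simp_all)
  then show ?thesis using HT_left_module[OF X] by (simp add: S.fg_iff)
qed

lemma eval_left_module: "left_module S (eval_module T)"
proof -
  have "abelian_group (eval_module T)"
    by (rule abelian_groupI) (auto simp: T.M.a_ac intro: bexI[of _ "\<ominus>\<^bsub>T\<^esub> x" for x] T.M.l_neg)
  then show ?thesis
    by (intro left_module.intro left_module_axioms.intro S.ring_A)
      (use mod_hom_closed[of _ A T T] linD(2)[OF mod_homD, of _ A T T] in simp_all)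
qed

lemma eval_fg: "fg_module S (eval_module T)"
proof -
  have "lin K (K_space A T) (K_space S (eval_module T)) (\<lambda>x. x)" by (rule linI) auto
  moreover have "fgen K (K_space A T)" using T by (simp add: fg_iff)
  ultimately have "fgen K (K_space S (eval_module T))"
    using fgen_image[OF K_space_left_module[OF Tl] S.K_space_left_module[OF eval_left_module]] by auto
  then show ?thesis using eval_left_module by (simp add: S.fg_iff)
qed

abbreviation "DT \<equiv> dual K (End_alg A T) (eval_module T)"

lemma DT_fg: "fg_module B DT"
  using S.dual_fg[OF eval_fg] .

lemma DHT_fg: "fg_module A X \<Longrightarrow> fg_module B (DHT X)"
  using S.dual_fg[OF HT_fg] .

lemma DHT_left_module: "left_module A X \<Longrightarrow> left_module B (DHT X)"
  using S.dual_left_module[OF HT_left_module] .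

lemma HS_lin:
  assumes "left_module A X" "lin A X Y f" shows "lin B (HS X) (HS Y) (\<lambda>h. \<lambda>x\<in>carrier T. f (h x))"
proof (rule linI)
  fix h assume "h \<in> carrier (HS X)"
  then have "h \<in> mod_hom A T X" by simp
  from lin_restrict[OF Tl lin_comp[OF mod_homD[OF this] assms(2)]]
  show "(\<lambda>x\<in>carrier T. f (h x)) \<in> carrier (HS Y)" by simp
next
  fix h h' assume "h \<in> carrier (HS X)" "h' \<in> carrier (HS X)"
  then show "(\<lambda>x\<in>carrier T. f ((h \<oplus>\<^bsub>HS X\<^esub> h') x)) = (\<lambda>x\<in>carrier T. f (h x)) \<oplus>\<^bsub>HS Y\<^esub> (\<lambda>x\<in>carrier T. f (h' x))"
    using mod_hom_closed[of h A T X] mod_hom_closed[of h' A T X] linD(2)[OF assms(2)] by (auto simp: fun_eq_iff)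
next
  fix b h assume "b \<in> carrier B" "h \<in> carrier (HS X)"
  then show "(\<lambda>x\<in>carrier T. f ((b \<odot>\<^bsub>HS X\<^esub> h) x)) = b \<odot>\<^bsub>HS Y\<^esub> (\<lambda>x\<in>carrier T. f (h x))"
    using mod_hom_closed[of b A T T] by (auto simp: fun_eq_iff compose_def)
qed

lemma HT_lin:
  assumes "left_module A X" "lin A X Y f" shows "lin S (HT Y) (HT X) (\<lambda>h. \<lambda>x\<in>carrier X. h (f x))"
proof (rule linI)
  fix h assume "h \<in> carrier (HT Y)"
  then have "h \<in> mod_hom A Y T" by simp
  from lin_restrict[OF assms(1) lin_comp[OF assms(2) mod_homD[OF this]]]
  show "(\<lambda>x\<in>carrier X. h (f x)) \<in> carrier (HT X)" by simp
qed (use linD(1)[OF assms(2)] in \<open>auto simp: fun_eq_iff compose_def\<close>)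

lemma DHT_lin:
  assumes "left_module A X" "left_module A Y" "lin A X Y f"
  shows "lin B (DHT X) (DHT Y) (\<lambda>\<xi>. \<lambda>h\<in>mod_hom A Y T. \<xi> (\<lambda>x\<in>carrier X. h (f x)))"
  using S.dual_lin[OF HT_left_module[OF assms(2)] HT_left_module[OF assms(1)] HT_lin[OF assms(1,3)]] by simp

text \<open>An additive functor respects sums of maps through \<open>Z\<close>; in particular
  \<open>Hom(T, -)\<close> sends \<open>add PI\<close> to \<open>add P\<close>.\<close>

lemma HS_fac:
  assumes "left_module A Z" "left_module A X" "left_module A Y" "fac A Z X Y f"
  shows "fac B (HS Z) (HS X) (HS Y) (\<lambda>h. \<lambda>x\<in>carrier T. f (h x))"
  using assms(4)
proof induction
  case (fac_zero f)
  show ?case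
  proof (rule fac.fac_zero)
    fix h assume "h \<in> carrier (HS X)"
    then show "(\<lambda>x\<in>carrier T. f (h x)) = \<zero>\<^bsub>HS Y\<^esub>"
      using mod_hom_closed[of h A T X] fac_zero by (auto simp: fun_eq_iff)
  qed
next
  case (fac_step f r s h)
  show ?case
  proof (rule fac.fac_step[OF fac_step.IH HS_lin[OF assms(2) fac_step.hyps(2)] HS_lin[OF assms(1) fac_step.hyps(3)]])
    fix g assume "g \<in> carrier (HS X)"
    then show "(\<lambda>x\<in>carrier T. h (g x)) =
        (\<lambda>x\<in>carrier T. f (g x)) \<oplus>\<^bsub>HS Y\<^esub> (\<lambda>x\<in>carrier T. s ((\<lambda>x\<in>carrier T. r (g x)) x))"
      using mod_hom_closed[of g A T X] fac_step.hyps(4) by (auto simp: fun_eq_iff)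
  qed
qed

text \<open>\<open>D Hom(-, T)\<close> is covariant and additive, so it sends \<open>add PI\<close>
  to \<open>add I\<close>.\<close>

lemma DHT_fac:
  assumes "left_module A Z" "left_module A X" "left_module A Y" "fac A Z X Y f"
  shows "fac B (DHT Z) (DHT X) (DHT Y) (\<lambda>\<xi>. \<lambda>h\<in>mod_hom A Y T. \<xi> (\<lambda>x\<in>carrier X. h (f x)))"
  using assms(4)
proof induction
  case (fac_zero f)
  show ?case
  proof (rule fac.fac_zero)
    fix \<xi> assume \<xi>: "\<xi> \<in> carrier (DHT X)"
    have "\<xi> (\<lambda>x\<in>carrier X. h (f x)) = \<zero>\<^bsub>K\<^esub>" if h: "h \<in> mod_hom A Y T" for h
    proof -
      have "(\<lambda>x\<in>carrier X. h (f x)) = \<zero>\<^bsub>K_space S (HT X)\<^esub>"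
        using fac_zero lin_zero[OF assms(3) Tl mod_homD[OF h]] by (auto simp: fun_eq_iff)
      then show ?thesis
        using lin_zero[OF S.K_space_left_module[OF HT_left_module[OF assms(2)]] regular_left_module[OF ring_K]
            mod_homD, of \<xi>] \<xi>
        by simp
    qed
    then show "(\<lambda>h\<in>mod_hom A Y T. \<xi> (\<lambda>x\<in>carrier X. h (f x))) = \<zero>\<^bsub>DHT Y\<^esub>" by (auto simp: fun_eq_iff)
  qed
next
  case (fac_step f r s h)
  show ?case
  proof (rule fac.fac_step[OF fac_step.IH DHT_lin[OF assms(2,1) fac_step.hyps(2)] DHT_lin[OF assms(1,3)
      fac_step.hyps(3)]])
    fix \<xi> assume \<xi>: "\<xi> \<in> carrier (DHT X)"
    have f: "lin A X Y f" using fac_lin[OF assms(2,3) fac_step.hyps(1)] .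
    have "\<xi> (\<lambda>x\<in>carrier X. g (h x)) = \<xi> (\<lambda>x\<in>carrier X. g (f x)) \<oplus>\<^bsub>K\<^esub> \<xi> (\<lambda>x\<in>carrier X. g (s (r x)))"
      if g: "g \<in> mod_hom A Y T" for g
    proof -
      have c: "(\<lambda>x\<in>carrier X. g (f x)) \<in> mod_hom A X T" "(\<lambda>x\<in>carrier X. g (s (r x))) \<in> mod_hom A X T"
        using lin_restrict[OF assms(2) lin_comp[OF f mod_homD[OF g]]]
          lin_restrict[OF assms(2) lin_comp[OF lin_comp[OF fac_step.hyps(2,3)] mod_homD[OF g]]] .
      have eq: "(\<lambda>x\<in>carrier X. g (h x)) = (\<lambda>x\<in>carrier X. g (f x)) \<oplus>\<^bsub>K_space S (HT X)\<^esub> (\<lambda>x\<in>carrier X. g (s (r x)))"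
        using fac_step.hyps(4) linD(1)[OF f] linD(1)[OF fac_step.hyps(2)] linD(1)[OF fac_step.hyps(3)]
            linD(2)[OF mod_homD[OF g]]
        by (auto simp: fun_eq_iff)
      have "lin K (K_space S (HT X)) (regular K) \<xi>" using \<xi> by (intro mod_homD) simp
      from linD(2)[OF this, of "\<lambda>x\<in>carrier X. g (f x)" "\<lambda>x\<in>carrier X. g (s (r x))"] c
      show ?thesis unfolding eq by simp
    qed
    moreover have "(\<lambda>k\<in>mod_hom A Z T. \<xi> (\<lambda>x\<in>carrier X. k (r x))) (\<lambda>x\<in>carrier Z. g (s x)) = \<xi> (\<lambda>x\<in>carrier X. g (s
        (r x)))"
      if g: "g \<in> mod_hom A Y T" for g
    proof -
      have "(\<lambda>x\<in>carrier Z. g (s x)) \<in> mod_hom A Z T"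
        using lin_restrict[OF assms(1) lin_comp[OF fac_step.hyps(3) mod_homD[OF g]]] .
      moreover have "(\<lambda>x\<in>carrier X. (\<lambda>x\<in>carrier Z. g (s x)) (r x)) = (\<lambda>x\<in>carrier X. g (s (r x)))"
        using linD(1)[OF fac_step.hyps(2)] by (intro restrict_ext) simp
      ultimately show ?thesis by (simp only: restrict_apply if_True)
    qed
    ultimately show "(\<lambda>g\<in>mod_hom A Y T. \<xi> (\<lambda>x\<in>carrier X. g (h x))) =
        (\<lambda>g\<in>mod_hom A Y T. \<xi> (\<lambda>x\<in>carrier X. g (f x))) \<oplus>\<^bsub>DHT Y\<^esub>
        (\<lambda>g\<in>mod_hom A Y T. (\<lambda>k\<in>mod_hom A Z T. \<xi> (\<lambda>x\<in>carrier X. k (r x))) (\<lambda>x\<in>carrier Z. g (s x)))"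
      unfolding dual_simps Hom_End_target_simps by (intro restrict_ext) (simp only: restrict_apply if_True)
  qed
qed

end

section \<open>The modules \<open>P\<close> and \<open>I\<close>\<close>

locale endo_summand = endo K A T for K :: "'k ring" and A :: "('k, 'a) module" and T :: "('a, 't) module" +
  fixes PI :: "('a, 'p) module" and j :: "'p \<Rightarrow> 't" and q :: "'t \<Rightarrow> 'p"
  assumes PI: "fg_module A PI" and j: "j \<in> mod_hom A PI T" and q: "q \<in> mod_hom A T PI"
    and qj: "compose (carrier PI) q j = (\<lambda>x\<in>carrier PI. x)"
begin

abbreviation "P \<equiv> Hom_End_source A T PI"
abbreviation "I \<equiv> dual K (End_alg A T) (Hom_End_target A PI T)"

lemma PIl: "left_module A PI"
  using PI by (rule fgD)

lemma qj_apply: "x \<in> carrier PI \<Longrightarrow> q (j x) = x"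
  using fun_cong[OF qj, of x] by simp

lemma jp_in_S: "p \<in> mod_hom A T PI \<Longrightarrow> compose (carrier T) j p \<in> mod_hom A T T"
  using mod_hom_compose[OF Tl j] .

lemma fq_in_S: "f \<in> mod_hom A PI T \<Longrightarrow> compose (carrier T) f q \<in> mod_hom A T T"
  using mod_hom_compose[OF Tl _ q] .

lemma P_generated: "p \<in> mod_hom A T PI \<Longrightarrow> compose (carrier T) j p \<odot>\<^bsub>P\<^esub> q = p"
  using mod_hom_closed[of p A T PI] mod_hom_undefined[of p A T PI] by (auto simp: fun_eq_iff compose_def qj_apply)

text \<open>\<open>P\<close> is the projective module \<open>Be\<close>, freely generated by the element \<open>q\<close> of \<open>eP\<close>.\<close>

lemma P_lift:
  assumes Y: "left_module B Y" and Z: "left_module B Z" and g: "lin B Y Z g" and h: "lin B P Z h"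
    and hg: "\<And>p. p \<in> carrier P \<Longrightarrow> h p \<in> g ` carrier Y"
  obtains h' where "lin B P Y h'" "\<And>p. p \<in> carrier P \<Longrightarrow> g (h' p) = h p"
proof -
  interpret Y: left_module B Y by fact
  interpret Z: left_module B Z by fact
  \<comment> \<open>A preimage of \<open>h q\<close> determines the whole lift, as \<open>q\<close>
    generates \<open>P\<close>.\<close>
  obtain y where y: "y \<in> carrier Y" "g y = h q" using hg[of q] q by auto
  let ?j = "\<lambda>p. compose (carrier T) j p"
  have jS: "p \<in> mod_hom A T PI \<Longrightarrow> ?j p \<in> carrier B" for p using jp_in_S by simp
  have "lin B P Y (\<lambda>p. ?j p \<odot>\<^bsub>Y\<^esub> y)"
  proof (rule linI)
    fix p assume "p \<in> carrier P"
    then show "?j p \<odot>\<^bsub>Y\<^esub> y \<in> carrier Y" using jS y by (auto intro: Y.smult_closed)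
  next
    fix p p' assume *: "p \<in> carrier P" "p' \<in> carrier P"
    have "?j (p \<oplus>\<^bsub>P\<^esub> p') = ?j p \<oplus>\<^bsub>B\<^esub> ?j p'"
      using * linD(2)[OF mod_homD[OF j]] mod_hom_closed[of p A T PI] mod_hom_closed[of p' A T PI]
      by (auto simp: fun_eq_iff compose_def)
    then show "?j (p \<oplus>\<^bsub>P\<^esub> p') \<odot>\<^bsub>Y\<^esub> y = ?j p \<odot>\<^bsub>Y\<^esub> y \<oplus>\<^bsub>Y\<^esub> ?j p' \<odot>\<^bsub>Y\<^esub> y"
      using * jS y Y.smult_l_distr by simp
  next
    fix b p assume *: "b \<in> carrier B" "p \<in> carrier P"
    have "?j (b \<odot>\<^bsub>P\<^esub> p) = b \<otimes>\<^bsub>B\<^esub> ?j p"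
      using * mod_hom_closed[of b A T T] by (auto simp: fun_eq_iff compose_def)
    then show "?j (b \<odot>\<^bsub>P\<^esub> p) \<odot>\<^bsub>Y\<^esub> y = b \<odot>\<^bsub>Y\<^esub> (?j p \<odot>\<^bsub>Y\<^esub> y)"
      using Y.smult_assoc1[OF *(1) jS[of p] y(1)] * by simp
  qed
  moreover have "g (?j p \<odot>\<^bsub>Y\<^esub> y) = h p" if "p \<in> carrier P" for p
    using linD(3)[OF g jS[of p] y(1)] linD(3)[OF h jS[of p], of q] P_generated[of p] that y(2) q by simp
  ultimately show thesis using that by blast
qed

text \<open>Dually, a map to \<open>I\<close> is determined by the functional obtained by evaluation at \<open>j\<close>.\<close>

lemma I_extend:
  assumes Y: "left_module B Y" and Z: "fg_module B Z" and g: "lin B Y Z g" and h: "lin B Y I h"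
    and hg: "\<And>y. \<lbrakk>y \<in> carrier Y; g y = \<zero>\<^bsub>Z\<^esub>\<rbrakk> \<Longrightarrow> h y = \<zero>\<^bsub>I\<^esub>"
  obtains h' where "lin B Z I h'" "\<And>y. y \<in> carrier Y \<Longrightarrow> h' (g y) = h y"
proof -
  have Zl: "left_module B Z" using Z by (rule B.fgD)
  interpret Y: left_module B Y by fact
  interpret Z: left_module B Z by (rule Zl)
  note HTP = HT_left_module[OF PIl]
  interpret H: left_module S "HT PI" by (rule HTP)
  have hI: "h y \<in> mod_hom K (K_space S (HT PI)) (regular K)" if "y \<in> carrier Y" for y using linD(1)[OF h that] by simp
  have fgZ: "fgen K (K_space B Z)" using Z by (simp add: B.fg_iff)
  \<comment> \<open>Evaluation at \<open>j\<close> reduces the extension of \<open>h\<close> to that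
    of a single functional. The map itself is recovered from the action of the elements
    \<open>f q\<close>, because \<open>f q j = f\<close>.\<close>
  have hj: "lin K (K_space B Y) (regular K) (\<lambda>y. h y j)"
  proof (rule linI)
    fix c y assume *: "c \<in> carrier K" "y \<in> carrier (K_space B Y)"
    then have "h (c \<odot>\<^bsub>K_space B Y\<^esub> y) = (c \<odot>\<^bsub>B\<^esub> \<one>\<^bsub>B\<^esub>) \<odot>\<^bsub>I\<^esub> h y" using linD(3)[OF h, of "c \<odot>\<^bsub>B\<^esub> \<one>\<^bsub>B\<^esub>" y]
        B.scalar(1) by simp
    then have "h (c \<odot>\<^bsub>K_space B Y\<^esub> y) j = h y ((c \<odot>\<^bsub>S\<^esub> \<one>\<^bsub>S\<^esub>) \<odot>\<^bsub>HT PI\<^esub> j)" using j by simp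
    also have "\<dots> = c \<otimes>\<^bsub>K\<^esub> h y j" using S.K_space_lin_functional[OF mod_homD[OF hI] *(1), of y j] * j by simp
    finally show "h (c \<odot>\<^bsub>K_space B Y\<^esub> y) j = c \<odot>\<^bsub>regular K\<^esub> h y j" by simp
  next
    fix y assume "y \<in> carrier (K_space B Y)"
    then show "h y j \<in> carrier (regular K)" using mod_hom_closed[OF hI, of y j] j by simp
  next
    fix x y assume "x \<in> carrier (K_space B Y)" "y \<in> carrier (K_space B Y)"
    then show "h (x \<oplus>\<^bsub>K_space B Y\<^esub> y) j = h x j \<oplus>\<^bsub>regular K\<^esub> h y j" using linD(2)[OF h, of x y] j by simp
  qed
  obtain \<psi> where \<psi>: "lin K (K_space B Z) (regular K) \<psi>" "\<And>y. y \<in> carrier (K_space B Y) \<Longrightarrow> \<psi> (g y) = h y j"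
  proof (rule functional_factor[OF field_K B.K_space_left_module[OF Y] B.K_space_left_module[OF Zl] fgZ
      B.K_space_lin[OF g] hj])
    show "h y j = \<zero>\<^bsub>K\<^esub>" if "y \<in> carrier (K_space B Y)" "g y = \<zero>\<^bsub>K_space B Z\<^esub>" for y using hg[of y] that j by simp
  qed (rule that)
  let ?q = "\<lambda>f. compose (carrier T) f q"
  have qB: "f \<in> mod_hom A PI T \<Longrightarrow> ?q f \<in> carrier B" for f using fq_in_S by simp
  let ?h = "\<lambda>z. \<lambda>f\<in>mod_hom A PI T. \<psi> (?q f \<odot>\<^bsub>Z\<^esub> z)"
  have hz: "?h z \<in> carrier I" if z: "z \<in> carrier Z" for z
  proof -
    have "lin K (K_space S (HT PI)) (regular K) (\<lambda>f. \<psi> (?q f \<odot>\<^bsub>Z\<^esub> z))"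
    proof (rule linI)
      fix f assume "f \<in> carrier (K_space S (HT PI))"
      then show "\<psi> (?q f \<odot>\<^bsub>Z\<^esub> z) \<in> carrier (regular K)" using linD(1)[OF \<psi>(1), of "?q f \<odot>\<^bsub>Z\<^esub> z"] qB z
          Z.smult_closed by simp
    next
      fix f f' assume *: "f \<in> carrier (K_space S (HT PI))" "f' \<in> carrier (K_space S (HT PI))"
      have "?q (f \<oplus>\<^bsub>K_space S (HT PI)\<^esub> f') = ?q f \<oplus>\<^bsub>B\<^esub> ?q f'"
        using * by (auto simp: fun_eq_iff compose_def mod_hom_closed[OF q])
      then show "\<psi> (?q (f \<oplus>\<^bsub>K_space S (HT PI)\<^esub> f') \<odot>\<^bsub>Z\<^esub> z) = \<psi> (?q f \<odot>\<^bsub>Z\<^esub> z) \<oplus>\<^bsub>regular K\<^esub> \<psi> (?q f' \<odot>\<^bsub>Z\<^esub> z)"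
        using * qB z Z.smult_l_distr Z.smult_closed linD(2)[OF \<psi>(1)] by simp
    next
      fix c f assume *: "c \<in> carrier K" "f \<in> carrier (K_space S (HT PI))"
      have f: "f \<in> mod_hom A PI T" using * by simp
      have "?q (c \<odot>\<^bsub>K_space S (HT PI)\<^esub> f) x = ((c \<odot>\<^bsub>B\<^esub> \<one>\<^bsub>B\<^esub>) \<otimes>\<^bsub>B\<^esub> ?q f) x" for x
      proof (cases "x \<in> carrier T")
        case True
        note cx = T.smult_closed[OF scalar(1)[OF *(1)] True]
        have "f (q ((c \<odot>\<^bsub>A\<^esub> \<one>\<^bsub>A\<^esub>) \<odot>\<^bsub>T\<^esub> x)) = (c \<odot>\<^bsub>A\<^esub> \<one>\<^bsub>A\<^esub>) \<odot>\<^bsub>T\<^esub> f (q x)"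
          using linD(3)[OF mod_homD[OF fq_in_S[OF f]] scalar(1)[OF *(1)] True] True cx by simp
        then show ?thesis using True cx mod_hom_closed[OF q True] mod_hom_closed[OF f mod_hom_closed[OF q True]] by simp
      qed (simp add: compose_def)
      then have "?q (c \<odot>\<^bsub>K_space S (HT PI)\<^esub> f) = (c \<odot>\<^bsub>B\<^esub> \<one>\<^bsub>B\<^esub>) \<otimes>\<^bsub>B\<^esub> ?q f" by (rule ext)
      then have "?q (c \<odot>\<^bsub>K_space S (HT PI)\<^esub> f) \<odot>\<^bsub>Z\<^esub> z = (c \<odot>\<^bsub>B\<^esub> \<one>\<^bsub>B\<^esub>) \<odot>\<^bsub>Z\<^esub> (?q f \<odot>\<^bsub>Z\<^esub> z)"
        using Z.smult_assoc1[OF B.scalar(1)[OF *(1)] qB z, of f] * by simp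
      then show "\<psi> (?q (c \<odot>\<^bsub>K_space S (HT PI)\<^esub> f) \<odot>\<^bsub>Z\<^esub> z) = c \<odot>\<^bsub>regular K\<^esub> \<psi> (?q f \<odot>\<^bsub>Z\<^esub> z)"
        using B.K_space_lin_functional[OF \<psi>(1) *(1), of "?q f \<odot>\<^bsub>Z\<^esub> z"] qB[of f] * z Z.smult_closed by simp
    qed
    from lin_restrict[OF S.K_space_left_module[OF HTP] this] show ?thesis by simp
  qed
  have "lin B Z I ?h"
  proof (rule linI)
    fix z z' assume "z \<in> carrier Z" "z' \<in> carrier Z"
    then show "?h (z \<oplus>\<^bsub>Z\<^esub> z') = ?h z \<oplus>\<^bsub>I\<^esub> ?h z'"
      using qB Z.smult_r_distr Z.smult_closed linD(2)[OF \<psi>(1)] by (auto simp: fun_eq_iff)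
  next
    fix b z assume *: "b \<in> carrier B" "z \<in> carrier Z"
    have "\<psi> (?q f \<odot>\<^bsub>Z\<^esub> (b \<odot>\<^bsub>Z\<^esub> z)) = \<psi> (?q (compose (carrier PI) b f) \<odot>\<^bsub>Z\<^esub> z)" if f: "f \<in> mod_hom A PI T" for f
    proof -
      have "?q (compose (carrier PI) b f) = ?q f \<otimes>\<^bsub>B\<^esub> b"
        using * f by (auto simp: fun_eq_iff compose_def mod_hom_closed[OF q])
      then show ?thesis using Z.smult_assoc1[OF qB[OF f] *] by simp
    qed
    then show "?h (b \<odot>\<^bsub>Z\<^esub> z) = b \<odot>\<^bsub>I\<^esub> ?h z" using mod_hom_compose[OF PIl, of b T T] * by (auto simp: fun_eq_iff)
  qed (rule hz)
  moreover have "?h (g y) = h y" if y: "y \<in> carrier Y" for y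
  proof (rule mod_hom_ext)
    show "?h (g y) \<in> mod_hom K (K_space S (HT PI)) (regular K)" using hz[OF linD(1)[OF g y]] by simp
    show "h y \<in> mod_hom K (K_space S (HT PI)) (regular K)" using hI[OF y] .
    fix f assume f: "f \<in> carrier (K_space S (HT PI))"
    then have f': "f \<in> mod_hom A PI T" by simp
    have "\<psi> (?q f \<odot>\<^bsub>Z\<^esub> g y) = \<psi> (g (?q f \<odot>\<^bsub>Y\<^esub> y))" using linD(3)[OF g qB[OF f'] y] by simp
    also have "\<dots> = h (?q f \<odot>\<^bsub>Y\<^esub> y) j" using \<psi>(2) Y.smult_closed[OF qB[OF f'] y] by simp
    also have "\<dots> = h y (compose (carrier PI) (?q f) j)" using linD(3)[OF h qB[OF f'] y] j by simp
    also have "compose (carrier PI) (?q f) j = f"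
      using f' by (auto simp: fun_eq_iff compose_def mod_hom_closed[OF j] qj_apply mod_hom_undefined[OF f'])
    finally show "?h (g y) f = h y f" using f' by simp
  qed
  ultimately show thesis using that by blast
qed

end

section \<open>Exact sequences of \<open>B\<close>-modules\<close>

text \<open>Both directions of the isomorphism are kept as explicit maps, so that the differentials
  of a sequence can be conjugated by them.\<close>

definition isos :: "('a, 'z) ring_scheme \<Rightarrow> ('a, 'm) module \<Rightarrow> ('a, 'n) module \<Rightarrow> ('m \<Rightarrow> 'n) \<Rightarrow> ('n \<Rightarrow> 'm) \<Rightarrow> bool" where
  "isos R M N f g \<longleftrightarrow> left_module R M \<and> left_module R N \<and> lin R M N f \<and> lin R N M g \<and>
    (\<forall>x\<in>carrier M. g (f x) = x) \<and> (\<forall>y\<in>carrier N. f (g y) = y)"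

lemma isosD:
  assumes "isos R M N f g"
  shows "left_module R M" "left_module R N" "lin R M N f" "lin R N M g"
    "x \<in> carrier M \<Longrightarrow> g (f x) = x" "y \<in> carrier N \<Longrightarrow> f (g y) = y"
    "x \<in> carrier M \<Longrightarrow> f x \<in> carrier N" "y \<in> carrier N \<Longrightarrow> g y \<in> carrier M"
  using assms by (auto simp: isos_def lin_def)

lemma isos_id: "left_module R M \<Longrightarrow> isos R M M (\<lambda>x. x) (\<lambda>x. x)"
  by (simp add: isos_def lin_id)

lemma isos_zero:
  assumes "isos R M N f g" "x \<in> carrier M" shows "f x = \<zero>\<^bsub>N\<^esub> \<longleftrightarrow> x = \<zero>\<^bsub>M\<^esub>"
  using isosD[OF assms(1)] lin_zero[of R M N f] lin_zero[of R N M g] assms(2) by metis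

lemma transport_lin:
  assumes "isos R L L' fL gL" "isos R M M' fM gM" "lin R L M \<delta>"
  shows "lin R L' M' (\<lambda>x. fM (\<delta> (gL x)))"
  using lin_comp[OF lin_comp[OF isosD(4)[OF assms(1)] assms(3)] isosD(3)[OF assms(2)]] .

lemma transport_image:
  assumes L: "isos R L L' fL gL" and M: "isos R M M' fM gM"
  shows "(\<lambda>x\<in>carrier L'. fM (\<delta> (gL x))) ` carrier L' = fM ` \<delta> ` carrier L"
proof -
  have "gL ` carrier L' = carrier L" using isosD[OF L] by force
  then have "(\<lambda>x. fM (\<delta> (gL x))) ` carrier L' = fM ` \<delta> ` carrier L" by (metis image_image)
  then show ?thesis by simp
qed

lemma transport_exact:
  assumes L: "isos R L L' fL gL" and M: "isos R M M' fM gM" and N: "isos R N N' fN gN"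
    and "lin R M N \<epsilon>" "\<delta> ` carrier L = {x \<in> carrier M. \<epsilon> x = \<zero>\<^bsub>N\<^esub>}"
  shows "(\<lambda>x\<in>carrier L'. fM (\<delta> (gL x))) ` carrier L' = a_kernel M' N' (\<lambda>x\<in>carrier M'. fN (\<epsilon> (gM x)))"
proof -
  have "fM ` {x \<in> carrier M. \<epsilon> x = \<zero>\<^bsub>N\<^esub>} = {x \<in> carrier M'. \<epsilon> (gM x) = \<zero>\<^bsub>N\<^esub>}"
    using isosD[OF M] by force
  then show ?thesis
    using isos_zero[OF N linD(1)[OF assms(4) isosD(8)[OF M]]]
    unfolding transport_image[OF L M] assms(5) a_kernel_def' by auto
qed

context fdalg
begin

lemma postcomp_mod_hom:
  assumes "left_module A L" "left_module A M" "left_module A N" "lin A M N f"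
  shows "postcomp A L M f \<in> mod_hom K (Hom A L M) (Hom A L N)"
proof (rule mod_homI[OF Hom_left_module[OF assms(1,2)]])
  have cl: "compose (carrier L) f h \<in> mod_hom A L N" if "h \<in> mod_hom A L M" for h
    using lin_restrict[OF assms(1) lin_comp[OF mod_homD[OF that] assms(4)]] by (simp add: compose_def)
  interpret N: left_module A N by fact
  interpret M: left_module A M by fact
  show "lin K (Hom A L M) (Hom A L N) (postcomp A L M f)"
  proof (rule linI)
    show "postcomp A L M f h \<in> carrier (Hom A L N)" if "h \<in> carrier (Hom A L M)" for h
      using cl that by (simp add: postcomp_def)
  next
    fix g h assume *: "g \<in> carrier (Hom A L M)" "h \<in> carrier (Hom A L M)"
    then have gh: "g \<in> mod_hom A L M" "h \<in> mod_hom A L M" by simp_all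
    have "(\<lambda>x\<in>carrier L. g x \<oplus>\<^bsub>M\<^esub> h x) \<in> mod_hom A L M"
      using lin_restrict[OF assms(1) lin_sum[OF assms(2) mod_homD[OF gh(1)] mod_homD[OF gh(2)]]] .
    moreover have "compose (carrier L) f (\<lambda>x\<in>carrier L. g x \<oplus>\<^bsub>M\<^esub> h x) =
        (\<lambda>x\<in>carrier L. compose (carrier L) f g x \<oplus>\<^bsub>N\<^esub> compose (carrier L) f h x)"
      unfolding compose_def using linD(2)[OF assms(4) mod_hom_closed[OF gh(1)] mod_hom_closed[OF gh(2)]]
      by (intro restrict_ext) simp
    ultimately show "postcomp A L M f (g \<oplus>\<^bsub>Hom A L M\<^esub> h) = postcomp A L M f g \<oplus>\<^bsub>Hom A L N\<^esub> postcomp A L M f h"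
      using gh by (simp add: postcomp_def)
  next
    fix c g assume *: "c \<in> carrier K" "g \<in> carrier (Hom A L M)"
    then have g: "g \<in> mod_hom A L M" by simp
    have "(\<lambda>x\<in>carrier L. (c \<odot>\<^bsub>A\<^esub> \<one>\<^bsub>A\<^esub>) \<odot>\<^bsub>M\<^esub> g x) \<in> mod_hom A L M"
      using lin_restrict[OF assms(1) lin_comp[OF mod_homD[OF g] scalar_lin[OF assms(2) *(1)]]] .
    moreover have "compose (carrier L) f (\<lambda>x\<in>carrier L. (c \<odot>\<^bsub>A\<^esub> \<one>\<^bsub>A\<^esub>) \<odot>\<^bsub>M\<^esub> g x) =
        (\<lambda>x\<in>carrier L. (c \<odot>\<^bsub>A\<^esub> \<one>\<^bsub>A\<^esub>) \<odot>\<^bsub>N\<^esub> compose (carrier L) f g x)"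
      unfolding compose_def using linD(3)[OF assms(4) scalar(1)[OF *(1)] mod_hom_closed[OF g]]
      by (intro restrict_ext) simp
    ultimately show "postcomp A L M f (c \<odot>\<^bsub>Hom A L M\<^esub> g) = c \<odot>\<^bsub>Hom A L N\<^esub> postcomp A L M f g"
      using g by (simp add: postcomp_def)
  qed
qed (simp add: postcomp_def)

lemma precomp_mod_hom:
  assumes "left_module A L" "left_module A M" "left_module A N" "lin A M N f"
  shows "precomp A M N L f \<in> mod_hom K (Hom A N L) (Hom A M L)"
proof (rule mod_homI[OF Hom_left_module[OF assms(3,1)]])
  have cl: "compose (carrier M) h f \<in> mod_hom A M L" if "h \<in> mod_hom A N L" for h
    using lin_restrict[OF assms(2) lin_comp[OF assms(4) mod_homD[OF that]]] by (simp add: compose_def)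
  show "lin K (Hom A N L) (Hom A M L) (precomp A M N L f)"
  proof (rule linI)
    show "precomp A M N L f h \<in> carrier (Hom A M L)" if "h \<in> carrier (Hom A N L)" for h
      using cl that by (simp add: precomp_def)
  next
    fix g h assume *: "g \<in> carrier (Hom A N L)" "h \<in> carrier (Hom A N L)"
    then have gh: "g \<in> mod_hom A N L" "h \<in> mod_hom A N L" by simp_all
    have "(\<lambda>x\<in>carrier N. g x \<oplus>\<^bsub>L\<^esub> h x) \<in> mod_hom A N L"
      using lin_restrict[OF assms(3) lin_sum[OF assms(1) mod_homD[OF gh(1)] mod_homD[OF gh(2)]]] .
    moreover have "compose (carrier M) (\<lambda>x\<in>carrier N. g x \<oplus>\<^bsub>L\<^esub> h x) f =
        (\<lambda>x\<in>carrier M. compose (carrier M) g f x \<oplus>\<^bsub>L\<^esub> compose (carrier M) h f x)"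
      unfolding compose_def using linD(1)[OF assms(4)] by (intro restrict_ext) simp
    ultimately show "precomp A M N L f (g \<oplus>\<^bsub>Hom A N L\<^esub> h) = precomp A M N L f g \<oplus>\<^bsub>Hom A M L\<^esub> precomp A M N L f h"
      using gh by (simp add: precomp_def)
  next
    fix c g assume *: "c \<in> carrier K" "g \<in> carrier (Hom A N L)"
    then have g: "g \<in> mod_hom A N L" by simp
    have "(\<lambda>x\<in>carrier N. (c \<odot>\<^bsub>A\<^esub> \<one>\<^bsub>A\<^esub>) \<odot>\<^bsub>L\<^esub> g x) \<in> mod_hom A N L"
      using lin_restrict[OF assms(3) lin_comp[OF mod_homD[OF g] scalar_lin[OF assms(1) *(1)]]] .
    moreover have "compose (carrier M) (\<lambda>x\<in>carrier N. (c \<odot>\<^bsub>A\<^esub> \<one>\<^bsub>A\<^esub>) \<odot>\<^bsub>L\<^esub> g x) f =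
        (\<lambda>x\<in>carrier M. (c \<odot>\<^bsub>A\<^esub> \<one>\<^bsub>A\<^esub>) \<odot>\<^bsub>L\<^esub> compose (carrier M) g f x)"
      unfolding compose_def using linD(1)[OF assms(4)] by (intro restrict_ext) simp
    ultimately show "precomp A M N L f (c \<odot>\<^bsub>Hom A N L\<^esub> g) = c \<odot>\<^bsub>Hom A M L\<^esub> precomp A M N L f g"
      using g by (simp add: precomp_def)
  qed
qed (simp add: precomp_def)

end

context endo_summand
begin

lemma Pl: "left_module B P" and Il: "left_module B I"
  using HS_left_module[OF PIl] DHT_left_module[OF PIl] by auto

lemma postcomp_lift:
  assumes "left_module B L" "left_module B M" "lin B L M f" "h \<in> mod_hom B P M"
    "\<And>p. p \<in> carrier P \<Longrightarrow> h p \<in> f ` carrier L"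
  shows "h \<in> postcomp B P L f ` mod_hom B P L"
proof -
  obtain h' where h': "lin B P L h'" "\<And>p. p \<in> carrier P \<Longrightarrow> f (h' p) = h p"
    using P_lift[OF assms(1,2,3) mod_homD[OF assms(4)] assms(5)] by blast
  have r: "(\<lambda>p\<in>carrier P. h' p) \<in> mod_hom B P L" using lin_restrict[OF Pl h'(1)] .
  have "compose (carrier P) f (\<lambda>p\<in>carrier P. h' p) = h"
    by (rule ext) (use h'(2) mod_hom_undefined[OF assms(4)] in \<open>simp add: compose_def del: Hom_End_source_simps\<close>)
  then show ?thesis using r by (intro image_eqI[OF _ r]) (simp add: postcomp_def)
qed

lemma postcomp_exact:
  assumes *: "left_module B L" "left_module B M'" "left_module B N" "lin B L M' f" "lin B M' N g"
    "f ` carrier L = {x \<in> carrier M'. g x = \<zero>\<^bsub>N\<^esub>}"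
  shows "postcomp B P L f ` mod_hom B P L = a_kernel (Hom B P M') (Hom B P N) (postcomp B P M' g)"
proof
  show "postcomp B P L f ` mod_hom B P L \<subseteq> a_kernel (Hom B P M') (Hom B P N) (postcomp B P M' g)"
  proof
    fix k assume "k \<in> postcomp B P L f ` mod_hom B P L"
    then obtain h where h: "h \<in> mod_hom B P L" "k = compose (carrier P) f h" by (auto simp: postcomp_def)
    have k: "k \<in> mod_hom B P M'" using mod_homD[OF h(1)] lin_restrict[OF Pl lin_comp[OF _ *(4)]] h(2) by (simp
        add: compose_def)
    have "g (k x) = \<zero>\<^bsub>N\<^esub>" if "x \<in> carrier P" for x
      using *(6) mod_hom_closed[OF h(1) that] that h(2) by (simp add: compose_def del: Hom_End_source_simps) blast
    then have "postcomp B P M' g k = \<zero>\<^bsub>Hom B P N\<^esub>" using k unfolding postcomp_def Hom_simps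
      by (simp add: compose_def del: Hom_End_source_simps cong: restrict_cong)
    then show "k \<in> a_kernel (Hom B P M') (Hom B P N) (postcomp B P M' g)" using k by (simp add: a_kernel_def')
  qed
  show "a_kernel (Hom B P M') (Hom B P N) (postcomp B P M' g) \<subseteq> postcomp B P L f ` mod_hom B P L"
  proof
    fix k assume "k \<in> a_kernel (Hom B P M') (Hom B P N) (postcomp B P M' g)"
    then have k: "k \<in> mod_hom B P M'" "compose (carrier P) g k = (\<lambda>x\<in>carrier P. \<zero>\<^bsub>N\<^esub>)"
      by (auto simp: a_kernel_def' postcomp_def)
    have "k x \<in> f ` carrier L" if "x \<in> carrier P" for x
      using fun_cong[OF k(2), of x] that mod_hom_closed[OF k(1) that] *(6) by (simp add: compose_def del:
          Hom_End_source_simps)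
    then show "k \<in> postcomp B P L f ` mod_hom B P L" using postcomp_lift[OF *(1,2,4) k(1)] by blast
  qed
qed

text \<open>By projectivity of \<open>P\<close> the second exactness condition in
  \<open>gen_cat\<close> follows from the first.\<close>

lemma Hom_P_right_exact:
  assumes t: "\<And>i. i \<le> n \<Longrightarrow> left_module B (t i)" and M: "left_module B M" and ex: "right_exact B t d p M n"
  shows "right_exact K (\<lambda>i. Hom B P (t i)) (\<lambda>i. postcomp B P (t (Suc i)) (d i)) (postcomp B P (t 0) p) (Hom B P M) n"
proof -
  have p: "lin B (t 0) M p" "p ` carrier (t 0) = carrier M" and d: "\<And>i. i < n \<Longrightarrow> lin B (t (Suc i)) (t i) (d i)"
    and e0: "0 < n \<Longrightarrow> d 0 ` carrier (t 1) = {x \<in> carrier (t 0). p x = \<zero>\<^bsub>M\<^esub>}"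
    and e: "\<And>i. Suc i < n \<Longrightarrow> d (Suc i) ` carrier (t (Suc (Suc i))) = {x \<in> carrier (t (Suc i)). d i x = \<zero>\<^bsub>t i\<^esub>}"
    using ex by (auto simp: right_exact_def a_kernel_def' dest: mod_homD)
  have surj: "postcomp B P (t 0) p ` mod_hom B P (t 0) = mod_hom B P M"
  proof
    show "postcomp B P (t 0) p ` mod_hom B P (t 0) \<subseteq> mod_hom B P M"
      using mod_hom_closed[OF B.postcomp_mod_hom[OF Pl t[of 0] M p(1)]] by auto
    show "mod_hom B P M \<subseteq> postcomp B P (t 0) p ` mod_hom B P (t 0)"
      using postcomp_lift[OF t[of 0] M p(1)] p(2) mod_hom_closed[of _ B P M] by blast
  qed
  have "postcomp B P (t 1) (d 0) ` mod_hom B P (t 1) = a_kernel (Hom B P (t 0)) (Hom B P M) (postcomp B P (t 0)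
      p)" if "0 < n"
    using postcomp_exact[OF t[of 1] t[of 0] M _ p(1) e0[OF that]] d[of 0] that by simp
  moreover have "postcomp B P (t 0) p \<in> mod_hom K (Hom B P (t 0)) (Hom B P M)"
    using B.postcomp_mod_hom[OF Pl t M p(1)] by simp
  moreover have "postcomp B P (t (Suc i)) (d i) \<in> mod_hom K (Hom B P (t (Suc i))) (Hom B P (t i))" if "i < n" for i
    using B.postcomp_mod_hom[OF Pl t t d[OF that]] that by simp
  moreover have "postcomp B P (t (Suc (Suc i))) (d (Suc i)) ` mod_hom B P (t (Suc (Suc i))) =
    a_kernel (Hom B P (t (Suc i))) (Hom B P (t i)) (postcomp B P (t (Suc i)) (d i))" if "Suc i < n" for i
    using postcomp_exact[OF t t t d d e[OF that]] that by simp
  ultimately show ?thesis unfolding right_exact_def using surj by simp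
qed

lemma precomp_exact:
  assumes "left_module B L" "left_module B M" "fg_module B N" "lin B L M f" "lin B M N g"
    "f ` carrier L = {x \<in> carrier M. g x = \<zero>\<^bsub>N\<^esub>}"
  shows "precomp B M N I g ` mod_hom B N I = a_kernel (Hom B M I) (Hom B L I) (precomp B L M I f)"
proof
  note Nl = B.fgD[OF assms(3)]
  show "precomp B M N I g ` mod_hom B N I \<subseteq> a_kernel (Hom B M I) (Hom B L I) (precomp B L M I f)"
  proof
    fix k assume "k \<in> precomp B M N I g ` mod_hom B N I"
    then obtain h where h: "h \<in> mod_hom B N I" "k = compose (carrier M) h g" by (auto simp: precomp_def)
    have k: "k \<in> mod_hom B M I" using lin_restrict[OF assms(2) lin_comp[OF assms(5) mod_homD[OF h(1)]]] h(2) by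
        (simp add: compose_def)
    have "k (f x) = \<zero>\<^bsub>I\<^esub>" if "x \<in> carrier L" for x
    proof -
      have "f x \<in> carrier M" "g (f x) = \<zero>\<^bsub>N\<^esub>" using assms(6) that by blast+
      then show ?thesis using lin_zero[OF Nl Il mod_homD[OF h(1)]] h(2) by (simp del: dual_simps)
    qed
    then have "precomp B L M I f k = \<zero>\<^bsub>Hom B L I\<^esub>" using k unfolding precomp_def Hom_simps
      by (simp add: compose_def del: dual_simps cong: restrict_cong)
    then show "k \<in> a_kernel (Hom B M I) (Hom B L I) (precomp B L M I f)" using k by (simp add: a_kernel_def')
  qed
  show "a_kernel (Hom B M I) (Hom B L I) (precomp B L M I f) \<subseteq> precomp B M N I g ` mod_hom B N I"
  proof
    fix k assume "k \<in> a_kernel (Hom B M I) (Hom B L I) (precomp B L M I f)"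
    then have k: "k \<in> mod_hom B M I" "compose (carrier L) k f = (\<lambda>x\<in>carrier L. \<zero>\<^bsub>I\<^esub>)"
      by (auto simp: a_kernel_def' precomp_def simp del: dual_simps)
    have z: "k y = \<zero>\<^bsub>I\<^esub>" if y: "y \<in> carrier M" "g y = \<zero>\<^bsub>N\<^esub>" for y
    proof -
      obtain x where "x \<in> carrier L" "y = f x" using assms(6) y by blast
      then show ?thesis using fun_cong[OF k(2), of x] by (simp del: dual_simps)
    qed
    obtain h where h: "lin B N I h" "\<And>y. y \<in> carrier M \<Longrightarrow> h (g y) = k y"
      using I_extend[OF assms(2,3,5) mod_homD[OF k(1)] z] by blast
    have r: "(\<lambda>x\<in>carrier N. h x) \<in> mod_hom B N I" using lin_restrict[OF Nl h(1)] .
    have "compose (carrier M) (\<lambda>x\<in>carrier N. h x) g = k"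
      by (rule ext) (use h(2) mod_hom_undefined[OF k(1)] linD(1)[OF assms(5)] in \<open>simp add: compose_def\<close>)
    then show "k \<in> precomp B M N I g ` mod_hom B N I" by (intro image_eqI[OF _ r]) (use r in \<open>simp add: precomp_def\<close>)
  qed
qed

text \<open>Injectivity of \<open>I\<close> plays the same role for \<open>cogen_cat\<close>; finite
  generation of the terms enters through the extension of functionals.\<close>

lemma Hom_I_right_exact:
  assumes t: "\<And>i. i \<le> n \<Longrightarrow> fg_module B (t i)" and N: "left_module B N" and ex: "left_exact B N j' t d n"
  shows "right_exact K (\<lambda>i. Hom B (t i) I) (\<lambda>i. precomp B (t i) (t (Suc i)) I (d i)) (precomp B N (t 0) I j')
      (Hom B N I) n"
proof -
  have j': "lin B N (t 0) j'" "inj_on j' (carrier N)" and d: "\<And>i. i < n \<Longrightarrow> lin B (t i) (t (Suc i)) (d i)"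
    and e0: "0 < n \<Longrightarrow> j' ` carrier N = {x \<in> carrier (t 0). d 0 x = \<zero>\<^bsub>t 1\<^esub>}"
    and e: "\<And>i. Suc i < n \<Longrightarrow> d i ` carrier (t i) = {x \<in> carrier (t (Suc i)). d (Suc i) x = \<zero>\<^bsub>t (Suc (Suc i))\<^esub>}"
    using ex by (auto simp: left_exact_def a_kernel_def' dest: mod_homD)
  note tl = B.fgD[OF t]
  interpret N: left_module B N by (rule N)
  have surj: "precomp B N (t 0) I j' ` mod_hom B (t 0) I = mod_hom B N I"
  proof
    show "precomp B N (t 0) I j' ` mod_hom B (t 0) I \<subseteq> mod_hom B N I"
      using mod_hom_closed[OF B.precomp_mod_hom[OF Il N tl[of 0] j'(1)]] by auto
    show "mod_hom B N I \<subseteq> precomp B N (t 0) I j' ` mod_hom B (t 0) I"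
    proof
      fix k assume k: "k \<in> mod_hom B N I"
      have z: "k y = \<zero>\<^bsub>I\<^esub>" if "y \<in> carrier N" "j' y = \<zero>\<^bsub>t 0\<^esub>" for y
      proof -
        have "y = \<zero>\<^bsub>N\<^esub>" using inj_onD[OF j'(2), of y "\<zero>\<^bsub>N\<^esub>"] that lin_zero[OF N tl[of 0] j'(1)] by simp
        then show ?thesis using lin_zero[OF N Il mod_homD[OF k]] by simp
      qed
      obtain h where h: "lin B (t 0) I h" "\<And>y. y \<in> carrier N \<Longrightarrow> h (j' y) = k y"
        using I_extend[OF N t[of 0] j'(1) mod_homD[OF k] z] by blast
      have r: "(\<lambda>x\<in>carrier (t 0). h x) \<in> mod_hom B (t 0) I" using lin_restrict[OF tl[of 0] h(1)] by simp
      have "compose (carrier N) (\<lambda>x\<in>carrier (t 0). h x) j' = k"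
        by (rule ext) (use h(2) mod_hom_undefined[OF k] linD(1)[OF j'(1)] in \<open>simp add: compose_def\<close>)
      then show "k \<in> precomp B N (t 0) I j' ` mod_hom B (t 0) I" by (intro image_eqI[OF _ r]) (use r in
          \<open>simp add: precomp_def\<close>)
    qed
  qed
  have "precomp B (t 0) (t 1) I (d 0) ` mod_hom B (t 1) I = a_kernel (Hom B (t 0) I) (Hom B N I) (precomp B N (t
      0) I j')" if "0 < n"
    using precomp_exact[OF N tl[of 0] t[of 1] j'(1) _ e0[OF that]] d[of 0] that by simp
  moreover have "precomp B N (t 0) I j' \<in> mod_hom K (Hom B (t 0) I) (Hom B N I)"
    using B.precomp_mod_hom[OF Il N tl[of 0] j'(1)] by simp
  moreover have "precomp B (t i) (t (Suc i)) I (d i) \<in> mod_hom K (Hom B (t (Suc i)) I) (Hom B (t i) I)" if "i < n" for i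
    using B.precomp_mod_hom[OF Il tl tl d[OF that]] that by simp
  moreover have "precomp B (t (Suc i)) (t (Suc (Suc i))) I (d (Suc i)) ` mod_hom B (t (Suc (Suc i))) I =
    a_kernel (Hom B (t (Suc i)) I) (Hom B (t i) I) (precomp B (t i) (t (Suc i)) I (d i))" if "Suc i < n" for i
    using precomp_exact[OF tl tl t d d e[OF that]] that by simp
  ultimately show ?thesis unfolding right_exact_def using surj by simp
qed

text \<open>Accepts terms of any element type whose identity is a sum through \<open>P\<close>,
  replaces them by copies of the prescribed type and adds exactness under
  \<open>Hom(P, -)\<close>.\<close>

lemma gen_catI:
  fixes Y :: "nat \<Rightarrow> ('t \<Rightarrow> 't, 'y) module" and M :: "('t \<Rightarrow> 't, 'm) module"
  assumes M: "fg_module B M" and Y: "\<And>i. i \<le> m \<Longrightarrow> fg_module B (Y i)" "\<And>i. i \<le> m \<Longrightarrow> fac B P (Y i) (Y i) (\<lambda>x. x)"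
    and \<pi>: "lin B (Y 0) M \<pi>" "\<pi> ` carrier (Y 0) = carrier M" and \<delta>: "\<And>i. i < m \<Longrightarrow> lin B (Y (Suc i)) (Y i) (\<delta> i)"
    and e0: "0 < m \<Longrightarrow> \<delta> 0 ` carrier (Y (Suc 0)) = {x \<in> carrier (Y 0). \<pi> x = \<zero>\<^bsub>M\<^esub>}"
    and e: "\<And>i. Suc i < m \<Longrightarrow> \<delta> (Suc i) ` carrier (Y (Suc (Suc i))) = {x \<in> carrier (Y (Suc i)). \<delta> i x = \<zero>\<^bsub>Y i\<^esub>}"
  shows "M \<in> gen_cat K B (int m) P"
proof -
  have Ml: "left_module B M" using M by (rule B.fgD)
  define good where "good i s \<longleftrightarrow> fst s \<in> add_cat B P \<and> isos B (Y i) (fst s) (fst (snd s)) (snd (snd s))"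
    for i and s :: "('t \<Rightarrow> 't, nat \<Rightarrow> 't \<Rightarrow> 'p) module \<times> ('y \<Rightarrow> nat \<Rightarrow> 't \<Rightarrow> 'p) \<times> ((nat \<Rightarrow> 't \<Rightarrow> 'p) \<Rightarrow> 'y)"
  have ex: "\<exists>s. good i s" if i: "i \<le> m" for i
  proof -
    obtain t :: "('t \<Rightarrow> 't, nat \<Rightarrow> 't \<Rightarrow> 'p) module" and f g where t: "t \<in> add_cat B P" "left_module B t" "lin B (Y i) t f"
      "lin B t (Y i) g" "\<And>x. x \<in> carrier (Y i) \<Longrightarrow> g (f x) = x" "\<And>x. x \<in> carrier t \<Longrightarrow> f (g x) = x"
      using add_cat_copy[OF Pl Y(1)[OF i] Y(2)[OF i]] by blast
    have "isos B (Y i) t f g" unfolding isos_def using t B.fgD[OF Y(1)[OF i]] by blast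
    then have "good i (t, f, g)" unfolding good_def fst_conv snd_conv using t(1) by simp
    then show ?thesis ..
  qed
  define s where "s i = (SOME s. good i s)" for i
  have s: "good i (s i)" if "i \<le> m" for i unfolding s_def by (rule someI_ex[OF ex[OF that]])
  define t f g where "t i = fst (s i)" "f i = fst (snd (s i))" "g i = snd (snd (s i))" for i
  have t: "t i \<in> add_cat B P" "isos B (Y i) (t i) (f i) (g i)" if "i \<le> m" for i
    using s[OF that] by (simp_all add: t_f_g_def good_def)
  note idM = isos_id[OF Ml]
  let ?d = "\<lambda>i. \<lambda>x\<in>carrier (t (Suc i)). f i (\<delta> i (g (Suc i) x))" and ?p = "\<lambda>x\<in>carrier (t 0). \<pi> (g 0 x)"
  have tl: "left_module B (t i)" if "i \<le> m" for i using isosD(2)[OF t(2)[OF that]] .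
  have "right_exact B t ?d ?p M m"
    unfolding right_exact_def
  proof (intro conjI allI impI)
    show "?p \<in> mod_hom B (t 0) M" using lin_restrict[OF tl transport_lin[OF t(2) idM \<pi>(1)]] by simp
    show "?d i \<in> mod_hom B (t (Suc i)) (t i)" if "i < m" for i
      using lin_restrict[OF tl transport_lin[OF t(2) t(2) \<delta>[OF that]]] that by simp
    show "?p ` carrier (t 0) = carrier M" using transport_image[OF t(2)[of 0] idM, of \<pi>] \<pi>(2) by simp
    show "?d 0 ` carrier (t 1) = a_kernel (t 0) M ?p" if "0 < m"
      using transport_exact[OF t(2)[of "Suc 0"] t(2)[of 0] idM \<pi>(1) e0[OF that]] that by simp
    show "?d (Suc i) ` carrier (t (Suc (Suc i))) = a_kernel (t (Suc i)) (t i) (?d i)" if "Suc i < m" for i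
      using transport_exact[OF t(2) t(2) t(2) \<delta> e[OF that]] that by simp
  qed
  moreover from Hom_P_right_exact[OF tl Ml this]
  have "right_exact K (\<lambda>i. Hom B P (t i)) (\<lambda>i. postcomp B P (t (Suc i)) (?d i)) (postcomp B P (t 0) ?p) (Hom B P M) m" .
  ultimately show ?thesis unfolding gen_cat_def using M t(1)
    by (intro CollectI conjI impI exI[of _ t] exI[of _ ?d] exI[of _ ?p]) simp_all
qed

lemma cogen_catI:
  fixes Y :: "nat \<Rightarrow> ('t \<Rightarrow> 't, 'y) module" and N :: "('t \<Rightarrow> 't, 'n) module"
  assumes N: "fg_module B N" and Y: "\<And>i. i \<le> m \<Longrightarrow> fg_module B (Y i)" "\<And>i. i \<le> m \<Longrightarrow> fac B I (Y i) (Y i) (\<lambda>x. x)"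
    and \<iota>: "lin B N (Y 0) \<iota>" "inj_on \<iota> (carrier N)" and \<delta>: "\<And>i. i < m \<Longrightarrow> lin B (Y i) (Y (Suc i)) (\<delta> i)"
    and e0: "0 < m \<Longrightarrow> \<iota> ` carrier N = {x \<in> carrier (Y 0). \<delta> 0 x = \<zero>\<^bsub>Y (Suc 0)\<^esub>}"
    and e: "\<And>i. Suc i < m \<Longrightarrow> \<delta> i ` carrier (Y i) = {x \<in> carrier (Y (Suc i)). \<delta> (Suc i) x = \<zero>\<^bsub>Y (Suc (Suc i))\<^esub>}"
  shows "N \<in> cogen_cat K B (int m) I"
proof -
  have Nl: "left_module B N" using N by (rule B.fgD)
  define good where "good i s \<longleftrightarrow> fst s \<in> add_cat B I \<and> isos B (Y i) (fst s) (fst (snd s)) (snd (snd s))"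
    for i and s :: "('t \<Rightarrow> 't, nat \<Rightarrow> ('p \<Rightarrow> 't) \<Rightarrow> 'k) module \<times> ('y \<Rightarrow> nat \<Rightarrow> ('p \<Rightarrow> 't) \<Rightarrow> 'k) \<times> ((nat \<Rightarrow> ('p \<Rightarrow> 't) \<Rightarrow>
        'k) \<Rightarrow> 'y)"
  have ex: "\<exists>s. good i s" if i: "i \<le> m" for i
  proof -
    obtain t :: "('t \<Rightarrow> 't, nat \<Rightarrow> ('p \<Rightarrow> 't) \<Rightarrow> 'k) module" and f g where t: "t \<in> add_cat B I" "left_module B t"
        "lin B (Y i) t f"
      "lin B t (Y i) g" "\<And>x. x \<in> carrier (Y i) \<Longrightarrow> g (f x) = x" "\<And>x. x \<in> carrier t \<Longrightarrow> f (g x) = x"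
      using add_cat_copy[OF Il Y(1)[OF i] Y(2)[OF i]] by blast
    have "isos B (Y i) t f g" unfolding isos_def using t B.fgD[OF Y(1)[OF i]] by blast
    then have "good i (t, f, g)" unfolding good_def fst_conv snd_conv using t(1) by simp
    then show ?thesis ..
  qed
  define s where "s i = (SOME s. good i s)" for i
  have s: "good i (s i)" if "i \<le> m" for i unfolding s_def by (rule someI_ex[OF ex[OF that]])
  define t f g where "t i = fst (s i)" "f i = fst (snd (s i))" "g i = snd (snd (s i))" for i
  have t: "t i \<in> add_cat B I" "isos B (Y i) (t i) (f i) (g i)" if "i \<le> m" for i
    using s[OF that] by (simp_all add: t_f_g_def good_def)
  note idN = isos_id[OF Nl]
  let ?d = "\<lambda>i. \<lambda>x\<in>carrier (t i). f (Suc i) (\<delta> i (g i x))" and ?j = "\<lambda>x\<in>carrier N. f 0 (\<iota> x)"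
  have tl: "left_module B (t i)" and tf: "fg_module B (t i)" if "i \<le> m" for i
    using t(1)[OF that] isosD(2)[OF t(2)[OF that]] by (auto simp: add_cat_def)
  have "left_exact B N ?j t ?d m"
    unfolding left_exact_def
  proof (intro conjI allI impI)
    show "?j \<in> mod_hom B N (t 0)" using lin_restrict[OF Nl transport_lin[OF idN t(2) \<iota>(1)]] by simp
    show "?d i \<in> mod_hom B (t i) (t (Suc i))" if "i < m" for i
      using lin_restrict[OF tl transport_lin[OF t(2) t(2) \<delta>[OF that]]] that by simp
    show "inj_on ?j (carrier N)"
    proof (rule inj_onI)
      fix x y assume xy: "x \<in> carrier N" "y \<in> carrier N" "?j x = ?j y"
      have gf: "g 0 (f 0 (\<iota> z)) = \<iota> z" if "z \<in> carrier N" for z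
        by (rule isosD(5)[OF t(2)[OF le0] linD(1)[OF \<iota>(1) that]])
      have "f 0 (\<iota> x) = f 0 (\<iota> y)" using xy by simp
      then have "\<iota> x = \<iota> y" using gf[OF xy(1)] gf[OF xy(2)] by (metis (no_types))
      then show "x = y" using inj_onD[OF \<iota>(2) _ xy(1,2)] by blast
    qed
    show "?j ` carrier N = a_kernel (t 0) (t 1) (?d 0)" if "0 < m"
      using transport_exact[OF idN t(2)[of 0] t(2)[of "Suc 0"] \<delta>[OF that] e0[OF that]] that by simp
    show "?d i ` carrier (t i) = a_kernel (t (Suc i)) (t (Suc (Suc i))) (?d (Suc i))" if "Suc i < m" for i
      using transport_exact[OF t(2) t(2) t(2) \<delta> e[OF that]] that by simp
  qed
  moreover from Hom_I_right_exact[OF tf Nl this]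
  have "right_exact K (\<lambda>i. Hom B (t i) I) (\<lambda>i. precomp B (t i) (t (Suc i)) I (?d i)) (precomp B N (t 0) I ?j)
      (Hom B N I) m" .
  ultimately show ?thesis unfolding cogen_cat_def using N t(1)
    by (intro CollectI conjI impI exI[of _ t] exI[of _ ?d] exI[of _ ?j]) simp_all
qed

end

section \<open>The two presentations of \<open>DT\<close>\<close>

lemma (in endo) K_space_eval: "lin K (K_space S (eval_module T)) V f \<longleftrightarrow> lin K (K_space A T) V f"
  using T.smult_closed scalar(1) by (simp add: lin_def)

context endo_summand
begin

lemma DT_I: "lin K (K_space A T) (regular K) \<xi> \<Longrightarrow> (\<lambda>x\<in>carrier T. \<xi> x) \<in> carrier DT"
  using lin_restrict[OF S.K_space_left_module[OF eval_left_module]] by (simp add: K_space_eval)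

lemma DT_D: "\<xi> \<in> carrier DT \<Longrightarrow> lin K (K_space A T) (regular K) \<xi>" "\<xi> \<in> carrier DT \<Longrightarrow> x \<notin> carrier T \<Longrightarrow> \<xi> x = undefined"
  by (simp_all add: mod_hom_iff K_space_eval extensional_def)

text \<open>\<open>Hom(T, -)\<close> is applied to the tower, and \<open>h\<close> in
  \<open>Hom(T, t 0)\<close> goes to the functional \<open>\<epsilon> (p 0 (h x))\<close>. Every
  functional comes from a map to \<open>N 0\<close> by \<open>dualizing_rep\<close>; the bound on
  \<open>m\<close> allows this map, like those to the first \<open>m\<close> syzygies, to be
  lifted.\<close>

lemma gen_part:
  fixes t N :: "nat \<Rightarrow> ('a, 'n) module"
  assumes tower: "tower J d t N p" and J: "inje J" "fac A PI J J (\<lambda>x. x)" and eps: "dualizing (N 0) \<epsilon>"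
    and pd: "pdim_le TYPE(nat \<Rightarrow> 'k) A k T" and m: "m + k \<le> d"
  shows "DT \<in> gen_cat K B (int m) P"
proof -
  have Tw: "fg_module A (N i)" "fg_module A (t i)" "fac A J (t i) (t i) (\<lambda>x. x)" "lin A (t i) (N i) (p i)"
    "N (Suc i) = submod (t i) {x \<in> carrier (t i). p i x = \<zero>\<^bsub>N i\<^esub>}" if "i \<le> m" for i
    using tower that m by (auto simp: tower_def)
  have tl: "left_module A (t i)" and Nl: "left_module A (N i)" if "i \<le> m" for i using fgD Tw that by auto
  have ker: "submodule {x \<in> carrier (t i). p i x = \<zero>\<^bsub>N i\<^esub>} A (t i)" if "i \<le> m" for i
    using kernel_submodule[OF tl Nl Tw(4)] that by simp
  have lift: "\<exists>g. g \<in> mod_hom A T (t i) \<and> (\<forall>x\<in>carrier T. p i (g x) = f x)" if i: "i \<le> m" and f: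
      "lin A T (N i) f" for i f
  proof -
    have "i + k \<le> d" using i m by simp
    then obtain g where g: "lin A T (t i) g" "\<And>x. x \<in> carrier T \<Longrightarrow> p i (g x) = f x"
      using lift_along_tower[OF tower J(1) pd T _ f] by blast
    then show ?thesis using lin_restrict[OF Tl g(1)] by (intro exI[of _ "\<lambda>x\<in>carrier T. g x"]) simp
  qed
  have eps': "lin K (K_space A (N 0)) (regular K) \<epsilon>" using eps by (simp add: dualizing_def)
  have pS: "lin A (t (Suc i)) (t i) (p (Suc i))" if "Suc i \<le> m" for i
    using lin_from_submod[OF Tw(4)[OF that, unfolded Tw(5)[OF Suc_leD[OF that]]] ker[OF Suc_leD[OF that]]] .
  have pS0: "p i (p (Suc i) x) = \<zero>\<^bsub>N i\<^esub>" if "Suc i \<le> m" "x \<in> carrier (t (Suc i))" for i x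
    using linD(1)[OF Tw(4)[OF that(1)] that(2)] Tw(5)[OF Suc_leD[OF that(1)]] by simp
  let ?\<pi> = "\<lambda>h. \<lambda>x\<in>carrier T. \<epsilon> (p 0 (h x))" and ?\<delta> = "\<lambda>i h. \<lambda>x\<in>carrier T. p (Suc i) (h x)"
  have func: "lin K (K_space A T) (regular K) (\<lambda>x. \<epsilon> (p 0 (h x)))" if "h \<in> mod_hom A T (t 0)" for h
    using lin_comp[OF K_space_lin[OF lin_comp[OF mod_homD[OF that] Tw(4)[OF le0]]] eps'] .
  \<comment> \<open>A map killed by \<open>p i\<close> has its values in the next syzygy and lifts
    from there.\<close>
  have exact: "\<exists>g. g \<in> mod_hom A T (t (Suc i)) \<and> (\<lambda>x\<in>carrier T. p (Suc i) (g x)) = h"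
    if i: "Suc i \<le> m" and h: "h \<in> mod_hom A T (t i)" and z: "\<And>x. x \<in> carrier T \<Longrightarrow> p i (h x) = \<zero>\<^bsub>N i\<^esub>" for i h
  proof -
    have "lin A T (N (Suc i)) h" unfolding Tw(5)[OF Suc_leD[OF i]]
      by (rule lin_into_submod[OF mod_homD[OF h]]) (use z mod_hom_closed[OF h] in simp)
    then obtain g where g: "g \<in> mod_hom A T (t (Suc i))" "\<forall>x\<in>carrier T. p (Suc i) (g x) = h x" using lift[OF i] by blast
    have "(\<lambda>x\<in>carrier T. p (Suc i) (g x)) = h"
      by (rule ext) (use g(2) mod_hom_undefined[OF h] in simp)
    then show ?thesis using g(1) by blast
  qed
  show ?thesis
  proof (rule gen_catI[of _ _ "\<lambda>i. HS (t i)" ?\<pi> ?\<delta>])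
    show "fg_module B DT" by (rule DT_fg)
    show "fg_module B (HS (t i))" if "i \<le> m" for i using HS_fg Tw(2)[OF that] .
    show "fac B P (HS (t i)) (HS (t i)) (\<lambda>x. x)" if "i \<le> m" for i
    proof (rule fac_cong[OF HS_fac[OF PIl tl tl fac_trans[OF tl tl fgD[OF inje_fg[OF J(1)]] Tw(3) J(2)]]])
      show "h = (\<lambda>x\<in>carrier T. h x)" if "h \<in> carrier (HS (t i))" for h
        using that mod_hom_undefined[of h A T "t i"] by (auto simp: fun_eq_iff)
    qed (use that in simp_all)
    show "lin B (HS (t 0)) DT ?\<pi>"
    proof (rule linI)
      fix h assume h: "h \<in> carrier (HS (t 0))"
      then show "?\<pi> h \<in> carrier DT" by (intro DT_I func) simp
    next
      fix g h assume "g \<in> carrier (HS (t 0))" "h \<in> carrier (HS (t 0))"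
      then have gh: "g \<in> mod_hom A T (t 0)" "h \<in> mod_hom A T (t 0)" by simp_all
      have "\<epsilon> (p 0 (g x \<oplus>\<^bsub>t 0\<^esub> h x)) = \<epsilon> (p 0 (g x)) \<oplus>\<^bsub>K\<^esub> \<epsilon> (p 0 (h x))" if "x \<in> carrier T" for x
        using linD(2)[OF lin_comp[OF K_space_lin[OF Tw(4)[OF le0]] eps'], of "g x" "h x"]
          mod_hom_closed[OF gh(1) that] mod_hom_closed[OF gh(2) that] by simp
      then show "?\<pi> (g \<oplus>\<^bsub>HS (t 0)\<^esub> h) = ?\<pi> g \<oplus>\<^bsub>DT\<^esub> ?\<pi> h"
        unfolding Hom_End_source_simps dual_simps eval_module_simps by (intro restrict_ext) simp
    next
      fix b h assume "b \<in> carrier B" "h \<in> carrier (HS (t 0))"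
      then have bh: "b \<in> mod_hom A T T" "h \<in> mod_hom A T (t 0)" by simp_all
      show "?\<pi> (b \<odot>\<^bsub>HS (t 0)\<^esub> h) = b \<odot>\<^bsub>DT\<^esub> ?\<pi> h"
        unfolding Hom_End_source_simps dual_simps eval_module_simps
        by (intro restrict_ext) (use mod_hom_closed[OF bh(1)] in simp)
    qed
    show "?\<pi> ` carrier (HS (t 0)) = carrier DT"
    proof
      show "?\<pi> ` carrier (HS (t 0)) \<subseteq> carrier DT" using DT_I func by auto
      show "carrier DT \<subseteq> ?\<pi> ` carrier (HS (t 0))"
      proof
        fix \<xi> assume \<xi>: "\<xi> \<in> carrier DT"
        obtain g where g: "lin A T (N 0) g" "\<And>x. x \<in> carrier T \<Longrightarrow> \<epsilon> (g x) = \<xi> x"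
          using dualizing_rep[OF eps Tl DT_D(1)[OF \<xi>]] by blast
        obtain h where h: "h \<in> mod_hom A T (t 0)" "\<forall>x\<in>carrier T. p 0 (h x) = g x" using lift[OF le0 g(1)] by blast
        have "\<xi> = ?\<pi> h" by (rule ext) (use g(2) h(2) DT_D(2)[OF \<xi>] in simp)
        then show "\<xi> \<in> ?\<pi> ` carrier (HS (t 0))" using h(1) by simp
      qed
    qed
    show "lin B (HS (t (Suc i))) (HS (t i)) (?\<delta> i)" if "i < m" for i using HS_lin[OF tl pS] that by simp
    show "?\<delta> 0 ` carrier (HS (t (Suc 0))) = {h \<in> carrier (HS (t 0)). ?\<pi> h = \<zero>\<^bsub>DT\<^esub>}" if m0: "0 < m"
    proof
      show "?\<delta> 0 ` carrier (HS (t (Suc 0))) \<subseteq> {h \<in> carrier (HS (t 0)). ?\<pi> h = \<zero>\<^bsub>DT\<^esub>}"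
      proof
        fix k assume "k \<in> ?\<delta> 0 ` carrier (HS (t (Suc 0)))"
        then obtain h where h: "h \<in> mod_hom A T (t (Suc 0))" "k = ?\<delta> 0 h" by auto
        have k: "k \<in> mod_hom A T (t 0)" using lin_restrict[OF Tl lin_comp[OF mod_homD[OF h(1)] pS[of 0]]] h(2)
            m0 by simp
        have "\<epsilon> (p 0 (k x)) = \<zero>\<^bsub>K\<^esub>" if "x \<in> carrier T" for x
          using pS0[of 0 "h x"] mod_hom_closed[OF h(1) that] h(2) m0 that
            lin_zero[OF K_space_left_module[OF Nl[OF le0]] regular_left_module[OF ring_K] eps'] by simp
        then have "?\<pi> k = \<zero>\<^bsub>DT\<^esub>" unfolding dual_simps eval_module_simps by (intro restrict_ext) simp
        with k show "k \<in> {h \<in> carrier (HS (t 0)). ?\<pi> h = \<zero>\<^bsub>DT\<^esub>}" by simp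
      qed
      show "{h \<in> carrier (HS (t 0)). ?\<pi> h = \<zero>\<^bsub>DT\<^esub>} \<subseteq> ?\<delta> 0 ` carrier (HS (t (Suc 0)))"
      proof
        fix h assume "h \<in> {h \<in> carrier (HS (t 0)). ?\<pi> h = \<zero>\<^bsub>DT\<^esub>}"
        then have h: "h \<in> mod_hom A T (t 0)" "?\<pi> h = (\<lambda>x\<in>carrier T. \<zero>\<^bsub>K\<^esub>)" by auto
        \<comment> \<open>A map into \<open>N 0\<close> whose composite with
          \<open>\<epsilon>\<close> vanishes is zero, so the kernel of \<open>?\<pi>\<close>
          consists of the maps killed by \<open>p 0\<close>.\<close>
        have "p 0 (h x) = \<zero>\<^bsub>N 0\<^esub>" if "x \<in> carrier T" for x
        proof (rule dualizing_zero[OF eps Tl lin_comp[OF mod_homD[OF h(1)] Tw(4)[OF le0]] _ that])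
          show "\<epsilon> (p 0 (h y)) = \<zero>\<^bsub>K\<^esub>" if "y \<in> carrier T" for y using fun_cong[OF h(2), of y] that by simp
        qed
        then obtain g where "g \<in> mod_hom A T (t (Suc 0))" "?\<delta> 0 g = h" using exact[OF _ h(1)] m0 by auto
        then show "h \<in> ?\<delta> 0 ` carrier (HS (t (Suc 0)))" by (intro image_eqI[of _ _ g]) simp_all
      qed
    qed
    show "?\<delta> (Suc i) ` carrier (HS (t (Suc (Suc i)))) = {h \<in> carrier (HS (t (Suc i))). ?\<delta> i h = \<zero>\<^bsub>HS (t i)\<^esub>}"
      if i: "Suc i < m" for i
    proof
      have im: "Suc i \<le> m" "Suc (Suc i) \<le> m" "i \<le> m" using i by auto
      have z: "\<zero>\<^bsub>N (Suc i)\<^esub> = \<zero>\<^bsub>t i\<^esub>" using Tw(5)[OF im(3)] by simp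
      show "?\<delta> (Suc i) ` carrier (HS (t (Suc (Suc i)))) \<subseteq> {h \<in> carrier (HS (t (Suc i))). ?\<delta> i h = \<zero>\<^bsub>HS (t i)\<^esub>}"
      proof
        fix k assume "k \<in> ?\<delta> (Suc i) ` carrier (HS (t (Suc (Suc i))))"
        then obtain h where h: "h \<in> mod_hom A T (t (Suc (Suc i)))" "k = ?\<delta> (Suc i) h" by auto
        have k: "k \<in> mod_hom A T (t (Suc i))" using lin_restrict[OF Tl lin_comp[OF mod_homD[OF h(1)] pS[OF
            im(2)]]] h(2) by simp
        have "p (Suc i) (k x) = \<zero>\<^bsub>t i\<^esub>" if "x \<in> carrier T" for x
          using pS0[OF im(2) mod_hom_closed[OF h(1) that]] h(2) that z by simp
        then have "?\<delta> i k = \<zero>\<^bsub>HS (t i)\<^esub>" unfolding Hom_End_source_simps by (intro restrict_ext) simp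
        with k show "k \<in> {h \<in> carrier (HS (t (Suc i))). ?\<delta> i h = \<zero>\<^bsub>HS (t i)\<^esub>}" by simp
      qed
      show "{h \<in> carrier (HS (t (Suc i))). ?\<delta> i h = \<zero>\<^bsub>HS (t i)\<^esub>} \<subseteq> ?\<delta> (Suc i) ` carrier (HS (t (Suc (Suc i))))"
      proof
        fix h assume "h \<in> {h \<in> carrier (HS (t (Suc i))). ?\<delta> i h = \<zero>\<^bsub>HS (t i)\<^esub>}"
        then have h: "h \<in> mod_hom A T (t (Suc i))" "?\<delta> i h = (\<lambda>x\<in>carrier T. \<zero>\<^bsub>t i\<^esub>)" by auto
        have "p (Suc i) (h x) = \<zero>\<^bsub>N (Suc i)\<^esub>" if "x \<in> carrier T" for x using fun_cong[OF h(2), of x] that z by simp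
        then obtain g where "g \<in> mod_hom A T (t (Suc (Suc i)))" "?\<delta> (Suc i) g = h" using exact[OF im(2) h(1)] by auto
        then show "h \<in> ?\<delta> (Suc i) ` carrier (HS (t (Suc (Suc i))))" by (intro image_eqI[of _ _ g]) simp_all
      qed
    qed
  qed
qed

text \<open>By \<open>extend\<close>, the sequence \<open>Hom(t (k - 1), T) \<rightarrow> ...
  \<rightarrow> Hom(t 0, T) \<rightarrow> T \<rightarrow> 0\<close> is exact at \<open>T\<close> and
  at every term but the first, its last map being evaluation at the image of \<open>\<one>\<close>.
  The dual sequence is the one sought. The final term \<open>t k\<close> is left out, whence the
  index \<open>k - 1\<close>.\<close>

lemma cogen_part:
  assumes tc: "tilting_coresolution A k T j0 t d" and k: "1 \<le> k"
    and tP: "\<And>i. i < k \<Longrightarrow> t i \<in> add_cat A PI"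
    and extend: "\<And>c g. \<lbrakk>c < k; lin A (submod (t c) {x \<in> carrier (t c). d c x = \<zero>\<^bsub>t (Suc c)\<^esub>}) T g\<rbrakk> \<Longrightarrow>
      \<exists>h. lin A (t c) T h \<and> (\<forall>x \<in> carrier (t c). d c x = \<zero>\<^bsub>t (Suc c)\<^esub> \<longrightarrow> h x = g x)"
  shows "DT \<in> cogen_cat K B (int (k - 1)) I"
proof -
  define m where "m = k - 1"
  have km: "k = Suc m" using k by (simp add: m_def)
  note D = tilting_coresolutionD[OF tc]
  have tf: "fg_module A (t i)" if "i \<le> k" for i using D(1)[OF that] by (simp add: add_cat_def)
  have tl: "left_module A (t i)" if "i \<le> k" for i using fgD[OF tf[OF that]] .
  \<comment> \<open>Under the identification of \<open>Hom(A, T)\<close> with \<open>T\<close>,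
    composition with \<open>j0\<close> becomes evaluation at \<open>u\<close>.\<close>
  define u where "u = j0 \<one>\<^bsub>A\<^esub>"
  have u: "u \<in> carrier (t 0)" "d 0 u = \<zero>\<^bsub>t (Suc 0)\<^esub>"
  proof -
    interpret A: ring A by (rule ring_A)
    have "u \<in> j0 ` carrier A" by (simp add: u_def)
    then show "u \<in> carrier (t 0)" "d 0 u = \<zero>\<^bsub>t (Suc 0)\<^esub>" using D(7) by auto
  qed
  define Z where "Z c = {x \<in> carrier (t c). d c x = \<zero>\<^bsub>t (Suc c)\<^esub>}" for c
  have ext': "\<exists>h. h \<in> mod_hom A (t c) T \<and> (\<forall>x\<in>Z c. h x = g x)" if c: "c < k" and g:
      "lin A (submod (t c) (Z c)) T g" for c g
  proof -
    obtain h where h: "lin A (t c) T h" "\<forall>x \<in> carrier (t c). d c x = \<zero>\<^bsub>t (Suc c)\<^esub> \<longrightarrow> h x = g x"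
      using extend[OF c] g unfolding Z_def by blast
    then show ?thesis using lin_restrict[OF tl h(1)] c by (intro exI[of _ "\<lambda>x\<in>carrier (t c). h x"]) (simp add: Z_def)
  qed
  have Zs: "submodule (Z c) A (t c)" if "c < k" for c
    unfolding Z_def using kernel_submodule[OF tl tl D(6)] that by simp
  \<comment> \<open>Exactness at \<open>Hom(t c, T)\<close>: a map that vanishes on
    \<open>Z c\<close> descends to the next kernel and extends from there to
    \<open>t (Suc c)\<close>.\<close>
  have factor: "\<exists>h'. h' \<in> mod_hom A (t (Suc c)) T \<and> (\<lambda>x\<in>carrier (t c). h' (d c x)) = h"
    if c: "Suc c < k" and h: "h \<in> mod_hom A (t c) T" and z: "\<And>x. x \<in> Z c \<Longrightarrow> h x = \<zero>\<^bsub>T\<^esub>" for c h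
  proof -
    have ck: "c < k" "c \<le> k" "Suc c \<le> k" using c by auto
    have Zl: "left_module A (submod (t (Suc c)) (Z (Suc c)))" using submodule_left_module[OF tl[OF ck(3)] Zs[OF c]] .
    have dZ: "lin A (t c) (submod (t (Suc c)) (Z (Suc c))) (d c)"
        "d c ` carrier (t c) = carrier (submod (t (Suc c)) (Z (Suc c)))"
      using lin_into_submod[OF D(6)[OF ck(2)], of "Z (Suc c)"] D(8)[OF ck(1)] by (auto simp: Z_def)
    obtain g where g: "lin A (submod (t (Suc c)) (Z (Suc c))) T g" "\<And>x. x \<in> carrier (t c) \<Longrightarrow> g (d c x) = h x"
    proof (rule lin_factor[OF tl[OF ck(2)] Zl Tl dZ mod_homD[OF h]])
      show "h x = \<zero>\<^bsub>T\<^esub>" if "x \<in> carrier (t c)" "d c x = \<zero>\<^bsub>submod (t (Suc c)) (Z (Suc c))\<^esub>" for x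
        using z[of x] that by (simp add: Z_def)
    qed (rule that)
    obtain h' where h': "h' \<in> mod_hom A (t (Suc c)) T" "\<forall>x\<in>Z (Suc c). h' x = g x" using ext'[OF c g(1)] by blast
    have "(\<lambda>x\<in>carrier (t c). h' (d c x)) = h"
    proof (rule ext)
      show "(\<lambda>x\<in>carrier (t c). h' (d c x)) x = h x" for x
        using g(2)[of x] h'(2) linD(1)[OF dZ(1), of x] mod_hom_undefined[OF h, of x] by (cases "x \<in> carrier (t c)") auto
    qed
    then show ?thesis using h'(1) by blast
  qed
  \<comment> \<open>Evaluation at \<open>u\<close> is onto: the map \<open>a \<mapsto> a x\<close>,
    carried over to the image of \<open>j0\<close>, extends to \<open>t 0\<close>.\<close>
  have gen: "\<exists>h. h \<in> mod_hom A (t 0) T \<and> h u = x" if x: "x \<in> carrier T" for x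
  proof -
    interpret A: ring A by (rule ring_A)
    have G: "left_module A (regular A)" using fgD[OF fg_regular] .
    interpret G: left_module A "regular A" by (rule G)
    have ax: "lin A (regular A) T (\<lambda>a. a \<odot>\<^bsub>T\<^esub> x)"
      using x by (intro linI) (auto simp: T.smult_closed T.smult_l_distr T.smult_assoc1)
    have jZ: "lin A (regular A) (submod (t 0) (Z 0)) j0" "j0 ` carrier (regular A) = carrier (submod (t 0) (Z 0))"
      using lin_into_submod[OF D(4), of "Z 0"] D(7) by (auto simp: Z_def)
    obtain g where g: "lin A (submod (t 0) (Z 0)) T g" "\<And>a. a \<in> carrier (regular A) \<Longrightarrow> g (j0 a) = a \<odot>\<^bsub>T\<^esub> x"
    proof (rule lin_factor[OF G submodule_left_module[OF tl[OF le0] Zs[of 0]] Tl jZ ax])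
      fix a assume a: "a \<in> carrier (regular A)" "j0 a = \<zero>\<^bsub>submod (t 0) (Z 0)\<^esub>"
      then have "a = \<zero>\<^bsub>A\<^esub>" using inj_onD[OF D(5), of a "\<zero>\<^bsub>A\<^esub>"] lin_zero[OF G tl[OF le0] D(4)] by simp
      then show "a \<odot>\<^bsub>T\<^esub> x = \<zero>\<^bsub>T\<^esub>" using x by (simp add: T.smult_zero_left)
    qed (use km that in auto)
    obtain h where h: "h \<in> mod_hom A (t 0) T" "\<forall>x\<in>Z 0. h x = g x" using ext'[OF _ g(1)] km by auto
    have "h u = x" using h(2) g(2)[of "\<one>\<^bsub>A\<^esub>"] u x by (simp add: Z_def T.smult_one u_def[symmetric])
    then show ?thesis using h(1) by blast
  qed
  \<comment> \<open>\<open>Z 0\<close> consists of the multiples of \<open>u\<close>, so a map that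
    kills \<open>u\<close> satisfies the hypothesis of \<open>factor\<close>.\<close>
  have vanish: "h x = \<zero>\<^bsub>T\<^esub>" if h: "h \<in> mod_hom A (t 0) T" "h u = \<zero>\<^bsub>T\<^esub>" and x: "x \<in> Z 0" for h x
  proof -
    interpret A: ring A by (rule ring_A)
    obtain a where a: "a \<in> carrier A" "x = j0 a" using D(7) x by (auto simp: Z_def)
    then have "x = a \<odot>\<^bsub>t 0\<^esub> u" using linD(3)[OF D(4), of a "\<one>\<^bsub>A\<^esub>"] by (simp add: u_def)
    then show ?thesis using linD(3)[OF mod_homD[OF h(1)] a(1) u(1)] h(2) a(1) T.smult_zero_right by simp
  qed
  have ev: "lin S (HT (t 0)) (eval_module T) (\<lambda>h. h u)"
    using u(1) mod_hom_closed[of _ A "t 0" T] by (intro linI) simp_all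
  let ?\<iota> = "\<lambda>\<xi>. \<lambda>h\<in>mod_hom A (t 0) T. \<xi> (h u)"
  let ?\<delta> = "\<lambda>i \<eta>. \<lambda>h\<in>mod_hom A (t (Suc i)) T. \<eta> (\<lambda>x\<in>carrier (t i). h (d i x))"
  have HTl: "left_module S (HT (t i))" and HTf: "fgen K (K_space S (HT (t i)))" if "i \<le> k" for i
    using HT_fg[OF tf[OF that]] by (auto simp: S.fg_iff)
  have hd: "(\<lambda>x\<in>carrier (t i). h (d i x)) \<in> mod_hom A (t i) T" if "i < k" "h \<in> mod_hom A (t (Suc i)) T" for i h
    using lin_restrict[OF tl lin_comp[OF D(6) mod_homD[OF that(2)]]] that(1) by simp
  have \<iota>: "lin B DT (DHT (t 0)) ?\<iota>"
    using S.dual_lin[OF HTl[OF le0] eval_left_module ev] by simp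
  have DHTD: "lin K (K_space S (HT X)) (regular K) \<eta>" if "\<eta> \<in> carrier (DHT X)" for X :: "('a, 'x) module" and \<eta>
    using that by (intro mod_homD) simp
  have "DT \<in> cogen_cat K B (int m) I"
  proof (rule cogen_catI[of _ _ "\<lambda>i. DHT (t i)" ?\<iota> ?\<delta>])
    show "fg_module B DT" by (rule DT_fg)
    show "fg_module B (DHT (t i))" if "i \<le> m" for i using DHT_fg[OF tf] that km by simp
    show "fac B I (DHT (t i)) (DHT (t i)) (\<lambda>x. x)" if "i \<le> m" for i
    proof (rule fac_cong[OF DHT_fac[OF PIl tl tl add_cat_fac[OF PIl tP]]])
      fix \<eta> assume \<eta>: "\<eta> \<in> carrier (DHT (t i))"
      have "(\<lambda>x\<in>carrier (t i). h x) = h" if "h \<in> mod_hom A (t i) T" for h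
        by (rule ext) (use mod_hom_undefined[OF that] in simp)
      then show "\<eta> = (\<lambda>h\<in>mod_hom A (t i) T. \<eta> (\<lambda>x\<in>carrier (t i). h x))"
        using \<eta> mod_hom_undefined[of \<eta> K "K_space S (HT (t i))" "regular K"] by (intro ext) simp
    qed (use that km in simp_all)
    show "lin B DT (DHT (t 0)) ?\<iota>" by (rule \<iota>)
    show "inj_on ?\<iota> (carrier DT)"
    proof (rule inj_onI)
      fix \<xi> \<eta> assume *: "\<xi> \<in> carrier DT" "\<eta> \<in> carrier DT" "?\<iota> \<xi> = ?\<iota> \<eta>"
      have "\<xi> x = \<eta> x" if x: "x \<in> carrier T" for x
      proof -
        obtain h where "h \<in> mod_hom A (t 0) T" "h u = x" using gen[OF x] by blast
        then show ?thesis using fun_cong[OF *(3), of h] by simp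
      qed
      then show "\<xi> = \<eta>" using DT_D(2)[OF *(1)] DT_D(2)[OF *(2)] by (intro ext) metis
    qed
    show "lin B (DHT (t i)) (DHT (t (Suc i))) (?\<delta> i)" if "i < m" for i
      using DHT_lin[OF tl tl D(6)] that km by simp
    show "?\<iota> ` carrier DT = {\<eta> \<in> carrier (DHT (t 0)). ?\<delta> 0 \<eta> = \<zero>\<^bsub>DHT (t (Suc 0))\<^esub>}" if m0: "0 < m"
    proof
      show "?\<iota> ` carrier DT \<subseteq> {\<eta> \<in> carrier (DHT (t 0)). ?\<delta> 0 \<eta> = \<zero>\<^bsub>DHT (t (Suc 0))\<^esub>}"
      proof
        fix \<eta> assume "\<eta> \<in> ?\<iota> ` carrier DT"
        then obtain \<xi> where \<xi>: "\<xi> \<in> carrier DT" "\<eta> = ?\<iota> \<xi>" by blast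
        have "\<eta> (\<lambda>x\<in>carrier (t 0). h (d 0 x)) = \<zero>\<^bsub>K\<^esub>" if h: "h \<in> mod_hom A (t (Suc 0)) T" for h
        proof -
          have "h (d 0 u) = \<zero>\<^bsub>T\<^esub>" using lin_zero[OF tl Tl mod_homD[OF h]] u(2) km by simp
          then show ?thesis using hd[of 0 h] h km u(1) \<xi> lin_zero[OF K_space_left_module[OF Tl]
              regular_left_module[OF ring_K] DT_D(1)[OF \<xi>(1)]]
            by simp
        qed
        then have "?\<delta> 0 \<eta> = \<zero>\<^bsub>DHT (t (Suc 0))\<^esub>" unfolding dual_simps Hom_End_target_simps by (intro restrict_ext)
        then show "\<eta> \<in> {\<eta> \<in> carrier (DHT (t 0)). ?\<delta> 0 \<eta> = \<zero>\<^bsub>DHT (t (Suc 0))\<^esub>}" using linD(1)[OF \<iota> \<xi>(1)] \<xi>(2) by blast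
      qed
      show "{\<eta> \<in> carrier (DHT (t 0)). ?\<delta> 0 \<eta> = \<zero>\<^bsub>DHT (t (Suc 0))\<^esub>} \<subseteq> ?\<iota> ` carrier DT"
      proof
        fix \<eta> assume "\<eta> \<in> {\<eta> \<in> carrier (DHT (t 0)). ?\<delta> 0 \<eta> = \<zero>\<^bsub>DHT (t (Suc 0))\<^esub>}"
        then have \<eta>: "\<eta> \<in> carrier (DHT (t 0))" "?\<delta> 0 \<eta> = (\<lambda>h\<in>mod_hom A (t (Suc 0)) T. \<zero>\<^bsub>K\<^esub>)" by simp_all
        have z: "\<eta> h = \<zero>\<^bsub>K\<^esub>" if h: "h \<in> carrier (K_space S (HT (t 0)))" "h u = \<zero>\<^bsub>K_space S (eval_module T)\<^esub>" for h
        proof -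
          have h': "h \<in> mod_hom A (t 0) T" "h u = \<zero>\<^bsub>T\<^esub>" using h by simp_all
          obtain h1 where h1: "h1 \<in> mod_hom A (t (Suc 0)) T" "(\<lambda>x\<in>carrier (t 0). h1 (d 0 x)) = h"
            using factor[OF _ h'(1) vanish[OF h']] m0 km by auto
          show ?thesis using fun_cong[OF \<eta>(2), of h1] unfolding restrict_apply h1(2) using h1(1) by simp
        qed
        have evf: "fgen K (K_space S (eval_module T))" using eval_fg by (simp add: S.fg_iff)
        \<comment> \<open>\<open>\<eta>\<close> vanishes on the kernel of evaluation at
          \<open>u\<close>, hence depends only on \<open>h u\<close>; the resulting functional on
          \<open>T\<close> is the desired preimage.\<close>
        obtain \<psi> where \<psi>: "lin K (K_space S (eval_module T)) (regular K) \<psi>"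
            "\<And>h. h \<in> carrier (K_space S (HT (t 0))) \<Longrightarrow> \<psi> (h u) = \<eta> h"
          using functional_factor[OF field_K S.K_space_left_module[OF HTl[OF le0]] S.K_space_left_module[OF
              eval_left_module] evf
            S.K_space_lin[OF ev] DHTD[OF \<eta>(1)] z] by blast
        have "(\<lambda>x\<in>carrier T. \<psi> x) \<in> carrier DT" using DT_I \<psi>(1) by (simp add: K_space_eval)
        moreover have "\<eta> = ?\<iota> (\<lambda>x\<in>carrier T. \<psi> x)"
        proof (rule ext)
          fix h
          show "\<eta> h = ?\<iota> (\<lambda>x\<in>carrier T. \<psi> x) h"
          proof (cases "h \<in> mod_hom A (t 0) T")
            case True then show ?thesis using \<psi>(2)[of h] mod_hom_closed[OF True u(1)] by simp
          next
            case False then show ?thesis using mod_hom_undefined[of \<eta> K "K_space S (HT (t 0))" "regular K" h]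
                \<eta>(1) by simp
          qed
        qed
        ultimately show "\<eta> \<in> ?\<iota> ` carrier DT" by (intro image_eqI[of _ _ "\<lambda>x\<in>carrier T. \<psi> x"])
      qed
    qed
    show "?\<delta> i ` carrier (DHT (t i)) = {\<eta> \<in> carrier (DHT (t (Suc i))). ?\<delta> (Suc i) \<eta> = \<zero>\<^bsub>DHT (t (Suc (Suc i)))\<^esub>}"
        if i: "Suc i < m" for i
    proof
      have ik: "i < k" "Suc i < k" "Suc (Suc i) < k" "i \<le> k" "Suc i \<le> k" "Suc (Suc i) \<le> k" using i km by auto
      have \<delta>l: "lin B (DHT (t i)) (DHT (t (Suc i))) (?\<delta> i)" using DHT_lin[OF tl[OF ik(4)] tl[OF ik(5)] D(6)[OF ik(4)]] .
      show "?\<delta> i ` carrier (DHT (t i)) \<subseteq> {\<eta> \<in> carrier (DHT (t (Suc i))). ?\<delta> (Suc i) \<eta> = \<zero>\<^bsub>DHT (t (Suc (Suc i)))\<^esub>}"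
      proof
        fix \<eta> assume "\<eta> \<in> ?\<delta> i ` carrier (DHT (t i))"
        then obtain \<xi> where \<xi>: "\<xi> \<in> carrier (DHT (t i))" "\<eta> = ?\<delta> i \<xi>" by blast
        have "\<eta> (\<lambda>x\<in>carrier (t (Suc i)). h (d (Suc i) x)) = \<zero>\<^bsub>K\<^esub>" if h: "h \<in> mod_hom A (t (Suc (Suc i))) T" for h
        proof -
          have dx: "d i x \<in> carrier (t (Suc i))" "h (d (Suc i) (d i x)) = \<zero>\<^bsub>T\<^esub>" if "x \<in> carrier (t i)" for x
          proof -
            have "d i x \<in> {x \<in> carrier (t (Suc i)). d (Suc i) x = \<zero>\<^bsub>t (Suc (Suc i))\<^esub>}" using D(8)[OF ik(1)] that
                by blast
            then show "d i x \<in> carrier (t (Suc i))" "h (d (Suc i) (d i x)) = \<zero>\<^bsub>T\<^esub>"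
              using lin_zero[OF tl[OF ik(6)] Tl mod_homD[OF h]] by auto
          qed
          have "(\<lambda>x\<in>carrier (t i). (\<lambda>x\<in>carrier (t (Suc i)). h (d (Suc i) x)) (d i x)) = \<zero>\<^bsub>K_space S (HT (t i))\<^esub>"
            unfolding K_space_simps Hom_End_target_simps by (intro restrict_ext) (simp add: dx)
          then show ?thesis unfolding \<xi>(2) restrict_apply[of _ _ "\<lambda>x\<in>carrier (t (Suc i)). h (d (Suc i) x)"]
            using hd[OF ik(2) h] lin_zero[OF S.K_space_left_module[OF HTl[OF ik(4)]] regular_left_module[OF
                ring_K] DHTD[OF \<xi>(1)]]
            by (simp only: if_True regular_simps)
        qed
        then have "?\<delta> (Suc i) \<eta> = \<zero>\<^bsub>DHT (t (Suc (Suc i)))\<^esub>" unfolding dual_simps Hom_End_target_simps by (intro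
            restrict_ext)
        then show "\<eta> \<in> {\<eta> \<in> carrier (DHT (t (Suc i))). ?\<delta> (Suc i) \<eta> = \<zero>\<^bsub>DHT (t (Suc (Suc i)))\<^esub>}" using
            linD(1)[OF \<delta>l \<xi>(1)] \<xi>(2) by blast
      qed
      show "{\<eta> \<in> carrier (DHT (t (Suc i))). ?\<delta> (Suc i) \<eta> = \<zero>\<^bsub>DHT (t (Suc (Suc i)))\<^esub>} \<subseteq> ?\<delta> i ` carrier (DHT (t i))"
      proof
        fix \<eta> assume "\<eta> \<in> {\<eta> \<in> carrier (DHT (t (Suc i))). ?\<delta> (Suc i) \<eta> = \<zero>\<^bsub>DHT (t (Suc (Suc i)))\<^esub>}"
        then have \<eta>: "\<eta> \<in> carrier (DHT (t (Suc i)))" "?\<delta> (Suc i) \<eta> = (\<lambda>h\<in>mod_hom A (t (Suc (Suc i))) T. \<zero>\<^bsub>K\<^esub>)"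
            by simp_all
        have gl: "lin S (HT (t (Suc i))) (HT (t i)) (\<lambda>h. \<lambda>x\<in>carrier (t i). h (d i x))" using HT_lin[OF tl[OF
            ik(4)] D(6)[OF ik(4)]] .
        have z: "\<eta> h = \<zero>\<^bsub>K\<^esub>" if h: "h \<in> carrier (K_space S (HT (t (Suc i))))"
            "(\<lambda>x\<in>carrier (t i). h (d i x)) = \<zero>\<^bsub>K_space S (HT (t i))\<^esub>" for h
        proof -
          have h': "h \<in> mod_hom A (t (Suc i)) T" using h by simp
          have "h x = \<zero>\<^bsub>T\<^esub>" if x: "x \<in> Z (Suc i)" for x
          proof -
            obtain y where "y \<in> carrier (t i)" "x = d i y" using D(8)[OF ik(1)] x unfolding Z_def by blast
            then show ?thesis using fun_cong[OF h(2), of y] by simp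
          qed
          then obtain h1 where h1: "h1 \<in> mod_hom A (t (Suc (Suc i))) T" "(\<lambda>x\<in>carrier (t (Suc i)). h1 (d (Suc i) x)) = h"
            using factor[OF ik(3) h'] by blast
          show ?thesis using fun_cong[OF \<eta>(2), of h1] unfolding restrict_apply h1(2) using h1(1) by simp
        qed
        obtain \<psi> where \<psi>: "lin K (K_space S (HT (t i))) (regular K) \<psi>"
          "\<And>h. h \<in> carrier (K_space S (HT (t (Suc i)))) \<Longrightarrow> \<psi> (\<lambda>x\<in>carrier (t i). h (d i x)) = \<eta> h"
          using functional_factor[OF field_K S.K_space_left_module[OF HTl[OF ik(5)]] S.K_space_left_module[OF
              HTl[OF ik(4)]] HTf[OF ik(4)]
            S.K_space_lin[OF gl] DHTD[OF \<eta>(1)] z] by blast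
        have "(\<lambda>h\<in>mod_hom A (t i) T. \<psi> h) \<in> carrier (DHT (t i))"
          using lin_restrict[OF S.K_space_left_module[OF HTl[OF ik(4)]] \<psi>(1)] by simp
        moreover have "\<eta> = ?\<delta> i (\<lambda>h\<in>mod_hom A (t i) T. \<psi> h)"
        proof (rule ext)
          fix h
          show "\<eta> h = ?\<delta> i (\<lambda>h\<in>mod_hom A (t i) T. \<psi> h) h"
          proof (cases "h \<in> mod_hom A (t (Suc i)) T")
            case True
            have "\<eta> h = \<psi> (\<lambda>x\<in>carrier (t i). h (d i x))" using \<psi>(2)[of h] True by simp
            then show ?thesis using True hd[OF ik(1) True] by (simp only: restrict_apply if_True)
          next
            case False then show ?thesis using mod_hom_undefined[of \<eta> K "K_space S (HT (t (Suc i)))" "regular K"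
                h] \<eta>(1) by simp
          qed
        qed
        ultimately show "\<eta> \<in> ?\<delta> i ` carrier (DHT (t i))" by (intro image_eqI[of _ _ "\<lambda>h\<in>mod_hom A (t i) T. \<psi> h"])
      qed
    qed
  qed
  then show ?thesis by (simp add: m_def)
qed

end

section \<open>The intermediate extension\<close>

lemma compose_undefined [simp]: "x \<notin> C \<Longrightarrow> compose C f g x = undefined"
  by (simp add: compose_def)

text \<open>\<open>E\<close> is described by a bijection \<open>\<psi>\<close> to the functionals on
  \<open>PI\<close> under which \<open>c\<close> in \<open>eBe\<close> acts through
  \<open>q c j\<close>. The algebra over which \<open>E\<close> was originally given does not
  appear, so the transport of structure to the corner is dealt with separately.\<close>

locale intermediate = endo_summand K A T PI j q
  for K :: "'k ring" and A :: "('k, 'a) module" and T :: "('a, 't) module" and PI :: "('a, 'p) module"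
    and j :: "'p \<Rightarrow> 't" and q :: "'t \<Rightarrow> 'p" +
  fixes E :: "('t \<Rightarrow> 't, 'e) module" and \<psi> :: "'e \<Rightarrow> 'p \<Rightarrow> 'k"
  assumes E_group: "abelian_group E"
    and \<psi>_bij: "bij_betw \<psi> (carrier E) (mod_hom K (K_space A PI) (regular K))"
    and \<psi>_add: "\<lbrakk>m \<in> carrier E; n \<in> carrier E\<rbrakk> \<Longrightarrow> \<psi> (m \<oplus>\<^bsub>E\<^esub> n) = (\<lambda>p\<in>carrier PI. \<psi> m p \<oplus>\<^bsub>K\<^esub> \<psi> n p)"
    and act_closed: "\<lbrakk>c \<in> carrier (corner (op_alg (End_alg A T)) (compose (carrier T) j q)); m \<in> carrier E\<rbrakk> \<Longrightarrow>
      c \<odot>\<^bsub>E\<^esub> m \<in> carrier E"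
    and \<psi>_act: "\<lbrakk>c \<in> carrier (corner (op_alg (End_alg A T)) (compose (carrier T) j q)); m \<in> carrier E\<rbrakk> \<Longrightarrow>
      \<psi> (c \<odot>\<^bsub>E\<^esub> m) = (\<lambda>p\<in>carrier PI. \<psi> m (q (c (j p))))"
begin

abbreviation "e \<equiv> compose (carrier T) j q"
abbreviation "C \<equiv> corner B e"
abbreviation "N \<equiv> Be_module B e"
abbreviation "eB \<equiv> eB_module B e"
abbreviation "L \<equiv> mod_hom K (K_space A PI) (regular K)"

sublocale E: abelian_group E
  by (rule E_group)

lemma e_in_S: "e \<in> mod_hom A T T"
  using jp_in_S[OF q] .

lemma j_closed: "p \<in> carrier PI \<Longrightarrow> j p \<in> carrier T" and q_closed: "t \<in> carrier T \<Longrightarrow> q t \<in> carrier PI"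
  using mod_hom_closed[OF j] mod_hom_closed[OF q] by auto

lemma S_closed: "x \<in> mod_hom A T T \<Longrightarrow> t \<in> carrier T \<Longrightarrow> x t \<in> carrier T"
  by (rule mod_hom_closed)

text \<open>Products in \<open>B\<close> are reversed composites. Thus \<open>Be\<close> consists of
  the endomorphisms \<open>e x\<close>, those with values in the summand, and \<open>eB\<close> of
  the endomorphisms \<open>y e\<close>, those that factor through the projection.\<close>

lemma Be_iff: "x \<in> carrier N \<longleftrightarrow> x \<in> mod_hom A T T \<and> (\<forall>t\<in>carrier T. j (q (x t)) = x t)"
proof
  assume "x \<in> carrier N"
  then obtain b where b: "b \<in> mod_hom A T T" "x = compose (carrier T) e b" by (auto simp: Be_module_def)
  then show "x \<in> mod_hom A T T \<and> (\<forall>t\<in>carrier T. j (q (x t)) = x t)"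
    using mod_hom_compose[OF Tl e_in_S b(1)] S_closed[OF b(1)] q_closed j_closed by (simp add: qj_apply)
next
  assume x: "x \<in> mod_hom A T T \<and> (\<forall>t\<in>carrier T. j (q (x t)) = x t)"
  have "compose (carrier T) e x t = x t" for t
    by (cases "t \<in> carrier T") (use x mod_hom_undefined[of x A T T] S_closed[of x] in simp_all)
  then have "x = compose (carrier T) e x" by auto
  then show "x \<in> carrier N" using x by (auto simp: Be_module_def)
qed

lemma eB_iff: "y \<in> carrier eB \<longleftrightarrow> y \<in> mod_hom A T T \<and> (\<forall>t\<in>carrier T. y (j (q t)) = y t)"
proof
  assume "y \<in> carrier eB"
  then obtain b where b: "b \<in> mod_hom A T T" "y = compose (carrier T) b e" by (auto simp: eB_module_def)
  then show "y \<in> mod_hom A T T \<and> (\<forall>t\<in>carrier T. y (j (q t)) = y t)"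
    using mod_hom_compose[OF Tl b(1) e_in_S] q_closed j_closed by (simp add: qj_apply)
next
  assume y: "y \<in> mod_hom A T T \<and> (\<forall>t\<in>carrier T. y (j (q t)) = y t)"
  have "compose (carrier T) y e t = y t" for t
    by (cases "t \<in> carrier T") (use y mod_hom_undefined[of y A T T] in simp_all)
  then have "y = compose (carrier T) y e" by auto
  then show "y \<in> carrier eB" using y by (auto simp: eB_module_def)
qed

lemma corner_iff: "c \<in> carrier C \<longleftrightarrow> c \<in> carrier N \<and> c \<in> carrier eB"
proof
  assume "c \<in> carrier C"
  then obtain b where b: "b \<in> mod_hom A T T" "c = compose (carrier T) e (compose (carrier T) b e)"
    by (auto simp: corner_def)
  have "compose (carrier T) b e \<in> mod_hom A T T" using mod_hom_compose[OF Tl b(1) e_in_S] .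
  then have "c \<in> mod_hom A T T" using mod_hom_compose[OF Tl e_in_S] b(2) by simp
  then show "c \<in> carrier N \<and> c \<in> carrier eB"
    using b S_closed[OF b(1)] q_closed j_closed by (simp add: Be_iff eB_iff qj_apply)
next
  assume c: "c \<in> carrier N \<and> c \<in> carrier eB"
  then have c': "c \<in> mod_hom A T T" "\<And>t. t \<in> carrier T \<Longrightarrow> j (q (c t)) = c t" "\<And>t. t \<in> carrier T \<Longrightarrow> c (j (q t)) = c t"
    by (auto simp: Be_iff eB_iff)
  have "compose (carrier T) e (compose (carrier T) c e) t = c t" for t
    by (cases "t \<in> carrier T") (simp_all add: c' S_closed mod_hom_undefined[OF c'(1)])
  then have "c = compose (carrier T) e (compose (carrier T) c e)" by auto
  then show "c \<in> carrier C" using c'(1) by (auto simp: corner_def)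
qed

lemma N_S: "x \<in> carrier N \<Longrightarrow> x \<in> mod_hom A T T" and eB_S: "y \<in> carrier eB \<Longrightarrow> y \<in> mod_hom A T T"
  by (simp_all add: Be_iff eB_iff)

lemma N_simps: "x \<oplus>\<^bsub>N\<^esub> y = x \<oplus>\<^bsub>S\<^esub> y" "c \<odot>\<^bsub>N\<^esub> x = compose (carrier T) c x"
  by (simp_all add: Be_module_def)

lemma eB_simps: "x \<oplus>\<^bsub>eB\<^esub> y = x \<oplus>\<^bsub>S\<^esub> y" "c \<odot>\<^bsub>eB\<^esub> y = compose (carrier T) y c"
  by (simp_all add: eB_module_def)

lemma S_add: "\<lbrakk>x \<in> mod_hom A T T; y \<in> mod_hom A T T\<rbrakk> \<Longrightarrow> x \<oplus>\<^bsub>S\<^esub> y \<in> mod_hom A T T"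
  using S.ring_A by (metis End_alg_simps(1) abelian_groupE(1) ring_def)

lemma N_add: assumes "x \<in> carrier N" "y \<in> carrier N" shows "x \<oplus>\<^bsub>N\<^esub> y \<in> carrier N"
  using assms S_add[of x y] linD(2)[OF mod_homD[OF j]] linD(2)[OF mod_homD[OF q]] S_closed[of x] S_closed[of y] q_closed
  by (simp add: Be_iff N_simps)

lemma N_compose: assumes "x \<in> carrier N" "b \<in> mod_hom A T T" shows "compose (carrier T) x b \<in> carrier N"
  using assms mod_hom_compose[OF Tl, of x T T b] S_closed[of b] by (simp add: Be_iff)

lemma N_act: assumes "a \<in> carrier C" "x \<in> carrier N" shows "compose (carrier T) a x \<in> carrier N"
  using assms mod_hom_compose[OF Tl, of a T T x] S_closed[of x] by (simp add: corner_iff Be_iff)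

lemma eB_compose: assumes "y \<in> carrier eB" "b \<in> mod_hom A T T" shows "compose (carrier T) b y \<in> carrier eB"
  using assms mod_hom_compose[OF Tl, of b T T y] j_closed q_closed by (simp add: eB_iff)

lemma pairing_corner: assumes "x \<in> carrier N" "y \<in> carrier eB" shows "compose (carrier T) x y \<in> carrier C"
  using assms N_compose eB_compose N_S eB_S by (simp add: corner_iff)

abbreviation "\<psi>' \<equiv> inv_into (carrier E) \<psi>"

lemma \<psi>_inv: "m \<in> carrier E \<Longrightarrow> \<psi>' (\<psi> m) = m" "l \<in> L \<Longrightarrow> \<psi> (\<psi>' l) = l" "l \<in> L \<Longrightarrow> \<psi>' l \<in> carrier E" "m \<in> carrier E \<Longrightarrow> \<psi> m \<in> L"
  using \<psi>_bij by (auto simp: bij_betw_inv_into_left bij_betw_inv_into_right bij_betw_apply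
    intro: bij_betw_apply[OF bij_betw_inv_into])

lemma \<psi>_eq: "\<lbrakk>m \<in> carrier E; n \<in> carrier E; \<psi> m = \<psi> n\<rbrakk> \<Longrightarrow> m = n"
  using \<psi>_inv(1) by metis

lemma restr_L:
  assumes "\<xi> \<in> carrier DT" "y \<in> mod_hom A T T" shows "(\<lambda>p\<in>carrier PI. \<xi> (y (j p))) \<in> L"
  using lin_restrict[OF K_space_left_module[OF PIl]
    lin_comp[OF K_space_lin[OF lin_comp[OF mod_homD[OF j] mod_homD[OF assms(2)]]] DT_D(1)[OF assms(1)]]] by simp

text \<open>The value of the multiplication map from \<open>Be \<otimes> E\<close> to
  \<open>DT\<close> at a pure tensor; \<open>m\<close> is read as the element of \<open>e DT\<close>
  given by \<open>\<psi> m\<close> after \<open>q\<close>.\<close>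

definition xi :: "('t \<Rightarrow> 't) \<Rightarrow> 'e \<Rightarrow> 't \<Rightarrow> 'k" where
  "xi x m = (\<lambda>t\<in>carrier T. \<psi> m (q (x t)))"

text \<open>The map from \<open>DT\<close> to \<open>Hom(eB, E)\<close>: for \<open>y\<close> in
  \<open>eB\<close> the multiple \<open>y \<xi>\<close> lies in \<open>e DT\<close>, and restriction
  along \<open>j\<close> turns it into an element of \<open>E\<close>.\<close>

definition \<delta> :: "('t \<Rightarrow> 'k) \<Rightarrow> ('t \<Rightarrow> 't) \<Rightarrow> 'e" where
  "\<delta> \<xi> = (\<lambda>y\<in>carrier eB. \<psi>' (\<lambda>p\<in>carrier PI. \<xi> (y (j p))))"

lemma xi_DT: assumes "x \<in> mod_hom A T T" "m \<in> carrier E" shows "xi x m \<in> carrier DT"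
  unfolding xi_def
  using DT_I[OF lin_comp[OF K_space_lin[OF lin_comp[OF mod_homD[OF assms(1)] mod_homD[OF q]]] mod_homD[OF
      \<psi>_inv(4)[OF assms(2)]]]] .

lemma \<delta>_val: assumes "\<xi> \<in> carrier DT" "y \<in> carrier eB"
  shows "\<delta> \<xi> y \<in> carrier E" "\<psi> (\<delta> \<xi> y) = (\<lambda>p\<in>carrier PI. \<xi> (y (j p)))"
  using assms \<psi>_inv(2,3)[OF restr_L[OF assms(1) eB_S[OF assms(2)]]] by (simp_all add: \<delta>_def)

lemma \<delta>_right_adjoint: assumes \<xi>: "\<xi> \<in> carrier DT" shows "\<delta> \<xi> \<in> mod_hom C eB E"
  unfolding mod_hom_def
proof (intro CollectI conjI ballI)
  show "\<delta> \<xi> \<in> carrier eB \<rightarrow>\<^sub>E carrier E" using \<delta>_val(1)[OF \<xi>] by (auto simp: \<delta>_def)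
  fix y z assume yz: "y \<in> carrier eB" "z \<in> carrier eB"
  have add: "y \<oplus>\<^bsub>eB\<^esub> z \<in> carrier eB"
    using yz S_add[OF eB_S eB_S] j_closed q_closed by (simp add: eB_iff eB_simps)
  show "\<delta> \<xi> (y \<oplus>\<^bsub>eB\<^esub> z) = \<delta> \<xi> y \<oplus>\<^bsub>E\<^esub> \<delta> \<xi> z"
  proof (rule \<psi>_eq)
    have "\<xi> (y (j p) \<oplus>\<^bsub>T\<^esub> z (j p)) = \<xi> (y (j p)) \<oplus>\<^bsub>K\<^esub> \<xi> (z (j p))" if "p \<in> carrier PI" for p
      using linD(2)[OF DT_D(1)[OF \<xi>]] S_closed[OF eB_S[OF yz(1)]] S_closed[OF eB_S[OF yz(2)]] j_closed[OF that] by simp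
    then show "\<psi> (\<delta> \<xi> (y \<oplus>\<^bsub>eB\<^esub> z)) = \<psi> (\<delta> \<xi> y \<oplus>\<^bsub>E\<^esub> \<delta> \<xi> z)"
      unfolding \<psi>_add[OF \<delta>_val(1)[OF \<xi> yz(1)] \<delta>_val(1)[OF \<xi> yz(2)]] \<delta>_val(2)[OF \<xi> add] \<delta>_val(2)[OF \<xi> yz(1)]
          \<delta>_val(2)[OF \<xi> yz(2)]
      by (intro restrict_ext) (simp add: eB_simps j_closed)
  qed (use \<delta>_val(1)[OF \<xi>] yz add in simp_all)
next
  fix c y assume c: "c \<in> carrier C" and y: "y \<in> carrier eB"
  have cS: "c \<in> mod_hom A T T" and ce: "\<And>t. t \<in> carrier T \<Longrightarrow> j (q (c t)) = c t"
    using c by (auto simp: corner_iff Be_iff)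
  have cy: "c \<odot>\<^bsub>eB\<^esub> y \<in> carrier eB" using c eB_compose[of c "y"] eB_S[OF y] by (simp add: eB_simps corner_iff)
  show "\<delta> \<xi> (c \<odot>\<^bsub>eB\<^esub> y) = c \<odot>\<^bsub>E\<^esub> \<delta> \<xi> y"
  proof (rule \<psi>_eq)
    show "\<psi> (\<delta> \<xi> (c \<odot>\<^bsub>eB\<^esub> y)) = \<psi> (c \<odot>\<^bsub>E\<^esub> \<delta> \<xi> y)"
      unfolding \<psi>_act[OF c \<delta>_val(1)[OF \<xi> y]] \<delta>_val(2)[OF \<xi> cy] \<delta>_val(2)[OF \<xi> y]
      by (intro restrict_ext) (simp add: eB_simps j_closed ce q_closed S_closed[OF cS])
  qed (use \<delta>_val(1)[OF \<xi>] y cy act_closed[OF c] in simp_all)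
qed

lemma \<delta>_add: assumes "\<xi> \<in> carrier DT" "\<eta> \<in> carrier DT" "y \<in> carrier eB" shows "\<delta> (\<xi> \<oplus>\<^bsub>DT\<^esub> \<eta>) y = \<delta> \<xi> y \<oplus>\<^bsub>E\<^esub> \<delta> \<eta> y"
proof -
  interpret D: left_module B DT using B.fgD[OF DT_fg] .
  have s: "\<xi> \<oplus>\<^bsub>DT\<^esub> \<eta> \<in> carrier DT" using D.M.a_closed[OF assms(1,2)] .
  show ?thesis
  proof (rule \<psi>_eq)
    show "\<psi> (\<delta> (\<xi> \<oplus>\<^bsub>DT\<^esub> \<eta>) y) = \<psi> (\<delta> \<xi> y \<oplus>\<^bsub>E\<^esub> \<delta> \<eta> y)"
      unfolding \<psi>_add[OF \<delta>_val(1)[OF assms(1,3)] \<delta>_val(1)[OF assms(2,3)]] \<delta>_val(2)[OF s assms(3)]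
        \<delta>_val(2)[OF assms(1,3)] \<delta>_val(2)[OF assms(2,3)]
      by (intro restrict_ext) (simp add: S_closed[OF eB_S[OF assms(3)]] j_closed)
  qed (use \<delta>_val(1) s assms in simp_all)
qed

lemma \<delta>_smult: assumes "\<xi> \<in> carrier DT" "b \<in> mod_hom A T T" "y \<in> carrier eB"
  shows "\<delta> (b \<odot>\<^bsub>DT\<^esub> \<xi>) y = \<delta> \<xi> (compose (carrier T) b y)"
proof -
  interpret D: left_module B DT using B.fgD[OF DT_fg] .
  have s: "b \<odot>\<^bsub>DT\<^esub> \<xi> \<in> carrier DT" using D.smult_closed[of b \<xi>] assms by simp
  have "(\<lambda>p\<in>carrier PI. (b \<odot>\<^bsub>DT\<^esub> \<xi>) (y (j p))) = (\<lambda>p\<in>carrier PI. \<xi> (compose (carrier T) b y (j p)))"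
    by (intro restrict_ext) (simp add: S_closed[OF eB_S[OF assms(3)]] j_closed)
  then show ?thesis using assms eB_compose[OF assms(3,2)] by (simp only: \<delta>_def restrict_apply if_True)
qed

text \<open>On pure tensors the composite of the two maps is given by the formula that characterises
  \<open>zeta\<close>.\<close>

lemma \<delta>_xi: assumes "x \<in> carrier N" "m \<in> carrier E"
  shows "\<delta> (xi x m) = (\<lambda>y\<in>carrier eB. (y \<otimes>\<^bsub>B\<^esub> x) \<odot>\<^bsub>E\<^esub> m)"
proof (rule ext)
  fix y
  show "\<delta> (xi x m) y = (\<lambda>y\<in>carrier eB. (y \<otimes>\<^bsub>B\<^esub> x) \<odot>\<^bsub>E\<^esub> m) y"
  proof (cases "y \<in> carrier eB")
    case True
    note x = xi_DT[OF N_S[OF assms(1)] assms(2)] and c = pairing_corner[OF assms(1) True]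
    have "\<delta> (xi x m) y = compose (carrier T) x y \<odot>\<^bsub>E\<^esub> m"
    proof (rule \<psi>_eq[OF \<delta>_val(1)[OF x True] act_closed[OF c assms(2)]])
      show "\<psi> (\<delta> (xi x m) y) = \<psi> (compose (carrier T) x y \<odot>\<^bsub>E\<^esub> m)"
        unfolding \<psi>_act[OF c assms(2)] \<delta>_val(2)[OF x True]
        by (intro restrict_ext) (simp add: xi_def S_closed[OF eB_S[OF True]] j_closed)
    qed
    then show ?thesis using True by simp
  qed (simp add: \<delta>_def)
qed

section \<open>The free abelian group behind the tensor product\<close>

abbreviation "F \<equiv> tensor_free N E"
abbreviation "H \<equiv> tensor_null C N E"

lemma F_iff: "c \<in> carrier F \<longleftrightarrow> Poly_Mapping.keys c \<subseteq> carrier N \<times> carrier E"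
  by (simp add: tensor_free_def)

lemma F_mult [simp]: "c \<otimes>\<^bsub>F\<^esub> d = c + d" and F_one [simp]: "\<one>\<^bsub>F\<^esub> = 0"
  by (simp_all add: tensor_free_def)

lemma F_comm_group: "comm_group F"
  by (simp add: tensor_free_def abelian_free_Abelian_group)

lemma F_diff: "\<lbrakk>c \<in> carrier F; d \<in> carrier F\<rbrakk> \<Longrightarrow> c - d \<in> carrier F"
  using keys_diff[of c d] by (auto simp: F_iff)

lemma F_of: "\<lbrakk>x \<in> carrier N; m \<in> carrier E\<rbrakk> \<Longrightarrow> frag_of (x, m) \<in> carrier F"
  by (simp add: F_iff)

lemma relations_F: "tensor_relations C N E \<subseteq> carrier F"
proof
  fix r assume "r \<in> tensor_relations C N E"
  then show "r \<in> carrier F"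
    unfolding tensor_relations_def using N_add N_act act_closed
    by (auto intro!: F_diff F_of simp: N_simps(2))
qed

lemma H_subgroup: "subgroup H F"
proof -
  interpret F: comm_group F by (rule F_comm_group)
  show ?thesis unfolding tensor_null_def using F.generate_is_subgroup[OF relations_F] .
qed

lemma H_F: "h \<in> H \<Longrightarrow> h \<in> carrier F"
  using subgroup.mem_carrier[OF H_subgroup] .

lemma H_least:
  assumes "subgroup U F" "tensor_relations C N E \<subseteq> U" "h \<in> H" shows "h \<in> U"
proof -
  interpret F: comm_group F by (rule F_comm_group)
  show ?thesis using F.generate_subgroup_incl[OF assms(2,1)] assms(3) by (auto simp: tensor_null_def)
qed

lemma F_subgroupI:
  assumes "U \<subseteq> carrier F" "0 \<in> U" "\<And>c d. \<lbrakk>c \<in> U; d \<in> U\<rbrakk> \<Longrightarrow> c - d \<in> U" shows "subgroup U F"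
proof -
  interpret F: comm_group F by (rule F_comm_group)
  have neg: "- c \<in> U" if "c \<in> U" for c using assms(3)[OF assms(2) that] by simp
  show ?thesis
  proof (rule F.subgroupI)
    show "inv\<^bsub>F\<^esub> c \<in> U" if "c \<in> U" for c
      using neg[OF that] assms(1) that by (simp add: tensor_free_def subset_iff)
    show "c \<otimes>\<^bsub>F\<^esub> d \<in> U" if "c \<in> U" "d \<in> U" for c d using assms(3)[OF that(1) neg[OF that(2)]] by simp
  qed (use assms in auto)
qed

text \<open>The product of \<open>b\<close> and \<open>x\<close> in \<open>B\<close> is the
  composite \<open>x b\<close>, so this is the map on representatives by which
  \<open>left_adjoint\<close> defines its action.\<close>

definition push :: "('t \<Rightarrow> 't) \<Rightarrow> (('t \<Rightarrow> 't) \<times> 'e \<Rightarrow>\<^sub>0 int) \<Rightarrow> (('t \<Rightarrow> 't) \<times> 'e \<Rightarrow>\<^sub>0 int)" where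
  "push b = frag_extend (\<lambda>(x, m). frag_of (compose (carrier T) x b, m))"

lemma push_of: "push b (frag_of (x, m)) = frag_of (compose (carrier T) x b, m)"
  by (simp add: push_def)

lemma push_diff: "push b (c - d) = push b c - push b d"
  by (simp add: push_def frag_extend_diff)

lemma push_F: assumes "b \<in> mod_hom A T T" "c \<in> carrier F" shows "push b c \<in> carrier F"
proof -
  have "Poly_Mapping.keys c \<subseteq> carrier N \<times> carrier E" using assms(2) by (simp add: F_iff)
  then show ?thesis
  proof (rule free_Abelian_group_induct[where P = "\<lambda>c. push b c \<in> carrier F"])
    show "push b 0 \<in> carrier F" by (simp add: push_def F_iff)
    show "push b (x - y) \<in> carrier F" if "push b x \<in> carrier F" "push b y \<in> carrier F" for x y
      using that by (simp add: push_diff F_diff)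
    show "push b (frag_of a) \<in> carrier F" if "a \<in> carrier N \<times> carrier E" for a
      using that N_compose[OF _ assms(1)] by (cases a) (auto simp: push_of intro!: F_of)
  qed
qed

lemma compose_assoc': "x \<in> mod_hom A T T \<Longrightarrow> b \<in> mod_hom A T T \<Longrightarrow> c \<in> mod_hom A T T \<Longrightarrow>
    compose (carrier T) (compose (carrier T) x b) c = compose (carrier T) x (compose (carrier T) b c)"
  using S_closed[of c] by (auto simp: fun_eq_iff compose_def)

text \<open>Relations go to relations of the same kind, because \<open>b\<close> acts on
  \<open>Be\<close> from one side and the corner from the other.\<close>

lemma push_H: assumes b: "b \<in> mod_hom A T T" and h: "h \<in> H" shows "push b h \<in> H"
proof -
  let ?U = "{c \<in> carrier F. push b c \<in> H}"
  interpret Hs: subgroup H F by (rule H_subgroup)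
  interpret F: comm_group F by (rule F_comm_group)
  have Hd: "c - d \<in> H" if "c \<in> H" "d \<in> H" for c d
  proof -
    have "inv\<^bsub>F\<^esub> d = - d" using H_F[OF that(2)] by (simp add: tensor_free_def)
    then show ?thesis using Hs.m_closed[OF that(1) Hs.m_inv_closed[OF that(2)]] by simp
  qed
  have U: "subgroup ?U F"
  proof (rule F_subgroupI)
    show "0 \<in> ?U" using Hs.one_closed by (simp add: push_def F_iff)
    show "c - d \<in> ?U" if "c \<in> ?U" "d \<in> ?U" for c d using that Hd by (simp add: push_diff F_diff)
  qed auto
  have rel: "r \<in> H" if "r \<in> tensor_relations C N E" for r
    unfolding tensor_null_def using generate.incl[OF that] .
  have "tensor_relations C N E \<subseteq> ?U"
  proof
    fix r assume r: "r \<in> tensor_relations C N E"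
    consider (a) x y m where "r = frag_of (x \<oplus>\<^bsub>N\<^esub> y, m) - frag_of (x, m) - frag_of (y, m)" "x \<in> carrier N"
        "y \<in> carrier N" "m \<in> carrier E"
      | (b) x m n where "r = frag_of (x, m \<oplus>\<^bsub>E\<^esub> n) - frag_of (x, m) - frag_of (x, n)" "x \<in> carrier N"
          "m \<in> carrier E" "n \<in> carrier E"
      | (c) a x m where "r = frag_of (a \<odot>\<^bsub>N\<^esub> x, m) - frag_of (x, a \<odot>\<^bsub>E\<^esub> m)" "a \<in> carrier C" "x \<in> carrier N"
          "m \<in> carrier E"
      using r unfolding tensor_relations_def by blast
    then have "push b r \<in> tensor_relations C N E"
    proof cases
      case a
      have "compose (carrier T) (x \<oplus>\<^bsub>N\<^esub> y) b t = (compose (carrier T) x b \<oplus>\<^bsub>N\<^esub> compose (carrier T) y b) t" for t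
        using S_closed[OF b] by (cases "t \<in> carrier T") (simp_all add: N_simps)
      then have "compose (carrier T) (x \<oplus>\<^bsub>N\<^esub> y) b = compose (carrier T) x b \<oplus>\<^bsub>N\<^esub> compose (carrier T) y b" ..
      then have "push b r = frag_of (compose (carrier T) x b \<oplus>\<^bsub>N\<^esub> compose (carrier T) y b, m)
          - frag_of (compose (carrier T) x b, m) - frag_of (compose (carrier T) y b, m)"
        unfolding a(1) push_diff push_of by simp
      then show ?thesis using N_compose[OF a(2) b] N_compose[OF a(3) b] a(4) unfolding tensor_relations_def by blast
    next
      case b': b
      have "push b r = frag_of (compose (carrier T) x b, m \<oplus>\<^bsub>E\<^esub> n)
          - frag_of (compose (carrier T) x b, m) - frag_of (compose (carrier T) x b, n)"
        unfolding b'(1) push_diff push_of ..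
      then show ?thesis using N_compose[OF b'(2) b] b'(3,4) unfolding tensor_relations_def by blast
    next
      case c
      have aS: "a \<in> mod_hom A T T" using c(2) by (simp add: corner_iff N_S)
      have "push b r = frag_of (a \<odot>\<^bsub>N\<^esub> compose (carrier T) x b, m) - frag_of (compose (carrier T) x b, a \<odot>\<^bsub>E\<^esub> m)"
        unfolding c(1) push_diff push_of N_simps compose_assoc'[OF aS N_S[OF c(3)] b] ..
      then show ?thesis using N_compose[OF c(3) b] c(2,4) unfolding tensor_relations_def by blast
    qed
    then show "r \<in> ?U" using rel relations_F r by auto
  qed
  then show ?thesis using H_least[OF U _ h] by blast
qed

end

context left_module
begin

lemma add_diff_cancel_right: "\<lbrakk>x \<in> carrier M; y \<in> carrier M\<rbrakk> \<Longrightarrow> (x \<oplus>\<^bsub>M\<^esub> y) \<ominus>\<^bsub>M\<^esub> y = x"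
  by (simp add: M.minus_eq M.a_assoc M.r_neg)

lemma add_diff_diff: "\<lbrakk>x \<in> carrier M; y \<in> carrier M\<rbrakk> \<Longrightarrow> ((x \<oplus>\<^bsub>M\<^esub> y) \<ominus>\<^bsub>M\<^esub> x) \<ominus>\<^bsub>M\<^esub> y = \<zero>\<^bsub>M\<^esub>"
  using add_diff_cancel_right[of y x] diff_self[of y] by (simp add: M.a_comm)

lemma smult_diff: "\<lbrakk>a \<in> carrier R; x \<in> carrier M; y \<in> carrier M\<rbrakk> \<Longrightarrow> a \<odot>\<^bsub>M\<^esub> (x \<ominus>\<^bsub>M\<^esub> y) = a \<odot>\<^bsub>M\<^esub> x \<ominus>\<^bsub>M\<^esub> a \<odot>\<^bsub>M\<^esub> y"
  by (simp add: M.minus_eq smult_r_distr smult_minus_right)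

end

section \<open>Generation and separation of \<open>DT\<close>\<close>

context endo_summand
begin

text \<open>An induction rule expressing \<open>DT = B e DT\<close>; the condition
  \<open>\<xi> (j (q t)) = \<xi> t\<close> says that \<open>\<xi>\<close> is in \<open>e DT\<close>.
  The first term of the presentation lies in \<open>add P\<close>, and \<open>P\<close> is generated
  by \<open>q\<close>. Since \<open>e\<close> fixes \<open>q\<close>, the image of \<open>q\<close>
  under a map to \<open>DT\<close> is in \<open>e DT\<close>.\<close>

lemma DT_generated:
  assumes gen: "DT \<in> gen_cat K B m P" and m: "0 \<le> m" and \<eta>: "\<eta> \<in> carrier DT"
    and zero: "\<zero>\<^bsub>DT\<^esub> \<in> U" and add: "\<And>\<xi> \<zeta>. \<lbrakk>\<xi> \<in> U; \<zeta> \<in> U\<rbrakk> \<Longrightarrow> \<xi> \<oplus>\<^bsub>DT\<^esub> \<zeta> \<in> U"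
    and base: "\<And>\<xi> p. \<lbrakk>\<xi> \<in> carrier DT; \<And>t. t \<in> carrier T \<Longrightarrow> \<xi> (j (q t)) = \<xi> t; p \<in> mod_hom A T PI\<rbrakk> \<Longrightarrow>
      compose (carrier T) j p \<odot>\<^bsub>DT\<^esub> \<xi> \<in> U"
  shows "\<eta> \<in> U"
proof -
  obtain t :: "nat \<Rightarrow> ('t \<Rightarrow> 't, nat \<Rightarrow> 't \<Rightarrow> 'p) module" and d \<pi> where t: "\<forall>i\<le>nat m. t i \<in> add_cat B P"
    and ex: "right_exact B t d \<pi> DT (nat m)"
    using gen m unfolding gen_cat_def by blast
  have t0: "t 0 \<in> add_cat B P" using t by simp
  have \<pi>: "lin B (t 0) DT \<pi>" "\<pi> ` carrier (t 0) = carrier DT" using ex by (auto simp: right_exact_def dest: mod_homD)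
  have t0l: "left_module B (t 0)" using t0 B.fgD by (auto simp: add_cat_def)
  have DTl: "left_module B DT" using B.fgD[OF DT_fg] .
  have key: "\<pi> (f z) \<in> U" if "fac B P (t 0) (t 0) f" "z \<in> carrier (t 0)" for f z
    using that
  proof induction
    case (fac_zero f)
    have "\<pi> (\<zero>\<^bsub>t 0\<^esub>) = \<zero>\<^bsub>DT\<^esub>" using lin_zero[OF t0l DTl \<pi>(1)] .
    then show ?case using zero fac_zero.hyps[OF fac_zero.prems] by (metis (no_types))
  next
    case (fac_step f r s h)
    note c = linD(1)[OF fac_lin[OF t0l t0l fac_step.hyps(1)] fac_step.prems]
      linD(1)[OF fac_step.hyps(3) linD(1)[OF fac_step.hyps(2) fac_step.prems]]
    have \<pi>s: "lin B P DT (\<lambda>p. \<pi> (s p))" using lin_comp[OF fac_step.hyps(3) \<pi>(1)] .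
    have r: "r z \<in> mod_hom A T PI" using linD(1)[OF fac_step.hyps(2) fac_step.prems] by simp
    have eS: "compose (carrier T) j q \<in> carrier B" using jp_in_S[OF q] by simp
    have eq: "\<pi> (s q) (j (q x)) = \<pi> (s q) x" if x: "x \<in> carrier T" for x
    proof -
      have "\<pi> (s q) = compose (carrier T) j q \<odot>\<^bsub>DT\<^esub> \<pi> (s q)"
        using linD(3)[OF \<pi>s eS, of q] q unfolding P_generated[OF q] by simp
      then have "\<pi> (s q) x = (compose (carrier T) j q \<odot>\<^bsub>DT\<^esub> \<pi> (s q)) x" by (rule fun_cong)
      then show ?thesis using x by simp
    qed
    have eq': "\<pi> (s (r z)) = compose (carrier T) j (r z) \<odot>\<^bsub>DT\<^esub> \<pi> (s q)"
      using linD(3)[OF \<pi>s, of "compose (carrier T) j (r z)" q] jp_in_S[OF r] q unfolding P_generated[OF r] by simp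
    have \<pi>q: "\<pi> (s q) \<in> carrier DT" using linD(1)[OF \<pi>s, of q] q by simp
    have "compose (carrier T) j (r z) \<odot>\<^bsub>DT\<^esub> \<pi> (s q) \<in> U"
      (is "?u \<in> U")
    proof (rule base[of "\<pi> (s q)" "r z"])
      show "\<pi> (s q) \<in> carrier DT" by (rule \<pi>q)
      show "\<pi> (s q) (j (q t)) = \<pi> (s q) t" if "t \<in> carrier T" for t using eq[OF that] .
      show "r z \<in> mod_hom A T PI" by (rule r)
    qed
    then have "\<pi> (f z) \<oplus>\<^bsub>DT\<^esub> ?u \<in> U" by (rule add[OF fac_step.IH[OF fac_step.prems]])
    moreover have "\<pi> (h z) = \<pi> (f z) \<oplus>\<^bsub>DT\<^esub> ?u"
      unfolding fac_step.hyps(4)[OF fac_step.prems] linD(2)[OF \<pi>(1) c] eq' ..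
    ultimately show ?case by (metis (no_types))
  qed
  have "\<eta> \<in> \<pi> ` carrier (t 0)" using \<eta> \<pi>(2) by simp
  then obtain z where "z \<in> carrier (t 0)" "\<eta> = \<pi> z" ..
  then show ?thesis using key[OF add_cat_fac[OF Pl t0], of z] by simp
qed

text \<open>Such a \<open>\<xi>\<close> is annihilated by all elements \<open>f q\<close>. A map
  \<open>r\<close> to \<open>I\<close> therefore sends it to zero, for the value of
  \<open>r \<xi>\<close> at \<open>f\<close> is that of \<open>(f q) (r \<xi>)\<close> at
  \<open>j\<close>. The first term of the copresentation is in \<open>add I\<close>, so the
  injective map \<open>\<iota>\<close> kills \<open>\<xi>\<close>.\<close>

lemma DT_separated:
  assumes cogen: "DT \<in> cogen_cat K B m I" and m: "0 \<le> m" and \<xi>: "\<xi> \<in> carrier DT"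
    and z: "\<And>f p. \<lbrakk>f \<in> mod_hom A PI T; p \<in> carrier PI\<rbrakk> \<Longrightarrow> \<xi> (f p) = \<zero>\<^bsub>K\<^esub>"
  shows "\<xi> = \<zero>\<^bsub>DT\<^esub>"
proof -
  obtain t :: "nat \<Rightarrow> ('t \<Rightarrow> 't, nat \<Rightarrow> ('p \<Rightarrow> 't) \<Rightarrow> 'k) module" and d \<iota> where t: "\<forall>i\<le>nat m. t i \<in> add_cat B I"
    and ex: "left_exact B DT \<iota> t d (nat m)"
    using cogen m unfolding cogen_cat_def by blast
  have t0: "t 0 \<in> add_cat B I" using t by simp
  have \<iota>: "lin B DT (t 0) \<iota>" "inj_on \<iota> (carrier DT)" using ex by (auto simp: left_exact_def dest: mod_homD)
  have t0l: "left_module B (t 0)" using t0 B.fgD by (auto simp: add_cat_def)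
  have DTl: "left_module B DT" using B.fgD[OF DT_fg] .
  interpret D: left_module B DT by (rule DTl)
  interpret t: left_module B "t 0" by (rule t0l)
  have zero: "r \<xi> = \<zero>\<^bsub>I\<^esub>" if r: "lin B DT I r" for r
  proof -
    have r\<xi>: "r \<xi> \<in> mod_hom K (K_space S (HT PI)) (regular K)" using linD(1)[OF r \<xi>] by simp
    have "r \<xi> f = \<zero>\<^bsub>K\<^esub>" if f: "f \<in> mod_hom A PI T" for f
    proof -
      let ?b = "compose (carrier T) f q"
      have b: "?b \<in> carrier B" using fq_in_S[OF f] by simp
      have "?b \<odot>\<^bsub>DT\<^esub> \<xi> = \<zero>\<^bsub>DT\<^esub>"
        unfolding dual_simps eval_module_simps by (intro restrict_ext) (simp add: z[OF f mod_hom_closed[OF q]])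
      then have "?b \<odot>\<^bsub>I\<^esub> r \<xi> = \<zero>\<^bsub>I\<^esub>" using linD(3)[OF r b \<xi>] lin_zero[OF DTl Il r] by simp
      then have "(?b \<odot>\<^bsub>I\<^esub> r \<xi>) j = \<zero>\<^bsub>I\<^esub> j" by simp
      then have "r \<xi> (compose (carrier PI) ?b j) = \<zero>\<^bsub>K\<^esub>" using j by simp
      moreover have "compose (carrier PI) ?b j x = f x" for x
        using mod_hom_closed[OF j] mod_hom_undefined[OF f] by (cases "x \<in> carrier PI") (auto simp: qj_apply compose_def)
      ultimately show ?thesis by (metis (no_types) ext)
    qed
    then show ?thesis using mod_hom_undefined[OF r\<xi>] by (auto simp: fun_eq_iff)
  qed
  have "f (\<iota> \<xi>) = \<zero>\<^bsub>t 0\<^esub>" if "fac B I (t 0) (t 0) f" for f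
    using that
  proof induction
    case (fac_zero f)
    then show ?case using linD(1)[OF \<iota>(1) \<xi>] .
  next
    case (fac_step f r s h)
    have "s (r (\<iota> \<xi>)) = \<zero>\<^bsub>t 0\<^esub>" using zero[OF lin_comp[OF \<iota>(1) fac_step.hyps(2)]] lin_zero[OF Il t0l
        fac_step.hyps(3)] by simp
    then show ?case using fac_step.hyps(4)[OF linD(1)[OF \<iota>(1) \<xi>]] fac_step.IH by simp
  qed
  then have "\<iota> \<xi> = \<iota> \<zero>\<^bsub>DT\<^esub>" using add_cat_fac[OF Il t0] lin_zero[OF DTl t0l \<iota>(1)] by simp
  then show ?thesis using inj_onD[OF \<iota>(2) _ \<xi> D.M.zero_closed] by blast
qed

end

section \<open>The canonical map \<open>zeta\<close>\<close>

context intermediate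
begin

abbreviation "LA \<equiv> left_adjoint B e E"
abbreviation "RA \<equiv> right_adjoint B e E"
abbreviation "cl c \<equiv> H #>\<^bsub>F\<^esub> c"

lemma LA_simps:
  "carrier LA = rcosets\<^bsub>F\<^esub> H" "D \<oplus>\<^bsub>LA\<^esub> D' = D <#>\<^bsub>F\<^esub> D'" "b \<odot>\<^bsub>LA\<^esub> D = (\<Union>c\<in>D. cl (push b c))"
  by (simp_all add: left_adjoint_def Let_def push_def)

lemma RA_simps: "carrier RA = mod_hom C eB E" "h \<oplus>\<^bsub>RA\<^esub> k = (\<lambda>y\<in>carrier eB. h y \<oplus>\<^bsub>E\<^esub> k y)"
  "b \<odot>\<^bsub>RA\<^esub> h = (\<lambda>y\<in>carrier eB. h (compose (carrier T) b y))"
  unfolding right_adjoint_def hom_struct_simps by simp_all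

lemma LA_iff: "D \<in> carrier LA \<longleftrightarrow> (\<exists>c\<in>carrier F. D = cl c)"
  by (auto simp: LA_simps RCOSETS_def)

lemma cl_iff: "c' \<in> cl c \<longleftrightarrow> (\<exists>h\<in>H. c' = h + c)"
  by (auto simp: r_coset_def)

lemma cl_self: "c \<in> cl c"
  using subgroup.one_closed[OF H_subgroup] by (force simp: cl_iff)

lemma cl_absorb: assumes "h \<in> H" "c \<in> carrier F" shows "cl (h + c) = cl c"
proof -
  interpret F: comm_group F by (rule F_comm_group)
  have "cl (h \<otimes>\<^bsub>F\<^esub> c) = (H #>\<^bsub>F\<^esub> h) #>\<^bsub>F\<^esub> c"
    using F.coset_mult_assoc[of H h c] H_F assms by blast
  then show ?thesis using F.coset_join2[OF H_F[OF assms(1)] H_subgroup assms(1)] by simp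
qed

lemma cl_add: assumes "c \<in> carrier F" "d \<in> carrier F" shows "cl c \<oplus>\<^bsub>LA\<^esub> cl d = cl (c + d)"
proof -
  interpret F: comm_group F by (rule F_comm_group)
  have "H \<lhd> F" using H_subgroup F.normal_iff_subgroup by simp
  from normal.rcos_sum[OF this assms] show ?thesis by (simp add: LA_simps)
qed

text \<open>The cosets united in the definition of the action coincide, because \<open>push\<close>
  preserves \<open>H\<close>.\<close>

lemma cl_smult: assumes b: "b \<in> mod_hom A T T" and c: "c \<in> carrier F" shows "b \<odot>\<^bsub>LA\<^esub> cl c = cl (push b c)"
proof -
  have "cl (push b c') = cl (push b c)" if c': "c' \<in> cl c" for c'
  proof -
    obtain h where h: "h \<in> H" "c' = h + c" using c' unfolding cl_iff by blast
    have "push b c' = push b h + push b c" by (simp add: h(2) push_def frag_extend_add)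
    then show ?thesis using cl_absorb[OF push_H[OF b h(1)] push_F[OF b c]] by simp
  qed
  then show ?thesis unfolding LA_simps using cl_self[of c] by blast
qed

text \<open>Provides the uniqueness behind the definite description in \<open>zeta\<close>; the free
  group is generated by the pairs, and both maps are additive.\<close>

lemma hom_LA_unique:
  assumes f: "f \<in> mod_hom B LA RA" and g: "g \<in> mod_hom B LA RA"
    and fg: "\<And>x m. \<lbrakk>x \<in> carrier N; m \<in> carrier E\<rbrakk> \<Longrightarrow> f (cl (frag_of (x, m))) = g (cl (frag_of (x, m)))"
  shows "f = g"
proof (rule mod_hom_ext[OF f g])
  have cLA: "cl c \<in> carrier LA" if "c \<in> carrier F" for c using that LA_iff by blast
  have val: "k (cl c) \<in> mod_hom C eB E" if "k \<in> mod_hom B LA RA" "c \<in> carrier F" for k c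
    using mod_hom_closed[OF that(1) cLA[OF that(2)]] by (simp add: RA_simps)
  have add: "k (cl (c + d)) y = k (cl c) y \<oplus>\<^bsub>E\<^esub> k (cl d) y"
    if k: "k \<in> mod_hom B LA RA" and cd: "c \<in> carrier F" "d \<in> carrier F" and y: "y \<in> carrier eB" for k c d y
  proof -
    have "k (cl c \<oplus>\<^bsub>LA\<^esub> cl d) = k (cl c) \<oplus>\<^bsub>RA\<^esub> k (cl d)" using linD(2)[OF mod_homD[OF k] cLA[OF cd(1)] cLA[OF cd(2)]] .
    then show ?thesis using y unfolding cl_add[OF cd] RA_simps by simp
  qed
  fix D assume "D \<in> carrier LA"
  then obtain c where c: "c \<in> carrier F" "D = cl c" unfolding LA_iff by blast
  have "Poly_Mapping.keys c \<subseteq> carrier N \<times> carrier E" using c(1) by (simp add: F_iff)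
  then have "f (cl c) = g (cl c)"
  proof (rule free_Abelian_group_induct[where P = "\<lambda>c. f (cl c) = g (cl c)"])
    have F0: "0 \<in> carrier F" by (simp add: F_iff)
    show "f (cl 0) = g (cl 0)"
    proof (rule mod_hom_ext[OF val[OF f F0] val[OF g F0]])
      fix y assume y: "y \<in> carrier eB"
      \<comment> \<open>\<open>left_adjoint\<close> has not been shown to be a module, so the value
        at the zero coset is found by additivity: it equals its own double in the group
        \<open>E\<close>.\<close>
      have k0: "k (cl 0) y = \<zero>\<^bsub>E\<^esub>" if k: "k \<in> mod_hom B LA RA" for k
        using add[OF k F0 F0 y] mod_hom_closed[OF val[OF k F0] y] E.add.r_cancel_one'[of "k (cl 0) y"
            "k (cl 0) y"] by simp
      show "f (cl 0) y = g (cl 0) y" unfolding k0[OF f] k0[OF g] ..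
    qed
    show "f (cl (x - y)) = g (cl (x - y))"
      if "Poly_Mapping.keys x \<subseteq> carrier N \<times> carrier E" "Poly_Mapping.keys y \<subseteq> carrier N \<times> carrier E"
        "f (cl x) = g (cl x)" "f (cl y) = g (cl y)" for x y
    proof -
      have xy: "x \<in> carrier F" "y \<in> carrier F" "x - y \<in> carrier F" using that(1,2) F_diff by (auto simp: F_iff)
      show ?thesis
      proof (rule mod_hom_ext[OF val[OF f xy(3)] val[OF g xy(3)]])
        fix z assume z: "z \<in> carrier eB"
        have "f (cl (x - y)) z \<oplus>\<^bsub>E\<^esub> f (cl y) z = g (cl (x - y)) z \<oplus>\<^bsub>E\<^esub> f (cl y) z"
          using add[OF f xy(3,2) z] add[OF g xy(3,2) z] that(3,4) by simp
        then show "f (cl (x - y)) z = g (cl (x - y)) z"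
          using mod_hom_closed[OF val[OF f xy(3)] z] mod_hom_closed[OF val[OF g xy(3)] z] mod_hom_closed[OF
              val[OF f xy(2)] z]
          by simp
      qed
    qed
    show "f (cl (frag_of a)) = g (cl (frag_of a))" if "a \<in> carrier N \<times> carrier E" for a
      using that fg by (cases a) auto
  qed
  then show "f D = g D" using c(2) by simp
qed

text \<open>On the free group, the multiplication map to \<open>DT\<close> is the additive extension
  \<open>\<rho>\<close> of \<open>xi\<close>. It kills the relations and respects the action, so
  \<open>\<delta>\<close> after \<open>\<rho>\<close> induces a homomorphism with the right values
  on pure tensors, which by uniqueness is \<open>zeta\<close>.\<close>

lemma zeta_range:
  obtains \<rho> where "\<And>c. c \<in> carrier F \<Longrightarrow> \<rho> c \<in> carrier DT" "\<rho> 0 = \<zero>\<^bsub>DT\<^esub>"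
    "\<And>c d. \<lbrakk>c \<in> carrier F; d \<in> carrier F\<rbrakk> \<Longrightarrow> \<rho> (c + d) = \<rho> c \<oplus>\<^bsub>DT\<^esub> \<rho> d"
    "\<And>x m. \<lbrakk>x \<in> carrier N; m \<in> carrier E\<rbrakk> \<Longrightarrow> \<rho> (frag_of (x, m)) = xi x m"
    "zeta B e E ` carrier LA = (\<lambda>c. \<delta> (\<rho> c)) ` carrier F"
proof -
  have DTl: "left_module B DT" using B.fgD[OF DT_fg] .
  interpret D: left_module B DT by (rule DTl)
  have Dg: "comm_group (add_monoid DT)" by (rule D.M.a_comm_group)
  interpret Fg: comm_group F by (rule F_comm_group)
  have "(\<lambda>(x, m). xi x m) ` (carrier N \<times> carrier E) \<subseteq> carrier (add_monoid DT)" using xi_DT N_S by auto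
  then obtain \<rho> where \<rho>: "\<rho> \<in> hom F (add_monoid DT)" "\<And>a. a \<in> carrier N \<times> carrier E
      \<Longrightarrow> \<rho> (frag_of a) = (\<lambda>(x, m). xi x m) a"
    using comm_group.free_Abelian_group_universal[OF Dg] unfolding tensor_free_def by metis
  have \<rho>c: "\<rho> c \<in> carrier DT" if "c \<in> carrier F" for c using hom_in_carrier[OF \<rho>(1) that] by simp
  have \<rho>a: "\<rho> (c + d) = \<rho> c \<oplus>\<^bsub>DT\<^esub> \<rho> d" if "c \<in> carrier F" "d \<in> carrier F" for c d
    using hom_mult[OF \<rho>(1) that] by simp
  have \<rho>0: "\<rho> 0 = \<zero>\<^bsub>DT\<^esub>" using hom_one[OF \<rho>(1) Fg.is_group comm_group.axioms(2)[OF Dg]] by simp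
  have \<rho>x: "\<rho> (frag_of (x, m)) = xi x m" if "x \<in> carrier N" "m \<in> carrier E" for x m using \<rho>(2)[of "(x, m)"] that by simp
  have \<rho>d: "\<rho> (c - d) = \<rho> c \<ominus>\<^bsub>DT\<^esub> \<rho> d" if "c \<in> carrier F" "d \<in> carrier F" for c d
  proof -
    have "(c - d) + d = c" by simp
    then have eq: "\<rho> (c - d) \<oplus>\<^bsub>DT\<^esub> \<rho> d = \<rho> c" using \<rho>a[OF F_diff[OF that] that(2)] by metis
    show ?thesis using D.add_diff_cancel_right[OF \<rho>c[OF F_diff[OF that]] \<rho>c[OF that(2)]] unfolding eq by (rule sym)
  qed
  have diff3: "(a \<ominus>\<^bsub>DT\<^esub> b) \<ominus>\<^bsub>DT\<^esub> c = \<zero>\<^bsub>DT\<^esub>" if "a = b \<oplus>\<^bsub>DT\<^esub> c" "b \<in> carrier DT" "c \<in> carrier DT" for a b c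
    unfolding that(1) by (rule D.add_diff_diff[OF that(2,3)])
  \<comment> \<open>The three kinds of relations reflect additivity in each variable and
    compatibility with the corner; the last one rests on \<open>j (q (x t)) = x t\<close> for
    \<open>x\<close> in \<open>Be\<close>.\<close>
  have \<rho>H: "\<rho> h = \<zero>\<^bsub>DT\<^esub>" if h: "h \<in> H" for h
  proof -
    let ?U = "{c \<in> carrier F. \<rho> c = \<zero>\<^bsub>DT\<^esub>}"
    have U: "subgroup ?U F"
    proof (rule F_subgroupI)
      show "0 \<in> ?U" using \<rho>0 by (simp add: F_iff)
      show "c - d \<in> ?U" if "c \<in> ?U" "d \<in> ?U" for c d using that \<rho>d F_diff D.diff_self[OF D.M.zero_closed] by simp
    qed auto
    have "\<rho> r = \<zero>\<^bsub>DT\<^esub>" if r: "r \<in> tensor_relations C N E" for r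
    proof -
      consider (a) x y m where "r = frag_of (x \<oplus>\<^bsub>N\<^esub> y, m) - frag_of (x, m) - frag_of (y, m)" "x \<in> carrier N"
          "y \<in> carrier N" "m \<in> carrier E"
        | (b) x m n where "r = frag_of (x, m \<oplus>\<^bsub>E\<^esub> n) - frag_of (x, m) - frag_of (x, n)" "x \<in> carrier N"
            "m \<in> carrier E" "n \<in> carrier E"
        | (c) a x m where "r = frag_of (a \<odot>\<^bsub>N\<^esub> x, m) - frag_of (x, a \<odot>\<^bsub>E\<^esub> m)" "a \<in> carrier C" "x \<in> carrier N"
            "m \<in> carrier E"
        using r unfolding tensor_relations_def by blast
      then show ?thesis
      proof cases
        case a
        note s = N_add[OF a(2,3)]
        have "\<psi> m (q (x t \<oplus>\<^bsub>T\<^esub> y t)) = \<psi> m (q (x t)) \<oplus>\<^bsub>K\<^esub> \<psi> m (q (y t))" if "t \<in> carrier T" for t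
          using linD(2)[OF lin_comp[OF K_space_lin[OF mod_homD[OF q]] mod_homD[OF \<psi>_inv(4)[OF a(4)]]], of "x t" "y t"]
            S_closed[OF N_S[OF a(2)] that] S_closed[OF N_S[OF a(3)] that] by simp
        then have "xi (x \<oplus>\<^bsub>N\<^esub> y) m = xi x m \<oplus>\<^bsub>DT\<^esub> xi y m"
          unfolding dual_simps eval_module_simps xi_def by (intro restrict_ext) (simp add: N_simps)
        then show ?thesis unfolding a(1)
          using \<rho>d[OF F_diff[OF F_of[OF s a(4)] F_of[OF a(2,4)]] F_of[OF a(3,4)]] \<rho>d[OF F_of[OF s a(4)] F_of[OF a(2,4)]]
            \<rho>x s a(2-4) diff3[OF _ xi_DT[OF N_S[OF a(2)] a(4)] xi_DT[OF N_S[OF a(3)] a(4)]] by simp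
      next
        case b
        note s = E.a_closed[OF b(3,4)]
        have "xi x (m \<oplus>\<^bsub>E\<^esub> n) = xi x m \<oplus>\<^bsub>DT\<^esub> xi x n"
          unfolding dual_simps eval_module_simps xi_def \<psi>_add[OF b(3,4)]
          by (intro restrict_ext) (simp add: q_closed S_closed[OF N_S[OF b(2)]])
        then show ?thesis unfolding b(1)
          using \<rho>d[OF F_diff[OF F_of[OF b(2) s] F_of[OF b(2,3)]] F_of[OF b(2,4)]] \<rho>d[OF F_of[OF b(2) s] F_of[OF b(2,3)]]
            \<rho>x s b(2-4) diff3[OF _ xi_DT[OF N_S[OF b(2)] b(3)] xi_DT[OF N_S[OF b(2)] b(4)]] by simp
      next
        case c
        note s = N_act[OF c(2,3), folded N_simps(2)] and s' = act_closed[OF c(2,4)]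
        have jq: "j (q (x t)) = x t" if "t \<in> carrier T" for t using c(3) that by (simp add: Be_iff)
        have "xi (a \<odot>\<^bsub>N\<^esub> x) m = xi x (a \<odot>\<^bsub>E\<^esub> m)"
          unfolding xi_def N_simps(2) \<psi>_act[OF c(2,4)]
          by (intro restrict_ext) (simp add: q_closed S_closed[OF N_S[OF c(3)]] jq)
        then show ?thesis unfolding c(1)
          using \<rho>d[OF F_of[OF s c(4)] F_of[OF c(3) s']] \<rho>x[OF s c(4)] \<rho>x[OF c(3) s']
            D.diff_self[OF xi_DT[OF N_S[OF c(3)] s']] by simp
      qed
    qed
    then have "tensor_relations C N E \<subseteq> ?U" using relations_F by blast
    then show ?thesis using H_least[OF U _ h] by blast
  qed
  \<comment> \<open>The action on representatives becomes the action on \<open>DT\<close>.\<close>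
  have \<rho>p: "\<rho> (push b c) = b \<odot>\<^bsub>DT\<^esub> \<rho> c" if b: "b \<in> mod_hom A T T" and c: "c \<in> carrier F" for b c
  proof -
    have bB: "b \<in> carrier B" using b by simp
    have "Poly_Mapping.keys c \<subseteq> carrier N \<times> carrier E" using c by (simp add: F_iff)
    then show ?thesis
    proof (rule free_Abelian_group_induct[where P = "\<lambda>c. \<rho> (push b c) = b \<odot>\<^bsub>DT\<^esub> \<rho> c"])
      have "push b 0 = 0" by (simp add: push_def)
      then show "\<rho> (push b 0) = b \<odot>\<^bsub>DT\<^esub> \<rho> 0" using \<rho>0 D.smult_zero_right[OF bB] by simp
      show "\<rho> (push b (x - y)) = b \<odot>\<^bsub>DT\<^esub> \<rho> (x - y)"
        if "Poly_Mapping.keys x \<subseteq> carrier N \<times> carrier E" "Poly_Mapping.keys y \<subseteq> carrier N \<times> carrier E"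
          "\<rho> (push b x) = b \<odot>\<^bsub>DT\<^esub> \<rho> x" "\<rho> (push b y) = b \<odot>\<^bsub>DT\<^esub> \<rho> y" for x y
      proof -
        have xy: "x \<in> carrier F" "y \<in> carrier F" using that(1,2) by (auto simp: F_iff)
        have "b \<odot>\<^bsub>DT\<^esub> (\<rho> x \<ominus>\<^bsub>DT\<^esub> \<rho> y) = b \<odot>\<^bsub>DT\<^esub> \<rho> x \<ominus>\<^bsub>DT\<^esub> b \<odot>\<^bsub>DT\<^esub> \<rho> y"
          using D.smult_diff[OF bB \<rho>c[OF xy(1)] \<rho>c[OF xy(2)]] .
        then show ?thesis unfolding push_diff \<rho>d[OF push_F[OF b xy(1)] push_F[OF b xy(2)]] \<rho>d[OF xy] that(3,4)
            by (rule sym)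
      qed
      show "\<rho> (push b (frag_of a)) = b \<odot>\<^bsub>DT\<^esub> \<rho> (frag_of a)" if aN: "a \<in> carrier N \<times> carrier E" for a
      proof -
        obtain x m where a: "a = (x, m)" "x \<in> carrier N" "m \<in> carrier E" using aN by blast
        have "xi (compose (carrier T) x b) m = b \<odot>\<^bsub>DT\<^esub> xi x m"
          unfolding dual_simps eval_module_simps xi_def by (intro restrict_ext) (simp add: S_closed[OF b])
        then show ?thesis unfolding a(1) push_of using \<rho>x a(2,3) N_compose[OF a(2) b] by simp
      qed
    qed
  qed
  \<comment> \<open>Any representative of the coset will do, since \<open>\<rho>\<close> vanishes on
    \<open>H\<close>.\<close>
  define f where "f = (\<lambda>D\<in>carrier LA. \<delta> (\<rho> (SOME c. c \<in> D)))"
  have fcl: "f (cl c) = \<delta> (\<rho> c)" if c: "c \<in> carrier F" for c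
  proof -
    have "(SOME c'. c' \<in> cl c) \<in> cl c" using someI[of "\<lambda>c'. c' \<in> cl c", OF cl_self] .
    then obtain h where h: "h \<in> H" "(SOME c'. c' \<in> cl c) = h + c" unfolding cl_iff by (elim bexE)
    have "cl c \<in> carrier LA" using c LA_iff by blast
    then have "f (cl c) = \<delta> (\<rho> (SOME c'. c' \<in> cl c))" unfolding f_def by (rule restrict_apply')
    then show ?thesis unfolding h(2) \<rho>a[OF H_F[OF h(1)] c] \<rho>H[OF h(1)] D.M.l_zero[OF \<rho>c[OF c]] .
  qed
  have \<delta>u: "\<delta> \<xi> y = undefined" if "y \<notin> carrier eB" for \<xi> y using that by (simp add: \<delta>_def)
  have "f \<in> mod_hom B LA RA"
    unfolding mod_hom_def
  proof (intro CollectI conjI ballI)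
    show "f \<in> carrier LA \<rightarrow>\<^sub>E carrier RA"
    proof (rule PiE_I)
      fix D assume "D \<in> carrier LA"
      then obtain c where c: "c \<in> carrier F" "D = cl c" unfolding LA_iff by blast
      show "f D \<in> carrier RA" using \<delta>_right_adjoint[OF \<rho>c[OF c(1)]] fcl[OF c(1)] c(2) by (simp add: RA_simps)
    qed (simp add: f_def)
    fix D D' assume "D \<in> carrier LA" "D' \<in> carrier LA"
    then obtain c d where c: "c \<in> carrier F" "D = cl c" "d \<in> carrier F" "D' = cl d" unfolding LA_iff by blast
    have s: "c + d \<in> carrier F" using Fg.m_closed[OF c(1,3)] by simp
    have "\<delta> (\<rho> c \<oplus>\<^bsub>DT\<^esub> \<rho> d) y = (\<delta> (\<rho> c) \<oplus>\<^bsub>RA\<^esub> \<delta> (\<rho> d)) y" for y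
      using \<delta>_add[OF \<rho>c[OF c(1)] \<rho>c[OF c(3)], of y] \<delta>u unfolding RA_simps by (cases "y \<in> carrier eB") simp_all
    then have "\<delta> (\<rho> c \<oplus>\<^bsub>DT\<^esub> \<rho> d) = \<delta> (\<rho> c) \<oplus>\<^bsub>RA\<^esub> \<delta> (\<rho> d)" ..
    then show "f (D \<oplus>\<^bsub>LA\<^esub> D') = f D \<oplus>\<^bsub>RA\<^esub> f D'"
      unfolding c(2,4) cl_add[OF c(1,3)] fcl[OF s] fcl[OF c(1)] fcl[OF c(3)] \<rho>a[OF c(1,3)] .
  next
    fix b D assume b: "b \<in> carrier B" and "D \<in> carrier LA"
    then obtain c where c: "c \<in> carrier F" "D = cl c" unfolding LA_iff by blast
    have bS: "b \<in> mod_hom A T T" using b by simp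
    have "\<delta> (b \<odot>\<^bsub>DT\<^esub> \<rho> c) y = (b \<odot>\<^bsub>RA\<^esub> \<delta> (\<rho> c)) y" for y
      using \<delta>_smult[OF \<rho>c[OF c(1)] bS, of y] \<delta>u unfolding RA_simps by (cases "y \<in> carrier eB") simp_all
    then have "\<delta> (b \<odot>\<^bsub>DT\<^esub> \<rho> c) = b \<odot>\<^bsub>RA\<^esub> \<delta> (\<rho> c)" ..
    then show "f (b \<odot>\<^bsub>LA\<^esub> D) = b \<odot>\<^bsub>RA\<^esub> f D"
      unfolding c(2) cl_smult[OF bS c(1)] fcl[OF push_F[OF bS c(1)]] fcl[OF c(1)] \<rho>p[OF bS c(1)] .
  qed
  moreover have f_pure: "\<forall>x\<in>carrier N. \<forall>m\<in>carrier E. f (pure_tensor C N E x m) = (\<lambda>y\<in>carrier eB. (y \<otimes>\<^bsub>B\<^esub> x) \<odot>\<^bsub>E\<^esub> m)"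
    using fcl[OF F_of] \<rho>x \<delta>_xi by (simp add: pure_tensor_def)
  ultimately have f: "f \<in> mod_hom B LA RA \<and> (\<forall>x\<in>carrier N. \<forall>m\<in>carrier E. f (pure_tensor C N E x m) = (\<lambda>y\<in>carrier
      eB. (y \<otimes>\<^bsub>B\<^esub> x) \<odot>\<^bsub>E\<^esub> m))"
    by (rule conjI)
  have "zeta B e E = f"
    unfolding zeta_def
  proof (rule the_equality)
    show "f \<in> mod_hom B LA RA \<and> (\<forall>x\<in>carrier N. \<forall>m\<in>carrier E. f (pure_tensor C N E x m) = (\<lambda>y\<in>carrier eB. (y \<otimes>\<^bsub>B\<^esub>
        x) \<odot>\<^bsub>E\<^esub> m))"
      by (rule f)
    fix g assume g: "g \<in> mod_hom B LA RA \<and> (\<forall>x\<in>carrier N. \<forall>m\<in>carrier E. g (pure_tensor C N E x m) = (\<lambda>y\<in>carrier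
        eB. (y \<otimes>\<^bsub>B\<^esub> x) \<odot>\<^bsub>E\<^esub> m))"
    show "g = f"
    proof (rule hom_LA_unique)
      show "g \<in> mod_hom B LA RA" by (rule conjunct1[OF g])
      show "f \<in> mod_hom B LA RA" by (rule conjunct1[OF f])
      show "g (cl (frag_of (x, m))) = f (cl (frag_of (x, m)))" if xm: "x \<in> carrier N" "m \<in> carrier E" for x m
      proof -
        have "g (pure_tensor C N E x m) = f (pure_tensor C N E x m)"
          unfolding bspec[OF bspec[OF conjunct2[OF g] xm(1)] xm(2)] bspec[OF bspec[OF f_pure xm(1)] xm(2)] ..
        then show ?thesis unfolding pure_tensor_def .
      qed
    qed
  qed
  moreover have "f ` carrier LA = (\<lambda>c. \<delta> (\<rho> c)) ` carrier F"
  proof -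
    have "carrier LA = cl ` carrier F" using LA_iff by blast
    then show ?thesis using fcl by (auto simp: image_image)
  qed
  ultimately show thesis using that[OF \<rho>c \<rho>0 \<rho>a \<rho>x] by simp
qed

theorem DT_intermediate_extension:
  assumes gen: "DT \<in> gen_cat K B m P" "0 \<le> m" and cogen: "DT \<in> cogen_cat K B n I" "0 \<le> n"
  shows "mod_iso B DT (intermediate_extension B e E)"
proof -
  have DTl: "left_module B DT" using B.fgD[OF DT_fg] .
  interpret D: left_module B DT by (rule DTl)
  obtain \<rho> where \<rho>: "\<And>c. c \<in> carrier F \<Longrightarrow> \<rho> c \<in> carrier DT" "\<rho> 0 = \<zero>\<^bsub>DT\<^esub>"
    "\<And>c d. \<lbrakk>c \<in> carrier F; d \<in> carrier F\<rbrakk> \<Longrightarrow> \<rho> (c + d) = \<rho> c \<oplus>\<^bsub>DT\<^esub> \<rho> d"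
    "\<And>x m. \<lbrakk>x \<in> carrier N; m \<in> carrier E\<rbrakk> \<Longrightarrow> \<rho> (frag_of (x, m)) = xi x m"
    "zeta B e E ` carrier LA = (\<lambda>c. \<delta> (\<rho> c)) ` carrier F" using zeta_range by metis
  interpret Fg: comm_group F by (rule F_comm_group)
  have "\<eta> \<in> \<rho> ` carrier F" if "\<eta> \<in> carrier DT" for \<eta>
  proof (rule DT_generated[OF gen that])
    have "0 \<in> carrier F" by (simp add: F_iff)
    then show "\<zero>\<^bsub>DT\<^esub> \<in> \<rho> ` carrier F" using \<rho>(2) by (metis imageI)
    show "\<xi> \<oplus>\<^bsub>DT\<^esub> \<zeta> \<in> \<rho> ` carrier F" if xz: "\<xi> \<in> \<rho> ` carrier F" "\<zeta> \<in> \<rho> ` carrier F" for \<xi> \<zeta>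
    proof -
      obtain c d where c: "c \<in> carrier F" "d \<in> carrier F" "\<xi> = \<rho> c" "\<zeta> = \<rho> d" using xz by blast
      have "c + d \<in> carrier F" using Fg.m_closed[OF c(1,2)] by simp
      then show ?thesis using \<rho>(3)[OF c(1,2)] c(3,4) by (metis imageI)
    qed
    show "compose (carrier T) j p \<odot>\<^bsub>DT\<^esub> \<xi> \<in> \<rho> ` carrier F"
      if \<xi>: "\<xi> \<in> carrier DT" "\<And>t. t \<in> carrier T \<Longrightarrow> \<xi> (j (q t)) = \<xi> t" and p: "p \<in> mod_hom A T PI" for \<xi> p
    proof -
      \<comment> \<open>For \<open>\<xi>\<close> in \<open>e DT\<close> the multiple
        \<open>(j p) \<xi>\<close> is the image of the pure tensor of \<open>j p\<close> with the
        restriction of \<open>\<xi>\<close> to the summand.\<close>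
      define l where "l = (\<lambda>p\<in>carrier PI. \<xi> (j p))"
      have l: "l \<in> L" unfolding l_def
        using lin_restrict[OF K_space_left_module[OF PIl] lin_comp[OF K_space_lin[OF mod_homD[OF j]] DT_D(1)[OF
            \<xi>(1)]]] by simp
      define x where "x = compose (carrier T) j p"
      have x: "x \<in> carrier N" unfolding x_def Be_iff using jp_in_S[OF p] mod_hom_closed[OF p] by (simp add: qj_apply)
      have "xi x (\<psi>' l) = x \<odot>\<^bsub>DT\<^esub> \<xi>"
        unfolding xi_def \<psi>_inv(2)[OF l] dual_simps eval_module_simps
        by (intro restrict_ext) (simp add: l_def q_closed S_closed[OF N_S[OF x]] \<xi>(2))
      then show ?thesis using \<rho>(4)[OF x \<psi>_inv(3)[OF l]] F_of[OF x \<psi>_inv(3)[OF l]] unfolding x_def[symmetric] by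
          (metis imageI)
    qed
  qed
  then have "\<rho> ` carrier F = carrier DT" using \<rho>(1) by blast
  then have img: "zeta B e E ` carrier LA = \<delta> ` carrier DT" using \<rho>(5) by (metis image_image)
  have \<delta>u: "\<delta> \<xi> y = undefined" if "y \<notin> carrier eB" for \<xi> y using that by (simp add: \<delta>_def)
  have "lin B DT RA \<delta>"
  proof (rule linI)
    show "\<delta> \<xi> \<in> carrier RA" if "\<xi> \<in> carrier DT" for \<xi> using \<delta>_right_adjoint[OF that] by (simp add: RA_simps)
    show "\<delta> (\<xi> \<oplus>\<^bsub>DT\<^esub> \<eta>) = \<delta> \<xi> \<oplus>\<^bsub>RA\<^esub> \<delta> \<eta>" if "\<xi> \<in> carrier DT" "\<eta> \<in> carrier DT" for \<xi> \<eta>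
    proof (rule ext)
      show "\<delta> (\<xi> \<oplus>\<^bsub>DT\<^esub> \<eta>) y = (\<delta> \<xi> \<oplus>\<^bsub>RA\<^esub> \<delta> \<eta>) y" for y
        using \<delta>_add[OF that, of y] \<delta>u unfolding RA_simps by (cases "y \<in> carrier eB") simp_all
    qed
    show "\<delta> (b \<odot>\<^bsub>DT\<^esub> \<xi>) = b \<odot>\<^bsub>RA\<^esub> \<delta> \<xi>" if "b \<in> carrier B" "\<xi> \<in> carrier DT" for b \<xi>
    proof (rule ext)
      show "\<delta> (b \<odot>\<^bsub>DT\<^esub> \<xi>) y = (b \<odot>\<^bsub>RA\<^esub> \<delta> \<xi>) y" for y
        using \<delta>_smult[OF that(2), of b y] that(1) \<delta>u unfolding RA_simps by (cases "y \<in> carrier eB") simp_all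
    qed
  qed
  then have lin: "lin B DT (intermediate_extension B e E) \<delta>"
    unfolding intermediate_extension_def img by (rule lin_into_submod) blast
  have "inj_on \<delta> (carrier DT)"
  proof (rule inj_onI)
    fix \<xi> \<eta> assume *: "\<xi> \<in> carrier DT" "\<eta> \<in> carrier DT" "\<delta> \<xi> = \<delta> \<eta>"
    have d: "\<xi> \<ominus>\<^bsub>DT\<^esub> \<eta> \<in> carrier DT" using D.M.minus_closed[OF *(1,2)] .
    \<comment> \<open>Testing at \<open>y = f q\<close> recovers the values of the functionals on
      the image of \<open>f\<close>, which is what \<open>DT_separated\<close> asks for.\<close>
    have eq: "\<xi> (f p) = \<eta> (f p)" if f: "f \<in> mod_hom A PI T" and p: "p \<in> carrier PI" for f p
    proof -
      define y where "y = compose (carrier T) f q"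
      have y: "y \<in> carrier eB" unfolding y_def eB_iff using fq_in_S[OF f] q_closed j_closed by (simp add: qj_apply)
      have yj: "y (j p) = f p" using j_closed[OF p] by (simp add: y_def qj_apply[OF p])
      have "(\<lambda>p\<in>carrier PI. \<xi> (y (j p))) p = (\<lambda>p\<in>carrier PI. \<eta> (y (j p))) p"
        using \<delta>_val(2)[OF *(1) y] \<delta>_val(2)[OF *(2) y] *(3) by metis
      then show ?thesis using p yj by simp
    qed
    \<comment> \<open>Subtraction in \<open>DT\<close> is not given pointwise; the values of the
      difference are extracted from this sum.\<close>
    have d\<eta>: "(\<xi> \<ominus>\<^bsub>DT\<^esub> \<eta>) \<oplus>\<^bsub>DT\<^esub> \<eta> = \<xi>" using D.diff_add_cancel[OF *(1,2)] .
    have "\<xi> \<ominus>\<^bsub>DT\<^esub> \<eta> = \<zero>\<^bsub>DT\<^esub>"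
    proof (rule DT_separated[OF cogen d])
      fix f p assume f: "f \<in> mod_hom A PI T" and p: "p \<in> carrier PI"
      interpret K: ring K by (rule ring_K)
      have fp: "f p \<in> carrier T" using mod_hom_closed[OF f p] .
      have "((\<xi> \<ominus>\<^bsub>DT\<^esub> \<eta>) \<oplus>\<^bsub>DT\<^esub> \<eta>) (f p) = \<eta> (f p)" unfolding d\<eta> using eq[OF f p] .
      then have "(\<xi> \<ominus>\<^bsub>DT\<^esub> \<eta>) (f p) \<oplus>\<^bsub>K\<^esub> \<eta> (f p) = \<eta> (f p)" using fp by simp
      moreover have "(\<xi> \<ominus>\<^bsub>DT\<^esub> \<eta>) (f p) \<in> carrier K" "\<eta> (f p) \<in> carrier K"
        using linD(1)[OF DT_D(1)[OF d], of "f p"] linD(1)[OF DT_D(1)[OF *(2)], of "f p"] fp by simp_all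
      ultimately show "(\<xi> \<ominus>\<^bsub>DT\<^esub> \<eta>) (f p) = \<zero>\<^bsub>K\<^esub>" using K.l_zero K.add.right_cancel K.zero_closed by metis
    qed
    then show "\<xi> = \<eta>" using D.eq_by_diff[OF *(1,2)] by blast
  qed
  then have "bij_betw \<delta> (carrier DT) (carrier (intermediate_extension B e E))"
    unfolding intermediate_extension_def img by (simp add: bij_betw_def)
  then show ?thesis by (rule mod_isoI[OF DTl lin])
qed

end

section \<open>Assembly of the two memberships and the corner action\<close>

context endo_summand
begin

lemma DT_gen_cat:
  assumes dd: "domdim_ge TYPE(nat \<Rightarrow> 'k) A (d + 1)"
    and fac: "\<And>Q :: ('a, nat \<Rightarrow> 'k) module. \<lbrakk>proj Q; inje Q\<rbrakk> \<Longrightarrow> fac A PI Q Q (\<lambda>x. x)"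
    and pd: "pdim_le TYPE(nat \<Rightarrow> 'k) A k T"
  shows "DT \<in> gen_cat K B (int d - int k) P"
proof (cases "k \<le> d")
  case True
  \<comment> \<open>Dominant dimension at least \<open>d + 1\<close> makes
    \<open>J 0, ..., J d\<close> projective, enough for a tower with terms
    \<open>t 0, ..., t d\<close>.\<close>
  obtain i J \<delta> where res: "injective_resolution TYPE(nat \<Rightarrow> 'k) A (regular A) i J \<delta>" and J: "\<And>c. c \<le> d \<Longrightarrow> proj (J c)"
    using dd unfolding domdim_ge_def by (metis less_Suc_eq_le Suc_eq_plus1)
  have J0: "inje (J 0)" using injective_resolutionD(1)[OF res] .
  obtain N0 :: "('a, nat \<Rightarrow> 'k) module" and \<epsilon> where N0: "dualizing N0 \<epsilon>" by (rule dualizing_exists)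
  obtain t N p where t: "N 0 = N0" "tower (J 0) d t N p"
    using codominant_tower[OF res J dualizing_inje[OF N0]] by blast
  have "DT \<in> gen_cat K B (int (d - k)) P"
    using gen_part[OF t(2) J0 fac[OF J J0] _ pd, of \<epsilon> "d - k"] N0 True unfolding t(1) by simp
  then show ?thesis using True by (simp add: of_nat_diff)
next
  \<comment> \<open>The index is negative here, and \<open>gen_cat\<close> then contains every
    finitely generated module.\<close>
  case False
  then show ?thesis using DT_fg by (simp add: gen_cat_def)
qed

lemma DT_cogen_cat:
  assumes st: "special_tilting TYPE(nat \<Rightarrow> 'k) A PI k T"
  shows "DT \<in> cogen_cat K B (int k - 1) I"
proof (cases "1 \<le> k")
  case True
  obtain i t \<delta> where tc: "tilting_coresolution A k T i t \<delta>" and t: "\<And>c. c < k \<Longrightarrow> t c \<in> add_cat A PI"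
    using st unfolding special_tilting_def by blast
  have pd: "pdim_le TYPE(nat \<Rightarrow> 'k) A k T" and E: "\<And>i. i > 0 \<Longrightarrow> Ext_vanishes TYPE(nat \<Rightarrow> 'k) A i T T" and PI: "proj PI"
    using st unfolding special_tilting_def tilting_def by blast+
  have "proj (t c)" if "c < k" for c
    using t[OF that] by (intro proj_fac[OF PI _ add_cat_fac[OF PIl]]) (auto simp: add_cat_def)
  then have "DT \<in> cogen_cat K B (int (k - 1)) I"
    using special_coresolution_extend[OF T pd E tc] by (intro cogen_part[OF tc True t]) simp_all
  then show ?thesis using True by (simp add: of_nat_diff)
next
  \<comment> \<open>For \<open>k = 0\<close> the index is \<open>-1\<close>, with no condition
    beyond finite generation.\<close>
  case False
  then show ?thesis using DT_fg by (simp add: cogen_cat_def)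
qed

text \<open>For \<open>c\<close> in the corner, \<open>q c j\<close> is an endomorphism of
  \<open>PI\<close> that \<open>to_corner\<close> sends back to \<open>c\<close>. Conversely every
  preimage of \<open>c\<close> acts on \<open>PI\<close> as \<open>q c j\<close>, whichever one
  \<open>inv_into\<close> selects.\<close>

lemma corner_inverse:
  assumes \<phi>: "\<phi> ` U = mod_hom A PI PI" and c: "c \<in> carrier (corner B (compose (carrier T) j q))"
  shows "inv_into U (\<lambda>a. to_corner T j q (\<phi> a)) c \<in> U"
    "p \<in> carrier PI \<Longrightarrow> \<phi> (inv_into U (\<lambda>a. to_corner T j q (\<phi> a)) c) p = q (c (j p))"
proof -
  let ?a = "inv_into U (\<lambda>a. to_corner T j q (\<phi> a)) c"
  obtain b where b: "b \<in> mod_hom A T T" "c = compose (carrier T) (compose (carrier T) j q) (compose (carrier T)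
      b (compose (carrier T) j q))"
    using c by (auto simp: corner_def)
  note cl = mod_hom_closed[OF j] mod_hom_closed[OF q] mod_hom_closed[OF b(1)]
  have "compose (carrier PI) q (compose (carrier PI) b j) \<in> mod_hom A PI PI"
    by (intro mod_hom_compose[OF PIl q] mod_hom_compose[OF PIl b(1) j])
  then obtain a where a: "a \<in> U" "\<phi> a = compose (carrier PI) q (compose (carrier PI) b j)" using \<phi> by (metis
      (no_types) imageE)
  have "to_corner T j q (\<phi> a) t = c t" for t
    by (cases "t \<in> carrier T") (use cl in \<open>simp_all add: to_corner_def a(2) b(2) compose_def\<close>)
  then have "c = to_corner T j q (\<phi> a)" by (simp add: fun_eq_iff)
  then have "c \<in> (\<lambda>a. to_corner T j q (\<phi> a)) ` U" using a(1) by (rule image_eqI)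
  then have *: "?a \<in> U" "to_corner T j q (\<phi> ?a) = c" by (rule inv_into_into, rule f_inv_into_f)
  show "?a \<in> U" by (rule *(1))
  assume p: "p \<in> carrier PI"
  have "\<phi> ?a \<in> mod_hom A PI PI" using \<phi> *(1) by blast
  then have "\<phi> ?a p \<in> carrier PI" using p by (rule mod_hom_closed)
  moreover have "q (c (j p)) = q (to_corner T j q (\<phi> ?a) (j p))" unfolding *(2) ..
  ultimately show "\<phi> ?a p = q (c (j p))" using p cl(1)[OF p] by (simp add: to_corner_def qj_apply)
qed

text \<open>Turns the identifications of the algebra with the corner and of \<open>E\<close> with
  the dual of \<open>PI\<close> into the data of \<open>intermediate\<close>: an element of the
  corner acts on \<open>E\<close> through the algebra element assigned to it.\<close>

lemma intermediateI:
  assumes E: "fg_module R E" and \<phi>: "\<phi> ` carrier R = mod_hom A PI PI"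
    and \<psi>: "lin R E (restrict_scalars \<phi> (dual K (End_alg A PI) (eval_module PI))) \<psi>"
      "bij_betw \<psi> (carrier E) (mod_hom K (K_space A PI) (regular K))"
  shows "intermediate K A T PI j q (restrict_scalars (inv_into (carrier R) (\<lambda>a. to_corner T j q (\<phi> a))) E) \<psi>"
proof -
  interpret E: left_module R E using E by (simp add: fg_module_def)
  define E' where "E' = restrict_scalars (inv_into (carrier R) (\<lambda>a. to_corner T j q (\<phi> a))) E"
  note simps = E'_def restrict_scalars_simps
  have "intermediate K A T PI j q E' \<psi>"
  proof (intro intermediate.intro endo_summand_axioms intermediate_axioms.intro)
    show "abelian_group E'"
      by (rule abelian_groupI) (auto simp: simps E.M.a_ac E.M.l_neg E.M.r_neg intro!: bexI[of _ "\<ominus>\<^bsub>E\<^esub> x" for x])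
    show "bij_betw \<psi> (carrier E') (mod_hom K (K_space A PI) (regular K))" using \<psi>(2) by (simp add: simps)
    show "\<psi> (m \<oplus>\<^bsub>E'\<^esub> n) = (\<lambda>p\<in>carrier PI. \<psi> m p \<oplus>\<^bsub>K\<^esub> \<psi> n p)" if "m \<in> carrier E'" "n \<in> carrier E'" for m n
      using linD(2)[OF \<psi>(1), of m n] that by (simp add: simps)
    fix c m assume c: "c \<in> carrier (corner B (compose (carrier T) j q))" and "m \<in> carrier E'"
    then have m: "m \<in> carrier E" by (simp add: simps)
    note a = corner_inverse[OF \<phi> c]
    show "c \<odot>\<^bsub>E'\<^esub> m \<in> carrier E'" using E.smult_closed[OF a(1) m] by (simp add: simps)
    have "\<psi> (c \<odot>\<^bsub>E'\<^esub> m) = (\<lambda>p\<in>carrier PI. \<psi> m (\<phi> (inv_into (carrier R) (\<lambda>a. to_corner T j q (\<phi> a)) c) p))"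
      using linD(3)[OF \<psi>(1) a(1) m] by (simp add: simps)
    also have "\<dots> = (\<lambda>p\<in>carrier PI. \<psi> m (q (c (j p))))"
      by (rule restrict_ext) (simp add: a(2))
    finally show "\<psi> (c \<odot>\<^bsub>E'\<^esub> m) = (\<lambda>p\<in>carrier PI. \<psi> m (q (c (j p))))" .
  qed
  then show ?thesis unfolding E'_def .
qed

end

theorem theorem6p3:
  fixes K :: "'k ring"
    and A :: "('k, 'a) module" and E :: "('a, 'e) module"
    and \<Gamma> :: "('k, 'g) module" and X :: "'g set" and PI :: "('g, 'g) module"
    and T :: "('g, 't) module" and B :: "('k, 't \<Rightarrow> 't) module"
    and d k :: nat
    and \<phi> :: "'a \<Rightarrow> ('g \<Rightarrow> 'g)"
    and j :: "'g \<Rightarrow> 't" and q :: "'t \<Rightarrow> 'g" and e :: "'t \<Rightarrow> 't"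
    and P :: "('t \<Rightarrow> 't, 't \<Rightarrow> 'g) module"
    and I :: "('t \<Rightarrow> 't, ('g \<Rightarrow> 't) \<Rightarrow> 'k) module"
    and DT :: "('t \<Rightarrow> 't, 't \<Rightarrow> 'k) module"
    and E' :: "('t \<Rightarrow> 't, 'e) module"
  assumes "field K"
    and "fd_algebra K A" and "basic A (regular A)"
    and "fg_module A E" and "basic A E" and "generating_cogenerating K A E"
    and "fd_algebra K \<Gamma>" and "alg_iso K \<Gamma> (op_alg (End_alg A E)) \<noteq> {}"
    and "1 \<le> d" and "domdim_eq TYPE(nat \<Rightarrow> 'k) \<Gamma> (d + 1)"
    and "max_proj_inj_summand TYPE(nat \<Rightarrow> 'k) \<Gamma> X"
    and "PI = submod (regular \<Gamma>) X"
    \<comment> \<open>the identifications \<open>A = End_\<Gamma>(PI)^op\<close> and \<open>E = D PI\<close>\<close>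
    and "\<phi> \<in> alg_iso K A (op_alg (End_alg \<Gamma> PI))"
    and "mod_iso A E (restrict_scalars \<phi> (dual K (End_alg \<Gamma> PI) (eval_module PI)))"
    \<comment> \<open>\<open>T = T_k\<close>\<close>
    and "k \<le> d + 1"
    and "special_tilting TYPE(nat \<Rightarrow> 'k) \<Gamma> PI k T" and "basic \<Gamma> T"
    and "B = op_alg (End_alg \<Gamma> T)"
    \<comment> \<open>\<open>PI\<close> as a summand of \<open>T\<close>, and the projection \<open>e = e_k\<close> onto it\<close>
    and "j \<in> mod_hom \<Gamma> PI T" and "q \<in> mod_hom \<Gamma> T PI"
    and "compose (carrier PI) q j = (\<lambda>x\<in>carrier PI. x)"
    and "e = compose (carrier T) j q"
    and "P = Hom_End_source \<Gamma> T PI"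
    and "I = dual K (End_alg \<Gamma> T) (Hom_End_target \<Gamma> PI T)"
    and "DT = dual K (End_alg \<Gamma> T) (eval_module T)"
    \<comment> \<open>\<open>E\<close> as a module over \<open>eBe\<close>, via \<open>A = End_\<Gamma>(PI)^op = eBe\<close>\<close>
    and "E' = restrict_scalars (inv_into (carrier A) (\<lambda>a. to_corner T j q (\<phi> a))) E"
  shows "DT \<in> gen_cat K B (int d - int k) P \<inter> cogen_cat K B (int k - 1) I \<and>
    (1 \<le> k \<and> k \<le> d \<longrightarrow> mod_iso B DT (intermediate_extension B e E'))"
proof -
  note st = \<open>special_tilting TYPE(nat \<Rightarrow> 'k) \<Gamma> PI k T\<close> and max = \<open>max_proj_inj_summand TYPE(nat \<Rightarrow> 'k) \<Gamma> X\<close>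
  have tl: "fg_module \<Gamma> T" "pdim_le TYPE(nat \<Rightarrow> 'k) \<Gamma> k T" and PI: "projective TYPE(nat \<Rightarrow> 'k) \<Gamma> PI"
    using st by (auto simp: special_tilting_def tilting_def)
  interpret G: fdalg K \<Gamma> by unfold_locales fact
  interpret G: endo_summand K \<Gamma> T PI j q
    by unfold_locales (use tl(1) G.proj_fg[OF PI] assms in simp_all)
  interpret P: endo K \<Gamma> PI by unfold_locales (rule G.PI)
  have gen: "DT \<in> gen_cat K B (int d - int k) P"
    unfolding \<open>DT = _\<close> \<open>B = _\<close> \<open>P = _\<close>
  proof (rule G.DT_gen_cat)
    show "domdim_ge TYPE(nat \<Rightarrow> 'k) \<Gamma> (d + 1)" using \<open>domdim_eq _ _ _\<close> by (simp add: domdim_eq_def)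
    show "fac \<Gamma> PI Q Q (\<lambda>x. x)" if "projective TYPE(nat \<Rightarrow> 'k) \<Gamma> Q" "injective TYPE(nat \<Rightarrow> 'k) \<Gamma> Q"
      for Q :: "('g, nat \<Rightarrow> 'k) module"
      unfolding \<open>PI = _\<close> by (rule G.proj_inj_fac[OF max that])
  qed (rule tl(2))
  have cogen: "DT \<in> cogen_cat K B (int k - 1) I"
    unfolding \<open>DT = _\<close> \<open>B = _\<close> \<open>I = _\<close> by (rule G.DT_cogen_cat[OF st])
  have "mod_iso B DT (intermediate_extension B e E')" if k: "1 \<le> k" "k \<le> d"
  proof -
    obtain \<psi> where \<psi>: "\<psi> \<in> mod_hom A E (restrict_scalars \<phi> (dual K (End_alg \<Gamma> PI) (eval_module PI)))"
      "bij_betw \<psi> (carrier E) (carrier (restrict_scalars \<phi> (dual K (End_alg \<Gamma> PI) (eval_module PI))))"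
      using \<open>mod_iso A E _\<close> unfolding mod_iso_def by blast
    \<comment> \<open>The dual is formed over the endomorphism algebra of \<open>PI\<close>, but
      scalars act on \<open>PI\<close> as they do through \<open>\<Gamma>\<close>, so the
      functionals are the same.\<close>
    have "carrier (dual K (End_alg \<Gamma> PI) (eval_module PI)) = mod_hom K (K_space \<Gamma> PI) (regular K)"
      by (auto simp: mod_hom_iff P.K_space_eval)
    then have bij: "bij_betw \<psi> (carrier E) (mod_hom K (K_space \<Gamma> PI) (regular K))" using \<psi>(2) by simp
    have "\<phi> ` carrier A = mod_hom \<Gamma> PI PI"
      using \<open>\<phi> \<in> alg_iso _ _ _\<close> by (simp add: alg_iso_def ring_iso_def bij_betw_def)
    from G.intermediateI[OF \<open>fg_module A E\<close> this mod_homD[OF \<psi>(1)] bij]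
    interpret M: intermediate K \<Gamma> T PI j q E' \<psi> unfolding \<open>E' = _\<close> .
    \<comment> \<open>In this range of \<open>k\<close> both indices are nonnegative, so each of the
      two memberships provides a sequence with a first term.\<close>
    show ?thesis
      using M.DT_intermediate_extension[of "int d - int k" "int k - 1"] gen cogen k
      unfolding \<open>DT = _\<close> \<open>B = _\<close> \<open>e = _\<close> \<open>P = _\<close> \<open>I = _\<close> by simp
  qed
  then show ?thesis using gen cogen by blast
qed

end
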